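(* Assume that the operators $\mathcal{A}_\varepsilon u=-\mathrm{div}(a_\varepsilon(x,\nabla u))$ $G$-converge to $\mathcal{A}u=-\mathrm{div}(a(x,\nabla u))$ as $\varepsilon\to0^+$, that the functions $a_\varepsilon$ satisfy (H0)--(H8) uniformly in $\varepsilon$, and that $\rho_\varepsilon\rightharpoonup\rho$ weakly-* in $L^\infty(\Omega)$ with $0<\rho^-\le\rho_\varepsilon\le\rho^+<\infty$ a.e. in $\Omega$ for constants $\rho^\pm$ independent of $\varepsilon$. Let $\lambda_2^\varepsilon$ be the second eigenvalue of $$ -\mathrm{div}(a_\varepsilon(x,\nabla u))=\lambda\rho_\varepsilon|u|^{p-2}u\ \text{ in }\Omega,\qquad u=0\ \text{ on }\partial\Omega, $$ and let $\lambda_2$ be the second eigenvalue of the limit problem $$ -\mathrm{div}(a(x,\nabla u))=\lambda\rho|u|^{p-2}u\ \text{ in }\Omega,\qquad u=0\ \text{ on }\partial\Omega. $$ Then $$ \lim_{\varepsilon\to0}\lambda_2^\varepsilon=\lambda_2 . $$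
   Context: Here $1<p<\infty$, $p'=p/(p-1)$, and $\Omega\subset\mathbb{R}^N$, $N\ge1$, is a bounded domain. Hypotheses (H0)--(H8) for a function $b:\Omega\times\mathbb{R}^N\to\mathbb{R}^N$, with positive constants $\alpha,\beta,c$, for all $\xi,\xi_1,\xi_2,\dots\in\mathbb{R}^N$ and a.e. $x\in\Omega$ ("uniformly in $\varepsilon$" means that $b=a_\varepsilon$ satisfies them with $\alpha,\beta,c$ independent of $\varepsilon$): (H0) $b(x,\cdot)$ is continuous for a.e. $x$ and $b(\cdot,\xi)$ is measurable for every $\xi$; (H1) $0\le (b(x,\xi_1)-b(x,\xi_2))\cdot(\xi_1-\xi_2)$; (H2) $\alpha|\xi|^p\le b(x,\xi)\cdot\xi$; (H3) $|b(x,\xi)|\le\beta|\xi|^{p-1}$; (H4) $b(x,t\xi)=t^{p-1}b(x,\xi)$ for every $t>0$; (H5) $b(x,-\xi)=-b(x,\xi)$; (H6) with $\Psi(x,\xi_1,\xi_2)=b(x,\xi_1)\cdot\xi_1+b(x,\xi_2)\cdot\xi_2$ and $\delta=\min\{p/2,p-1\}$, $|b(x,\xi_1)-b(x,\xi_2)|\le c\,\Psi(x,\xi_1,\xi_2)^{(p-1-\delta)/p}\big[(b(x,\xi_1)-b(x,\xi_2))\cdot(\xi_1-\xi_2)\big]^{\delta/p}$; (H7) $\sum_{i=1}^k b(x,\xi_i)\cdot(\xi_{i+1}-\xi_i)\le 0$ for all $k\ge1$ and $\xi_1,\dots,\xi_{k+1}$ with $\xi_{k+1}=\xi_1$; (H8)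 with $\gamma=\max(2,p)$, $\alpha|\xi_1-\xi_2|^{\gamma}\Psi(x,\xi_1,\xi_2)^{1-\gamma/p}\le(b(x,\xi_1)-b(x,\xi_2))\cdot(\xi_1-\xi_2)$ (for $(\xi_1,\xi_2)\neq(0,0)$). $G$-convergence: $\mathcal{A}_\varepsilon$ $G$-converges to $\mathcal{A}$ if for every $f\in W^{-1,p'}(\Omega)$ and every $f_\varepsilon\to f$ strongly in $W^{-1,p'}(\Omega)$, the weak solutions $u^\varepsilon\in W^{1,p}_0(\Omega)$ of $-\mathrm{div}(a_\varepsilon(x,\nabla u^\varepsilon))=f_\varepsilon$ in $\Omega$ satisfy $u^\varepsilon\rightharpoonup u$ weakly in $W^{1,p}_0(\Omega)$ and $a_\varepsilon(x,\nabla u^\varepsilon)\rightharpoonup a(x,\nabla u)$ weakly in $(L^{p'}(\Omega))^N$, where $u\in W^{1,p}_0(\Omega)$ is the weak solution of $-\mathrm{div}(a(x,\nabla u))=f$ in $\Omega$. It is known that the $G$-limit coefficient $a$ then also satisfies (H0)--(H8) (for suitable positive constants). Potential. If $b$ satisfies (H0)--(H8), there is a unique Carathéodory function $\Phi$ which in the variable $\xi$ is even, $p$-homogeneous, strictly convex and differentiable, with $\nabla_\xi\Phi(x,\xi)=p\,b(x,\xi)$, $\Phi(x,0)=0$ and $\alpha|\xi|^p\le\Phi(x,\xi)\le\beta|\xi|^p$. Second eigenvalue. For a problem $-\mathrm{div}(b(x,\nabla u))=\lambda\sigma|u|^{p-2}u$ in $\Omega$, $u=0$ on $\partial\Omega$,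 with potential $\Phi$ of $b$ and weight $\sigma$, the second eigenvalue is the second variational eigenvalue $$\inf_{C\in\mathcal{C}_2}\sup_{v\in C}\frac{\int_\Omega\Phi(x,\nabla v)\,dx}{\int_\Omega\sigma|v|^p\,dx},$$ where $\mathcal{C}_2$ is the family of closed symmetric ($C=-C$) sets $C\subset W^{1,p}_0(\Omega)\setminus\{0\}$ of Krasnoselskii genus at least $2$ (the genus is the least $m$ for which there is an odd continuous map $C\to\mathbb{R}^m\setminus\{0\}$, $\infty$ if none exists, $0$ for $C=\emptyset$). *)

theory Defs
  imports
    "HOL-Analysis.Analysis"
    "HOL-Library.Extended_Nat"
    "HOL-Library.Extended_Real"
begin

text \<open>
  Functions on \<open>\<Omega>\<close> are total functions on the ambient Euclidean space; only their values on
  \<open>\<Omega>\<close> matter, and equality in Lebesgue and Sobolev spaces is equality almost everywhere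
  with respect to \<open>lebesgue_on \<Omega>\<close>.  All (semi)norms and integrals below respect it.
\<close>

section \<open>Lebesgue spaces\<close>

definition Lp :: "'a::euclidean_space set \<Rightarrow> real \<Rightarrow> ('a \<Rightarrow> 'b::euclidean_space) set" where
  "Lp \<Omega> p = {f. f \<in> borel_measurable (lebesgue_on \<Omega>) \<and>
                 integrable (lebesgue_on \<Omega>) (\<lambda>x. norm (f x) powr p)}"

definition Linf :: "'a::euclidean_space set \<Rightarrow> ('a \<Rightarrow> real) set" where
  "Linf \<Omega> = {f. f \<in> borel_measurable (lebesgue_on \<Omega>) \<and>
                 (\<exists>K. AE x in lebesgue_on \<Omega>. \<bar>f x\<bar> \<le> K)}"

definition conj_exp :: "real \<Rightarrow> real" where
  "conj_exp p = p / (p - 1)"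

definition Lp_weakly_tendsto ::
    "'a::euclidean_space set \<Rightarrow> real \<Rightarrow> ('i \<Rightarrow> 'a \<Rightarrow> 'b::euclidean_space) \<Rightarrow> ('a \<Rightarrow> 'b) \<Rightarrow> 'i filter \<Rightarrow> bool"
  where
  "Lp_weakly_tendsto \<Omega> q w w0 F \<longleftrightarrow>
     (\<forall>\<^sub>F i in F. w i \<in> Lp \<Omega> q) \<and> w0 \<in> Lp \<Omega> q \<and>
     (\<forall>\<psi> \<in> Lp \<Omega> (conj_exp q).
        ((\<lambda>i. \<integral>x. w i x \<bullet> \<psi> x \<partial>lebesgue_on \<Omega>) \<longlongrightarrow> (\<integral>x. w0 x \<bullet> \<psi> x \<partial>lebesgue_on \<Omega>)) F)"

definition Linf_weak_star_tendsto ::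
    "'a::euclidean_space set \<Rightarrow> ('i \<Rightarrow> 'a \<Rightarrow> real) \<Rightarrow> ('a \<Rightarrow> real) \<Rightarrow> 'i filter \<Rightarrow> bool" where
  "Linf_weak_star_tendsto \<Omega> r r0 F \<longleftrightarrow>
     (\<forall>\<^sub>F i in F. r i \<in> Linf \<Omega>) \<and> r0 \<in> Linf \<Omega> \<and>
     (\<forall>g. integrable (lebesgue_on \<Omega>) g \<longrightarrow>
        ((\<lambda>i. \<integral>x. r i x * g x \<partial>lebesgue_on \<Omega>) \<longlongrightarrow> (\<integral>x. r0 x * g x \<partial>lebesgue_on \<Omega>)) F)"

section \<open>The Sobolev space with zero boundary values, and its dual\<close>

primrec iter_partial :: "'a::euclidean_space list \<Rightarrow> ('a \<Rightarrow> real) \<Rightarrow> 'a \<Rightarrow> real" where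
  "iter_partial [] \<phi> = \<phi>"
| "iter_partial (e # es) \<phi> = iter_partial es (\<lambda>x. frechet_derivative \<phi> (at x) e)"

text \<open>\<open>C\<^sup>\<infinity>\<close>: every iterated partial derivative exists and is differentiable everywhere.\<close>

definition C_inf :: "('a::euclidean_space \<Rightarrow> real) \<Rightarrow> bool" where
  "C_inf \<phi> \<longleftrightarrow> (\<forall>es. set es \<subseteq> Basis \<longrightarrow> (\<forall>x. iter_partial es \<phi> differentiable (at x)))"

definition test_function :: "'a::euclidean_space set \<Rightarrow> ('a \<Rightarrow> real) \<Rightarrow> bool" where
  "test_function \<Omega> \<phi> \<longleftrightarrow>
     C_inf \<phi> \<and> compact (closure {x. \<phi> x \<noteq> 0}) \<and> closure {x. \<phi> x \<noteq> 0} \<subseteq> \<Omega>"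

definition grad :: "('a::euclidean_space \<Rightarrow> real) \<Rightarrow> 'a \<Rightarrow> 'a" where
  "grad \<phi> x = (\<Sum>i\<in>Basis. frechet_derivative \<phi> (at x) i *\<^sub>R i)"

definition has_weak_grad ::
    "'a::euclidean_space set \<Rightarrow> real \<Rightarrow> ('a \<Rightarrow> real) \<Rightarrow> ('a \<Rightarrow> 'a) \<Rightarrow> bool" where
  "has_weak_grad \<Omega> p u g \<longleftrightarrow> u \<in> Lp \<Omega> p \<and> g \<in> Lp \<Omega> p \<and>
     (\<forall>\<phi>. test_function \<Omega> \<phi> \<longrightarrow>
        (\<integral>x. u x *\<^sub>R grad \<phi> x \<partial>lebesgue_on \<Omega>) = - (\<integral>x. \<phi> x *\<^sub>R g x \<partial>lebesgue_on \<Omega>))"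

definition W1p :: "'a::euclidean_space set \<Rightarrow> real \<Rightarrow> ('a \<Rightarrow> real) set" where
  "W1p \<Omega> p = {u. \<exists>g. has_weak_grad \<Omega> p u g}"

text \<open>The weak gradient is determined up to a null set, so the choice is immaterial.\<close>

definition wgrad :: "'a::euclidean_space set \<Rightarrow> real \<Rightarrow> ('a \<Rightarrow> real) \<Rightarrow> 'a \<Rightarrow> 'a" where
  "wgrad \<Omega> p u = (SOME g. has_weak_grad \<Omega> p u g)"

definition W_norm :: "'a::euclidean_space set \<Rightarrow> real \<Rightarrow> ('a \<Rightarrow> real) \<Rightarrow> real" where
  "W_norm \<Omega> p u =
     ((\<integral>x. \<bar>u x\<bar> powr p \<partial>lebesgue_on \<Omega>) + (\<integral>x. norm (wgrad \<Omega> p u x) powr p \<partial>lebesgue_on \<Omega>)) powr (1 / p)"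

definition W_dist :: "'a::euclidean_space set \<Rightarrow> real \<Rightarrow> ('a \<Rightarrow> real) \<Rightarrow> ('a \<Rightarrow> real) \<Rightarrow> real" where
  "W_dist \<Omega> p u v = W_norm \<Omega> p (\<lambda>x. u x - v x)"

definition W01p :: "'a::euclidean_space set \<Rightarrow> real \<Rightarrow> ('a \<Rightarrow> real) set" where
  "W01p \<Omega> p = {u \<in> W1p \<Omega> p.
     \<exists>\<phi> :: nat \<Rightarrow> 'a \<Rightarrow> real. (\<forall>k. test_function \<Omega> (\<phi> k)) \<and> (\<lambda>k. W_dist \<Omega> p (\<phi> k) u) \<longlonglongrightarrow> 0}"

text \<open>\<open>W\<^sup>-\<^sup>1\<^sup>,\<^sup>p\<^sup>'\<close> is the space of bounded linear functionals on \<open>W01p\<close>.\<close>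

definition W_dual :: "'a::euclidean_space set \<Rightarrow> real \<Rightarrow> (('a \<Rightarrow> real) \<Rightarrow> real) set" where
  "W_dual \<Omega> p = {f.
     (\<forall>u \<in> W01p \<Omega> p. \<forall>v \<in> W01p \<Omega> p. f (\<lambda>x. u x + v x) = f u + f v) \<and>
     (\<forall>u \<in> W01p \<Omega> p. \<forall>t. f (\<lambda>x. t * u x) = t * f u) \<and>
     (\<exists>K. \<forall>u \<in> W01p \<Omega> p. \<bar>f u\<bar> \<le> K * W_norm \<Omega> p u)}"

definition W_dual_norm :: "'a::euclidean_space set \<Rightarrow> real \<Rightarrow> (('a \<Rightarrow> real) \<Rightarrow> real) \<Rightarrow> real" where
  "W_dual_norm \<Omega> p f = (SUP v \<in> {v \<in> W01p \<Omega> p. W_norm \<Omega> p v \<le> 1}. \<bar>f v\<bar>)"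

definition W_dual_tendsto ::
    "'a::euclidean_space set \<Rightarrow> real \<Rightarrow> ('i \<Rightarrow> ('a \<Rightarrow> real) \<Rightarrow> real) \<Rightarrow> (('a \<Rightarrow> real) \<Rightarrow> real) \<Rightarrow> 'i filter \<Rightarrow> bool"
  where
  "W_dual_tendsto \<Omega> p f f0 F \<longleftrightarrow> ((\<lambda>i. W_dual_norm \<Omega> p (\<lambda>v. f i v - f0 v)) \<longlongrightarrow> 0) F"

definition W01p_weakly_tendsto ::
    "'a::euclidean_space set \<Rightarrow> real \<Rightarrow> ('i \<Rightarrow> 'a \<Rightarrow> real) \<Rightarrow> ('a \<Rightarrow> real) \<Rightarrow> 'i filter \<Rightarrow> bool" where
  "W01p_weakly_tendsto \<Omega> p u u0 F \<longleftrightarrow>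
     (\<forall>\<^sub>F i in F. u i \<in> W01p \<Omega> p) \<and> u0 \<in> W01p \<Omega> p \<and>
     (\<forall>f \<in> W_dual \<Omega> p. ((\<lambda>i. f (u i)) \<longlongrightarrow> f u0) F)"

section \<open>Hypotheses on the coefficients\<close>

definition caratheodory :: "'a::euclidean_space set \<Rightarrow> ('a \<Rightarrow> 'a \<Rightarrow> 'b::euclidean_space) \<Rightarrow> bool" where
  "caratheodory \<Omega> b \<longleftrightarrow> (AE x in lebesgue_on \<Omega>. continuous_on UNIV (b x)) \<and>
     (\<forall>\<xi>. (\<lambda>x. b x \<xi>) \<in> borel_measurable (lebesgue_on \<Omega>))"

definition Psi :: "('a::euclidean_space \<Rightarrow> 'a \<Rightarrow> 'a) \<Rightarrow> 'a \<Rightarrow> 'a \<Rightarrow> 'a \<Rightarrow> real" where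
  "Psi b x \<xi>1 \<xi>2 = b x \<xi>1 \<bullet> \<xi>1 + b x \<xi>2 \<bullet> \<xi>2"

definition H1 :: "'a::euclidean_space set \<Rightarrow> ('a \<Rightarrow> 'a \<Rightarrow> 'a) \<Rightarrow> bool" where
  "H1 \<Omega> b \<longleftrightarrow> (AE x in lebesgue_on \<Omega>. \<forall>\<xi>1 \<xi>2. 0 \<le> (b x \<xi>1 - b x \<xi>2) \<bullet> (\<xi>1 - \<xi>2))"

definition H2 :: "'a::euclidean_space set \<Rightarrow> real \<Rightarrow> real \<Rightarrow> ('a \<Rightarrow> 'a \<Rightarrow> 'a) \<Rightarrow> bool" where
  "H2 \<Omega> p \<alpha> b \<longleftrightarrow> (AE x in lebesgue_on \<Omega>. \<forall>\<xi>. \<alpha> * norm \<xi> powr p \<le> b x \<xi> \<bullet> \<xi>)"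

definition H3 :: "'a::euclidean_space set \<Rightarrow> real \<Rightarrow> real \<Rightarrow> ('a \<Rightarrow> 'a \<Rightarrow> 'a) \<Rightarrow> bool" where
  "H3 \<Omega> p \<beta> b \<longleftrightarrow> (AE x in lebesgue_on \<Omega>. \<forall>\<xi>. norm (b x \<xi>) \<le> \<beta> * norm \<xi> powr (p - 1))"

definition H4 :: "'a::euclidean_space set \<Rightarrow> real \<Rightarrow> ('a \<Rightarrow> 'a \<Rightarrow> 'a) \<Rightarrow> bool" where
  "H4 \<Omega> p b \<longleftrightarrow>
     (AE x in lebesgue_on \<Omega>. \<forall>\<xi>. \<forall>t>0. b x (t *\<^sub>R \<xi>) = (t powr (p - 1)) *\<^sub>R b x \<xi>)"

definition H5 :: "'a::euclidean_space set \<Rightarrow> ('a \<Rightarrow> 'a \<Rightarrow> 'a) \<Rightarrow> bool" where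
  "H5 \<Omega> b \<longleftrightarrow> (AE x in lebesgue_on \<Omega>. \<forall>\<xi>. b x (- \<xi>) = - b x \<xi>)"

text \<open>
  In \<open>H6\<close>, \<open>0 powr 0 = 0\<close> is harmless: under \<open>H2\<close> and \<open>H3\<close>, \<open>Psi\<close> vanishes only at
  \<open>\<xi>1 = \<xi>2 = 0\<close>, where both sides are zero for either reading of \<open>0\<^sup>0\<close>.
\<close>

definition H6 :: "'a::euclidean_space set \<Rightarrow> real \<Rightarrow> real \<Rightarrow> ('a \<Rightarrow> 'a \<Rightarrow> 'a) \<Rightarrow> bool" where
  "H6 \<Omega> p c b \<longleftrightarrow> (let \<delta> = min (p / 2) (p - 1) in
     AE x in lebesgue_on \<Omega>. \<forall>\<xi>1 \<xi>2.
       norm (b x \<xi>1 - b x \<xi>2) \<le>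
         c * Psi b x \<xi>1 \<xi>2 powr ((p - 1 - \<delta>) / p) * ((b x \<xi>1 - b x \<xi>2) \<bullet> (\<xi>1 - \<xi>2)) powr (\<delta> / p))"

definition H7 :: "'a::euclidean_space set \<Rightarrow> ('a \<Rightarrow> 'a \<Rightarrow> 'a) \<Rightarrow> bool" where
  "H7 \<Omega> b \<longleftrightarrow> (AE x in lebesgue_on \<Omega>. \<forall>k\<ge>1. \<forall>\<xi> :: nat \<Rightarrow> 'a. \<xi> (k + 1) = \<xi> 1 \<longrightarrow>
     (\<Sum>i=1..k. b x (\<xi> i) \<bullet> (\<xi> (i + 1) - \<xi> i)) \<le> 0)"

definition H8 :: "'a::euclidean_space set \<Rightarrow> real \<Rightarrow> real \<Rightarrow> ('a \<Rightarrow> 'a \<Rightarrow> 'a) \<Rightarrow> bool" where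
  "H8 \<Omega> p \<alpha> b \<longleftrightarrow> (let \<gamma> = max 2 p in
     AE x in lebesgue_on \<Omega>. \<forall>\<xi>1 \<xi>2. (\<xi>1, \<xi>2) \<noteq> (0, 0) \<longrightarrow>
       \<alpha> * norm (\<xi>1 - \<xi>2) powr \<gamma> * Psi b x \<xi>1 \<xi>2 powr (1 - \<gamma> / p)
         \<le> (b x \<xi>1 - b x \<xi>2) \<bullet> (\<xi>1 - \<xi>2))"

definition H0_to_H8 ::
    "'a::euclidean_space set \<Rightarrow> real \<Rightarrow> real \<Rightarrow> real \<Rightarrow> real \<Rightarrow> ('a \<Rightarrow> 'a \<Rightarrow> 'a) \<Rightarrow> bool" where
  "H0_to_H8 \<Omega> p \<alpha> \<beta> c b \<longleftrightarrow> caratheodory \<Omega> b \<and> H1 \<Omega> b \<and> H2 \<Omega> p \<alpha> b \<and> H3 \<Omega> p \<beta> b \<and>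
     H4 \<Omega> p b \<and> H5 \<Omega> b \<and> H6 \<Omega> p c b \<and> H7 \<Omega> b \<and> H8 \<Omega> p \<alpha> b"

section \<open>Weak solutions and G-convergence\<close>

definition weak_solution ::
    "'a::euclidean_space set \<Rightarrow> real \<Rightarrow> ('a \<Rightarrow> 'a \<Rightarrow> 'a) \<Rightarrow> (('a \<Rightarrow> real) \<Rightarrow> real) \<Rightarrow> ('a \<Rightarrow> real) \<Rightarrow> bool"
  where
  "weak_solution \<Omega> p b f u \<longleftrightarrow> u \<in> W01p \<Omega> p \<and>
     (\<forall>v \<in> W01p \<Omega> p. (\<integral>x. b x (wgrad \<Omega> p u x) \<bullet> wgrad \<Omega> p v x \<partial>lebesgue_on \<Omega>) = f v)"

text \<open>
  The existential quantifier makes the solvability of the limit problem part of the notion;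
  \<open>u\<close> depends on \<open>f\<close> only, and is unique up to null sets as a weak limit.
\<close>

definition G_converges ::
    "'a::euclidean_space set \<Rightarrow> real \<Rightarrow> (real \<Rightarrow> 'a \<Rightarrow> 'a \<Rightarrow> 'a) \<Rightarrow> ('a \<Rightarrow> 'a \<Rightarrow> 'a) \<Rightarrow> bool" where
  "G_converges \<Omega> p a\<epsilon> a \<longleftrightarrow>
     (\<forall>f \<in> W_dual \<Omega> p. \<exists>u. weak_solution \<Omega> p a f u \<and>
       (\<forall>f\<epsilon> u\<epsilon>. (\<forall>\<epsilon>>0. f\<epsilon> \<epsilon> \<in> W_dual \<Omega> p) \<and> W_dual_tendsto \<Omega> p f\<epsilon> f (at_right 0) \<and>
                (\<forall>\<epsilon>>0. weak_solution \<Omega> p (a\<epsilon> \<epsilon>) (f\<epsilon> \<epsilon>) (u\<epsilon> \<epsilon>)) \<longrightarrow>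
          W01p_weakly_tendsto \<Omega> p u\<epsilon> u (at_right 0) \<and>
          Lp_weakly_tendsto \<Omega> (conj_exp p) (\<lambda>\<epsilon> x. a\<epsilon> \<epsilon> x (wgrad \<Omega> p (u\<epsilon> \<epsilon>) x))
            (\<lambda>x. a x (wgrad \<Omega> p u x)) (at_right 0)))"

section \<open>Potential, genus, second eigenvalue\<close>

definition is_potential ::
    "'a::euclidean_space set \<Rightarrow> real \<Rightarrow> ('a \<Rightarrow> 'a \<Rightarrow> 'a) \<Rightarrow> ('a \<Rightarrow> 'a \<Rightarrow> real) \<Rightarrow> bool" where
  "is_potential \<Omega> p b \<Phi> \<longleftrightarrow> caratheodory \<Omega> \<Phi> \<and>
     (AE x in lebesgue_on \<Omega>. \<forall>\<xi>. \<Phi> x (- \<xi>) = \<Phi> x \<xi>) \<and>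
     (AE x in lebesgue_on \<Omega>. \<forall>\<xi>. \<forall>t>0. \<Phi> x (t *\<^sub>R \<xi>) = t powr p * \<Phi> x \<xi>) \<and>
     (AE x in lebesgue_on \<Omega>. \<forall>\<xi> \<eta>. \<forall>t. \<xi> \<noteq> \<eta> \<and> 0 < t \<and> t < 1 \<longrightarrow>
        \<Phi> x ((1 - t) *\<^sub>R \<xi> + t *\<^sub>R \<eta>) < (1 - t) * \<Phi> x \<xi> + t * \<Phi> x \<eta>) \<and>
     (AE x in lebesgue_on \<Omega>. \<forall>\<xi>. GDERIV (\<Phi> x) \<xi> :> p *\<^sub>R b x \<xi>) \<and>
     (AE x in lebesgue_on \<Omega>. \<Phi> x 0 = 0) \<and>
     (\<exists>\<alpha>>0. \<exists>\<beta>>0. AE x in lebesgue_on \<Omega>. \<forall>\<xi>.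
        \<alpha> * norm \<xi> powr p \<le> \<Phi> x \<xi> \<and> \<Phi> x \<xi> \<le> \<beta> * norm \<xi> powr p)"

text \<open>Under the hypotheses the potential exists and is unique up to a null set of \<open>x\<close>.\<close>

definition potential ::
    "'a::euclidean_space set \<Rightarrow> real \<Rightarrow> ('a \<Rightarrow> 'a \<Rightarrow> 'a) \<Rightarrow> 'a \<Rightarrow> 'a \<Rightarrow> real" where
  "potential \<Omega> p b = (SOME \<Phi>. is_potential \<Omega> p b \<Phi>)"

text \<open>
  Odd continuous maps \<open>C \<rightarrow> \<real>\<^sup>m - {0}\<close>; a vector of \<open>\<real>\<^sup>m\<close> is given by its components
  \<open>h u i\<close>, \<open>i < m\<close>.  Continuity is with respect to \<open>W_dist\<close>, so \<open>h\<close> does not distinguish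
  functions that agree almost everywhere.
\<close>

definition odd_map ::
    "'a::euclidean_space set \<Rightarrow> real \<Rightarrow> ('a \<Rightarrow> real) set \<Rightarrow> nat \<Rightarrow> (('a \<Rightarrow> real) \<Rightarrow> nat \<Rightarrow> real) \<Rightarrow> bool"
  where
  "odd_map \<Omega> p C m h \<longleftrightarrow>
     (\<forall>u\<in>C. \<exists>i<m. h u i \<noteq> 0) \<and>
     (\<forall>u\<in>C. \<forall>i<m. h (\<lambda>x. - u x) i = - h u i) \<and>
     (\<forall>u\<in>C. \<forall>e>0. \<exists>d>0. \<forall>v\<in>C. W_dist \<Omega> p v u < d \<longrightarrow> (\<forall>i<m. \<bar>h v i - h u i\<bar> < e))"

definition genus :: "'a::euclidean_space set \<Rightarrow> real \<Rightarrow> ('a \<Rightarrow> real) set \<Rightarrow> enat" where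
  "genus \<Omega> p C = Inf {enat m | m. \<exists>h. odd_map \<Omega> p C m h}"

definition C_family :: "'a::euclidean_space set \<Rightarrow> real \<Rightarrow> nat \<Rightarrow> ('a \<Rightarrow> real) set set" where
  "C_family \<Omega> p k = {C. C \<subseteq> W01p \<Omega> p \<and>
     (\<forall>u\<in>C. \<not> (AE x in lebesgue_on \<Omega>. u x = 0)) \<and>
     (\<forall>u\<in>C. (\<lambda>x. - u x) \<in> C) \<and>
     (\<forall>v u. (\<forall>n::nat. v n \<in> C) \<and> u \<in> W01p \<Omega> p \<and> (\<lambda>n. W_dist \<Omega> p (v n) u) \<longlonglongrightarrow> 0 \<longrightarrow> u \<in> C) \<and>
     enat k \<le> genus \<Omega> p C}"

text \<open>Extended reals, because the supremum over a single set \<open>C\<close> may be infinite.\<close>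

definition second_eigenvalue ::
    "'a::euclidean_space set \<Rightarrow> real \<Rightarrow> ('a \<Rightarrow> 'a \<Rightarrow> 'a) \<Rightarrow> ('a \<Rightarrow> real) \<Rightarrow> ereal" where
  "second_eigenvalue \<Omega> p b \<sigma> = (INF C \<in> C_family \<Omega> p 2. SUP v \<in> C.
     ereal ((\<integral>x. potential \<Omega> p b x (wgrad \<Omega> p v x) \<partial>lebesgue_on \<Omega>) /
            (\<integral>x. \<sigma> x * \<bar>v x\<bar> powr p \<partial>lebesgue_on \<Omega>)))"

end

theory Submission
 imports Defs "HOL-Library.Diagonal_Subsequence"
begin

text \<open>
 The genus enters only through two-piece functions.  If \<open>C\<close> has genus at least \<open>2\<close> and all its
 Rayleigh quotients are below \<open>\<mu>\<close>, then some \<open>u \<in> C\<close> has both pieces \<open>u\<^sup>+\<close> and \<open>u\<^sup>-\<close> below \<open>\<mu>\<close>: otherwise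
 exactly one piece is, and recording which one is an odd continuous map into \<open>{-1, 1}\<close>.  Conversely the circle
 \<open>cos t u\<^sup>+ + sin t u\<^sup>-\<close> has genus \<open>2\<close>, and the disjointness of the supports keeps its quotients below the larger
 of the two (\<open>two_piece_of_second_eigenvalue\<close>, \<open>second_eigenvalue_le_two_piece\<close>).  It remains to follow the
 energies of disjoint pieces.

 For the upper bound, take a two-piece function \<open>u\<close> of the limit problem and solve \<open>A\<^sub>n U\<^sub>n = A u\<close>.  Then
 \<open>U\<^sub>n\<close> tends to \<open>u\<close> in \<open>L\<^sup>p\<close>, and the energy of \<open>U\<^sub>n\<close>, being the right-hand side applied to \<open>U\<^sub>n\<close>, converges to that of
 \<open>u\<close>.  The energies of the two pieces are asymptotically bounded below by their limits, so each of them
 converges.  For the lower bound, normalised pieces of almost optimal functions are bounded in \<open>W\<close>, and Rellich's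
 theorem gives limits that are nonzero and still disjoint.  Both halves rest on \<open>energy_lower_bound\<close>: the
 energy is convex with derivative \<open>p b\<close>, and its subgradient inequality at a recovery sequence of the limit
 involves only products that converge.

 This needs the limit coefficient to be monotone and cyclically monotone as well, which is proved and not
 assumed (\<open>G_limit_admissible\<close>).  What is used of the structure conditions is collected in
 \<open>admissible_field\<close>: convex expressions in one or two vectors, bounded by products of fluxes with vectors.
 Along solutions such products converge by compensated compactness (\<open>div_curl\<close>) while convex expressions are lower
 semicontinuous, so the inequalities hold at the gradients of limit solutions.  Solutions
 of penalised minimisation problems show that these gradients are dense (\<open>limit_solutions_dense\<close>).

 The Sobolev space is treated as the closure of the test functions.  Rellich's theorem comes from means over
 balls, and weak compactness from uniform convexity of \<open>|\<cdot>|\<^sup>p\<close> in place of reflexivity.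
\<close>

abbreviation scaleR_ascii (infixr "*R" 75) where "r *R x == scaleR r x"
abbreviation seq_limit ("((_)/ ----> (_))" [60, 60] 60) where "X ----> L == (X \<longlongrightarrow> L) sequentially"
abbreviation leb where "leb S == lebesgue_on S"

section \<open>Convexity of powers of the norm\<close>

lemma norm_powr_add_le:
 fixes x y :: "'b::real_normed_vector"
 assumes "0 < p"
 shows "norm (x + y) powr p <= 2 powr p * (norm x powr p + norm y powr p)"
proof -
 have "norm (x + y) <= 2 * max (norm x) (norm y)"
  using norm_triangle_ineq[of x y] by linarith
 hence "norm (x + y) powr p <= (2 * max (norm x) (norm y)) powr p"
  using assms by (intro powr_mono2) auto
 also have "... = 2 powr p * (max (norm x) (norm y)) powr p"
  by (rule powr_mult)
 also have "... <= 2 powr p * (norm x powr p + norm y powr p)"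
  by (intro mult_left_mono) (auto simp: max_def)
 finally show ?thesis .
qed

lemma norm_powr_diff_le:
 fixes x y :: "'b::real_normed_vector"
 assumes "0 < p"
 shows "norm (x - y) powr p <= 2 powr p * (norm x powr p + norm y powr p)"
 using norm_powr_add_le[OF assms, of x "- y"] by simp

lemma conj_exp_gt_1: "1 < p ==> 1 < conj_exp p"
 by (simp add: conj_exp_def field_simps)

lemma conj_exp_reciprocal: "1 < p ==> 1 / p + 1 / conj_exp p = 1"
 by (simp add: conj_exp_def field_simps)

lemma conj_exp_mult: "1 < p ==> (p - 1) * conj_exp p = p"
 by (simp add: conj_exp_def field_simps)

lemma conj_exp_conj_exp: "1 < p ==> conj_exp (conj_exp p) = p"
 by (simp add: conj_exp_def field_simps)

lemma Young_norm:
 fixes x y :: "'b::real_inner"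
 assumes "1 < p"
 shows "\<bar>x \<bullet> y\<bar> <= norm x powr conj_exp p / conj_exp p + norm y powr p / p"
proof -
 have "norm x * norm y <= norm x powr conj_exp p / conj_exp p + norm y powr p / p"
  using Youngs_inequality[of "conj_exp p" p "norm x" "norm y"] assms conj_exp_gt_1[OF assms]
  conj_exp_reciprocal[OF assms] by (simp add: add.commute)
 thus ?thesis using Cauchy_Schwarz_ineq2[of x y] by linarith
qed

text \<open>The subgradient inequality for \<open>|\<cdot>|\<^sup>p\<close>.  It is Young's inequality in disguise; the default
 value \<open>0 powr (p - 2) = 0\<close> gives the right subgradient at the origin even when \<open>p < 2\<close>.\<close>

lemma norm_powr_tangent:
 fixes x y :: "'b::real_inner"
 assumes p: "1 < p"
 shows "norm x powr p + p * ((norm x powr (p - 2) *R x) \<bullet> (y - x)) <= norm y powr p"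
proof (cases "x = 0")
 case True thus ?thesis by simp
next
 case False
 hence nx: "norm x > 0" by simp
 let ?z = "norm x powr (p - 2) *R x"
 have e1: "norm x powr (p - 2) * norm x = norm x powr (p - 1)"
  using nx by (metis diff_add_cancel diff_diff_eq2 norm_ge_zero one_add_one powr_mult_base mult.commute add.commute diff_add_eq)
 have e2: "norm x powr (p - 1) * norm x = norm x powr p"
  using nx powr_mult_base[of "norm x" "p - 1"] by (simp add: mult.commute)
 have nz: "norm ?z = norm x powr (p - 1)" using e1 by simp
 have "norm ?z powr conj_exp p = norm x powr p"
  unfolding nz powr_powr conj_exp_mult[OF p] ..
 with Young_norm[OF p, of ?z y] abs_ge_self[of "?z \<bullet> y"] have "?z \<bullet> y <= norm x powr p / conj_exp p + norm y powr p / p"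
  by simp
 also have "norm x powr p / conj_exp p = norm x powr p * (1 - 1 / p)"
 proof -
  have "1 / conj_exp p = 1 - 1 / p" using conj_exp_reciprocal[OF p] by linarith
  thus ?thesis by (metis mult.right_neutral times_divide_eq_right)
 qed
 finally have Y: "p * (?z \<bullet> y) <= (p - 1) * norm x powr p + norm y powr p"
  using p by (simp add: field_simps)
 have zx: "?z \<bullet> x = norm x powr p"
  using e1 e2 by (simp add: dot_square_norm power2_eq_square mult.assoc[symmetric])
 have "p * (?z \<bullet> (y - x)) = p * (?z \<bullet> y) - p * norm x powr p"
  unfolding inner_diff_right zx by (simp only: right_diff_distrib)
 with Y show ?thesis by (simp only: left_diff_distrib mult_1)
qed

lemma norm_powr_midpoint_le:
 fixes x y :: "'b::real_inner"
 assumes p: "1 < p"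
 shows "norm ((1/2) *R (x + y)) powr p <= (norm x powr p + norm y powr p) / 2"
proof -
 let ?m = "(1/2) *R (x + y)" let ?z = "norm ?m powr (p - 2) *R ?m"
 have "y - ?m = - (x - ?m)" by (simp add: algebra_simps scaleR_2[symmetric])
 hence "?z \<bullet> (y - ?m) = - (?z \<bullet> (x - ?m))" by (metis inner_minus_right)
 with norm_powr_tangent[OF p, of ?m x] norm_powr_tangent[OF p, of ?m y] 
 show ?thesis by (simp del: inner_scaleR_left inner_scaleR_right)
qed

text \<open>Equality in the midpoint inequality forces equality in Young's inequality, hence in the
 Cauchy-Schwarz inequality.\<close>

lemma norm_powr_midpoint_eq:
 fixes x y :: "'b::real_inner"
 assumes p: "1 < p" and eq: "norm ((1/2) *R (x + y)) powr p = (norm x powr p + norm y powr p) / 2"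
 shows "x = y"
proof -
 let ?a = "norm x" and ?b = "norm y"
 have t: "norm ((1/2) *R (x + y)) <= (?a + ?b) / 2"
  using norm_triangle_ineq[of x y] by simp
 have c: "((?a + ?b) / 2) powr p <= (?a powr p + ?b powr p) / 2"
  using norm_powr_midpoint_le[OF p, of ?a ?b] by simp
 have t2: "norm ((1/2) *R (x + y)) powr p <= ((?a + ?b) / 2) powr p"
  using t p by (intro powr_mono2) auto
 have e3: "((?a + ?b) / 2) powr p = (?a powr p + ?b powr p) / 2" using t2 c eq by linarith
 have e4: "norm ((1/2) *R (x + y)) = (?a + ?b) / 2"
 proof -
  have "norm ((1/2) *R (x + y)) powr p = ((?a + ?b) / 2) powr p" using e3 eq by simp
  hence "(norm ((1/2) *R (x + y)) powr p) powr (1/p) = (((?a + ?b) / 2) powr p) powr (1/p)" by simp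
  thus ?thesis unfolding powr_powr using p by simp
 qed
 have ab: "?a = ?b"
 proof (rule ccontr)
  assume ne: "?a ~= ?b"
  define s where "s = (?a + ?b) / 2"
  have spos: "s > 0" using ne norm_ge_zero[of x] norm_ge_zero[of y] unfolding s_def by (simp del: norm_ge_zero)
  have tan: "t powr p + p * t powr (p - 1) * (r - t) <= r powr p" if "r >= 0" "t > 0" for r t
  proof -
  have "norm t powr p + p * ((norm t powr (p - 2) *R t) \<bullet> (r - t)) <= norm r powr p"
  by (rule norm_powr_tangent[OF p])
  moreover have "t powr (p - 2) * t = t powr (p - 1)"
  using that powr_mult_base[of t "p - 2"] by (simp add: mult.commute)
  ultimately show ?thesis using that by (simp add: mult.assoc)
  qed
  \<comment> \<open>two tangents, at \<open>s\<close> and halfway to \<open>r\<close>, show that the tangent at \<open>s\<close> lies strictly below\<close>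
  have strict: "s powr p + p * s powr (p - 1) * (r - s) < r powr p" if "r >= 0" "r ~= s" for r
  proof -
  define t where "t = (r + s) / 2"
  have tpos: "t > 0" using spos that unfolding t_def by simp
  have "(t powr (p - 1) - s powr (p - 1)) * (r - t) > 0"
  proof (cases "r > s")
  case True
  hence "t > s" "r > t" unfolding t_def by auto
  thus ?thesis using spos p by (intro mult_pos_pos) (auto intro!: powr_less_mono2)
  next
  case False
  hence "t < s" "r < t" using that unfolding t_def by auto
  thus ?thesis using tpos p by (intro mult_neg_neg) (auto intro!: powr_less_mono2)
  qed
  hence *: "p * ((t powr (p - 1) - s powr (p - 1)) * (r - t)) > 0" using p by simp
  have rt: "r - t = (r - s) / 2" "t - s = (r - s) / 2" unfolding t_def by (auto simp: field_simps)
  have "s powr p + p * s powr (p - 1) * ((r - s) / 2) <= t powr p"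
  using tan[of t s] spos tpos rt by simp
  moreover have "t powr p + p * t powr (p - 1) * ((r - s) / 2) <= r powr p"
  using tan[OF that(1) tpos] rt by simp
  moreover have "0 < p * t powr (p - 1) * ((r - s) / 2) - p * s powr (p - 1) * ((r - s) / 2)"
  using * unfolding rt by (simp only: left_diff_distrib right_diff_distrib mult.assoc)
  moreover have "p * s powr (p - 1) * (r - s) = 2 * (p * s powr (p - 1) * ((r - s) / 2))" by simp
  ultimately show ?thesis by linarith
  qed
  from ne have "?a ~= s" "?b ~= s" unfolding s_def by auto
  with strict[of ?a] strict[of ?b] have "2 * s powr p + p * s powr (p - 1) * (?a + ?b - 2 * s) < ?a powr p + ?b powr p"
  by (simp add: algebra_simps)
  moreover have "?a + ?b - 2 * s = 0" unfolding s_def by simp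
  moreover have "s powr p = (?a powr p + ?b powr p) / 2" using e3 by (simp only: s_def)
  ultimately show False by simp
 qed
 have e5: "norm (x + y) = ?a + ?b" using e4 by simp
 hence "norm x *R y = norm y *R x" by (simp add: norm_triangle_eq)
 thus "x = y" using ab by (cases "norm x = 0") auto
qed

text \<open>Both sides are \<open>p\<close>-homogeneous, so it suffices to look at the compact set of pairs with
 \<open>|x|\<^sup>p + |y|\<^sup>p = 1\<close> and \<open>|x - y|\<^sup>p >= et\<close>, where the midpoint gap has a positive minimum.\<close>

lemma norm_powr_uniformly_convex:
 assumes p: "1 < p" and et: "0 < et"
 obtains C where "0 <= C" "!!x y :: 'b::euclidean_space. norm (x - y) powr p
  <= et * (norm x powr p + norm y powr p)
  + C * ((norm x powr p + norm y powr p) / 2 - norm ((1/2) *R (x + y)) powr p)"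
proof -
 let ?S = "%z::'b\<times>'b. norm (fst z) powr p + norm (snd z) powr p"
 let ?D = "%z::'b\<times>'b. norm (fst z - snd z) powr p"
 let ?G = "%z::'b\<times>'b. ?S z / 2 - norm ((1/2) *R (fst z + snd z)) powr p"
 define K where "K = {z. ?S z = 1} \<inter> {z. et <= ?D z}"
 have cont: "continuous_on UNIV ?S" "continuous_on UNIV ?D" "continuous_on UNIV ?G"
  using p by (auto intro!: continuous_intros continuous_on_powr')
 have K_bd: "norm z <= 2" if "z \<in> K" for z
 proof -
  have s1: "?S z = 1" using that by (simp add: K_def)
  have "a powr p <= 1 ==> a >= 0 ==> a <= 1" for a :: real
  using gr_one_powr[of a p] p by linarith
  hence "norm (fst z) <= 1" "norm (snd z) <= 1" using s1 powr_ge_zero[of "norm (fst z)" p]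
  powr_ge_zero[of "norm (snd z)" p] by (metis add.commute add_increasing2 norm_ge_zero order_refl le_add_same_cancel2 )+
  thus ?thesis using norm_Pair_le[of "fst z" "snd z"] by simp
 qed
 have "compact K"
 proof -
  have "closed {z. ?S z = 1}" using cont(1) by (intro closed_Collect_eq) auto
  moreover have "closed {z. et <= ?D z}" using cont(2) by (intro closed_Collect_le) auto
  moreover have "bounded K" using K_bd unfolding bounded_iff by blast
  ultimately show ?thesis unfolding K_def by (auto simp: compact_eq_bounded_closed)
 qed
 have G_ge: "0 <= ?G z" for z using norm_powr_midpoint_le[OF p, of "fst z" "snd z"] by simp
 have G_pos: "0 < ?G z" if "z \<in> K" for z
 proof -
  have "fst z ~= snd z" using that et p by (auto simp: K_def)
  hence "?G z ~= 0" using norm_powr_midpoint_eq[OF p, of "fst z" "snd z"] by auto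
  with G_ge[of z] show ?thesis by linarith
 qed
 obtain m where m: "m > 0" "!!z. z \<in> K ==> m <= ?G z"
 proof (cases "K = {}")
  case True thus ?thesis using that[of 1] by simp
 next
  case False
  from continuous_attains_inf[OF \<open>compact K\<close> False continuous_on_subset[OF cont(3)]]
  obtain z0 where "z0 \<in> K" "\<forall>z\<in>K. ?G z0 <= ?G z" by auto
  thus ?thesis using G_pos that by blast
 qed
 define C where "C = 2 * 2 powr p / m"
 have C0: "0 <= C" using m by (simp add: C_def)
 show thesis
 proof (rule that[OF C0])
  fix x y :: 'b
  define S where "S = norm x powr p + norm y powr p"
  show "norm (x - y) powr p <= et * (norm x powr p + norm y powr p)
  + C * ((norm x powr p + norm y powr p) / 2 - norm ((1/2) *R (x + y)) powr p)"
  proof (cases "S = 0")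
  case True
  hence "x = 0" "y = 0" unfolding S_def
  by (metis add_nonneg_eq_0_iff norm_eq_zero powr_eq_0_iff powr_ge_zero)+
  thus ?thesis by simp
  next
  case False
  hence Spos: "S > 0" unfolding S_def using powr_ge_zero[of "norm x" p] powr_ge_zero[of "norm y" p] by linarith
  define t where "t = S powr (-1/p)"
  have t: "t > 0" "t powr p = 1 / S" using Spos p unfolding t_def powr_powr by (auto simp: powr_minus_divide)
  define z where "z = (t *R x, t *R y)"
  have sc: "norm (t *R w) powr p = norm w powr p / S" for w :: 'b
  using t by (simp add: powr_mult)
  have Sz: "?S z = 1" using Spos unfolding z_def by (simp del: norm_scaleR add: sc S_def[symmetric] add_divide_distrib[symmetric])
  have Dz: "?D z = norm (x - y) powr p / S"
  unfolding z_def using sc[of "x - y"] by (simp del: norm_scaleR add: scaleR_diff_right)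
  have Gz: "?G z = (S / 2 - norm ((1/2) *R (x + y)) powr p) / S"
  proof -
  have "(1/2) *R (t *R x + t *R y) = t *R ((1/2) *R (x + y))" by (simp add: scaleR_add_right mult.commute)
  hence "norm ((1/2) *R (fst z + snd z)) powr p = norm ((1/2) *R (x + y)) powr p / S"
  unfolding z_def fst_conv snd_conv by (simp only: sc)
  thus ?thesis unfolding Sz using Spos by (simp add: field_simps)
  qed
  have "?D z <= et + C * ?G z"
  proof (cases "z \<in> K")
  case True
  have "?D z <= 2 powr p * 1" using norm_powr_diff_le[of p "fst z" "snd z"] p Sz by simp
  also have "... <= C * m" using m by (simp add: C_def)
  also have "... <= C * ?G z" using m(2)[OF True] C0 by (rule mult_left_mono)
  finally show ?thesis using et by linarith
  next
  case False
  hence "?D z < et" using Sz by (auto simp: K_def)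
  moreover have "0 <= C * ?G z" using C0 G_ge by (rule mult_nonneg_nonneg)
  ultimately show ?thesis by linarith
  qed
  hence "?D z * S <= (et + C * ?G z) * S" using Spos by (intro mult_right_mono) auto
  thus ?thesis unfolding Dz Gz using Spos by (simp add: distrib_right S_def[symmetric])
  qed
 qed
qed

section \<open>Lebesgue spaces\<close>

lemma LpD:
 assumes "f \<in> Lp Om p"
 shows "f \<in> borel_measurable (leb Om)" "integrable (leb Om) (%x. norm (f x) powr p)"
 using assms by (auto simp: Lp_def)

lemma borel_measurable_norm_powr [measurable]:
 fixes f :: "_ => 'b::{real_normed_vector,second_countable_topology}"
 assumes [measurable]: "f \<in> borel_measurable M"
 shows "(%x. norm (f x) powr p) \<in> borel_measurable M"
 by measurable

lemma Lp_dominated: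
 fixes f :: "'a::euclidean_space => 'b::euclidean_space"
 assumes "f \<in> borel_measurable (leb Om)" "integrable (leb Om) D"
  "AE x in leb Om. norm (f x) powr p <= D x"
 shows "f \<in> Lp Om p"
 unfolding Lp_def
proof (intro CollectI conjI)
 show "integrable (leb Om) (%x. norm (f x) powr p)"
  by (rule Bochner_Integration.integrable_bound[OF assms(2) borel_measurable_norm_powr[OF assms(1)]])
  (use assms(3) in eventually_elim, simp)
qed (rule assms(1))

lemma Lp_0 [simp]: "(%x. 0) \<in> Lp Om p"
 by (simp add: Lp_def)

lemma Lp_add:
 assumes "0 < p" "f \<in> Lp Om p" "g \<in> Lp Om p"
 shows "(%x. f x + g x) \<in> Lp Om p"
proof (rule Lp_dominated)
 show "integrable (leb Om) (%x. 2 powr p * (norm (f x) powr p + norm (g x) powr p))"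
  using LpD[OF assms(2)] LpD[OF assms(3)] by auto
qed (use LpD[OF assms(2)] LpD[OF assms(3)] norm_powr_add_le[OF assms(1)] in auto)

lemma Lp_scaleR:
 assumes "f \<in> Lp Om p"
 shows "(%x. c *R f x) \<in> Lp Om p"
 using LpD[OF assms] by (auto simp: Lp_def powr_mult)

lemma Lp_mult: "f \<in> Lp Om p ==> (%x. c * f x :: real) \<in> Lp Om p"
 using Lp_scaleR[of f Om p c] by simp

lemma Lp_minus: "f \<in> Lp Om p ==> (%x. - f x) \<in> Lp Om p"
 using Lp_scaleR[of f Om p "-1"] by simp

lemma Lp_diff:
 assumes "0 < p" "f \<in> Lp Om p" "g \<in> Lp Om p"
 shows "(%x. f x - g x) \<in> Lp Om p"
 using Lp_add[OF assms(1,2) Lp_minus[OF assms(3)]] by simp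

lemma Lp_bounded_scaleR:
 fixes f :: "'a::euclidean_space => 'b::euclidean_space"
 assumes p: "0 < p" and f: "f \<in> Lp Om p" and c: "c \<in> borel_measurable (leb Om)"
  and K: "!!x. x \<in> Om ==> \<bar>c x\<bar> <= K"
 shows "(%x. c x *R f x) \<in> Lp Om p"
proof (rule Lp_dominated)
 show "(%x. c x *R f x) \<in> borel_measurable (leb Om)" using c LpD(1)[OF f] by measurable
 show "integrable (leb Om) (%x. \<bar>K\<bar> powr p * norm (f x) powr p)" using LpD(2)[OF f] by simp
 show "AE x in leb Om. norm (c x *R f x) powr p <= \<bar>K\<bar> powr p * norm (f x) powr p"
 proof (rule AE_I2)
  fix x assume "x \<in> space (leb Om)"
  hence "\<bar>c x\<bar> <= \<bar>K\<bar>" using K[of x] by (simp add: abs_le_iff)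
  thus "norm (c x *R f x) powr p <= \<bar>K\<bar> powr p * norm (f x) powr p"
  using p by (auto simp: powr_mult intro!: mult_right_mono powr_mono2)
 qed
qed

lemma Lp_inner_integrable:
 fixes f g :: "'a::euclidean_space => 'b::euclidean_space"
 assumes p: "1 < p" and f: "f \<in> Lp Om (conj_exp p)" and g: "g \<in> Lp Om p"
 shows "integrable (leb Om) (%x. f x \<bullet> g x)"
proof (rule Bochner_Integration.integrable_bound)
 show "integrable (leb Om) (%x. norm (f x) powr conj_exp p / conj_exp p + norm (g x) powr p / p)"
  using LpD[OF f] LpD[OF g] by auto
 show "(%x. f x \<bullet> g x) \<in> borel_measurable (leb Om)"
  using LpD(1)[OF f] LpD(1)[OF g] by measurable
 show "AE x in leb Om. norm (f x \<bullet> g x) <= norm (norm (f x) powr conj_exp p / conj_exp p + norm (g x) powr p / p)"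
  using order_trans[OF Young_norm[OF p] abs_ge_self] by (intro AE_I2) simp
qed

lemma Lp_Young:
 fixes f g :: "'a::euclidean_space => 'b::euclidean_space"
 assumes p: "1 < p" and f: "f \<in> Lp Om (conj_exp p)" and g: "g \<in> Lp Om p"
 shows "\<bar>LINT x|leb Om. f x \<bullet> g x\<bar> <=
  (LINT x|leb Om. norm (f x) powr conj_exp p) / conj_exp p + (LINT x|leb Om. norm (g x) powr p) / p"
proof -
 have "\<bar>LINT x|leb Om. f x \<bullet> g x\<bar> <= (LINT x|leb Om. \<bar>f x \<bullet> g x\<bar>)"
  by (rule integral_abs_bound)
 also have "... <= (LINT x|leb Om. norm (f x) powr conj_exp p / conj_exp p + norm (g x) powr p / p)"
  using Young_norm[OF p] LpD(2)[OF f] LpD(2)[OF g] Lp_inner_integrable[OF p f g]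
  by (intro integral_mono) auto
 also have "... = (LINT x|leb Om. norm (f x) powr conj_exp p) / conj_exp p + (LINT x|leb Om. norm (g x) powr p) / p"
  using LpD(2)[OF f] LpD(2)[OF g] by simp
 finally show ?thesis .
qed

lemma Lp_integral_nonneg: "0 <= (LINT x|leb Om. norm (f x) powr p)"
 by (rule integral_nonneg_AE) simp

lemma Lp_integral_eq_0:
 assumes "f \<in> Lp Om p" "(LINT x|leb Om. norm (f x) powr p) = 0"
 shows "AE x in leb Om. f x = 0"
proof -
 have "AE x in leb Om. norm (f x) powr p = 0"
  using integral_nonneg_eq_0_iff_AE[of "leb Om" "%x. norm (f x) powr p"] LpD(2)[OF assms(1)] assms(2) by auto
 thus ?thesis by eventually_elim simp
qed

text \<open>Hoelder's inequality follows from Young's by rescaling \<open>f\<close> and \<open>g\<close> to unit norm.\<close>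

lemma Lp_Holder:
 fixes f g :: "'a::euclidean_space => 'b::euclidean_space"
 assumes p: "1 < p" and f: "f \<in> Lp Om (conj_exp p)" and g: "g \<in> Lp Om p"
 shows "\<bar>LINT x|leb Om. f x \<bullet> g x\<bar> <=
  (LINT x|leb Om. norm (f x) powr conj_exp p) powr (1 / conj_exp p) *
  (LINT x|leb Om. norm (g x) powr p) powr (1 / p)" (is "_ <= ?A powr _ * ?B powr _")
proof (cases "?A = 0 \<or> ?B = 0")
 case True
 hence "AE x in leb Om. f x \<bullet> g x = 0"
  using Lp_integral_eq_0[OF f] Lp_integral_eq_0[OF g] by auto
 hence "(LINT x|leb Om. f x \<bullet> g x) = 0" by (rule integral_eq_zero_AE)
 thus ?thesis by simp
next
 case False
 let ?q = "conj_exp p"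
 have A: "?A > 0" and B: "?B > 0" using False Lp_integral_nonneg[of Om f ?q] Lp_integral_nonneg[of Om g p] by (auto simp: less_le)
 have q: "1 < ?q" by (rule conj_exp_gt_1[OF p])
 define s where "s = ?A powr (-1/?q)" define t where "t = ?B powr (-1/p)"
 have s: "s > 0" "s powr ?q = 1 / ?A" using A q unfolding s_def powr_powr by (auto simp: powr_minus_divide)
 have t: "t > 0" "t powr p = 1 / ?B" using B p unfolding t_def powr_powr by (auto simp: powr_minus_divide)
 have "\<bar>LINT x|leb Om. (s *R f x) \<bullet> (t *R g x)\<bar> <=
  (LINT x|leb Om. norm (s *R f x) powr ?q) / ?q + (LINT x|leb Om. norm (t *R g x) powr p) / p"
  by (intro Lp_Young p Lp_scaleR f g)
 also have "... = 1" using s t A B conj_exp_reciprocal[OF p] by (simp add: powr_mult)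
 also have "(LINT x|leb Om. (s *R f x) \<bullet> (t *R g x)) = s * t * (LINT x|leb Om. f x \<bullet> g x)"
  by (simp add: mult_ac)
 finally have "s * t * \<bar>LINT x|leb Om. f x \<bullet> g x\<bar> <= 1" using s t by (simp add: abs_mult)
 hence "\<bar>LINT x|leb Om. f x \<bullet> g x\<bar> <= (1 / s) * (1 / t)" using s(1) t(1) by (simp add: field_simps)
 moreover have "1 / s = ?A powr (1 / ?q)" "1 / t = ?B powr (1 / p)"
  by (auto simp: s_def t_def powr_minus_divide)
 ultimately show ?thesis by simp
qed

subsection \<open>Strong convergence\<close>

text \<open>Membership is part of the notion: the integral of a function that is not integrable is \<open>0\<close> and would fake convergence.\<close>

definition Lp_tendsto :: "'a::euclidean_space set => real => (nat => 'a => 'b::euclidean_space) => ('a => 'b) => bool"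
 where "Lp_tendsto Om p f F \<longleftrightarrow> (\<forall>n. f n \<in> Lp Om p) & F \<in> Lp Om p &
  (%n. LINT x|leb Om. norm (f n x - F x) powr p) ----> 0"

lemma Lp_tendstoD:
 assumes "Lp_tendsto Om p f F"
 shows "f n \<in> Lp Om p" "F \<in> Lp Om p" "(%n. LINT x|leb Om. norm (f n x - F x) powr p) ----> 0"
 using assms by (auto simp: Lp_tendsto_def)

lemma Lp_tendsto_subseq: "Lp_tendsto Om p f F ==> strict_mono r ==> Lp_tendsto Om p (%n. f (r n)) F"
 unfolding Lp_tendsto_def using LIMSEQ_subseq_LIMSEQ[of "%n. LINT x|leb Om. norm (f n x - F x) powr p" 0 r]
 by (simp add: o_def)

lemma Lp_tendsto_const: "F \<in> Lp Om p ==> Lp_tendsto Om p (%n. F) F"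
 by (simp add: Lp_tendsto_def)

lemma Lp_integral_triangle:
 fixes f g h :: "'a::euclidean_space => 'b::euclidean_space"
 assumes "0 < p" "f \<in> Lp Om p" "g \<in> Lp Om p"
  and "h \<in> borel_measurable (leb Om)" "AE x in leb Om. norm (h x) <= norm (f x) + norm (g x)"
 shows "(LINT x|leb Om. norm (h x) powr p) <=
  2 powr p * ((LINT x|leb Om. norm (f x) powr p) + (LINT x|leb Om. norm (g x) powr p))"
proof -
 let ?D = "%x. 2 powr p * (norm (f x) powr p + norm (g x) powr p)"
 have I: "integrable (leb Om) ?D" using LpD(2)[OF assms(2)] LpD(2)[OF assms(3)] by auto
 have le: "AE x in leb Om. norm (h x) powr p <= ?D x"
  using assms(5)
 proof eventually_elim
  case (elim x)
  have "norm (h x) powr p <= norm (norm (f x) + norm (g x)) powr p" using elim assms(1) by (intro powr_mono2) auto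
  also have "... <= ?D x" using norm_powr_add_le[OF assms(1), of "norm (f x)" "norm (g x)"] by simp
  finally show ?case .
 qed
 have "h \<in> Lp Om p" by (rule Lp_dominated[OF assms(4) I le])
 hence "(LINT x|leb Om. norm (h x) powr p) <= (LINT x|leb Om. ?D x)"
  by (intro integral_mono_AE I le LpD(2))
 also have "... = 2 powr p * ((LINT x|leb Om. norm (f x) powr p) + (LINT x|leb Om. norm (g x) powr p))"
  using LpD(2)[OF assms(2)] LpD(2)[OF assms(3)] by simp
 finally show ?thesis .
qed

lemma Lp_tendsto_squeeze:
 fixes f :: "nat => 'a::euclidean_space => 'b::euclidean_space"
 assumes "!!n. f n \<in> Lp Om p" "F \<in> Lp Om p"
  "!!n. (LINT x|leb Om. norm (f n x - F x) powr p) <= e n" "e ----> 0"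
 shows "Lp_tendsto Om p f F"
 unfolding Lp_tendsto_def
 using assms tendsto_sandwich[of "%_. 0" "%n. LINT x|leb Om. norm (f n x - F x) powr p" sequentially e 0]
 by (auto simp: Lp_integral_nonneg)

lemma Lp_tendsto_add:
 assumes p: "0 < p" and f: "Lp_tendsto Om p f F" and g: "Lp_tendsto Om p g G"
 shows "Lp_tendsto Om p (%n x. f n x + g n x) (%x. F x + G x)"
proof (rule Lp_tendsto_squeeze)
 let ?e = "%n. 2 powr p * ((LINT x|leb Om. norm (f n x - F x) powr p) + (LINT x|leb Om. norm (g n x - G x) powr p))"
 note [measurable] = LpD(1)[OF Lp_tendstoD(1)[OF f]] LpD(1)[OF Lp_tendstoD(2)[OF f]]
  LpD(1)[OF Lp_tendstoD(1)[OF g]] LpD(1)[OF Lp_tendstoD(2)[OF g]]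
 show "(LINT x|leb Om. norm (f n x + g n x - (F x + G x)) powr p) <= ?e n" for n
  by (intro Lp_integral_triangle p Lp_diff Lp_tendstoD[OF f] Lp_tendstoD[OF g] AE_I2)
  (measurable, auto simp: norm_diff_triangle_ineq)
 show "?e ----> 0" by (auto intro!: tendsto_eq_intros Lp_tendstoD(3)[OF f] Lp_tendstoD(3)[OF g])
qed (intro Lp_add p Lp_tendstoD[OF f] Lp_tendstoD[OF g])+

lemma Lp_tendsto_scaleR:
 assumes f: "Lp_tendsto Om p f F"
 shows "Lp_tendsto Om p (%n x. c *R f n x) (%x. c *R F x)"
proof (rule Lp_tendsto_squeeze)
 show "(LINT x|leb Om. norm (c *R f n x - c *R F x) powr p) <= \<bar>c\<bar> powr p * (LINT x|leb Om. norm (f n x - F x) powr p)" for n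
  by (simp add: scaleR_diff_right[symmetric] powr_mult)
 show "(%n. \<bar>c\<bar> powr p * (LINT x|leb Om. norm (f n x - F x) powr p)) ----> 0"
  by (auto intro!: tendsto_eq_intros Lp_tendstoD(3)[OF f])
qed (intro Lp_scaleR Lp_tendstoD[OF f])+

lemma Lp_tendsto_mult: "Lp_tendsto Om p f F ==> Lp_tendsto Om p (%n x. c * f n x) (%x. c * F x :: real)"
 using Lp_tendsto_scaleR[of Om p f F c] by simp

lemma Lp_tendsto_diff:
 assumes "0 < p" "Lp_tendsto Om p f F" "Lp_tendsto Om p g G"
 shows "Lp_tendsto Om p (%n x. f n x - g n x) (%x. F x - G x)"
 using Lp_tendsto_add[OF assms(1,2) Lp_tendsto_scaleR[OF assms(3), of "-1"]] by simp

lemma Lp_tendsto_unique: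
 assumes p: "0 < p" and "Lp_tendsto Om p f F" "Lp_tendsto Om p f G"
 shows "AE x in leb Om. F x = G x"
proof -
 have "Lp_tendsto Om p (%n x. 0) (%x. F x - G x)"
  using Lp_tendsto_diff[OF p assms(2,3)] by simp
 hence "(LINT x|leb Om. norm (F x - G x) powr p) = 0" "(%x. F x - G x) \<in> Lp Om p"
  by (auto simp: Lp_tendsto_def norm_minus_commute LIMSEQ_const_iff)
 from Lp_integral_eq_0[OF this(2,1)] show ?thesis by simp
qed

text \<open>Dominated convergence has no direct \<open>L\<^sup>p\<close> converse, but a sequence converging so fast that
 \<open>\<Sum>\<^sub>k |f\<^sub>k - F|\<^sup>p\<close> is integrable converges pointwise and is dominated.\<close>

lemma Lp_tendsto_dominated_subseq:
 fixes f :: "nat => 'a::euclidean_space => 'b::euclidean_space"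
 assumes p: "0 < p" and f: "Lp_tendsto Om p f F"
 obtains r D where "strict_mono r" "integrable (leb Om) D"
  "AE x in leb Om. (%k. f (r k) x) ----> F x"
  "AE x in leb Om. \<forall>k. norm (f (r k) x) powr p <= D x"
proof -
 let ?M = "leb Om"
 let ?d = "%n. LINT x|?M. norm (f n x - F x) powr p"
 have "\<exists>r. strict_mono r & (\<forall>k. ?d (r k) < (1/2)^k)"
 proof -
  have ev: "\<exists>N. \<forall>n\<ge>N. ?d n < e" if "e > 0" for e
  using order_tendstoD(2)[OF Lp_tendstoD(3)[OF f] that] by (auto simp: eventually_sequentially)
  have "\<exists>r. \<forall>k. ?d (r k) < (1/2)^k & r k < r (Suc k)"
  proof (rule dependent_nat_choice)
  show "\<exists>x. ?d x < (1/2)^0" using ev[of 1] by auto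
  next
  fix x k
  obtain N where "\<forall>n\<ge>N. ?d n < (1/2)^Suc k" using ev[of "(1/2)^Suc k"] by auto
  thus "\<exists>y. ?d y < (1/2)^Suc k & x < y" by (intro exI[of _ "max N (Suc x)"]) auto
  qed
  thus ?thesis by (auto simp: strict_mono_Suc_iff)
 qed
 then obtain r where r: "strict_mono r" "!!k. ?d (r k) < (1/2)^k" by auto
 define h where "h k x = norm (f (r k) x - F x) powr p" for k x
 have h_int: "integrable ?M (h k)" for k
  unfolding h_def by (intro LpD(2) Lp_diff p Lp_tendstoD[OF f])
 have h0: "0 <= h k x" for k x by (simp add: h_def)
 have summ: "summable (%k. LINT x|?M. norm (h k x))"
 proof (rule summable_comparison_test'[of "%k. (1/2)^k" 0])
  show "norm (LINT x|?M. norm (h k x)) <= (1/2)^k" for k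
  using r(2)[of k] Lp_integral_nonneg[of Om "%x. f (r k) x - F x" p] by (simp add: h_def)
 qed simp
 have "(\<integral>\<^sup>+x. (\<Sum>k. ennreal (h k x)) \<partial>?M) = (\<Sum>k. \<integral>\<^sup>+x. ennreal (h k x) \<partial>?M)"
  using h_int by (intro nn_integral_suminf) auto
 also have "... = (\<Sum>k. ennreal (LINT x|?M. norm (h k x)))"
  using h0 by (subst nn_integral_eq_integral[OF h_int]) auto
 also have "... < \<infinity>" using summ by (subst suminf_ennreal2) auto
 finally have "AE x in ?M. (\<Sum>k. ennreal (h k x)) ~= \<infinity>"
  using h_int by (intro nn_integral_PInf_AE) auto
 hence AE_sum: "AE x in ?M. summable (%k. h k x)"
 proof eventually_elim
  case (elim x)
  thus ?case using h_def by (intro summable_suminf_not_top) auto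
 qed
 hence AE_sum': "AE x in ?M. summable (%k. norm (h k x))"
  by eventually_elim (simp add: h_def)
 define D where "D x = 2 powr p * (norm (F x) powr p + (\<Sum>k. h k x))" for x
 show thesis
 proof (rule that[OF r(1), of D])
  show "integrable ?M D" unfolding D_def
  using integrable_suminf[OF h_int AE_sum' summ] LpD(2)[OF Lp_tendstoD(2)[OF f]] by auto
  show "AE x in ?M. (%k. f (r k) x) ----> F x"
  using AE_sum
  proof eventually_elim
  case (elim x)
  have "(%k. h k x powr (1/p)) ----> 0"
  using tendsto_powr'[OF summable_LIMSEQ_zero[OF elim] tendsto_const[of "1/p"]] p by (auto simp: h_def)
  hence "(%k. norm (f (r k) x - F x)) ----> 0" using p by (simp add: h_def powr_powr)
  thus ?case by (simp add: tendsto_norm_zero_iff LIM_zero_iff)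
  qed
  show "AE x in ?M. \<forall>k. norm (f (r k) x) powr p <= D x"
  using AE_sum
  proof eventually_elim
  case (elim x)
  show ?case
  proof
  fix k
  have "norm (f (r k) x) powr p <= 2 powr p * (norm (F x) powr p + h k x)"
  unfolding h_def using norm_powr_add_le[OF p, of "F x" "f (r k) x - F x"] by simp
  also have "h k x <= (\<Sum>k. h k x)"
  using sum_le_suminf[OF elim, of "{k}"] by (simp add: h_def)
  finally show "norm (f (r k) x) powr p <= D x" by (simp add: D_def)
  qed
  qed
 qed
qed

lemma Lp_tendsto_dominated:
 fixes f :: "nat => 'a::euclidean_space => 'b::euclidean_space"
 assumes p: "0 < p" and f: "!!n. f n \<in> borel_measurable (leb Om)"
  and F: "F \<in> borel_measurable (leb Om)" and D: "integrable (leb Om) D"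
  and conv: "AE x in leb Om. (%k. f k x) ----> F x"
  and dom: "!!n. AE x in leb Om. norm (f n x) powr p <= D x"
 shows "Lp_tendsto Om p f F"
proof -
 let ?M = "leb Om"
 have dom': "AE x in ?M. \<forall>n. norm (f n x) powr p <= D x" using dom by (simp add: AE_all_countable)
 have FD: "AE x in ?M. norm (F x) powr p <= D x"
  using conv dom'
 proof eventually_elim
  case (elim x)
  have "(%k. norm (f k x) powr p) ----> norm (F x) powr p"
  using elim(1) p by (intro tendsto_powr' tendsto_norm) auto
  thus ?case using elim(2) by (intro LIMSEQ_le_const2) auto
 qed
 have fL: "f n \<in> Lp Om p" for n by (rule Lp_dominated[OF f D dom])
 have FL: "F \<in> Lp Om p" by (rule Lp_dominated[OF F D FD])
 have "(%n. LINT x|?M. norm (f n x - F x) powr p) ----> (LINT x|?M. 0)"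
 proof (rule integral_dominated_convergence[where w = "%x. 2 powr p * (D x + D x)"])
  show "AE x in ?M. (%n. norm (f n x - F x) powr p) ----> 0"
  using conv
  proof eventually_elim
  case (elim x)
  have "(%n. norm (f n x - F x)) ----> 0" using elim by (intro tendsto_norm_zero) (simp add: LIM_zero)
  from tendsto_powr'[OF this tendsto_const[of p]] show ?case using p by auto
  qed
  show "AE x in ?M. norm (norm (f n x - F x) powr p) <= 2 powr p * (D x + D x)" for n
  using dom[of n] FD
  proof eventually_elim
  case (elim x)
  have "norm (f n x - F x) powr p <= 2 powr p * (norm (f n x) powr p + norm (F x) powr p)"
  by (rule norm_powr_diff_le[OF p])
  also have "... <= 2 powr p * (D x + D x)" using elim by (intro mult_left_mono add_mono) auto
  finally show ?case by simp
  qed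
 qed (use f F D in auto)
 thus ?thesis using fL FL by (simp add: Lp_tendsto_def)
qed

lemma tendsto_subseq_subseq:
 fixes X :: "nat => 'b::topological_space"
 assumes "!!s. strict_mono (s::nat=>nat) ==> \<exists>r. strict_mono (r::nat=>nat) & (%n. X (s (r n))) ----> L"
 shows "X ----> L"
proof (rule ccontr)
 assume "\<not> X ----> L"
 then obtain U where U: "open U" "L \<in> U" "\<not> (\<forall>\<^sub>F n in sequentially. X n \<in> U)"
  by (auto simp: tendsto_def)
 hence "\<exists>\<^sub>F n in sequentially. X n \<notin> U" by (simp add: frequently_def)
 hence inf: "infinite {n. X n \<notin> U}" by (simp add: cofinite_eq_sequentially[symmetric] frequently_cofinite)
 define s where "s = enumerate {n. X n \<notin> U}"
 have s: "strict_mono s" "!!n. X (s n) \<notin> U"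
  using strict_mono_enumerate[OF inf] enumerate_in_set[OF inf] by (auto simp: s_def)
 obtain r where "(%n. X (s (r n))) ----> L" using assms[OF s(1)] by auto
 hence "\<forall>\<^sub>F n in sequentially. X (s (r n)) \<in> U" using U by (auto simp: tendsto_def)
 thus False using s(2) by (simp add: eventually_sequentially)
qed

lemma Lp_tendsto_integral_bounded:
 assumes p: "0 < p" and f: "Lp_tendsto Om p f F"
 obtains K where "!!n. (LINT x|leb Om. norm (f n x) powr p) <= K"
proof -
 have "Bseq (%n. LINT x|leb Om. norm (f n x - F x) powr p)"
  using Lp_tendstoD(3)[OF f] convergentI convergent_imp_Bseq by blast
 then obtain K where K: "!!n. norm (LINT x|leb Om. norm (f n x - F x) powr p) <= K"
  by (auto simp: Bseq_def)
 have "(LINT x|leb Om. norm (f n x) powr p) <= 2 powr p * (K + (LINT x|leb Om. norm (F x) powr p))" for n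
 proof -
  have "(LINT x|leb Om. norm (f n x) powr p) <= 2 powr p * ((LINT x|leb Om. norm (f n x - F x) powr p) + (LINT x|leb Om. norm (F x) powr p))"
  using norm_triangle_ineq[of "f n x - F x" "F x" for x]
  by (intro Lp_integral_triangle p Lp_diff Lp_tendstoD[OF f] LpD(1)[OF Lp_tendstoD(1)[OF f]] AE_I2) simp
  also have "... <= 2 powr p * (K + (LINT x|leb Om. norm (F x) powr p))"
  using K[of n] by (intro mult_left_mono add_right_mono) auto
  finally show ?thesis .
 qed
 thus thesis by (rule that)
qed

text \<open>A functional that is continuous along pointwise convergent dominated sequences is continuous in \<open>L\<^sup>p\<close>.\<close>

lemma Lp_tendsto_integral_norm:
 fixes f :: "nat => 'a::euclidean_space => 'b::euclidean_space"
 assumes p: "0 < p" and f: "Lp_tendsto Om p f F"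
 shows "(%n. LINT x|leb Om. norm (f n x) powr p) ----> (LINT x|leb Om. norm (F x) powr p)"
proof (rule tendsto_subseq_subseq)
 fix s :: "nat => nat" assume s: "strict_mono s"
 obtain r D where r: "strict_mono r" and D: "integrable (leb Om) D"
  "AE x in leb Om. (%k. f (s (r k)) x) ----> F x"
  "AE x in leb Om. \<forall>k. norm (f (s (r k)) x) powr p <= D x"
  by (rule Lp_tendsto_dominated_subseq[OF p Lp_tendsto_subseq[OF f s]])
 have "(%n. LINT x|leb Om. norm (f (s (r n)) x) powr p) ----> (LINT x|leb Om. norm (F x) powr p)"
 proof (rule integral_dominated_convergence[where w = D])
  show "AE x in leb Om. (%n. norm (f (s (r n)) x) powr p) ----> norm (F x) powr p"
  using D(2)
  proof eventually_elim
  case (elim x)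
  thus ?case using p by (intro tendsto_powr' tendsto_norm) auto
  qed
  show "AE x in leb Om. norm (norm (f (s (r n)) x) powr p) <= D x" for n
  using D(3) by eventually_elim auto
 qed (use D(1) LpD(1)[OF Lp_tendstoD(1)[OF f]] LpD(1)[OF Lp_tendstoD(2)[OF f]] in auto)
 thus "\<exists>r. strict_mono r & (%n. LINT x|leb Om. norm (f (s (r n)) x) powr p) ----> (LINT x|leb Om. norm (F x) powr p)"
  using r by blast
qed

text \<open>The Riesz-Fischer argument: a subsequence with summable increments converges pointwise, and Fatou does the rest.\<close>

lemma Lp_complete:
 fixes f :: "nat => 'a::euclidean_space => 'b::euclidean_space"
 assumes p: "0 < p" and f: "!!n. f n \<in> Lp Om p"
  and cauchy: "!!e. 0 < e ==> \<exists>N. \<forall>m\<ge>N. \<forall>n\<ge>N. (LINT x|leb Om. norm (f m x - f n x) powr p) < e"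
 obtains F where "Lp_tendsto Om p f F"
proof -
 let ?M = "leb Om"
 let ?d = "%m n. LINT x|?M. norm (f m x - f n x) powr p"
 \<comment> \<open>the factor 4 leaves room for a geometric weight that makes the increments summable\<close>
 define c where "c = (1/2 :: real) powr p * (1/2)"
 have c: "0 < c" "c < 1" using p powr_less_mono2[of p "1/2" 1] by (auto simp: c_def)
 obtain N where N: "!!k m n. m >= N k ==> n >= N k ==> ?d m n < c ^ k"
  using cauchy[of "c ^ k" for k] c(1) by (metis zero_less_power)
 define r where "r k = k + (\<Sum>j\<le>k. N j)" for k
 have rN: "r k >= N k" for k unfolding r_def by (simp add: trans_le_add2 member_le_sum)
 have r: "strict_mono r" unfolding r_def strict_mono_Suc_iff by simp
 have rS: "r (Suc k) >= N k" for k using rN[of k] r by (meson le_trans less_imp_le lessI strict_monoD)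
 define h where "h k x = (2 powr p) ^ k * norm (f (r (Suc k)) x - f (r k) x) powr p" for k x
 have h_int: "integrable ?M (h k)" for k
  unfolding h_def by (intro integrable_mult_right LpD(2) Lp_diff p f)
 have h0: "0 <= h k x" for k x by (simp add: h_def)
 have summ: "summable (%k. LINT x|?M. norm (h k x))"
 proof (rule summable_comparison_test'[of "%k. (1/2)^k" 0])
  fix k
  have "(LINT x|?M. norm (h k x)) = (2 powr p) ^ k * ?d (r (Suc k)) (r k)"
  using h0 by (simp add: h_def)
  also have "... <= (2 powr p) ^ k * c ^ k"
  using N[OF rS[of k] rN[of k]] by (intro mult_left_mono) auto
  also have "... = (1/2)^k" unfolding c_def power_mult_distrib[symmetric]
  by (simp add: powr_divide mult.assoc[symmetric])
  finally show "norm (LINT x|?M. norm (h k x)) <= (1/2)^k" by simp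
 qed simp
 have "(\<integral>\<^sup>+x. (\<Sum>k. ennreal (h k x)) \<partial>?M) = (\<Sum>k. \<integral>\<^sup>+x. ennreal (h k x) \<partial>?M)"
  using h_int by (intro nn_integral_suminf) auto
 also have "... = (\<Sum>k. ennreal (LINT x|?M. norm (h k x)))"
  using h0 by (subst nn_integral_eq_integral[OF h_int]) auto
 also have "... < \<infinity>" using summ by (subst suminf_ennreal2) auto
 finally have "AE x in ?M. (\<Sum>k. ennreal (h k x)) ~= \<infinity>"
  using h_int by (intro nn_integral_PInf_AE) auto
 hence AE_conv: "AE x in ?M. convergent (%k. f (r k) x)"
 proof eventually_elim
  case (elim x)
  have "summable (%k. h k x)" using elim h0 by (intro summable_suminf_not_top) auto
  hence "(%k. h k x) ----> 0" by (rule summable_LIMSEQ_zero)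
  hence "Bseq (%k. h k x)" using convergentI convergent_imp_Bseq by blast
  then obtain B where B: "B > 0" "!!k. h k x <= B" using h0 by (auto simp: Bseq_def)
  have inc: "norm (f (r (Suc k)) x - f (r k) x) <= B powr (1/p) * (1/2)^k" for k
  proof -
  have "norm (f (r (Suc k)) x - f (r k) x) powr p <= B * ((1/2) powr p)^k"
  using B(2)[of k] by (simp add: h_def powr_divide power_divide field_simps)
  hence "(norm (f (r (Suc k)) x - f (r k) x) powr p) powr (1/p) <= (B * ((1/2) powr p)^k) powr (1/p)"
  using p by (intro powr_mono2) auto
  also have "... = B powr (1/p) * (((1/2) powr p)^k) powr (1/p)" by (rule powr_mult)
  also have "((1/2::real) powr p)^k = ((1/2)^k) powr p"
  by (simp add: powr_realpow[symmetric] powr_powr mult.commute)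
  finally show ?thesis using p by (simp add: powr_powr)
  qed
  have "summable (%k. f (r (Suc k)) x - f (r k) x)"
  by (rule summable_comparison_test'[where N = 0 and g = "%k. B powr (1/p) * (1/2)^k"])
  (auto intro!: summable_mult inc)
  then obtain l where "(%n. \<Sum>k<n. f (r (Suc k)) x - f (r k) x) ----> l"
  by (auto simp: summable_def sums_def)
  hence "(%n. (f (r n) x - f (r 0) x) + f (r 0) x) ----> l + f (r 0) x"
  by (intro tendsto_add tendsto_const) (use sum_lessThan_telescope[of "%k. f (r k) x"] in simp)
  thus ?case by (auto simp: convergent_def)
 qed
 define F where "F x = lim (%k. f (r k) x)" for x
 have [measurable]: "f n \<in> borel_measurable ?M" for n using LpD(1)[OF f] .
 have Fm[measurable]: "F \<in> borel_measurable ?M" unfolding F_def by measurable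
 have AE_F: "AE x in ?M. (%k. f (r k) x) ----> F x"
  using AE_conv by eventually_elim (simp add: F_def convergent_LIMSEQ_iff)
 have fatou: "(\<integral>\<^sup>+x. norm (f m x - F x) powr p \<partial>?M) <= ennreal e"
  if "e > 0" "!!n. n >= N0 ==> ?d m n <= e" for m e N0
 proof -
  have "(\<integral>\<^sup>+x. norm (f m x - F x) powr p \<partial>?M) = (\<integral>\<^sup>+x. liminf (%k. ennreal (norm (f m x - f (r k) x) powr p)) \<partial>?M)"
  using AE_F
  proof (intro nn_integral_cong_AE, eventually_elim)
  case (elim x)
  have "(%k. norm (f m x - f (r k) x) powr p) ----> norm (f m x - F x) powr p"
  using p by (intro tendsto_powr' tendsto_norm tendsto_diff tendsto_const elim) auto
  hence "(%k. ennreal (norm (f m x - f (r k) x) powr p)) ----> ennreal (norm (f m x - F x) powr p)"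
  by (rule tendsto_ennrealI)
  from lim_imp_Liminf[OF _ this] show ?case by simp
  qed
  also have "... <= liminf (%k. \<integral>\<^sup>+x. norm (f m x - f (r k) x) powr p \<partial>?M)"
  by (intro nn_integral_liminf) measurable
  also have "... <= ennreal e"
  proof (rule Liminf_le)
  have "(\<integral>\<^sup>+x. norm (f m x - f (r k) x) powr p \<partial>?M) = ennreal (?d m (r k))" for k
  by (intro nn_integral_eq_integral LpD(2) Lp_diff p f) simp
  moreover have "?d m (r k) <= e" if "k >= N0" for k
  using \<open>!!n. n >= N0 ==> ?d m n <= e\<close> that strict_mono_imp_increasing[OF r, of k] by (meson le_trans)
  ultimately show "\<forall>\<^sub>F k in sequentially. (\<integral>\<^sup>+x. norm (f m x - f (r k) x) powr p \<partial>?M) <= ennreal e"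
  unfolding eventually_sequentially using \<open>e > 0\<close> by (auto intro!: ennreal_leI)
  qed simp
  finally show ?thesis .
 qed
 have mem: "(%x. f m x - F x) \<in> Lp Om p & ?M = ?M & (LINT x|?M. norm (f m x - F x) powr p) <= e"
  if "e > 0" "!!n. n >= N0 ==> ?d m n <= e" for m e N0
 proof -
  from fatou[OF that] have le: "(\<integral>\<^sup>+x. norm (f m x - F x) powr p \<partial>?M) <= ennreal e" by simp
  have "integrable ?M (%x. norm (f m x - F x) powr p)"
  using le by (intro integrableI_bounded) (auto simp: le_less_trans[OF _ ennreal_less_top])
  moreover have "(LINT x|?M. norm (f m x - F x) powr p) <= e"
  using le \<open>e > 0\<close> nn_integral_eq_integral[OF calculation] by simp
  ultimately show ?thesis by (auto simp: Lp_def)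
 qed
 have FL: "F \<in> Lp Om p"
 proof -
  have "(%x. f (N 0) x - F x) \<in> Lp Om p"
  using mem[of 1 "N 0" "N 0"] N[of 0 "N 0"] by (auto intro: less_imp_le)
  from Lp_diff[OF p f[of "N 0"] this] show ?thesis by simp
 qed
 have "Lp_tendsto Om p f F"
  unfolding Lp_tendsto_def
 proof (intro conjI allI f FL LIMSEQ_I)
  fix e :: real assume "e > 0"
  then obtain N0 where N0: "!!m n. m >= N0 ==> n >= N0 ==> ?d m n < e / 2" using cauchy[of "e/2"] by auto
  have "(LINT x|?M. norm (f m x - F x) powr p) <= e / 2" if "m >= N0" for m
  using mem[of "e/2" N0 m] N0[OF that] \<open>e > 0\<close> by (auto intro: less_imp_le)
  thus "\<exists>no. \<forall>n\<ge>no. norm ((LINT x|?M. norm (f n x - F x) powr p) - 0) < e"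
  using \<open>e > 0\<close> by (intro exI[of _ N0]) (fastforce simp: Lp_integral_nonneg)
 qed
 thus thesis by (rule that)
qed

text \<open>A strongly convergent factor may be replaced by its limit against factors that are merely bounded in the dual exponent.\<close>

lemma Lp_tendsto_weak:
 fixes f :: "nat => 'a::euclidean_space => 'b::euclidean_space"
 assumes p: "1 < p" and f: "Lp_tendsto Om p f F" and g: "!!n. g n \<in> Lp Om (conj_exp p)"
  and K: "!!n. (LINT x|leb Om. norm (g n x) powr conj_exp p) <= K"
 shows "(%n. (LINT x|leb Om. g n x \<bullet> f n x) - (LINT x|leb Om. g n x \<bullet> F x)) ----> 0"
proof (rule Lim_null_comparison)
 let ?d = "%n. LINT x|leb Om. norm (f n x - F x) powr p"
 show "\<forall>\<^sub>F n in sequentially. norm ((LINT x|leb Om. g n x \<bullet> f n x) - (LINT x|leb Om. g n x \<bullet> F x))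
  <= K powr (1 / conj_exp p) * ?d n powr (1/p)"
 proof (intro always_eventually allI)
  fix n
  have "(LINT x|leb Om. g n x \<bullet> f n x) - (LINT x|leb Om. g n x \<bullet> F x) = (LINT x|leb Om. g n x \<bullet> (f n x - F x))"
  using Lp_inner_integrable[OF p g Lp_tendstoD(1)[OF f]] Lp_inner_integrable[OF p g Lp_tendstoD(2)[OF f]]
  by (simp add: inner_diff_right)
  also have "\<bar>...\<bar> <= (LINT x|leb Om. norm (g n x) powr conj_exp p) powr (1 / conj_exp p) * ?d n powr (1/p)"
  using p by (intro Lp_Holder g Lp_diff Lp_tendstoD[OF f]) auto
  also have "... <= K powr (1 / conj_exp p) * ?d n powr (1/p)"
  using K[of n] conj_exp_gt_1[OF p] by (intro mult_right_mono powr_mono2) (auto simp: Lp_integral_nonneg)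
  finally show "norm ((LINT x|leb Om. g n x \<bullet> f n x) - (LINT x|leb Om. g n x \<bullet> F x)) <= K powr (1 / conj_exp p) * ?d n powr (1/p)"
  by simp
 qed
 have "(%n. ?d n powr (1/p)) ----> 0"
  using tendsto_powr'[OF Lp_tendstoD(3)[OF f] tendsto_const[of "1/p"]] p by (auto simp: Lp_integral_nonneg)
 thus "(%n. K powr (1 / conj_exp p) * ?d n powr (1/p)) ----> 0" by (rule tendsto_mult_right_zero)
qed

section \<open>Smooth functions\<close>

text \<open>The profiles \<open>exp (-1/t) / t\<^sup>n\<close>, extended by \<open>0\<close>: the derivative of each is a combination of two others.\<close>

definition theta :: "nat => real => real" where
 "theta n t = (if t <= 0 then 0 else exp (- (1 / t)) / t ^ n)"

lemma theta_tendsto_0: "(theta n \<longlongrightarrow> 0) (at 0)"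
proof -
 have "((%t. theta n t) \<longlongrightarrow> 0) (at_right 0)"
 proof (rule Lim_transform_eventually)
  have "((%t::real. (inverse t) ^ n / exp (inverse t)) \<longlongrightarrow> 0) (at_right 0)"
  by (rule filterlim_compose[OF tendsto_power_div_exp_0 filterlim_inverse_at_top_right])
  thus "((%t::real. (inverse t) ^ n / exp (inverse t)) \<longlongrightarrow> 0) (at_right 0)" .
  show "\<forall>\<^sub>F t in at_right 0. (inverse t) ^ n / exp (inverse t) = theta n t"
  using eventually_at_right_less[of "0::real"]
  by eventually_elim (simp add: theta_def exp_minus field_simps)
 qed
 moreover have "(theta n \<longlongrightarrow> 0) (at_left 0)"
  by (rule Lim_transform_eventually[OF tendsto_const])
  (auto simp: theta_def eventually_at intro!: exI[of _ 1])
 ultimately show ?thesis by (simp add: filterlim_at_split)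
qed

lemma theta_deriv: "(theta n has_real_derivative (theta (n + 2) t - n * theta (n + 1) t)) (at t)"
proof -
 consider "t < 0" | "t = 0" | "t > 0" by linarith
 thus ?thesis
 proof cases
  case 1
  have "((%t. 0) has_real_derivative 0) (at t)" by simp
  hence "(theta n has_real_derivative 0) (at t)"
  by (rule has_field_derivative_transform_within_open[of _ _ _ "{..<0}"]) (use 1 in \<open>auto simp: theta_def\<close>)
  thus ?thesis using 1 by (simp add: theta_def)
 next
  case 2
  have "((%h. (theta n (0 + h) - theta n 0) / h) \<longlongrightarrow> 0) (at 0)"
  by (rule Lim_transform_eventually[OF theta_tendsto_0[of "Suc n"]])
  (auto simp: theta_def field_simps eventually_at intro!: exI[of _ 1])
  thus ?thesis using 2 by (simp add: DERIV_def theta_def)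
 next
  case 3
  have "((%t. exp (- (1 / t)) / t ^ n) has_real_derivative
  ((exp (- (1 / t)) * (1 / t^2)) * t ^ n - exp (- (1 / t)) * (n * t ^ (n - 1))) / (t ^ n * t ^ n)) (at t)"
  using 3 by (auto intro!: derivative_eq_intros simp: power2_eq_square)
  moreover have "((exp (- (1 / t)) * (1 / t^2)) * t ^ n - exp (- (1 / t)) * (n * t ^ (n - 1))) / (t ^ n * t ^ n)
  = theta (n + 2) t - n * theta (n + 1) t"
  using 3 by (cases n) (auto simp: theta_def field_simps power2_eq_square)
  ultimately have "((%t. exp (- (1 / t)) / t ^ n) has_real_derivative (theta (n + 2) t - n * theta (n + 1) t)) (at t)"
  by simp
  thus ?thesis
  by (rule has_field_derivative_transform_within_open[of _ _ _ "{0<..}"]) (use 3 in \<open>auto simp: theta_def\<close>)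
 qed
qed

lemma theta_0_bounds: "0 <= theta 0 t" "theta 0 t <= 1" "0 < theta 0 t \<longleftrightarrow> 0 < t"
 by (auto simp: theta_def)

text \<open>Differentiation maps this algebra into itself, so its members have derivatives of all orders.\<close>

inductive smooth_alg :: "('a::euclidean_space => real) => bool" where
 base: "C_inf f ==> smooth_alg f"
| add: "smooth_alg f ==> smooth_alg g ==> smooth_alg (%x. f x + g x)"
| mult: "smooth_alg f ==> smooth_alg g ==> smooth_alg (%x. f x * g x)"
| theta: "C_inf f ==> smooth_alg (%x. theta n (f x))"

lemma C_inf_differentiable: "C_inf f ==> f differentiable (at x)"
 unfolding C_inf_def by (metis empty_set empty_subsetI iter_partial.simps(1))

lemma C_inf_partial:
 fixes f :: "'a::euclidean_space => real"
 shows "C_inf f ==> e \<in> Basis ==> C_inf (%x. frechet_derivative f (at x) e)"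
 unfolding C_inf_def
proof (intro allI impI)
 fix es :: "'a list" and x :: 'a
 assume C: "\<forall>es. set es \<subseteq> Basis --> (\<forall>x. iter_partial es f differentiable at x)" and "e \<in> Basis" "set es \<subseteq> Basis"
 hence "set (e # es) \<subseteq> Basis" by simp
 from C[rule_format, OF this] have "iter_partial (e # es) f differentiable at x" .
 thus "iter_partial es (%x. frechet_derivative f (at x) e) differentiable at x" by simp
qed

lemma iter_partial_const_differentiable: "iter_partial es (%x. c) differentiable (at x)"
 by (induction es arbitrary: c) auto

lemma C_inf_const: "C_inf (%x. c)"
 by (simp add: C_inf_def iter_partial_const_differentiable)

lemma frechet_derivative_unique: "(f has_derivative f') (at x) ==> frechet_derivative f (at x) = f'"
 using frechet_derivative_at by metis

lemma C_inf_inner: "C_inf (%x. x \<bullet> v)"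
 unfolding C_inf_def
proof (intro allI impI)
 fix es :: "'a list" and x
 show "iter_partial es (%x. x \<bullet> v) differentiable at x"
 proof (cases es)
  case Nil thus ?thesis by (simp add: bounded_linear_imp_differentiable bounded_linear_inner_left)
 next
  case (Cons e es')
  have "((%x. x \<bullet> v) has_derivative (%h. h \<bullet> v)) (at y)" for y :: 'a
  by (auto intro!: derivative_eq_intros)
  hence "frechet_derivative (%x. x \<bullet> v) (at y) = (%h. h \<bullet> v)" for y :: 'a
  by (rule frechet_derivative_unique)
  thus ?thesis by (simp add: Cons iter_partial_const_differentiable)
 qed
qed

lemma smooth_alg_derivative:
 "smooth_alg f ==> (\<forall>x. f differentiable (at x)) & (\<forall>e\<in>Basis. smooth_alg (%x. frechet_derivative f (at x) e))"
proof (induction rule: smooth_alg.induct)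
 case (base f)
 thus ?case using C_inf_differentiable C_inf_partial smooth_alg.base by blast
next
 case (add f g)
 hence d: "f differentiable (at x)" "g differentiable (at x)" for x by auto
 have "((%x. f x + g x) has_derivative (%h. frechet_derivative f (at x) h + frechet_derivative g (at x) h)) (at x)" for x
  using d[of x] unfolding frechet_derivative_works by (rule has_derivative_add)
 hence fd: "frechet_derivative (%x. f x + g x) (at x) = (%h. frechet_derivative f (at x) h + frechet_derivative g (at x) h)" for x
  by (rule frechet_derivative_unique)
 have "smooth_alg (%x. frechet_derivative f (at x) e + frechet_derivative g (at x) e)" if "e \<in> Basis" for e
  using add that by (intro smooth_alg.add) blast+
 moreover have "(%x. f x + g x) differentiable at x" for x using d by (intro differentiable_add)
 ultimately show ?case unfolding fd by blast
next
 case (mult f g)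
 hence d: "f differentiable (at x)" "g differentiable (at x)" for x by auto
 have "((%x. f x * g x) has_derivative (%h. f x * frechet_derivative g (at x) h + frechet_derivative f (at x) h * g x)) (at x)" for x
  using d[of x] unfolding frechet_derivative_works by (rule has_derivative_mult)
 hence fd: "frechet_derivative (%x. f x * g x) (at x) = (%h. f x * frechet_derivative g (at x) h + frechet_derivative f (at x) h * g x)" for x
  by (rule frechet_derivative_unique)
 have "smooth_alg (%x. f x * frechet_derivative g (at x) e + frechet_derivative f (at x) e * g x)" if "e \<in> Basis" for e
  using mult that by (intro smooth_alg.add smooth_alg.mult) blast+
 moreover have "(%x. f x * g x) differentiable at x" for x using d by (intro differentiable_mult)
 ultimately show ?case unfolding fd by blast
next
 case (theta f n)
 have d: "f differentiable (at x)" for x using C_inf_differentiable[OF theta] .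
 have hd: "((%x. theta n (f x)) has_derivative (%h. (theta (n + 2) (f x) + (- real n) * theta (n + 1) (f x)) * frechet_derivative f (at x) h)) (at x)" for x
  using has_derivative_compose[OF d[of x, unfolded frechet_derivative_works] theta_deriv[of n "f x", unfolded has_field_derivative_def]]
  by (simp add: o_def mult.commute)
 hence fd: "frechet_derivative (%x. theta n (f x)) (at x) = (%h. (theta (n + 2) (f x) + (- real n) * theta (n + 1) (f x)) * frechet_derivative f (at x) h)" for x
  by (rule frechet_derivative_unique)
 have "smooth_alg (%x. (theta (n + 2) (f x) + (- real n) * theta (n + 1) (f x)) * frechet_derivative f (at x) e)" if "e \<in> Basis" for e
  by (intro smooth_alg.add smooth_alg.mult smooth_alg.theta theta smooth_alg.base[OF C_inf_const]
  smooth_alg.base[OF C_inf_partial[OF theta that]])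
 moreover have "(%x. theta n (f x)) differentiable at x" for x using hd unfolding differentiable_def by blast
 ultimately show ?case unfolding fd by blast
qed

lemma smooth_alg_C_inf: "smooth_alg f ==> C_inf f"
proof -
 have "smooth_alg f ==> set es \<subseteq> Basis ==> iter_partial es f differentiable (at x)" for es x and f :: "'a::euclidean_space => real"
 proof (induction es arbitrary: f)
  case Nil thus ?case using smooth_alg_derivative[of f] by simp
 next
  case (Cons e es)
  hence "smooth_alg (%x. frechet_derivative f (at x) e)" using smooth_alg_derivative[of f] by simp
  from Cons.IH[OF this] Cons.prems show ?case by simp
 qed
 thus "smooth_alg f ==> C_inf f" by (simp add: C_inf_def)
qed

lemma C_inf_add: "C_inf f ==> C_inf g ==> C_inf (%x. f x + g x)"
 by (rule smooth_alg_C_inf[OF smooth_alg.add[OF smooth_alg.base smooth_alg.base]])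

lemma C_inf_mult: "C_inf f ==> C_inf g ==> C_inf (%x. f x * g x)"
 by (rule smooth_alg_C_inf[OF smooth_alg.mult[OF smooth_alg.base smooth_alg.base]])

lemma C_inf_theta: "C_inf f ==> C_inf (%x. theta n (f x))"
 by (rule smooth_alg_C_inf[OF smooth_alg.theta])

lemma C_inf_diff:
 assumes "C_inf f" "C_inf g"
 shows "C_inf (%x. f x - g x)"
proof -
 have "C_inf (%x. f x + (-1) * g x)" by (intro C_inf_add C_inf_mult C_inf_const assms)
 thus ?thesis by simp
qed

lemma C_inf_prod: "finite A ==> (!!i. i \<in> A ==> C_inf (f i)) ==> C_inf (%x. \<Prod>i\<in>A. f i x)"
proof (induction rule: finite_induct)
 case empty show ?case by (simp add: C_inf_const)
next
 case (insert i A)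
 have "C_inf (%x. f i x * (\<Prod>i\<in>A. f i x))" using insert by (intro C_inf_mult) blast+
 thus ?case using insert by simp
qed

lemma frechet_derivative_eq_grad:
 assumes "f differentiable (at x)"
 shows "frechet_derivative f (at x) h = grad f x \<bullet> h"
proof -
 interpret D: linear "frechet_derivative f (at x)" by (rule linear_frechet_derivative[OF assms])
 have "frechet_derivative f (at x) h = frechet_derivative f (at x) (\<Sum>i\<in>Basis. (h \<bullet> i) *R i)"
  by (simp only: euclidean_representation)
 also have "... = (\<Sum>i\<in>Basis. (h \<bullet> i) * frechet_derivative f (at x) i)"
  by (simp only: D.sum D.scale real_scaleR_def)
 also have "... = grad f x \<bullet> h"
  unfolding grad_def inner_sum_left inner_scaleR_left
  by (intro sum.cong refl) (simp only: inner_commute mult.commute)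
 finally show ?thesis .
qed

lemma has_derivative_grad:
 assumes "f differentiable (at x)"
 shows "(f has_derivative (%h. grad f x \<bullet> h)) (at x)"
proof -
 have "frechet_derivative f (at x) = (%h. grad f x \<bullet> h)"
  using frechet_derivative_eq_grad[OF assms] by blast
 thus ?thesis using assms unfolding frechet_derivative_works by simp
qed

lemma grad_eqI: "(f has_derivative (%h. g \<bullet> h)) (at x) ==> grad f x = g"
 using frechet_derivative_unique[of f "%h. g \<bullet> h" x] by (simp add: grad_def euclidean_representation)

lemma grad_const [simp]: "grad (%x. c) x = 0"
 by (rule grad_eqI) simp

lemma grad_add: "f differentiable (at x) ==> g differentiable (at x) ==> grad (%x. f x + g x) x = grad f x + grad g x"
 by (rule grad_eqI) (auto intro!: derivative_eq_intros has_derivative_grad simp: inner_add_left)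

lemma grad_mult: "f differentiable (at x) ==> g differentiable (at x) ==> grad (%x. f x * g x) x = f x *R grad g x + g x *R grad f x"
 by (rule grad_eqI) (auto intro!: derivative_eq_intros has_derivative_grad simp: inner_add_left)

lemma grad_compose: "f differentiable (at x) ==> (G has_real_derivative d) (at (f x)) ==> grad (%x. G (f x)) x = d *R grad f x"
 by (rule grad_eqI)
  (use has_derivative_compose[OF has_derivative_grad[of f x], of G "(*) d"] in \<open>simp add: has_field_derivative_def\<close>)

lemma grad_cmult: "f differentiable (at x) ==> grad (%x. c * f x) x = c *R grad f x"
 by (simp add: grad_mult)

lemma C_inf_continuous: "C_inf f ==> continuous_on S f"
 by (intro differentiable_imp_continuous_on) (simp add: C_inf_differentiable differentiable_on_def differentiable_at_withinI)

lemma C_inf_grad_continuous: "C_inf f ==> continuous_on S (grad f)"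
 unfolding grad_def[abs_def] by (intro continuous_intros C_inf_continuous C_inf_partial) auto

subsection \<open>Test functions\<close>

lemma test_functionD:
 assumes "test_function Om f"
 shows "C_inf f" "f differentiable (at x)" "continuous_on S f" "continuous_on S (grad f)"
  "f \<in> borel_measurable borel" "grad f \<in> borel_measurable borel"
proof -
 show C: "C_inf f" using assms by (simp add: test_function_def)
 show "f differentiable (at x)" "continuous_on S f" "continuous_on S (grad f)"
  using C by (rule C_inf_differentiable C_inf_continuous C_inf_grad_continuous)+
 show "f \<in> borel_measurable borel" "grad f \<in> borel_measurable borel"
  using C_inf_continuous[OF C] C_inf_grad_continuous[OF C]
  by (auto intro: borel_measurable_continuous_onI)
qed

lemma test_function_subset: "test_function U f ==> U \<subseteq> V ==> test_function V f"
 by (auto simp: test_function_def)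

lemma test_functionI:
 assumes "C_inf f" "compact K" "K \<subseteq> Om" "!!x. f x ~= 0 ==> x \<in> K"
 shows "test_function Om f"
proof -
 have sub: "closure {x. f x ~= 0} \<subseteq> K"
  by (rule closure_minimal) (use assms(4) compact_imp_closed[OF assms(2)] in blast)+
 have "bounded (closure {x. f x ~= 0})" by (rule bounded_subset[OF compact_imp_bounded[OF assms(2)] sub])
 hence "compact (closure {x. f x ~= 0})" unfolding compact_eq_bounded_closed by (simp only: closed_closure simp_thms)
 thus ?thesis using assms(1,3) sub unfolding test_function_def by blast
qed

lemma test_function_support:
 assumes "test_function Om f"
 obtains K where "compact K" "K \<subseteq> Om" "!!x. x \<notin> K ==> f x = 0" "!!x. x \<notin> K ==> grad f x = 0"
proof -
 define K where "K = closure {x. f x ~= 0}"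
 have K: "compact K" "K \<subseteq> Om" using assms by (simp_all add: test_function_def K_def)
 have z: "f x = 0" if "x \<notin> K" for x
  using that closure_subset[of "{x. f x ~= 0}"] unfolding K_def by blast
 have "grad f x = 0" if x: "x \<notin> K" for x
 proof (rule grad_eqI)
  have op: "open (- K)" using compact_imp_closed[OF K(1)] by (rule open_Compl)
  have "((%x. 0) has_derivative (%h. 0 \<bullet> h)) (at x)" by simp
  thus "(f has_derivative (%h. 0 \<bullet> h)) (at x)"
  proof (rule has_derivative_transform_within_open[OF _ op])
  show "x \<in> - K" using x by simp
  show "0 = f y" if "y \<in> - K" for y using z[of y] that by simp
  qed
 qed
 with K z show thesis by (rule that)
qed

lemma test_function_mono_support:
 assumes "test_function Om f" "C_inf g" "!!x. f x = 0 ==> g x = 0"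
 shows "test_function Om g"
proof -
 obtain K where K: "compact K" "K \<subseteq> Om" "!!x. x \<notin> K ==> f x = 0" "!!x. x \<notin> K ==> grad f x = 0"
  by (rule test_function_support[OF assms(1)]) (rule that)
 with assms show ?thesis by (intro test_functionI[of g K]) auto
qed

lemma test_function_0: "test_function Om (%x. 0)"
 by (rule test_functionI[of _ "{}"]) (auto intro: C_inf_const)

lemma test_function_add:
 assumes "test_function Om f" "test_function Om g"
 shows "test_function Om (%x. f x + g x)"
proof -
 obtain K where K: "compact K" "K \<subseteq> Om" "!!x. x \<notin> K ==> f x = 0" "!!x. x \<notin> K ==> grad f x = 0"
  by (rule test_function_support[OF assms(1)]) (rule that)
 obtain K' where K': "compact K'" "K' \<subseteq> Om" "!!x. x \<notin> K' ==> g x = 0" "!!x. x \<notin> K' ==> grad g x = 0"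
  by (rule test_function_support[OF assms(2)]) (rule that)
 show ?thesis
 proof (rule test_functionI)
  show "C_inf (%x. f x + g x)" by (intro C_inf_add test_functionD(1)[OF assms(1)] test_functionD(1)[OF assms(2)])
  show "compact (K \<union> K')" "K \<union> K' \<subseteq> Om" using K K' by auto
  show "x \<in> K \<union> K'" if "f x + g x ~= 0" for x
  using K(3)[of x] K'(3)[of x] that by (cases "x \<in> K"; cases "x \<in> K'") simp_all
 qed
qed

lemma test_function_mult: "C_inf g ==> test_function Om f ==> test_function Om (%x. g x * f x)"
 by (rule test_function_mono_support[of Om f]) (auto intro: C_inf_mult test_functionD)

lemma test_function_cmult: "test_function Om f ==> test_function Om (%x. c * f x)"
 by (intro test_function_mult C_inf_const)

lemma test_function_bounded:
 assumes "test_function Om f"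
 obtains B where "0 < B" "!!x. \<bar>f x\<bar> <= B" "!!x. norm (grad f x) <= B"
proof -
 obtain K where K: "compact K" "K \<subseteq> Om" "!!x. x \<notin> K ==> f x = 0" "!!x. x \<notin> K ==> grad f x = 0"
  by (rule test_function_support[OF assms]) (rule that)
 have "bounded (f ` K)" "bounded (grad f ` K)"
  using K(1) test_functionD(3,4)[OF assms, of K] by (auto intro!: compact_imp_bounded compact_continuous_image)
 then obtain B1 B2 where B: "!!x. x \<in> K ==> \<bar>f x\<bar> <= B1" "!!x. x \<in> K ==> norm (grad f x) <= B2"
  by (auto simp: bounded_iff)
 show thesis
 proof (rule that[of "max 1 (max B1 B2)"])
  fix x show "\<bar>f x\<bar> <= max 1 (max B1 B2)" using B(1)[of x] K(3)[of x] by (cases "x \<in> K") auto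
  show "norm (grad f x) <= max 1 (max B1 B2)" using B(2)[of x] K(4)[of x] by (cases "x \<in> K") auto
 qed simp
qed

lemma compact_support_integrable:
 fixes f :: "'a::euclidean_space => 'b::{banach,second_countable_topology}"
 assumes "compact K" "continuous_on UNIV f" "!!x. x \<notin> K ==> f x = 0"
 shows "integrable lborel f"
proof -
 have "integrable lborel (%x. indicator K x *R f x)"
  by (rule borel_integrable_compact[OF assms(1) continuous_on_subset[OF assms(2)]]) simp
 moreover have "(%x. indicator K x *R f x) = f" using assms(3) by (auto simp: indicator_def fun_eq_iff)
 ultimately show ?thesis by simp
qed

lemma integral_lebesgue_on_eq_lborel:
 fixes f :: "'a::euclidean_space => 'b::euclidean_space"
 assumes "Om \<in> sets lebesgue" "f \<in> borel_measurable borel" "!!x. x \<notin> Om ==> f x = 0"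
 shows "integral\<^sup>L (leb Om) f = integral\<^sup>L lborel f"
  "integrable (leb Om) f \<longleftrightarrow> integrable lborel f"
proof -
 have eq: "(%x. if x \<in> Om then f x else 0) = f" using assms(3) by auto
 have "integral\<^sup>L (leb Om) f = integral\<^sup>L lebesgue f"
  using Lebesgue_Measure.integral_restrict_UNIV[OF assms(1), of f] by (simp add: eq)
 thus "integral\<^sup>L (leb Om) f = integral\<^sup>L lborel f" using assms(2) by (simp add: integral_completion)
 have "integrable (leb Om) f \<longleftrightarrow> integrable lebesgue f"
  using Lebesgue_Measure.integrable_restrict_UNIV[OF assms(1), of f] by (simp add: eq)
 thus "integrable (leb Om) f \<longleftrightarrow> integrable lborel f" using assms(2) by (simp add: integrable_completion)
qed

lemma borel_measurable_lebesgue_onI: "f \<in> borel_measurable borel ==> f \<in> borel_measurable (leb Om)"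
 by (simp add: measurable_completion measurable_restrict_space1)

text \<open>A product of bumps \<open>exp (-1/t)\<close> in each coordinate; as \<open>k\<close> grows it increases to the
 indicator of the box, and the shift by \<open>1\<close> keeps its support compact inside the box.\<close>

definition box_bump :: "'a::euclidean_space => 'a => nat => 'a => real" where
 "box_bump a b k x = (\<Prod>i\<in>Basis. theta 0 (real k * ((x - a) \<bullet> i) - 1) * theta 0 (real k * ((b - x) \<bullet> i) - 1))"

lemma box_bump_01: "0 <= box_bump a b k x" "box_bump a b k x <= 1"
proof -
 show "0 <= box_bump a b k x" unfolding box_bump_def by (intro prod_nonneg) (auto simp: theta_0_bounds)
 show "box_bump a b k x <= 1" unfolding box_bump_def
  by (intro prod_le_1 conjI mult_nonneg_nonneg mult_le_one) (auto simp: theta_0_bounds)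
qed

lemma box_bump_test: "test_function (box a b) (box_bump a b k)"
proof (cases "k = 0")
 case True
 have "box_bump a b k = (%x. 0)" using True by (auto simp: box_bump_def theta_def fun_eq_iff)
 thus ?thesis by (simp add: test_function_0)
next
 case False
 let ?d = "(\<Sum>i\<in>Basis. (1 / real k) *R i) :: 'a"
 have di: "?d \<bullet> i = 1 / real k" if "i \<in> Basis" for i using that by (simp add: inner_sum_left_Basis)
 show ?thesis
 proof (rule test_functionI)
  have "C_inf (%x. real k * ((x - a) \<bullet> i) - 1)" "C_inf (%x. real k * ((b - x) \<bullet> i) - 1)" for i :: 'a
  by (auto simp: inner_diff_left intro!: C_inf_diff C_inf_mult C_inf_const C_inf_inner)
  thus "C_inf (box_bump a b k)" unfolding box_bump_def[abs_def]
  by (intro C_inf_prod C_inf_mult C_inf_theta) auto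
  show "compact (cbox (a + ?d) (b - ?d))" by simp
  show "cbox (a + ?d) (b - ?d) \<subseteq> box a b"
  proof
  fix x assume x: "x \<in> cbox (a + ?d) (b - ?d)"
  have "1 / real k > 0" using False by simp
  moreover have "a \<bullet> i + 1 / real k <= x \<bullet> i & x \<bullet> i <= b \<bullet> i - 1 / real k" if "i \<in> Basis" for i
  using x that unfolding mem_box by (auto simp: inner_add_left inner_diff_left di)
  ultimately have "a \<bullet> i < x \<bullet> i & x \<bullet> i < b \<bullet> i" if "i \<in> Basis" for i
  using that by (smt (verit))
  thus "x \<in> box a b" unfolding mem_box by blast
  qed
  fix x assume "box_bump a b k x ~= 0"
  hence nz: "\<forall>i\<in>Basis. theta 0 (real k * ((x - a) \<bullet> i) - 1) ~= 0 & theta 0 (real k * ((b - x) \<bullet> i) - 1) ~= 0"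
  by (auto simp: box_bump_def)
  hence "\<forall>i\<in>Basis. real k * ((x - a) \<bullet> i) > 1 & real k * ((b - x) \<bullet> i) > 1"
  by (auto simp: theta_def split: if_splits)
  thus "x \<in> cbox (a + ?d) (b - ?d)" unfolding mem_box using False
  by (auto simp: inner_add_left inner_diff_left di field_simps intro: less_imp_le)
 qed
qed

lemma theta_0_tendsto_1: "s > 0 ==> (%k. theta 0 (real k * s - 1)) ----> 1"
proof -
 assume s: "s > 0"
 have lim: "filterlim (%k. real k * s - 1) at_top sequentially"
  using filterlim_tendsto_add_at_top[OF tendsto_const[of "-1"] filterlim_at_top_mult_tendsto_pos[OF tendsto_const s filterlim_real_sequentially]]
  by simp
 have "(%k. exp (- (inverse (real k * s - 1)))) ----> exp (- 0)"
  by (intro tendsto_exp tendsto_minus tendsto_inverse_0_at_top lim)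
 moreover have "\<forall>\<^sub>F k in sequentially. exp (- (inverse (real k * s - 1))) = theta 0 (real k * s - 1)"
  using filterlim_at_top_dense[THEN iffD1, OF lim, rule_format, of 0]
  by eventually_elim (simp add: theta_def inverse_eq_divide)
 ultimately show ?thesis by (auto intro: Lim_transform_eventually)
qed

lemma box_bump_limit:
 assumes "x \<in> box a b"
 shows "(%k. box_bump a b k x) ----> 1"
proof -
 have "(%k. box_bump a b k x) ----> (\<Prod>i\<in>(Basis::'a set). 1 * 1)"
  unfolding box_bump_def
  using assms by (intro tendsto_prod tendsto_mult theta_0_tendsto_1) (auto simp: mem_box inner_diff_left)
 thus ?thesis by simp
qed

lemma box_bump_eq_0: "x \<notin> box a b ==> box_bump a b k x = 0"
 using box_bump_test[of a b k] closure_subset[of "{x. box_bump a b k x ~= 0}"]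
 unfolding test_function_def by blast

lemma open_indicator_limit:
 fixes U :: "'a::euclidean_space set"
 assumes "open U"
 obtains ps :: "nat => 'a => real" where "!!n. test_function U (ps n)" "!!n x. 0 <= ps n x" "!!n x. ps n x <= 1"
  "!!x. (%n. ps n x) ----> indicator U x"
proof (cases "U = {}")
 case True
 thus ?thesis by (intro that[of "%_ _. 0"]) (auto simp: test_function_0)
next
 case False
 obtain DD where D: "countable DD" "DD \<subseteq> Pow U" "!!X. X \<in> DD ==> \<exists>a b. X = box a b" "\<Union>DD = U"
  by (rule open_countable_Union_open_box[OF assms]) (rule that)
 have "DD ~= {}" using False D(4) by auto
 define B where "B = from_nat_into DD"
 have B: "range B = DD" unfolding B_def by (rule range_from_nat_into[OF \<open>DD ~= {}\<close> D(1)])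
 have "\<forall>j. \<exists>a b. B j = box a b" using D(3) B by blast
 then obtain a b where ab: "!!j. B j = box (a j) (b j)" by metis
 define ps where "ps n x = 1 - (\<Prod>j<n. 1 - box_bump (a j) (b j) n x)" for n x
 have prod01: "0 <= (\<Prod>j\<in>J. 1 - box_bump (a j) (b j) n x)" "(\<Prod>j\<in>J. 1 - box_bump (a j) (b j) n x) <= 1" for J n x
  using box_bump_01 by (auto intro!: prod_nonneg prod_le_1)
 have boxU: "box (a j) (b j) \<subseteq> U" for j using ab B D(2) by blast
 show ?thesis
 proof (rule that[of ps])
  fix n x
  show "0 <= ps n x" "ps n x <= 1" using prod01[of n x "{..<n}"] by (auto simp: ps_def)
  let ?K = "\<Union>j<n. closure {x. box_bump (a j) (b j) n x ~= 0}"
  show "test_function U (ps n)"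
  proof (rule test_functionI[of _ ?K])
  show "C_inf (ps n)" unfolding ps_def
  using test_functionD(1)[OF box_bump_test] by (intro C_inf_diff C_inf_prod C_inf_const) auto
  show "compact ?K" using box_bump_test by (intro compact_UN) (auto simp: test_function_def)
  have "closure {x. box_bump (a j) (b j) n x ~= 0} \<subseteq> U" for j
  using box_bump_test[of "a j" "b j" n] boxU[of j] unfolding test_function_def by blast
  thus "?K \<subseteq> U" by blast
  show "x \<in> ?K" if "ps n x ~= 0" for x
  proof (rule ccontr)
  assume "x \<notin> ?K"
  hence "box_bump (a j) (b j) n x = 0" if "j < n" for j
  using that closure_subset[of "{x. box_bump (a j) (b j) n x ~= 0}"] by blast
  thus False using \<open>ps n x ~= 0\<close> by (simp add: ps_def)
  qed
  qed
 next
  fix x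
  show "(%n. ps n x) ----> indicator U x"
  proof (cases "x \<in> U")
  case False
  hence "x \<notin> box (a j) (b j)" for j using boxU by auto
  hence "ps n x = 0" for n by (simp add: ps_def box_bump_eq_0)
  thus ?thesis using False by simp
  next
  case True
  then obtain j where j: "x \<in> box (a j) (b j)" using D(4) B ab by (metis UN_E)
  have "\<forall>\<^sub>F n in sequentially. box_bump (a j) (b j) n x <= ps n x"
  using eventually_gt_at_top[of j]
  proof eventually_elim
  case (elim n)
  have "(\<Prod>j<n. 1 - box_bump (a j) (b j) n x) = (1 - box_bump (a j) (b j) n x) * (\<Prod>j\<in>{..<n}-{j}. 1 - box_bump (a j) (b j) n x)"
  using elim by (subst prod.remove[of _ j]) auto
  also have "... <= (1 - box_bump (a j) (b j) n x) * 1"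
  using prod01 box_bump_01 by (intro mult_left_mono) auto
  finally show ?case by (simp add: ps_def)
  qed
  moreover have "ps n x <= 1" for n using prod01 by (simp add: ps_def)
  ultimately have "(%n. ps n x) ----> 1"
  by (intro tendsto_sandwich[OF _ _ box_bump_limit[OF j] tendsto_const]) auto
  thus ?thesis using True by simp
  qed
 qed
qed

text \<open>A measurable set is, up to a null set, a decreasing limit of open sets, and an open set is
 the limit of test functions; so testing against nonnegative test functions detects the sign.\<close>

lemma AE_nonpos_of_test:
 fixes G :: "'a::euclidean_space => real"
 assumes "open Om" and G: "integrable (leb Om) G"
  and test: "!!ps. test_function Om ps ==> (!!x. 0 <= ps x) ==> (LINT x|leb Om. ps x * G x) <= 0"
 shows "AE x in leb Om. G x <= 0"
proof -
 let ?M = "leb Om"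
 have Om: "Om \<in> sets lebesgue" using assms(1) by simp
 have Gm[measurable]: "G \<in> borel_measurable ?M" using G by auto
 have op: "(LINT x|?M. indicator U x * G x) <= 0" if "open U" "U \<subseteq> Om" for U
 proof -
  obtain ps :: "nat => 'a => real" where ps: "!!n. test_function U (ps n)" "!!n x. 0 <= ps n x" "!!n x. ps n x <= 1"
  "!!x. (%n. ps n x) ----> indicator U x" by (rule open_indicator_limit[OF \<open>open U\<close>]) (rule that)
  have [measurable]: "ps n \<in> borel_measurable ?M" for n
  by (intro borel_measurable_lebesgue_onI test_functionD(5)[OF ps(1)])
  have [measurable]: "indicator U \<in> borel_measurable ?M"
  by (intro borel_measurable_lebesgue_onI borel_measurable_indicator) (simp add: \<open>open U\<close>)
  have "(%n. LINT x|?M. ps n x * G x) ----> (LINT x|?M. indicator U x * G x)"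
  by (rule integral_dominated_convergence[where w = "%x. \<bar>G x\<bar>"])
  (use G ps in \<open>auto intro!: AE_I2 tendsto_mult simp: abs_mult mult_left_le_one_le\<close>)
  moreover have "(LINT x|?M. ps n x * G x) <= 0" for n
  using ps by (intro test test_function_subset[OF _ \<open>U \<subseteq> Om\<close>])
  ultimately show ?thesis by (intro LIMSEQ_le_const2) auto
 qed
 define A where "A = {x \<in> Om. 0 < G x}"
 have AM: "A \<in> sets ?M" unfolding A_def by measurable (auto simp: A_def)
 hence "A \<in> sets lebesgue" using Om by (simp add: sets_restrict_space_iff)
 then obtain C T where CT: "gdelta C" "T \<in> null_sets lebesgue" "A \<union> T = C"
  by (rule lebesgue_set_almost_gdelta)
 from CT(1) obtain F :: "nat => 'a set" where F: "!!n. open (F n)" "C = \<Inter>(F ` UNIV)"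
  by (auto elim: gdelta.cases)
 define U where "U n = Om \<inter> (\<Inter>i\<le>n. F i)" for n
 have U: "open (U n)" "U n \<subseteq> Om" for n unfolding U_def using F assms(1) by (auto intro!: open_Int open_INT)
 have [measurable]: "indicator (U n) \<in> borel_measurable ?M" for n
  by (intro borel_measurable_lebesgue_onI borel_measurable_indicator) (simp add: U)
 have TM: "AE x in ?M. x \<notin> T"
 proof -
  have "AE x in lebesgue. x \<notin> T" by (rule AE_not_in[OF CT(2)])
  hence "AE x in lebesgue. x \<in> Om --> x \<notin> T" by eventually_elim simp
  thus ?thesis using Om by (simp add: AE_restrict_space_iff)
 qed
 have "(%n. LINT x|?M. indicator (U n) x * G x) ----> (LINT x|?M. indicator A x * G x)"
 proof (rule integral_dominated_convergence[where w = "%x. \<bar>G x\<bar>"])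
  show "AE x in ?M. (%n. indicator (U n) x * G x) ----> indicator A x * G x"
  using TM AE_space
  proof eventually_elim
  case (elim x)
  show ?case
  proof (cases "x \<in> A")
  case True
  hence "x \<in> U n" for n using F(2) CT(3) elim by (auto simp: U_def A_def)
  thus ?thesis using True by simp
  next
  case False
  hence "x \<notin> C" using CT(3) elim by auto
  then obtain m where "x \<notin> F m" using F(2) by auto
  hence "x \<notin> U n" if "n >= m" for n using that by (auto simp: U_def)
  hence "\<forall>\<^sub>F n in sequentially. indicator (U n) x * G x = indicator A x * G x"
  using False by (auto simp: eventually_sequentially intro!: exI[of _ m])
  thus ?thesis by (rule tendsto_eventually)
  qed
  qed
  show "AE x in ?M. norm (indicator (U n) x * G x) <= \<bar>G x\<bar>" for n
  by (intro AE_I2) (simp add: indicator_def)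
  show "(%x. indicator (U n) x * G x) \<in> borel_measurable ?M" for n by measurable
  show "(%x. indicator A x * G x) \<in> borel_measurable ?M" using AM by measurable
 qed (use G in simp)
 hence "(LINT x|?M. indicator A x * G x) <= 0" using op[OF U] by (intro LIMSEQ_le_const2) auto
 moreover have "0 <= indicator A x * G x" for x by (auto simp: A_def indicator_def)
 moreover have "integrable ?M (%x. indicator A x * G x)" using integrable_mult_indicator[OF AM G] by simp
 ultimately have "AE x in ?M. indicator A x * G x = 0"
  using integral_nonneg_eq_0_iff_AE[of ?M "%x. indicator A x * G x"] integral_nonneg_AE[of "%x. indicator A x * G x" ?M]
  by (auto intro: antisym)
 thus ?thesis using AE_space
  by eventually_elim (auto simp: A_def indicator_def split: if_splits)
qed

lemma AE_zero_of_test: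
 fixes g :: "'a::euclidean_space => 'b::euclidean_space"
 assumes "open Om" and g: "integrable (leb Om) g"
  and test: "!!ps. test_function Om ps ==> (LINT x|leb Om. ps x *R g x) = 0"
 shows "AE x in leb Om. g x = 0"
proof -
 let ?M = "leb Om"
 have "AE x in ?M. g x \<bullet> i = 0" if "i \<in> Basis" for i
 proof -
  have I: "integrable ?M (%x. g x \<bullet> i)" using g by simp
  have z: "(LINT x|?M. ps x * (g x \<bullet> i)) = 0" if "test_function Om ps" for ps
  proof -
  obtain B where B: "0 < B" "!!x. \<bar>ps x\<bar> <= B" "!!x. norm (grad ps x) <= B"
  by (rule test_function_bounded[OF \<open>test_function Om ps\<close>]) (rule that)
  have "integrable ?M (%x. ps x *R g x)"
  proof (rule Bochner_Integration.integrable_bound[of _ "%x. B *R g x"])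
  show "(%x. ps x *R g x) \<in> borel_measurable ?M"
  using borel_measurable_lebesgue_onI[OF test_functionD(5)[OF that]] g by measurable
  qed (use g B in \<open>auto intro!: AE_I2 mult_right_mono\<close>)
  hence "(LINT x|?M. (ps x *R g x) \<bullet> i) = (LINT x|?M. ps x *R g x) \<bullet> i" by (intro integral_inner_left)
  thus ?thesis using test[OF that] by simp
  qed
  have "AE x in ?M. g x \<bullet> i <= 0" by (rule AE_nonpos_of_test[OF assms(1) I]) (simp add: z)
  moreover have "AE x in ?M. - (g x \<bullet> i) <= 0"
  using I by (intro AE_nonpos_of_test[OF assms(1)]) (auto simp: z)
  ultimately show ?thesis by eventually_elim simp
 qed
 hence "AE x in ?M. \<forall>i\<in>Basis. g x \<bullet> i = 0" by (simp add: AE_finite_all)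
 thus ?thesis by eventually_elim (auto intro: euclidean_eqI)
qed

section \<open>Translation estimates for test functions\<close>

lemma integral_lborel_translate:
 fixes f :: "'a::euclidean_space => 'b::euclidean_space"
 assumes "f \<in> borel_measurable borel"
 shows "(LINT x|lborel. f (x + z)) = (LINT x|lborel. f x)"
proof -
 have "(LINT x|lborel. f x) = (\<integral>x. f x \<partial>distr lborel borel ((+) z))" by (simp add: lborel_distr_plus)
 also have "... = (LINT x|lborel. f (z + x))" using assms by (subst integral_distr) auto
 finally show ?thesis by (simp add: add.commute)
qed

lemma test_function_Lipschitz:
 assumes f: "test_function Om f" and B: "!!x. norm (grad f x) <= B"
 shows "\<bar>f y - f x\<bar> <= B * norm (y - x)"
proof -
 have B0: "0 <= B" using B[of undefined] norm_ge_zero order_trans by blast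
 have "norm (f y - f x) <= B * norm (y - x)"
 proof (rule differentiable_bound[where S = UNIV and f' = "%x h. grad f x \<bullet> h"])
  show "(f has_derivative (%h. grad f x \<bullet> h)) (at x within UNIV)" for x
  using has_derivative_grad[OF test_functionD(2)[OF f], of x] by simp
  show "onorm (%h. grad f x \<bullet> h) <= B" for x
  proof (rule onorm_bound[OF B0])
  show "norm (grad f x \<bullet> h) <= B * norm h" for h
  using Cauchy_Schwarz_ineq2[of "grad f x" h] mult_right_mono[OF B[of x] norm_ge_zero[of h]] by simp
  qed
 qed auto
 thus ?thesis by simp
qed

lemma test_function_difference_quotient:
 assumes f: "test_function UNIV f"
 obtains B R where "0 < B" "!!n x. \<bar>real (Suc n) * (f (x + (1 / real (Suc n)) *R h) - f x)\<bar> <= B * indicator (cball 0 R) x"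
  "!!x. (%n. real (Suc n) * (f (x + (1 / real (Suc n)) *R h) - f x)) ----> grad f x \<bullet> h"
proof -
 obtain B where B: "0 < B" "!!x. \<bar>f x\<bar> <= B" "!!x. norm (grad f x) <= B"
  by (rule test_function_bounded[OF f]) (rule that)
 obtain K where K: "compact K" "K \<subseteq> UNIV" "!!x. x \<notin> K ==> f x = 0" "!!x. x \<notin> K ==> grad f x = 0"
  by (rule test_function_support[OF f]) (rule that)
 obtain R where R: "!!x. x \<in> K ==> norm x <= R"
  using compact_imp_bounded[OF K(1)] unfolding bounded_iff by blast
 show thesis
 proof (rule that[of "B * norm h + 1" "R + norm h"])
  show "0 < B * norm h + 1" using B(1) by (simp add: add_nonneg_pos)
  fix x n
  let ?t = "1 / real (Suc n)"
  show "\<bar>real (Suc n) * (f (x + ?t *R h) - f x)\<bar> <= (B * norm h + 1) * indicator (cball 0 (R + norm h)) x"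
  proof (cases "x \<in> cball 0 (R + norm h)")
  case True
  have "\<bar>f (x + ?t *R h) - f x\<bar> <= B * (?t * norm h)"
  using test_function_Lipschitz[OF f B(3), of "x + ?t *R h" x] by simp
  hence "real (Suc n) * \<bar>f (x + ?t *R h) - f x\<bar> <= real (Suc n) * (B * (?t * norm h))"
  by (intro mult_left_mono) auto
  also have "... = B * norm h" by (simp add: field_simps)
  finally show ?thesis using True by (simp only: abs_mult abs_of_nat indicator_simps mult_1_right)
  next
  case False
  hence nx: "norm x > R + norm h" by simp
  have "norm (?t *R h) <= norm h" by (simp add: field_simps)
  hence "norm (x + ?t *R h) > R" using nx norm_triangle_ineq2[of x "- (?t *R h)"] by simp
  moreover have "norm x > R" using nx norm_ge_zero[of h] by linarith
  ultimately have "f x = 0" "f (x + ?t *R h) = 0" using R K(3) by (meson not_le)+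
  thus ?thesis using False by simp
  qed
 next
  fix x
  have "((%t. (f (x + t *R h) - f x) /\<^sub>R t) \<longlongrightarrow> grad f x \<bullet> h) (at 0)"
  proof -
  have "((%t. f (x + t *R h)) has_derivative (%t. grad f x \<bullet> (t *R h))) (at 0)"
  proof (rule has_derivative_compose[where f = "%t. x + t *R h" and g = f])
  show "((%t. x + t *R h) has_derivative (%t. t *R h)) (at 0)" by (auto intro!: derivative_eq_intros)
  show "(f has_derivative (\<bullet>) (grad f x)) (at (x + 0 *R h))"
  using has_derivative_grad[OF test_functionD(2)[OF f], of x] by simp
  qed
  hence "((%t. f (x + t *R h)) has_real_derivative (grad f x \<bullet> h)) (at 0)"
  unfolding has_field_derivative_def by (simp add: mult_commute_abs)
  thus ?thesis by (simp add: DERIV_def divide_inverse mult.commute)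
  qed
  moreover have "filterlim (%n. 1 / real (Suc n)) (at 0) sequentially"
  using LIMSEQ_inverse_real_of_nat unfolding filterlim_at by (simp add: inverse_eq_divide)
  ultimately have "((%n. (f (x + (1 / real (Suc n)) *R h) - f x) /\<^sub>R (1 / real (Suc n))) \<longlongrightarrow> grad f x \<bullet> h) sequentially"
  by (rule filterlim_compose)
  thus "(%n. real (Suc n) * (f (x + (1 / real (Suc n)) *R h) - f x)) ----> grad f x \<bullet> h" by simp
 qed
qed

lemma test_function_integrable:
 assumes f: "test_function UNIV f"
 shows "integrable lborel f" "integrable lborel (grad f)"
  "0 < p ==> integrable lborel (%x. \<bar>f x\<bar> powr p)" "0 < p ==> integrable lborel (%x. norm (grad f x) powr p)"
  "0 < p ==> integrable lborel (%x. \<bar>grad f x \<bullet> h\<bar> powr p)"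
proof -
 obtain K where K: "compact K" "K \<subseteq> UNIV" "!!x. x \<notin> K ==> f x = 0" "!!x. x \<notin> K ==> grad f x = 0"
  by (rule test_function_support[OF f]) (rule that)
 note c[continuous_intros] = test_functionD(3,4)[OF f, of UNIV]
 show "integrable lborel f" "integrable lborel (grad f)"
  using K c by (auto intro: compact_support_integrable)
 show "integrable lborel (%x. \<bar>f x\<bar> powr p)" "integrable lborel (%x. norm (grad f x) powr p)"
  "integrable lborel (%x. \<bar>grad f x \<bullet> h\<bar> powr p)" if "0 < p"
  using K that by (auto intro!: compact_support_integrable[OF K(1)] continuous_intros continuous_on_powr')
qed

lemma test_function_translate:
 assumes "test_function UNIV f"
 shows "integrable lborel (%x. f (x + z))" "0 < p ==> integrable lborel (%x. \<bar>f (x + z) - f (x + w)\<bar> powr p)"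
  "0 < p ==> integrable lborel (%x. \<bar>f (x + z)\<bar> powr p)"
proof -
 obtain K where K: "compact K" "K \<subseteq> UNIV" "!!x. x \<notin> K ==> f x = 0" "!!x. x \<notin> K ==> grad f x = 0"
  by (rule test_function_support[OF assms]) (rule that)
 have c: "continuous_on UNIV (%x. f (x + z))" for z
  by (rule continuous_on_compose2[OF test_functionD(3)[OF assms, of UNIV]]) (auto intro!: continuous_intros)
 have K': "compact ((%x. x - z) ` K)" for z
  by (intro compact_continuous_image continuous_intros K)
 have z0: "f (x + z) = 0" if "x \<notin> (%x. x - z) ` K" for x z
  using that by (intro K(3)) (metis add_diff_cancel image_eqI)
 show "integrable lborel (%x. f (x + z))"
  by (rule compact_support_integrable[OF K'[of z] c z0])
 show "integrable lborel (%x. \<bar>f (x + z)\<bar> powr p)" if "0 < p"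
 proof (rule compact_support_integrable[OF K'[of z]])
  show "continuous_on UNIV (%x. \<bar>f (x + z)\<bar> powr p)"
  using that by (intro continuous_on_powr' continuous_intros c) auto
 qed (use z0 that in auto)
 show "integrable lborel (%x. \<bar>f (x + z) - f (x + w)\<bar> powr p)" if "0 < p"
 proof (rule compact_support_integrable)
  show "compact ((%x. x - z) ` K \<union> (%x. x - w) ` K)" using K' by blast
  show "continuous_on UNIV (%x. \<bar>f (x + z) - f (x + w)\<bar> powr p)"
  using that by (intro continuous_on_powr' continuous_intros c) auto
 qed (use z0 that in auto)
qed

text \<open>No integration by parts is needed: the integral is translation invariant, so its derivative
 in any direction vanishes.\<close>

lemma integral_grad_eq_0:
 assumes f: "test_function UNIV f"
 shows "(LINT x|lborel. grad f x) = 0"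
proof (rule euclidean_eqI)
 fix i :: 'a assume "i \<in> Basis"
 obtain B R where B: "0 < B" "!!n x. \<bar>real (Suc n) * (f (x + (1 / real (Suc n)) *R i) - f x)\<bar> <= B * indicator (cball 0 R) x"
  "!!x. (%n. real (Suc n) * (f (x + (1 / real (Suc n)) *R i) - f x)) ----> grad f x \<bullet> i"
  by (rule test_function_difference_quotient[OF f, of i]) (rule that)
 note [measurable] = test_functionD(5,6)[OF f]
 have "(%n. LINT x|lborel. real (Suc n) * (f (x + (1 / real (Suc n)) *R i) - f x)) ----> (LINT x|lborel. grad f x \<bullet> i)"
 proof (rule integral_dominated_convergence[where w = "%x. B * indicator (cball 0 R) x"])
  show "integrable lborel (%x. B * indicator (cball 0 R :: 'a set) x)"
  by (intro integrable_mult_right integrable_real_indicator) (use emeasure_lborel_cball_finite[of 0 R] in \<open>auto simp: infinity_ennreal_def\<close>)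
  show "AE x in lborel. norm (real (Suc n) * (f (x + (1 / real (Suc n)) *R i) - f x)) <= B * indicator (cball 0 R) x" for n
  using B(2)[of n] by (intro AE_I2) (simp only: real_norm_def)
  show "AE x in lborel. (%n. real (Suc n) * (f (x + (1 / real (Suc n)) *R i) - f x)) ----> grad f x \<bullet> i"
  using B(3) by (intro AE_I2)
 qed measurable
 moreover have "(LINT x|lborel. real (Suc n) * (f (x + (1 / real (Suc n)) *R i) - f x)) = 0" for n
  using test_function_translate(1)[OF f] test_function_integrable(1)[OF f]
  by (simp add: integral_lborel_translate)
 ultimately have "(LINT x|lborel. grad f x \<bullet> i) = 0" by (simp add: LIMSEQ_const_iff)
 thus "(LINT x|lborel. grad f x) \<bullet> i = 0 \<bullet> i"
  using integral_inner_left[of i lborel "grad f"] test_function_integrable(2)[OF f] by simp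
qed

lemma sum_powr_le:
 fixes a :: "nat => real"
 assumes p: "1 < p"
 shows "\<bar>\<Sum>i<Suc n. a i\<bar> powr p <= real (Suc n) powr (p - 1) * (\<Sum>i<Suc n. \<bar>a i\<bar> powr p)"
proof -
 let ?N = "real (Suc n)"
 define m where "m = (\<Sum>i<Suc n. a i) / ?N"
 have "norm m powr p + p * ((norm m powr (p - 2) *R m) \<bullet> (a i - m)) <= \<bar>a i\<bar> powr p" for i
  using norm_powr_tangent[OF p, of m "a i"] by simp
 hence "(\<Sum>i<Suc n. norm m powr p + p * ((norm m powr (p - 2) *R m) \<bullet> (a i - m))) <= (\<Sum>i<Suc n. \<bar>a i\<bar> powr p)"
  by (intro sum_mono)
 also have "(\<Sum>i<Suc n. norm m powr p + p * ((norm m powr (p - 2) *R m) \<bullet> (a i - m)))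
  = ?N * norm m powr p + p * ((norm m powr (p - 2) *R m) \<bullet> ((\<Sum>i<Suc n. a i) - ?N * m))"
  by (simp only: sum.distrib sum_distrib_left[symmetric] inner_sum_right[symmetric] sum_subtractf sum_constant card_lessThan)
 also have "(\<Sum>i<Suc n. a i) - ?N * m = 0" by (simp only: m_def) (simp add: field_simps del: sum.lessThan_Suc)
 finally have "?N * \<bar>m\<bar> powr p <= (\<Sum>i<Suc n. \<bar>a i\<bar> powr p)" by (simp del: sum.lessThan_Suc)
 moreover have "\<bar>m\<bar> powr p = \<bar>\<Sum>i<Suc n. a i\<bar> powr p / ?N powr p"
  unfolding m_def abs_divide abs_of_nat by (rule powr_divide)
 moreover have "?N powr p = ?N powr (p - 1) * ?N" using powr_mult_base[of ?N "p - 1"] by (simp add: mult.commute)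
 ultimately show ?thesis by (simp add: field_simps del: sum.lessThan_Suc of_nat_Suc)
qed

text \<open>Splitting the step \<open>h\<close> into \<open>n\<close> equal ones shows that \<open>D(h) <= n\<^sup>p D(h/n)\<close> for
 \<open>D(h) = \<integral>|f(x + h) - f(x)|\<^sup>p dx\<close>; let \<open>n \<rightarrow> \<infinity>\<close>.\<close>

lemma translation_inequality:
 assumes p: "1 < p" and f: "test_function UNIV f"
 shows "(LINT x|lborel. \<bar>f (x + h) - f x\<bar> powr p) <= norm h powr p * (LINT x|lborel. norm (grad f x) powr p)"
proof -
 define D where "D z = (LINT x|lborel. \<bar>f (x + z) - f x\<bar> powr p)" for z
 note [measurable] = test_functionD(5,6)[OF f]
 have I: "integrable lborel (%x. \<bar>f (x + z) - f (x + w)\<bar> powr p)" for z w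
  using test_function_translate(2)[OF f] p by simp
 have DI: "(LINT x|lborel. \<bar>f (x + (w + z)) - f (x + w)\<bar> powr p) = D z" for z w
  using integral_lborel_translate[of "%x. \<bar>f (x + z) - f x\<bar> powr p" w] unfolding D_def
  by (simp add: add.assoc)
 have step: "D h <= real (Suc n) powr p * D ((1 / real (Suc n)) *R h)" for n
 proof -
  let ?N = "real (Suc n)" let ?t = "(1 / real (Suc n)) *R h"
  let ?a = "%x i. f (x + (real i *R ?t + ?t)) - f (x + real i *R ?t)"
  have tele: "f (x + h) - f x = (\<Sum>i<Suc n. ?a x i)" for x
  proof -
  have "(\<Sum>i<Suc n. ?a x i) = (\<Sum>i<Suc n. f (x + real (Suc i) *R ?t) - f (x + real i *R ?t))"
  by (intro sum.cong refl) (simp only: of_nat_Suc scaleR_left_distrib scaleR_one add.commute)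
  also have "... = f (x + real (Suc n) *R ?t) - f (x + real 0 *R ?t)"
  by (rule sum_lessThan_telescope[of "%i. f (x + real i *R ?t)"])
  finally show ?thesis by simp
  qed
  have "D h <= (LINT x|lborel. ?N powr (p - 1) * (\<Sum>i<Suc n. \<bar>?a x i\<bar> powr p))"
  unfolding D_def using I[of h 0] I
  by (intro integral_mono integrable_mult_right Bochner_Integration.integrable_sum)
  (simp_all only: tele sum_powr_le[OF p] add_0_right)
  also have "... = ?N powr (p - 1) * (\<Sum>i<Suc n. (LINT x|lborel. \<bar>?a x i\<bar> powr p))"
  proof -
  have "(LINT x|lborel. (\<Sum>i<Suc n. \<bar>?a x i\<bar> powr p)) = (\<Sum>i<Suc n. (LINT x|lborel. \<bar>?a x i\<bar> powr p))"
  by (rule Bochner_Integration.integral_sum) (rule I)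
  thus ?thesis by (simp only: integral_mult_right_zero)
  qed
  also have "... = ?N powr (p - 1) * (?N * D ?t)" by (simp only: DI sum_constant card_lessThan)
  also have "... = ?N powr p * D ?t" using powr_mult_base[of ?N "p - 1"] by (simp add: mult.assoc[symmetric] mult.commute)
  finally show ?thesis .
 qed
 obtain B R where B: "0 < B" "!!n x. \<bar>real (Suc n) * (f (x + (1 / real (Suc n)) *R h) - f x)\<bar> <= B * indicator (cball 0 R) x"
  "!!x. (%n. real (Suc n) * (f (x + (1 / real (Suc n)) *R h) - f x)) ----> grad f x \<bullet> h"
  by (rule test_function_difference_quotient[OF f, of h]) (rule that)
 have "(%n. LINT x|lborel. \<bar>real (Suc n) * (f (x + (1 / real (Suc n)) *R h) - f x)\<bar> powr p) ----> (LINT x|lborel. \<bar>grad f x \<bullet> h\<bar> powr p)"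
 proof (rule integral_dominated_convergence[where w = "%x. B powr p * indicator (cball 0 R) x"])
  show "integrable lborel (%x. B powr p * indicator (cball 0 R :: 'a set) x)"
  by (intro integrable_mult_right integrable_real_indicator) (use emeasure_lborel_cball_finite[of 0 R] in \<open>auto simp: infinity_ennreal_def\<close>)
  show "AE x in lborel. norm (\<bar>real (Suc n) * (f (x + (1 / real (Suc n)) *R h) - f x)\<bar> powr p) <= B powr p * indicator (cball 0 R) x" for n
  proof (intro AE_I2)
  fix x
  have "\<bar>real (Suc n) * (f (x + (1 / real (Suc n)) *R h) - f x)\<bar> powr p <= (B * indicator (cball 0 R) x) powr p"
  using p by (intro powr_mono2 B) auto
  also have "... = B powr p * indicator (cball 0 R) x" using p by (simp add: indicator_def)
  finally show "norm (\<bar>real (Suc n) * (f (x + (1 / real (Suc n)) *R h) - f x)\<bar> powr p) <= B powr p * indicator (cball 0 R) x" by simp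
  qed
  show "AE x in lborel. (%n. \<bar>real (Suc n) * (f (x + (1 / real (Suc n)) *R h) - f x)\<bar> powr p) ----> \<bar>grad f x \<bullet> h\<bar> powr p"
  using p by (intro AE_I2 tendsto_powr' tendsto_rabs B tendsto_const) auto
 qed measurable
 moreover have "D h <= (LINT x|lborel. \<bar>real (Suc n) * (f (x + (1 / real (Suc n)) *R h) - f x)\<bar> powr p)" for n
  using step[of n] by (simp add: abs_mult powr_mult D_def)
 ultimately have "D h <= (LINT x|lborel. \<bar>grad f x \<bullet> h\<bar> powr p)" by (intro LIMSEQ_le_const) auto
 also have "... <= (LINT x|lborel. norm h powr p * norm (grad f x) powr p)"
 proof (rule integral_mono)
  show "\<bar>grad f x \<bullet> h\<bar> powr p <= norm h powr p * norm (grad f x) powr p" for x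
  using powr_mono2[of p "\<bar>grad f x \<bullet> h\<bar>" "norm (grad f x) * norm h"] p Cauchy_Schwarz_ineq2[of "grad f x" h]
  by (simp add: powr_mult mult.commute)
 qed (use test_function_integrable(4,5)[OF f] p in auto)
 also have "... = norm h powr p * (LINT x|lborel. norm (grad f x) powr p)" by simp
 finally show ?thesis by (simp add: D_def)
qed

text \<open>Translating by more than the diameter makes the two copies of \<open>f\<close> disjoint.\<close>

lemma test_function_Poincare:
 assumes p: "1 < p" and Om: "bounded Om"
 obtains C where "0 < C" "!!f. test_function Om f ==>
  (LINT x|lborel. \<bar>f x\<bar> powr p) <= C * (LINT x|lborel. norm (grad f x) powr p)"
proof -
 obtain R where R: "R > 0" "!!x. x \<in> Om ==> norm x <= R" using Om by (auto simp: bounded_pos)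
 obtain e :: 'a where e: "norm e = 1" using norm_Basis nonempty_Basis by blast
 define h where "h = (3 * R) *R e"
 have nh: "norm h = 3 * R" using R e by (simp add: h_def)
 show thesis
 proof (rule that[of "(3 * R) powr p"])
  fix f assume f': "test_function Om f"
  hence f: "test_function UNIV f" by (rule test_function_subset) simp
  obtain K where K: "compact K" "K \<subseteq> Om" "!!x. x \<notin> K ==> f x = 0" "!!x. x \<notin> K ==> grad f x = 0"
  by (rule test_function_support[OF f']) (rule that)
  have "\<bar>f x\<bar> powr p <= \<bar>f (x + h) - f x\<bar> powr p" for x
  proof (cases "x \<in> Om")
  case True
  have "norm (x + h) > R" using R(2)[OF True] nh norm_triangle_ineq2[of h "- x"] R(1) by (simp add: add.commute)
  hence "f (x + h) = 0" using R(2) K(2,3) by (meson not_le subsetD)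
  thus ?thesis by simp
  next
  case False
  hence "f x = 0" using K(2,3) by blast
  thus ?thesis by simp
  qed
  hence "(LINT x|lborel. \<bar>f x\<bar> powr p) <= (LINT x|lborel. \<bar>f (x + h) - f x\<bar> powr p)"
  using test_function_integrable(3)[OF f, of p] test_function_translate(2)[OF f, of p h 0] p
  by (intro integral_mono) auto
  also have "... <= norm h powr p * (LINT x|lborel. norm (grad f x) powr p)" by (rule translation_inequality[OF p f])
  finally show "(LINT x|lborel. \<bar>f x\<bar> powr p) <= (3 * R) powr p * (LINT x|lborel. norm (grad f x) powr p)" by (simp add: nh)
 qed (use R in simp)
qed

section \<open>Rellich's compactness theorem for test functions\<close>

definition ball_vol :: "'a::euclidean_space itself => real => real" where
 "ball_vol _ h = measure lborel (ball (0::'a) h)"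

lemma integrable_indicator_ball: "integrable lborel (indicator (ball (0::'a::euclidean_space) h) :: 'a => real)"
 by (intro integrable_real_indicator) (use emeasure_lborel_ball_finite[of 0 h] in \<open>auto simp: infinity_ennreal_def\<close>)

lemma ball_vol_pos: "0 < h ==> 0 < ball_vol TYPE('a::euclidean_space) h"
 unfolding ball_vol_def by (rule content_ball_pos)

definition ball_mean :: "real => ('a::euclidean_space => real) => 'a => real" where
 "ball_mean h f x = (LINT z|lborel. indicator (ball 0 h) z * f (x + z)) / ball_vol TYPE('a) h"

text \<open>Jensen's inequality: integrate the tangent inequality at the mean.\<close>

lemma ball_mean_Jensen:
 fixes g :: "'a::euclidean_space => real"
 assumes p: "1 < p" and h: "0 < h"
  and g: "integrable lborel (%z. indicator (ball 0 h) z * g z)"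
  and gp: "integrable lborel (%z. indicator (ball 0 h) z * \<bar>g z\<bar> powr p)"
 shows "\<bar>(LINT z|lborel. indicator (ball 0 h) z * g z) / ball_vol TYPE('a) h\<bar> powr p <=
  (LINT z|lborel. indicator (ball 0 h) z * \<bar>g z\<bar> powr p) / ball_vol TYPE('a) h"
proof -
 let ?V = "ball_vol TYPE('a) h" let ?I = "%z. indicator (ball (0::'a) h) z :: real"
 note V = ball_vol_pos[OF h, where 'a = 'a]
 define m where "m = (LINT z|lborel. ?I z * g z) / ?V"
 define s where "s = p * (norm m powr (p - 2) * m)"
 have le: "?I z * (\<bar>m\<bar> powr p - s * m) + s * (?I z * g z) <= ?I z * \<bar>g z\<bar> powr p" for z
  using norm_powr_tangent[OF p, of m "g z"] by (auto simp: indicator_def s_def algebra_simps)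
 have int1: "integrable lborel (%z. ?I z * (\<bar>m\<bar> powr p - s * m))"
  using integrable_indicator_ball by (rule integrable_mult_left)
 have "(LINT z|lborel. ?I z * (\<bar>m\<bar> powr p - s * m) + s * (?I z * g z)) <= (LINT z|lborel. ?I z * \<bar>g z\<bar> powr p)"
  using g gp int1 by (intro integral_mono le Bochner_Integration.integrable_add integrable_mult_right) auto
 also have "(LINT z|lborel. ?I z * (\<bar>m\<bar> powr p - s * m) + s * (?I z * g z)) = ?V * (\<bar>m\<bar> powr p - s * m) + s * (?V * m)"
  using g int1 V by (simp add: Bochner_Integration.integral_add ball_vol_def m_def)
 finally have "\<bar>m\<bar> powr p * ?V <= (LINT z|lborel. ?I z * \<bar>g z\<bar> powr p)" by (simp add: algebra_simps)
 thus ?thesis using V unfolding m_def[symmetric] by (simp add: field_simps)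
qed

lemma continuous_ball_integrable:
 fixes g :: "'a::euclidean_space => real"
 assumes "continuous_on UNIV g"
 shows "integrable lborel (%z. indicator (ball 0 h) z * g z)"
proof -
 have "integrable lborel (%z. indicator (cball 0 h) z *R g z)"
  by (rule borel_integrable_compact) (use assms continuous_on_subset in auto)
 from integrable_mult_indicator[OF _ this, of "ball 0 h"]
 have "integrable lborel (%z. indicator (ball 0 h) z *R indicator (cball 0 h) z *R g z)" by simp
 moreover have "(%z. indicator (ball 0 h) z *R indicator (cball 0 h) z *R g z) = (%z. indicator (ball 0 h) z * g z)"
  by (auto simp: indicator_def fun_eq_iff)
 ultimately show ?thesis by simp
qed

lemma indicator_mult_powr_le:
 assumes "integrable lborel (g :: 'a::euclidean_space => real)" "!!z. 0 <= g z"
 shows "(LINT z|lborel. indicator (ball 0 h) z * g z) <= (LINT z|lborel. g z)"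
 using integrable_mult_indicator[OF _ assms(1), of "ball 0 h"] assms
 by (intro integral_mono) (auto simp: indicator_def)

lemma ball_mean_bounds:
 fixes f :: "'a::euclidean_space => real"
 assumes p: "1 < p" and h: "0 < h" and f: "test_function UNIV f"
 shows "\<bar>ball_mean h f x\<bar> powr p <= (LINT x|lborel. \<bar>f x\<bar> powr p) / ball_vol TYPE('a) h"
  "\<bar>ball_mean h f x - ball_mean h f y\<bar> powr p <=
  norm (x - y) powr p * (LINT x|lborel. norm (grad f x) powr p) / ball_vol TYPE('a) h"
proof -
 let ?V = "ball_vol TYPE('a) h"
 note V = ball_vol_pos[OF h, where 'a = 'a]
 have c: "continuous_on UNIV (%z. f (x + z))" for x
  by (rule continuous_on_compose2[OF test_functionD(3)[OF f, of UNIV]]) (auto intro!: continuous_intros)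
 have fm: "f \<in> borel_measurable borel" by (rule test_functionD(5)[OF f])
 have cp: "continuous_on UNIV g ==> continuous_on UNIV (%z. \<bar>g z\<bar> powr p)" for g :: "'a => real"
  using p by (intro continuous_on_powr' continuous_intros) auto
 have "\<bar>ball_mean h f x\<bar> powr p <= (LINT z|lborel. indicator (ball 0 h) z * \<bar>f (x + z)\<bar> powr p) / ?V"
  unfolding ball_mean_def by (intro ball_mean_Jensen p h continuous_ball_integrable cp c)
 also have "... <= (LINT z|lborel. \<bar>f (x + z)\<bar> powr p) / ?V"
  using V test_function_translate(3)[OF f, of p x] p
  by (intro divide_right_mono indicator_mult_powr_le) (auto simp: add.commute[of x])
 also have "(LINT z|lborel. \<bar>f (x + z)\<bar> powr p) = (LINT z|lborel. \<bar>f z\<bar> powr p)"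
  using integral_lborel_translate[of "%z. \<bar>f z\<bar> powr p" x] fm by (simp add: add.commute)
 finally show "\<bar>ball_mean h f x\<bar> powr p <= (LINT x|lborel. \<bar>f x\<bar> powr p) / ?V" .
 have "ball_mean h f x - ball_mean h f y = (LINT z|lborel. indicator (ball 0 h) z * (f (x + z) - f (y + z))) / ?V"
  unfolding ball_mean_def using continuous_ball_integrable[OF c[of x], of h] continuous_ball_integrable[OF c[of y], of h]
  by (simp add: right_diff_distrib diff_divide_distrib)
 hence "\<bar>ball_mean h f x - ball_mean h f y\<bar> powr p <= (LINT z|lborel. indicator (ball 0 h) z * \<bar>f (x + z) - f (y + z)\<bar> powr p) / ?V"
  by (simp only:) (intro ball_mean_Jensen p h continuous_ball_integrable cp continuous_on_diff c)
 also have "... <= (LINT z|lborel. \<bar>f (x + z) - f (y + z)\<bar> powr p) / ?V"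
  using V test_function_translate(2)[OF f, of p x y] p
  by (intro divide_right_mono indicator_mult_powr_le) (auto simp: add.commute)
 also have "(LINT z|lborel. \<bar>f (x + z) - f (y + z)\<bar> powr p) = (LINT z|lborel. \<bar>f (z + (x - y)) - f z\<bar> powr p)"
  using integral_lborel_translate[of "%z. \<bar>f (z + (x - y)) - f z\<bar> powr p" y] fm by (simp add: add.commute algebra_simps)
 also have "... <= norm (x - y) powr p * (LINT x|lborel. norm (grad f x) powr p)"
  by (rule translation_inequality[OF p f])
 finally show "\<bar>ball_mean h f x - ball_mean h f y\<bar> powr p <=
  norm (x - y) powr p * (LINT x|lborel. norm (grad f x) powr p) / ?V"
  using V by (simp add: divide_right_mono)
qed

lemma ball_mean_continuous:
 assumes f: "test_function UNIV f" and h: "0 < h"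
 shows "continuous_on UNIV (ball_mean h f)"
proof -
 obtain C where C: "\<bar>ball_mean h f x - ball_mean h f y\<bar> powr 2 <= norm (x - y) powr 2 * C" for x y
  using ball_mean_bounds(2)[OF _ h f, of 2] by (metis one_less_numeral_iff semiring_norm(76) times_divide_eq_right)
 show ?thesis
  unfolding continuous_on_eq_continuous_at[OF open_UNIV]
 proof
  fix x :: 'a
  have "((%y. norm (y - x) powr 2 * C) \<longlongrightarrow> 0 powr 2 * C) (at x)"
  by (intro tendsto_mult tendsto_powr' tendsto_const tendsto_norm_zero) (auto simp: LIM_zero_iff)
  hence "((%y. norm (y - x) powr 2 * C) \<longlongrightarrow> 0) (at x)" by simp
  hence "((%y. \<bar>ball_mean h f y - ball_mean h f x\<bar> powr 2) \<longlongrightarrow> 0) (at x)"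
  by (rule Lim_null_comparison[rotated]) (use C in auto)
  from tendsto_powr'[OF this tendsto_const[of "1/2"]]
  have "((%y. \<bar>ball_mean h f y - ball_mean h f x\<bar>) \<longlongrightarrow> 0) (at x)" by (simp add: powr_powr)
  thus "isCont (ball_mean h f) x" by (simp add: isCont_def tendsto_rabs_zero_iff LIM_zero_iff)
 qed
qed

lemma ball_mean_approx:
 assumes p: "1 < p" and h: "0 < h" and f: "test_function UNIV f"
 shows "integrable lborel (%x. \<bar>f x - ball_mean h f x\<bar> powr p)"
  "(LINT x|lborel. \<bar>f x - ball_mean h f x\<bar> powr p) <= h powr p * (LINT x|lborel. norm (grad f x) powr p)"
proof -
 let ?V = "ball_vol TYPE('a) h" let ?I = "%z. indicator (ball (0::'a) h) z :: real"
 let ?G = "LINT x|lborel. norm (grad f x) powr p"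
 note V = ball_vol_pos[OF h, where 'a = 'a]
 note fm[measurable] = test_functionD(5)[OF f]
 have Am[measurable]: "ball_mean h f \<in> borel_measurable borel"
  by (rule borel_measurable_continuous_onI[OF ball_mean_continuous[OF f h]])
 have G0: "0 <= ?G" by simp
 have c: "continuous_on UNIV (%z. f (x + z))" for x
  by (rule continuous_on_compose2[OF test_functionD(3)[OF f, of UNIV]]) (auto intro!: continuous_intros)
 have cp: "continuous_on UNIV g ==> continuous_on UNIV (%z. \<bar>g z\<bar> powr p)" for g :: "'a => real"
  using p by (intro continuous_on_powr' continuous_intros) auto
 have pt: "\<bar>f x - ball_mean h f x\<bar> powr p <= (LINT z|lborel. ?I z * \<bar>f (x + z) - f x\<bar> powr p) / ?V" for x
 proof -
  have "(LINT z|lborel. ?I z * (f (x + z) - f x)) = (LINT z|lborel. ?I z * f (x + z)) - (LINT z|lborel. ?I z * f x)"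
  unfolding right_diff_distrib
  by (intro Bochner_Integration.integral_diff continuous_ball_integrable c continuous_on_const)
  also have "(LINT z|lborel. ?I z * f x) = ?V * f x" by (simp add: ball_vol_def)
  finally have "ball_mean h f x - f x = (LINT z|lborel. ?I z * (f (x + z) - f x)) / ?V"
  unfolding ball_mean_def using V by (simp add: diff_divide_distrib)
  hence "\<bar>f x - ball_mean h f x\<bar> = \<bar>(LINT z|lborel. ?I z * (f (x + z) - f x)) / ?V\<bar>" by (metis abs_minus_commute)
  also have "... powr p <= (LINT z|lborel. ?I z * \<bar>f (x + z) - f x\<bar> powr p) / ?V"
  by (intro ball_mean_Jensen p h continuous_ball_integrable cp continuous_on_diff c continuous_on_const)
  finally show ?thesis .
 qed
 have "(\<integral>\<^sup>+x. \<bar>f x - ball_mean h f x\<bar> powr p \<partial>lborel) <=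
  (\<integral>\<^sup>+x. (\<integral>\<^sup>+z. ennreal (?I z * \<bar>f (x + z) - f x\<bar> powr p / ?V) \<partial>lborel) \<partial>lborel)"
 proof (rule nn_integral_mono)
  fix x
  have "(\<integral>\<^sup>+z. ennreal (?I z * \<bar>f (x + z) - f x\<bar> powr p / ?V) \<partial>lborel) = ennreal (LINT z|lborel. ?I z * \<bar>f (x + z) - f x\<bar> powr p / ?V)"
  using V by (intro nn_integral_eq_integral integrable_divide continuous_ball_integrable cp continuous_on_diff c continuous_on_const) (auto simp: indicator_def)
  also have "(LINT z|lborel. ?I z * \<bar>f (x + z) - f x\<bar> powr p / ?V) = (LINT z|lborel. ?I z * \<bar>f (x + z) - f x\<bar> powr p) / ?V"
  by simp
  finally show "ennreal (\<bar>f x - ball_mean h f x\<bar> powr p) <= (\<integral>\<^sup>+z. ennreal (?I z * \<bar>f (x + z) - f x\<bar> powr p / ?V) \<partial>lborel)"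
  using pt[of x] by (simp add: ennreal_leI)
 qed
 also have "... = (\<integral>\<^sup>+z. (\<integral>\<^sup>+x. ennreal (?I z * \<bar>f (x + z) - f x\<bar> powr p / ?V) \<partial>lborel) \<partial>lborel)"
 proof (rule lborel_pair.Fubini'[symmetric])
  have [measurable]: "ball (0::'a) h \<in> sets borel" by simp
  have "(%(x, z). ennreal (?I z * \<bar>f (x + z) - f x\<bar> powr p / ?V)) \<in> borel_measurable (borel \<Otimes>\<^sub>M borel)"
  by measurable
  thus "(%(x, z). ennreal (?I z * \<bar>f (x + z) - f x\<bar> powr p / ?V)) \<in> borel_measurable (lborel \<Otimes>\<^sub>M lborel)"
  by (simp add: measurable_cong_sets[OF sets_pair_measure_cong[OF sets_lborel sets_lborel] refl])
 qed
 also have "... <= (\<integral>\<^sup>+z. ennreal (?I z * (h powr p * ?G / ?V)) \<partial>lborel)"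
 proof (rule nn_integral_mono)
  fix z :: 'a
  show "(\<integral>\<^sup>+x. ennreal (?I z * \<bar>f (x + z) - f x\<bar> powr p / ?V) \<partial>lborel) <= ennreal (?I z * (h powr p * ?G / ?V))"
  proof (cases "z \<in> ball 0 h")
  case True
  have "(\<integral>\<^sup>+x. ennreal (\<bar>f (x + z) - f x\<bar> powr p / ?V) \<partial>lborel) = ennreal (LINT x|lborel. \<bar>f (x + z) - f x\<bar> powr p / ?V)"
  using test_function_translate(2)[OF f, of p z 0] p V by (intro nn_integral_eq_integral integrable_divide) auto
  also have "(LINT x|lborel. \<bar>f (x + z) - f x\<bar> powr p / ?V) = (LINT x|lborel. \<bar>f (x + z) - f x\<bar> powr p) / ?V" by simp
  also have "(LINT x|lborel. \<bar>f (x + z) - f x\<bar> powr p) <= norm z powr p * ?G"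
  by (rule translation_inequality[OF p f])
  also have "norm z powr p * ?G <= h powr p * ?G"
  using True p G0 by (intro mult_right_mono powr_mono2) auto
  finally show ?thesis using True V by (simp add: ennreal_leI divide_right_mono)
  qed simp
 qed
 also have "... = ennreal (LINT z|lborel. ?I z * (h powr p * ?G / ?V))"
  using V G0 by (intro nn_integral_eq_integral integrable_mult_left integrable_indicator_ball) auto
 also have "(LINT z|lborel. ?I z * (h powr p * ?G / ?V)) = h powr p * ?G"
  using V by (simp add: ball_vol_def)
 finally have fin: "(\<integral>\<^sup>+x. \<bar>f x - ball_mean h f x\<bar> powr p \<partial>lborel) <= ennreal (h powr p * ?G)" .
 show I: "integrable lborel (%x. \<bar>f x - ball_mean h f x\<bar> powr p)"
  using fin by (intro integrableI_bounded) (auto simp: le_less_trans[OF _ ennreal_less_top])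
 show "(LINT x|lborel. \<bar>f x - ball_mean h f x\<bar> powr p) <= h powr p * ?G"
  using fin nn_integral_eq_integral[OF I] G0 by simp
qed

lemma bounded_real_diagonal:
 fixes X :: "'i::countable => nat => real"
 assumes "!!j. \<exists>K. \<forall>n. \<bar>X j n\<bar> <= K"
 obtains r :: "nat => nat" where "strict_mono r" "!!j. convergent (%n. X j (r n))"
proof -
 interpret subseqs "%j s. convergent (%n. X (from_nat j) (s n))"
 proof
  fix n and s :: "nat => nat" assume "strict_mono s"
  obtain K where "\<forall>m. \<bar>X (from_nat n) m\<bar> <= K" using assms by blast
  hence "\<forall>m. X (from_nat n) (s m) \<in> {-K..K}" by (auto simp: abs_le_iff minus_le_iff)
  then obtain l r where "strict_mono r" "((%m. X (from_nat n) (s m)) \<circ> r) ----> l"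
  using compact_Icc[of "-K" K] unfolding compact_eq_seq_compact_metric seq_compact_def by metis
  thus "\<exists>r'. strict_mono r' & convergent (%m. X (from_nat n) ((s \<circ> r') m))"
  by (auto simp: o_def convergent_def)
 qed
 have "convergent (%n. X j (diagseq n))" for j
 proof -
  have "convergent (%n. X (from_nat (to_nat j)) ((diagseq \<circ> (+) (Suc (to_nat j))) n))"
  proof (rule diagseq_holds)
  fix r s :: "nat => nat" and n assume "strict_mono r" "convergent (%m. X (from_nat n) (s m))"
  thus "convergent (%m. X (from_nat n) ((s \<circ> r) m))"
  using convergent_subseq_convergent[of "%m. X (from_nat n) (s m)" r] by (simp add: o_def)
  qed
  hence "convergent (%n. X j (diagseq (n + Suc (to_nat j))))" by (simp add: o_def add.commute)
  thus ?thesis using convergent_ignore_initial_segment by blast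
 qed
 thus thesis using subseq_diagseq that by blast
qed

lemma test_function_outside: "test_function Om f ==> x \<notin> Om ==> f x = 0" "test_function Om f ==> x \<notin> Om ==> grad f x = 0"
 by (meson subsetD test_function_support)+

lemma test_function_Lp:
 assumes "Om \<in> sets lebesgue" "0 < p" and f: "test_function Om f"
 shows "f \<in> Lp Om p" "grad f \<in> Lp Om p"
  "(LINT x|leb Om. norm (f x) powr p) = (LINT x|lborel. norm (f x) powr p)"
  "(LINT x|leb Om. norm (grad f x) powr p) = (LINT x|lborel. norm (grad f x) powr p)"
proof -
 have fU: "test_function UNIV f" by (rule test_function_subset[OF f]) simp
 note [measurable] = test_functionD(5,6)[OF f]
 note 1 = integral_lebesgue_on_eq_lborel[OF assms(1), of "%x. norm (f x) powr p"]
 note 2 = integral_lebesgue_on_eq_lborel[OF assms(1), of "%x. norm (grad f x) powr p"]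
 show "f \<in> Lp Om p" "grad f \<in> Lp Om p"
  unfolding Lp_def using 1(2) 2(2) test_function_integrable(3,4)[OF fU assms(2)] test_function_outside[OF f]
  test_functionD(5,6)[OF f] by (auto intro: borel_measurable_lebesgue_onI)
 show "(LINT x|leb Om. norm (f x) powr p) = (LINT x|lborel. norm (f x) powr p)"
  "(LINT x|leb Om. norm (grad f x) powr p) = (LINT x|lborel. norm (grad f x) powr p)"
  using 1(1) 2(1) test_function_outside[OF f] by auto
qed

lemma finite_measure_lebesgue_on: "Om \<in> lmeasurable ==> finite_measure (leb Om)"
 by (intro finite_measureI) (auto simp: emeasure_restrict_space fmeasurable_def infinity_ennreal_def)

lemma integral_lebesgue_on_le_lborel:
 fixes g :: "'a::euclidean_space => real"
 assumes "Om \<in> sets lebesgue" "integrable lborel g" "!!x. 0 <= g x"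
 shows "(LINT x|leb Om. g x) <= (LINT x|lborel. g x)"
proof -
 have I: "integrable lebesgue g" using assms(2) by (simp add: integrable_completion borel_measurable_integrable)
 have "(LINT x|leb Om. g x) = (LINT x|lebesgue. (if x \<in> Om then g x else 0))"
  using Lebesgue_Measure.integral_restrict_UNIV[OF assms(1), of g] by simp
 also have "... <= (LINT x|lebesgue. g x)"
 proof (rule integral_mono)
  show "integrable lebesgue (%x. if x \<in> Om then g x else 0)"
  proof -
  have "(%x. indicator Om x *R g x) = (%x. if x \<in> Om then g x else 0)"
  by (auto simp: indicator_def fun_eq_iff)
  thus ?thesis using integrable_mult_indicator[OF assms(1) I] by simp
  qed
 qed (use I assms(3) in auto)
 also have "... = (LINT x|lborel. g x)" using assms(2) by (simp add: integral_completion borel_measurable_integrable)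
 finally show ?thesis .
qed

text \<open>The means over balls of a fixed radius are equi-Lipschitz and bounded, hence converge
 pointwise along one diagonal subsequence; and they are uniformly close to the functions in
 \<open>L\<^sup>p\<close> when the radius is small.\<close>

theorem test_function_Rellich:
 fixes f :: "nat => 'a::euclidean_space => real"
 assumes p: "1 < p" and Om: "open Om" "bounded Om"
  and f: "!!n. test_function Om (f n)" and G: "!!n. (LINT x|lborel. norm (grad (f n) x) powr p) <= G"
 obtains r :: "nat => nat" where "strict_mono r"
  "!!e. 0 < e ==> \<exists>N. \<forall>m\<ge>N. \<forall>n\<ge>N. (LINT x|leb Om. norm (f (r m) x - f (r n) x) powr p) < e"
proof -
 let ?M = "leb Om"
 have p0: "0 < p" using p by simp
 have Oms: "Om \<in> sets lebesgue" using Om(1) by simp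
 have Oml: "Om \<in> lmeasurable" by (rule lmeasurable_open[OF Om(2,1)])
 have fU: "test_function UNIV (f n)" for n by (rule test_function_subset[OF f]) simp
 note fm[measurable] = borel_measurable_lebesgue_onI[OF test_functionD(5)[OF f]]
 have G0: "0 <= G" using G[of 0] by (rule order_trans[rotated]) simp
 obtain C where C: "0 < C" "!!f. test_function Om f ==>
  (LINT x|lborel. \<bar>f x\<bar> powr p) <= C * (LINT x|lborel. norm (grad f x) powr p)"
  by (rule test_function_Poincare[OF p Om(2)]) (rule that)
 obtain d :: "nat => 'a" where d: "!!x e. e > 0 ==> \<exists>k. dist (d k) x < e"
 proof -
  obtain D :: "'a set" where D: "countable D" "!!X. open X ==> X ~= {} ==> \<exists>d \<in> D. d \<in> X"
  by (rule countable_dense_setE) (rule that)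
  have "D ~= {}" using D(2)[of UNIV] by auto
  have "\<exists>k. dist (from_nat_into D k) x < e" if "e > 0" for x :: 'a and e
  proof -
  have "ball x e ~= {}" using that by simp
  then obtain y where "y \<in> D" "y \<in> ball x e" using D(2)[of "ball x e"] by blast
  thus ?thesis using from_nat_into_surj[OF D(1)] by (metis dist_commute mem_ball)
  qed
  thus thesis by (rule that)
 qed
 let ?h = "%i::nat. 1 / real (Suc i)"
 let ?A = "%i n. ball_mean (?h i) (f n)"
 let ?V = "%i. ball_vol TYPE('a) (?h i)"
 have V: "0 < ?V i" for i by (intro ball_vol_pos) simp
 define K where "K i = (C * G / ?V i) powr (1/p)" for i
 have bd: "\<bar>?A i n x\<bar> <= K i" for i n x
 proof -
  have "\<bar>?A i n x\<bar> powr p <= (LINT x|lborel. \<bar>f n x\<bar> powr p) / ?V i"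
  by (rule ball_mean_bounds(1)[OF p _ fU]) simp
  also have "... <= C * G / ?V i"
  using order_trans[OF C(2)[OF f[of n]] mult_left_mono[OF G[of n] less_imp_le[OF C(1)]]] V[of i]
  by (intro divide_right_mono) auto
  finally have "(\<bar>?A i n x\<bar> powr p) powr (1/p) <= K i" unfolding K_def using p by (intro powr_mono2) auto
  thus ?thesis using p by (simp add: powr_powr)
 qed
 define Lc where "Lc i = (G / ?V i) powr (1/p)" for i
 have lip: "\<bar>?A i n x - ?A i n y\<bar> <= Lc i * norm (x - y)" for i n x y
 proof -
  have "\<bar>?A i n x - ?A i n y\<bar> powr p <= norm (x - y) powr p * (LINT x|lborel. norm (grad (f n) x) powr p) / ?V i"
  by (rule ball_mean_bounds(2)[OF p _ fU]) simp
  also have "... <= norm (x - y) powr p * G / ?V i"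
  using G[of n] V[of i] by (intro divide_right_mono mult_left_mono) auto
  also have "... = norm (x - y) powr p * (G / ?V i)" by simp
  finally have "(\<bar>?A i n x - ?A i n y\<bar> powr p) powr (1/p) <= (norm (x - y) powr p * (G / ?V i)) powr (1/p)"
  using p by (intro powr_mono2) auto
  thus ?thesis using p unfolding powr_mult by (simp add: powr_powr Lc_def mult.commute)
 qed
 have "\<exists>K. \<forall>n. \<bar>(%(i, k) n. ?A i n (d k)) j n\<bar> <= K" for j
  using bd[of "fst j" _ "d (snd j)"] by (auto simp: case_prod_beta)
 then obtain r :: "nat => nat" where r: "strict_mono r" and cd: "!!j. convergent (%n. (%(i, k) n. ?A i n (d k)) j (r n))"
  using bounded_real_diagonal by blast
 have conv_d: "convergent (%n. ?A i (r n) (d k))" for i k using cd[of "(i, k)"] by simp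
 have conv: "convergent (%n. ?A i (r n) x)" for i x
 proof (rule Cauchy_convergent, rule metric_CauchyI)
  fix e :: real assume e: "e > 0"
  have L0: "Lc i >= 0" by (simp add: Lc_def)
  obtain k where k: "dist (d k) x < e / (3 * (Lc i + 1))" using d e L0 by (metis add_nonneg_pos divide_pos_pos zero_less_numeral mult_pos_pos zero_less_one)
  have close: "\<bar>?A i n x - ?A i n (d k)\<bar> < e / 3" for n
  proof -
  have "\<bar>?A i n x - ?A i n (d k)\<bar> <= Lc i * dist (d k) x" using lip[of i n x "d k"] by (simp add: dist_norm norm_minus_commute)
  also have "... <= (Lc i + 1) * dist (d k) x" by (intro mult_right_mono) auto
  also have "... < (Lc i + 1) * (e / (3 * (Lc i + 1)))" using k L0 by (intro mult_strict_left_mono) auto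
  also have "... = e / 3" using L0 by (simp add: field_simps)
  finally show ?thesis .
  qed
  obtain N where N: "!!m n. m >= N ==> n >= N ==> dist (?A i (r m) (d k)) (?A i (r n) (d k)) < e / 3"
  using convergent_Cauchy[OF conv_d[of i k]] e unfolding Cauchy_def by (metis divide_pos_pos zero_less_numeral)
  show "\<exists>N. \<forall>m\<ge>N. \<forall>n\<ge>N. dist (?A i (r m) x) (?A i (r n) x) < e"
  proof (intro exI[of _ N] allI impI)
  fix m n assume "m >= N" "n >= N"
  from N[OF this] close[of "r m"] close[of "r n"] show "dist (?A i (r m) x) (?A i (r n) x) < e"
  unfolding dist_real_def by linarith
  qed
 qed
 define F where "F i x = lim (%n. ?A i (r n) x)" for i x
 have Am[measurable]: "?A i n \<in> borel_measurable ?M" for i n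
  by (intro borel_measurable_lebesgue_onI borel_measurable_continuous_onI ball_mean_continuous fU) simp
 have [measurable]: "F i \<in> borel_measurable ?M" for i unfolding F_def by measurable
 have tA: "Lp_tendsto Om p (%n. ?A i (r n)) (F i)" for i
 proof (rule Lp_tendsto_dominated[OF p0, where D = "%_. K i powr p"])
  show "integrable ?M (%_. K i powr p)" by (rule finite_measure.integrable_const[OF finite_measure_lebesgue_on[OF Oml]])
  show "AE x in ?M. (%n. ?A i (r n) x) ----> F i x"
  using conv by (simp add: F_def convergent_LIMSEQ_iff)
  show "AE x in ?M. norm (?A i (r n) x) powr p <= K i powr p" for n
  using bd p by (intro AE_I2 powr_mono2) auto
 qed measurable
 have fL: "f n \<in> Lp Om p" for n by (rule test_function_Lp[OF Oms p0 f])
 have AL: "?A i (r n) \<in> Lp Om p" for i n by (rule Lp_tendstoD(1)[OF tA])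
 have approx: "(LINT x|?M. norm (f n x - ?A i n x) powr p) <= (?h i) powr p * G" for i n
 proof -
  have "(LINT x|?M. norm (f n x - ?A i n x) powr p) <= (LINT x|lborel. \<bar>f n x - ?A i n x\<bar> powr p)"
  using ball_mean_approx(1)[OF p _ fU, of "?h i"] unfolding real_norm_def by (intro integral_lebesgue_on_le_lborel Oms) auto
  also have "... <= (?h i) powr p * (LINT x|lborel. norm (grad (f n) x) powr p)"
  by (rule ball_mean_approx(2)[OF p _ fU]) simp
  also have "... <= (?h i) powr p * G" using G[of n] by (intro mult_left_mono) auto
  finally show ?thesis .
 qed
 show thesis
 proof (rule that[OF r])
  fix e :: real assume "0 < e"
  show "\<exists>N. \<forall>m\<ge>N. \<forall>n\<ge>N. (LINT x|?M. norm (f (r m) x - f (r n) x) powr p) < e"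
  proof -
  define c :: real where "c = 2 powr p"
  have c: "c > 0" by (simp add: c_def)
  have lim: "(%i. ?h i powr p * G) ----> 0 powr p * G"
  using p LIMSEQ_inverse_real_of_nat by (intro tendsto_mult tendsto_powr' tendsto_const) (auto simp: inverse_eq_divide)
  have "0 < e / (2 * (c + c * c))" using \<open>0 < e\<close> c by (intro divide_pos_pos mult_pos_pos add_pos_pos) auto
  then obtain i where i: "?h i powr p * G < e / (2 * (c + c * c))"
  using order_tendstoD(2)[OF lim] by (auto simp: eventually_sequentially)
  define H where "H = ?h i powr p * G"
  have H: "c * H + c * c * H < e / 2"
  proof -
  have "(c + c * c) * H < (c + c * c) * (e / (2 * (c + c * c)))"
  using i c unfolding H_def by (intro mult_strict_left_mono add_pos_pos) auto
  also have "... = e / 2" using c by (simp add: field_simps add_pos_pos[THEN less_imp_neq, symmetric])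
  finally show ?thesis by (simp add: algebra_simps)
  qed
  have "0 < e / (4 * c * c * c)" using \<open>0 < e\<close> c by simp
  then obtain N where N: "!!n. n >= N ==> (LINT x|?M. norm (?A i (r n) x - F i x) powr p) < e / (4 * c * c * c)"
  using order_tendstoD(2)[OF Lp_tendstoD(3)[OF tA[of i]]] by (auto simp: eventually_sequentially)
  have "(LINT x|?M. norm (f (r m) x - f (r n) x) powr p) < e" if "m >= N" "n >= N" for m n
  proof -
  let ?X = "LINT x|?M. norm (f (r m) x - f (r n) x) powr p"
  let ?Y = "LINT x|?M. norm (f (r n) x - ?A i (r m) x) powr p"
  let ?Z = "LINT x|?M. norm (?A i (r m) x - ?A i (r n) x) powr p"
  have "?X <= c * ((LINT x|?M. norm (f (r m) x - ?A i (r m) x) powr p) + ?Y)"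
  unfolding c_def by (intro Lp_integral_triangle p0 Lp_diff fL AL AE_I2) (rule LpD(1)[OF Lp_diff[OF p0]], (rule fL AL)+, metis dist_norm dist_triangle2)
  also have "... <= c * (H + ?Y)" using approx[of "r m" i] c unfolding H_def by (intro mult_left_mono add_right_mono) auto
  finally have X: "?X <= c * (H + ?Y)" .
  have "?Y <= c * ((LINT x|?M. norm (f (r n) x - ?A i (r n) x) powr p) + ?Z)"
  unfolding c_def by (intro Lp_integral_triangle p0 Lp_diff fL AL AE_I2) (rule LpD(1)[OF Lp_diff[OF p0]], (rule fL AL)+, metis dist_norm dist_triangle2)
  also have "... <= c * (H + ?Z)" using approx[of "r n" i] c unfolding H_def by (intro mult_left_mono add_right_mono) auto
  finally have Y: "?Y <= c * (H + ?Z)" .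
  have "?Z <= c * ((LINT x|?M. norm (?A i (r m) x - F i x) powr p) + (LINT x|?M. norm (?A i (r n) x - F i x) powr p))"
  unfolding c_def by (intro Lp_integral_triangle p0 Lp_diff AL Lp_tendstoD(2)[OF tA] AE_I2) (rule LpD(1)[OF Lp_diff[OF p0]], (rule fL AL)+, metis dist_norm dist_triangle2)
  also have "... < c * (e / (4 * c * c * c) + e / (4 * c * c * c))"
  using N[OF that(1)] N[OF that(2)] c by (intro mult_strict_left_mono) auto
  finally have "c * c * ?Z < c * c * (c * (e / (4 * c * c * c) + e / (4 * c * c * c)))"
  using c by (intro mult_strict_left_mono) auto
  also have "... = e / 2" using c by (simp add: field_simps)
  finally have Z: "c * c * ?Z < e / 2" .
  have "c * ?Y <= c * (c * (H + ?Z))" using Y c by (intro mult_left_mono) auto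
  with X Z H show ?thesis by (simp add: algebra_simps)
  qed
  thus ?thesis by blast
  qed
 qed
qed

section \<open>The Sobolev space as a closure of test functions\<close>

lemma Lp_tendsto_Lipschitz_image:
 fixes f :: "nat => 'a::euclidean_space => 'b::euclidean_space" and h :: "nat => 'a => 'c::euclidean_space"
 assumes p: "0 < p" and f: "Lp_tendsto Om p f F"
  and h: "!!n. h n \<in> Lp Om p" "H \<in> Lp Om p"
  and le: "!!n x. x \<in> Om ==> norm (h n x - H x) <= K * norm (f n x - F x)"
 shows "Lp_tendsto Om p h H"
proof (rule Lp_tendsto_squeeze[OF h])
 let ?d = "%n. LINT x|leb Om. norm (f n x - F x) powr p"
 fix n
 have "(LINT x|leb Om. norm (h n x - H x) powr p) <= (LINT x|leb Om. \<bar>K\<bar> powr p * norm (f n x - F x) powr p)"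
 proof (rule integral_mono_AE)
  show "AE x in leb Om. norm (h n x - H x) powr p <= \<bar>K\<bar> powr p * norm (f n x - F x) powr p"
  proof (rule AE_I2)
  fix x assume "x \<in> space (leb Om)"
  hence "norm (h n x - H x) <= K * norm (f n x - F x)" using le by simp
  also have "... <= \<bar>K\<bar> * norm (f n x - F x)" by (intro mult_right_mono) auto
  finally show "norm (h n x - H x) powr p <= \<bar>K\<bar> powr p * norm (f n x - F x) powr p"
  using p unfolding powr_mult[symmetric] by (intro powr_mono2) auto
  qed
 qed (intro integrable_mult_right LpD(2) Lp_diff p h Lp_tendstoD[OF f])+
 thus "(LINT x|leb Om. norm (h n x - H x) powr p) <= \<bar>K\<bar> powr p * ?d n" by simp
next
 show "(%n. \<bar>K\<bar> powr p * (LINT x|leb Om. norm (f n x - F x) powr p)) ----> 0"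
  by (rule tendsto_mult_right_zero[OF Lp_tendstoD(3)[OF f]])
qed

lemma Lp_AE_cong:
 fixes f g :: "'a::euclidean_space => 'b::euclidean_space"
 assumes "f \<in> Lp Om p" "g \<in> borel_measurable (leb Om)" "AE x in leb Om. f x = g x"
 shows "g \<in> Lp Om p"
 by (rule Lp_dominated[OF assms(2) LpD(2)[OF assms(1)]]) (use assms(3) in \<open>eventually_elim, simp\<close>)

lemma Lp_tendsto_AE_cong:
 assumes "Lp_tendsto Om p f F" "G \<in> borel_measurable (leb Om)" "AE x in leb Om. F x = G x"
 shows "Lp_tendsto Om p f G"
proof -
 have "(LINT x|leb Om. norm (f n x - G x) powr p) = (LINT x|leb Om. norm (f n x - F x) powr p)" for n
 proof (rule integral_cong_AE)
  note [measurable] = assms(2) LpD(1)[OF Lp_tendstoD(1)[OF assms(1)]] LpD(1)[OF Lp_tendstoD(2)[OF assms(1)]]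
  show "(%x. norm (f n x - G x) powr p) \<in> borel_measurable (leb Om)"
  "(%x. norm (f n x - F x) powr p) \<in> borel_measurable (leb Om)" by measurable
  show "AE x in leb Om. norm (f n x - G x) powr p = norm (f n x - F x) powr p"
  using assms(3) by eventually_elim simp
 qed
 thus ?thesis using Lp_AE_cong[OF Lp_tendstoD(2)[OF assms(1)] assms(2,3)] assms(1) by (simp add: Lp_tendsto_def)
qed

locale bounded_domain =
 fixes Om :: "'a::euclidean_space set" and p :: real
 assumes open_dom: "open Om" and bounded_dom: "bounded Om" and p_gt_1: "1 < p"
begin

abbreviation "M \<equiv> leb Om"
abbreviation "q \<equiv> conj_exp p"
abbreviation nabla ("\<nabla>") where "\<nabla> \<equiv> wgrad Om p"
abbreviation Np where "Np g == LINT x|M. norm (g x) powr p"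
abbreviation Nd where "Nd g h == LINT x|M. norm (g x - h x) powr p"
abbreviation pairing where "pairing B u v x == B x (\<nabla> u x) \<bullet> \<nabla> v x"

lemma p_pos: "0 < p" using p_gt_1 by simp
lemma q_gt_1: "1 < q" by (rule conj_exp_gt_1[OF p_gt_1])
lemma q_pos: "0 < q" using q_gt_1 by simp
lemma dom_sets: "Om \<in> sets lebesgue" using open_dom by simp
lemma dom_lmeasurable: "Om \<in> lmeasurable" by (rule lmeasurable_open[OF bounded_dom open_dom])
lemma integrable_const_dom: "integrable M (%x. c :: 'b::{banach,second_countable_topology})"
 by (rule finite_measure.integrable_const[OF finite_measure_lebesgue_on[OF dom_lmeasurable]])

lemma Lp_bounded:
 fixes f :: "'a => 'b::euclidean_space"
 assumes "f \<in> borel_measurable M" "!!x. x \<in> Om ==> norm (f x) <= K" "0 < r"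
 shows "f \<in> Lp Om r"
 by (rule Lp_dominated[OF assms(1) integrable_const_dom[of "K powr r"]]) (use assms in \<open>auto intro!: AE_I2 powr_mono2\<close>)

lemma Lp_integrable:
 fixes f :: "'a => 'b::euclidean_space"
 assumes "f \<in> Lp Om r" "1 <= r"
 shows "integrable M f"
proof (rule Bochner_Integration.integrable_bound)
 show "integrable M (%x. 1 + norm (f x) powr r)" using integrable_const_dom[of "1::real"] LpD(2)[OF assms(1)] by simp
 show "AE x in M. norm (f x) <= norm (1 + norm (f x) powr r)"
 proof (rule AE_I2)
  fix x
  have "norm (f x) <= 1 + norm (f x) powr r"
  proof (cases "norm (f x) <= 1")
  case False
  hence "norm (f x) powr 1 <= norm (f x) powr r" using assms(2) by (intro powr_mono) auto
  thus ?thesis using False by simp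
  qed (simp add: add_increasing2)
  thus "norm (f x) <= norm (1 + norm (f x) powr r)" by simp
 qed
qed (rule LpD(1)[OF assms(1)])

text \<open>The gradient is carried along, so that limits can be taken before it is known to be a weak gradient.\<close>

definition W0 :: "('a => real) => ('a => 'a) => bool" where
 "W0 u g \<longleftrightarrow> (\<exists>ph. (\<forall>k. test_function Om (ph k)) & Lp_tendsto Om p ph u & Lp_tendsto Om p (%k. grad (ph k)) g)"

lemma W0E:
 assumes "W0 u g"
 obtains ph where "!!k. test_function Om (ph k)" "Lp_tendsto Om p ph u" "Lp_tendsto Om p (%k. grad (ph k)) g"
 using assms by (auto simp: W0_def)

lemma W0_Lp: assumes "W0 u g" shows "u \<in> Lp Om p" "g \<in> Lp Om p"
 using assms by (auto simp: W0_def dest: Lp_tendstoD)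

lemma W0_measurable: assumes "W0 u g" shows "u \<in> borel_measurable M" "g \<in> borel_measurable M"
 using W0_Lp[OF assms] by (auto dest: LpD)

lemma test_Lp: assumes "test_function Om f" "0 < r" shows "f \<in> Lp Om r" "grad f \<in> Lp Om r"
 using test_function_Lp[OF dom_sets assms(2,1)] by auto

lemma W0_test: "test_function Om f ==> W0 f (grad f)"
 unfolding W0_def using test_Lp[OF _ p_pos] by (intro exI[of _ "%_. f"]) (auto intro: Lp_tendsto_const)

lemma W0_add: assumes "W0 u g" "W0 v h" shows "W0 (%x. u x + v x) (%x. g x + h x)"
proof -
 obtain ph where ph: "!!k. test_function Om (ph k)" "Lp_tendsto Om p ph u" "Lp_tendsto Om p (%k. grad (ph k)) g"
  by (rule W0E[OF assms(1)]) (rule that)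
 obtain ps where ps: "!!k. test_function Om (ps k)" "Lp_tendsto Om p ps v" "Lp_tendsto Om p (%k. grad (ps k)) h"
  by (rule W0E[OF assms(2)]) (rule that)
 have "grad (%x. ph k x + ps k x) = (%x. grad (ph k) x + grad (ps k) x)" for k
  by (intro ext grad_add test_functionD(2)[OF ph(1)] test_functionD(2)[OF ps(1)])
 thus ?thesis unfolding W0_def
  using Lp_tendsto_add[OF p_pos ph(2) ps(2)] Lp_tendsto_add[OF p_pos ph(3) ps(3)] test_function_add[OF ph(1) ps(1)]
  by (intro exI[of _ "%k x. ph k x + ps k x"]) simp
qed

lemma W0_cmult: assumes "W0 u g" shows "W0 (%x. c * u x) (%x. c *R g x)"
proof -
 obtain ph where ph: "!!k. test_function Om (ph k)" "Lp_tendsto Om p ph u" "Lp_tendsto Om p (%k. grad (ph k)) g"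
  by (rule W0E[OF assms(1)]) (rule that)
 have "grad (%x. c * ph k x) = (%x. c *R grad (ph k) x)" for k
  by (intro ext grad_cmult test_functionD(2)[OF ph(1)])
 thus ?thesis unfolding W0_def
  using Lp_tendsto_mult[OF ph(2)] Lp_tendsto_scaleR[OF ph(3)] test_function_cmult[OF ph(1)]
  by (intro exI[of _ "%k x. c * ph k x"]) simp
qed

lemma W0_minus: assumes "W0 u g" shows "W0 (%x. - u x) (%x. - g x)"
 using W0_cmult[OF assms, of "-1"] by simp

lemma W0_diff: assumes "W0 u g" "W0 v h" shows "W0 (%x. u x - v x) (%x. g x - h x)"
 using W0_add[OF assms(1) W0_minus[OF assms(2)]] by simp

lemma W0_zero: "W0 (%x. 0) (%x. 0)"
 using W0_test[OF test_function_0] by (simp add: grad_const[abs_def])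

lemma W0_AE_cong:
 assumes "W0 u g" "u' \<in> borel_measurable M" "g' \<in> borel_measurable M" "AE x in M. u x = u' x" "AE x in M. g x = g' x"
 shows "W0 u' g'"
 using assms(1) Lp_tendsto_AE_cong[OF _ assms(2,4)] Lp_tendsto_AE_cong[OF _ assms(3,5)] unfolding W0_def by blast

lemma W0_approx:
 assumes "W0 u g" "0 < e"
 obtains ph where "test_function Om ph" "(Nd ph u) < e" "(LINT x|M. norm (grad ph x - g x) powr p) < e"
proof -
 obtain ph where ph: "!!k. test_function Om (ph k)" "Lp_tendsto Om p ph u" "Lp_tendsto Om p (%k. grad (ph k)) g"
  by (rule W0E[OF assms(1)]) (rule that)
 have "\<forall>\<^sub>F k in sequentially. (Nd (ph k) u) < e & (LINT x|M. norm (grad (ph k) x - g x) powr p) < e"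
  by (intro eventually_conj order_tendstoD(2)[OF Lp_tendstoD(3)] ph assms)
 thus thesis using ph(1) that unfolding eventually_sequentially by blast
qed

lemma W0_approx_seq:
 assumes W: "!!k. W0 (u k) (g k)"
 obtains ph where "!!k. test_function Om (ph k)" "!!k. (Nd (ph k) (u k)) < 1 / real (Suc k)"
  "!!k. (LINT x|M. norm (grad (ph k) x - g k x) powr p) < 1 / real (Suc k)"
proof -
 let ?P = "%k ph. test_function Om ph & (Nd ph (u k)) < 1 / real (Suc k) & (LINT x|M. norm (grad ph x - g k x) powr p) < 1 / real (Suc k)"
 have "\<exists>ph. ?P k ph" for k
 proof -
  have "0 < 1 / real (Suc k)" by simp
  then obtain ph where "test_function Om ph" "(Nd ph (u k)) < 1 / real (Suc k)"
  "(LINT x|M. norm (grad ph x - g k x) powr p) < 1 / real (Suc k)" by (rule W0_approx[OF W])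
  thus ?thesis by blast
 qed
 hence "?P k (SOME ph. ?P k ph)" for k by (rule someI_ex)
 thus thesis by (intro that[of "%k. SOME ph. ?P k ph"]) blast+
qed

lemma W0_closed:
 assumes W: "!!k. W0 (u k) (g k)" and u: "Lp_tendsto Om p u U" and g: "Lp_tendsto Om p g G"
 shows "W0 U G"
proof -
 obtain ph where ph: "!!k. test_function Om (ph k)" "!!k. (Nd (ph k) (u k)) < 1 / real (Suc k)"
  "!!k. (LINT x|M. norm (grad (ph k) x - g k x) powr p) < 1 / real (Suc k)"
  by (rule W0_approx_seq[OF W]) (rule that)
 have lim0: "(%k. 1 / real (Suc k)) ----> 0" using LIMSEQ_inverse_real_of_nat by (simp add: inverse_eq_divide)
 have 1: "Lp_tendsto Om p (%k x. ph k x - u k x) (%x. 0)"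
  using W0_Lp(1)[OF W] test_Lp(1)[OF ph(1) p_pos] less_imp_le[OF ph(2)]
  by (intro Lp_tendsto_squeeze[OF _ _ _ lim0] Lp_diff p_pos) auto
 have 2: "Lp_tendsto Om p (%k x. grad (ph k) x - g k x) (%x. 0)"
  using W0_Lp(2)[OF W] test_Lp(2)[OF ph(1) p_pos] less_imp_le[OF ph(3)]
  by (intro Lp_tendsto_squeeze[OF _ _ _ lim0] Lp_diff p_pos) auto
 show ?thesis unfolding W0_def
  using ph(1) Lp_tendsto_add[OF p_pos 1 u] Lp_tendsto_add[OF p_pos 2 g] by (intro exI[of _ ph]) simp
qed

subsection \<open>Weak gradients\<close>

lemma test_function_by_parts:
 assumes f: "test_function Om f" and g: "test_function Om g"
 shows "(LINT x|M. f x *R grad g x) = - (LINT x|M. g x *R grad f x)"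
proof -
 have fg: "test_function Om (%x. f x * g x)" by (rule test_function_mult[OF test_functionD(1)[OF f] g])
 have U: "test_function UNIV (%x. f x * g x)" by (rule test_function_subset[OF fg]) simp
 have eq: "grad (%x. f x * g x) = (%x. f x *R grad g x + g x *R grad f x)"
  by (intro ext grad_mult test_functionD(2)[OF f] test_functionD(2)[OF g])
 have int: "integrable M (%x. f x *R grad g x)" if f: "test_function Om f" and g: "test_function Om g" for f g
 proof -
  obtain B where B: "0 < B" "!!x. \<bar>f x\<bar> <= B" "!!x. norm (grad f x) <= B" by (rule test_function_bounded[OF f]) (rule that)
  have "(%x. f x *R grad g x) \<in> Lp Om 2"
  using test_Lp(2)[OF g, of 2] borel_measurable_lebesgue_onI[OF test_functionD(5)[OF f]] B(2)
  by (intro Lp_bounded_scaleR[where K = B]) auto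
  thus ?thesis by (rule Lp_integrable) simp
 qed
 have "(LINT x|M. f x *R grad g x) + (LINT x|M. g x *R grad f x) = (LINT x|M. grad (%x. f x * g x) x)"
  unfolding eq by (rule Bochner_Integration.integral_add[symmetric]) (intro int f g)+
 also have "... = (LINT x|lborel. grad (%x. f x * g x) x)"
  using test_functionD(6)[OF fg] test_function_outside(2)[OF fg] by (intro integral_lebesgue_on_eq_lborel dom_sets)
 also have "... = 0" by (rule integral_grad_eq_0[OF U])
 finally show ?thesis by (simp add: eq_neg_iff_add_eq_0)
qed

lemma Lp_tendsto_inner_const:
 fixes f :: "nat => 'a => 'b::euclidean_space"
 assumes f: "Lp_tendsto Om p f F" and g: "g \<in> Lp Om q"
 shows "(%n. LINT x|M. g x \<bullet> f n x) ----> (LINT x|M. g x \<bullet> F x)"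
 using Lp_tendsto_weak[OF p_gt_1 f g order_refl] by (simp add: LIM_zero_iff)

lemma W0_weak_grad: assumes W: "W0 u g" shows "has_weak_grad Om p u g"
 unfolding has_weak_grad_def
proof (intro conjI allI impI W0_Lp[OF W])
 fix ps assume ps: "test_function Om ps"
 obtain ph where ph: "!!k. test_function Om (ph k)" "Lp_tendsto Om p ph u" "Lp_tendsto Om p (%k. grad (ph k)) g"
  by (rule W0E[OF W]) (rule that)
 have psL: "grad ps \<in> Lp Om q" "ps \<in> Lp Om q" using test_Lp[OF ps q_pos] by auto
 obtain B where B: "0 < B" "!!x. \<bar>ps x\<bar> <= B" "!!x. norm (grad ps x) <= B" by (rule test_function_bounded[OF ps]) (rule that)
 note psm[measurable] = borel_measurable_lebesgue_onI[OF test_functionD(5)[OF ps], of Om] borel_measurable_lebesgue_onI[OF test_functionD(6)[OF ps], of Om]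
 have I1: "integrable M (%x. v x *R grad ps x)" if v: "v \<in> Lp Om p" for v :: "'a => real"
 proof (rule Lp_integrable[where r = p])
  show "(%x. v x *R grad ps x) \<in> Lp Om p"
  proof (rule Lp_dominated)
  show "integrable M (%x. B powr p * norm (v x) powr p)" using LpD(2)[OF v] by simp
  show "(%x. v x *R grad ps x) \<in> borel_measurable M" using LpD(1)[OF v] by measurable
  show "AE x in M. norm (v x *R grad ps x) powr p <= B powr p * norm (v x) powr p"
  proof (rule AE_I2)
  fix x
  have "norm (v x *R grad ps x) <= B * norm (v x)"
  using mult_right_mono[OF B(3)[of x] norm_ge_zero[of "v x"]] by (simp add: mult.commute)
  thus "norm (v x *R grad ps x) powr p <= B powr p * norm (v x) powr p"
  using p_pos unfolding powr_mult[symmetric] by (intro powr_mono2) auto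
  qed
  qed
 qed (use p_gt_1 in simp)
 have I2: "integrable M (%x. ps x *R w x)" if w: "w \<in> Lp Om p" for w :: "'a => 'a"
  using p_gt_1 p_pos B(2) by (intro Lp_integrable[where r = p] Lp_bounded_scaleR[where K = B] w psm) auto
 show "(LINT x|M. u x *R grad ps x) = - (LINT x|M. ps x *R g x)"
 proof (rule euclidean_eqI)
  fix i :: 'a assume i: "i \<in> Basis"
  have gi: "(%x. grad ps x \<bullet> i) \<in> Lp Om q"
  using psm(2) order_trans[OF Basis_le_norm[OF i] B(3)] by (intro Lp_bounded[where K = B] q_pos) auto
  have pi: "(%x. ps x *R i) \<in> Lp Om q"
  using B(2) i by (intro Lp_bounded[where K = B] q_pos) auto
  have e1: "(LINT x|M. v x *R grad ps x) \<bullet> i = (LINT x|M. (grad ps x \<bullet> i) \<bullet> v x)" if "v \<in> Lp Om p" for v :: "'a => real"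
  using integral_inner_left[OF I1[OF that], of i] by (simp add: mult.commute)
  have e2: "(LINT x|M. ps x *R w x) \<bullet> i = (LINT x|M. (ps x *R i) \<bullet> w x)" if "w \<in> Lp Om p" for w :: "'a => 'a"
  using integral_inner_left[OF I2[OF that], of i] by (simp add: inner_commute)
  have "(%k. LINT x|M. (grad ps x \<bullet> i) \<bullet> ph k x) ----> (LINT x|M. (grad ps x \<bullet> i) \<bullet> u x)"
  by (rule Lp_tendsto_inner_const[OF ph(2) gi])
  moreover have "(%k. - (LINT x|M. (ps x *R i) \<bullet> grad (ph k) x)) ----> - (LINT x|M. (ps x *R i) \<bullet> g x)"
  by (intro tendsto_minus Lp_tendsto_inner_const[OF ph(3) pi])
  moreover have "(LINT x|M. (grad ps x \<bullet> i) \<bullet> ph k x) = - (LINT x|M. (ps x *R i) \<bullet> grad (ph k) x)" for k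
  using e1[OF test_Lp(1)[OF ph(1) p_pos], of k] e2[OF test_Lp(2)[OF ph(1) p_pos], of k] test_function_by_parts[OF ph(1) ps, of k]
  by (metis inner_minus_left)
  ultimately have "(LINT x|M. (grad ps x \<bullet> i) \<bullet> u x) = - (LINT x|M. (ps x *R i) \<bullet> g x)"
  using LIMSEQ_unique by auto
  thus "(LINT x|M. u x *R grad ps x) \<bullet> i = - (LINT x|M. ps x *R g x) \<bullet> i"
  using e1[OF W0_Lp(1)[OF W]] e2[OF W0_Lp(2)[OF W]] by simp
 qed
qed

lemma weak_grad_unique:
 assumes "has_weak_grad Om p u g" "has_weak_grad Om p u h"
 shows "AE x in M. g x = h x"
proof -
 have L: "g \<in> Lp Om p" "h \<in> Lp Om p" using assms by (auto simp: has_weak_grad_def)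
 have "AE x in M. g x - h x = 0"
 proof (rule AE_zero_of_test[OF open_dom])
  show "integrable M (%x. g x - h x)" using p_gt_1 by (intro Lp_integrable[OF Lp_diff[OF p_pos L]]) simp
  fix ps assume ps: "test_function Om ps"
  obtain B where B: "0 < B" "!!x. \<bar>ps x\<bar> <= B" "!!x. norm (grad ps x) <= B" by (rule test_function_bounded[OF ps]) (rule that)
  have I: "integrable M (%x. ps x *R w x)" if "w \<in> Lp Om p" for w :: "'a => 'a"
  using p_gt_1 p_pos B(2) borel_measurable_lebesgue_onI[OF test_functionD(5)[OF ps]]
  by (intro Lp_integrable[where r = p] Lp_bounded_scaleR[where K = B] that) auto
  show "(LINT x|M. ps x *R (g x - h x)) = 0"
  using assms ps I[OF L(1)] I[OF L(2)] by (auto simp: has_weak_grad_def scaleR_diff_right)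
 qed
 thus ?thesis by simp
qed

lemma has_weak_grad_wgrad: "has_weak_grad Om p u g ==> has_weak_grad Om p u (\<nabla> u)"
 unfolding wgrad_def by (rule someI[of "has_weak_grad Om p u"])

lemma wgrad_AE: "has_weak_grad Om p u g ==> AE x in M. \<nabla> u x = g x"
 by (rule weak_grad_unique[OF has_weak_grad_wgrad])

lemma has_weak_grad_diff:
 assumes "has_weak_grad Om p u g" "has_weak_grad Om p v h"
 shows "has_weak_grad Om p (%x. u x - v x) (%x. g x - h x)"
 unfolding has_weak_grad_def
proof (intro conjI allI impI)
 have L: "u \<in> Lp Om p" "v \<in> Lp Om p" "g \<in> Lp Om p" "h \<in> Lp Om p" using assms by (auto simp: has_weak_grad_def)
 show "(%x. u x - v x) \<in> Lp Om p" "(%x. g x - h x) \<in> Lp Om p" using L by (auto intro: Lp_diff p_pos)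
 fix ps assume ps: "test_function Om ps"
 obtain B where B: "0 < B" "!!x. \<bar>ps x\<bar> <= B" "!!x. norm (grad ps x) <= B" by (rule test_function_bounded[OF ps]) (rule that)
 note psm[measurable] = borel_measurable_lebesgue_onI[OF test_functionD(5)[OF ps], of Om] borel_measurable_lebesgue_onI[OF test_functionD(6)[OF ps], of Om]
 have I1: "integrable M (%x. v x *R grad ps x)" if v: "v \<in> Lp Om p" for v :: "'a => real"
 proof (rule Bochner_Integration.integrable_bound)
  show "integrable M (%x. B * norm (v x))" using Lp_integrable[OF v] p_gt_1 by simp
  show "(%x. v x *R grad ps x) \<in> borel_measurable M" using LpD(1)[OF v] by measurable
  show "AE x in M. norm (v x *R grad ps x) <= norm (B * norm (v x))"
  using mult_right_mono[OF B(3) abs_ge_zero] B(1) by (intro AE_I2) (simp add: abs_mult mult.commute)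
 qed
 have I2: "integrable M (%x. ps x *R w x)" if "w \<in> Lp Om p" for w :: "'a => 'a"
  using p_gt_1 p_pos B(2) by (intro Lp_integrable[where r = p] Lp_bounded_scaleR[where K = B] that psm) auto
 show "(LINT x|M. (u x - v x) *R grad ps x) = - (LINT x|M. ps x *R (g x - h x))"
  using assms ps I1[OF L(1)] I1[OF L(2)] I2[OF L(3)] I2[OF L(4)]
  by (simp add: has_weak_grad_def scaleR_diff_left scaleR_diff_right)
qed

lemma W_norm_eq:
 assumes "has_weak_grad Om p u g"
 shows "W_norm Om p u = ((Np u) + (Np g)) powr (1 / p)"
proof -
 have "(Np (\<nabla> u)) = (Np g)"
  using wgrad_AE[OF assms] has_weak_grad_wgrad[OF assms] assms
  by (intro integral_cong_AE) (auto simp: has_weak_grad_def dest: LpD)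
 thus ?thesis by (simp add: W_norm_def)
qed

lemma W_dist_tendsto:
 assumes v: "!!n. has_weak_grad Om p (v n) (h n)" and u: "has_weak_grad Om p u g"
 shows "(%n. W_dist Om p (v n) u) ----> 0 \<longleftrightarrow> Lp_tendsto Om p v u & Lp_tendsto Om p h g"
proof -
 let ?A = "%n. LINT x|M. norm (v n x - u x) powr p" let ?B = "%n. LINT x|M. norm (h n x - g x) powr p"
 have L: "v n \<in> Lp Om p" "h n \<in> Lp Om p" "u \<in> Lp Om p" "g \<in> Lp Om p" for n
  using v u by (auto simp: has_weak_grad_def)
 have eq: "W_dist Om p (v n) u = (?A n + ?B n) powr (1/p)" for n
  unfolding W_dist_def by (rule W_norm_eq[OF has_weak_grad_diff[OF v u]])
 have "(%n. W_dist Om p (v n) u) ----> 0 \<longleftrightarrow> (%n. ?A n + ?B n) ----> 0"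
 proof
  assume "(%n. W_dist Om p (v n) u) ----> 0"
  hence "(%n. W_dist Om p (v n) u powr p) ----> 0 powr p"
  using p_pos by (intro tendsto_powr' tendsto_const) (auto simp: eq)
  thus "(%n. ?A n + ?B n) ----> 0" using p_pos by (simp add: eq powr_powr add_nonneg_nonneg)
 next
  assume "(%n. ?A n + ?B n) ----> 0"
  hence "(%n. (?A n + ?B n) powr (1/p)) ----> 0 powr (1/p)"
  using p_pos by (intro tendsto_powr' tendsto_const) (auto simp: add_nonneg_nonneg)
  thus "(%n. W_dist Om p (v n) u) ----> 0" by (simp add: eq)
 qed
 also have "... \<longleftrightarrow> ?A ----> 0 & ?B ----> 0"
 proof
  assume *: "(%n. ?A n + ?B n) ----> 0"
  show "?A ----> 0 & ?B ----> 0"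
  by (intro conjI tendsto_sandwich[OF _ _ tendsto_const *] always_eventually allI) auto
 next
  assume "?A ----> 0 & ?B ----> 0"
  thus "(%n. ?A n + ?B n) ----> 0" using tendsto_add[of ?A 0 sequentially ?B 0] by simp
 qed
 finally show ?thesis using L by (simp add: Lp_tendsto_def)
qed

lemma W0_W01p: assumes "W0 u g" shows "u \<in> W01p Om p"
proof -
 obtain ph where ph: "!!k. test_function Om (ph k)" "Lp_tendsto Om p ph u" "Lp_tendsto Om p (%k. grad (ph k)) g"
  by (rule W0E[OF assms]) (rule that)
 have "(%k. W_dist Om p (ph k) u) ----> 0"
  using W_dist_tendsto[of ph "%k. grad (ph k)", OF W0_weak_grad[OF W0_test[OF ph(1)]] W0_weak_grad[OF assms]] ph by blast
 thus ?thesis using W0_weak_grad[OF assms] ph(1) unfolding W01p_def W1p_def by blast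
qed

lemma W0_wgrad: assumes "u \<in> W01p Om p" shows "W0 u (\<nabla> u)"
proof -
 obtain g where g: "has_weak_grad Om p u g" using assms by (auto simp: W01p_def W1p_def)
 obtain ph where ph: "!!k. test_function Om (ph k)" "(%k. W_dist Om p (ph k) u) ----> 0"
  using assms by (auto simp: W01p_def)
 from W_dist_tendsto[of ph "%k. grad (ph k)", OF W0_weak_grad[OF W0_test[OF ph(1)]] has_weak_grad_wgrad[OF g]] ph
 show ?thesis unfolding W0_def by blast
qed

lemma W0_wgrad_AE: assumes "W0 u g" shows "AE x in M. \<nabla> u x = g x"
 by (rule wgrad_AE[OF W0_weak_grad[OF assms]])

lemma W0_unique: assumes "W0 u g" "W0 u h" shows "AE x in M. g x = h x"
 by (rule weak_grad_unique[OF assms[THEN W0_weak_grad]])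

lemma W0_unique_AE: assumes "W0 u g" "W0 v h" "AE x in M. u x = v x" shows "AE x in M. g x = h x"
 using W0_AE_cong[OF assms(1) W0_measurable(1)[OF assms(2)] W0_measurable(2)[OF assms(1)] assms(3)] W0_unique[OF _ assms(2)] by simp

lemma W0_Poincare:
 obtains C where "0 < C" "!!u g. W0 u g ==> (Np u) <= C * (Np g)"
proof -
 obtain C where C: "0 < C" "!!f. test_function Om f ==>
  (LINT x|lborel. \<bar>f x\<bar> powr p) <= C * (LINT x|lborel. norm (grad f x) powr p)"
  by (rule test_function_Poincare[OF p_gt_1 bounded_dom]) (rule that)
 have "(Np u) <= C * (Np g)" if W: "W0 u g" for u g
 proof -
  obtain ph where ph: "!!k. test_function Om (ph k)" "Lp_tendsto Om p ph u" "Lp_tendsto Om p (%k. grad (ph k)) g"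
  by (rule W0E[OF W]) (rule that)
  have "(Np (ph k)) <= C * (LINT x|M. norm (grad (ph k) x) powr p)" for k
  using C(2)[OF ph(1)] test_function_Lp(3,4)[OF dom_sets p_pos ph(1)] by simp
  thus ?thesis
  by (intro LIMSEQ_le[OF Lp_tendsto_integral_norm[OF p_pos ph(2)] tendsto_mult[OF tendsto_const Lp_tendsto_integral_norm[OF p_pos ph(3)]]]) auto
 qed
 thus thesis by (rule that[OF C(1)])
qed

theorem W0_Rellich:
 assumes W: "!!n. W0 (u n) (g n)" and G: "!!n. (Np (g n)) <= G"
 obtains r U where "strict_mono (r :: nat => nat)" "Lp_tendsto Om p (%n. u (r n)) U"
proof -
 obtain ph where ph: "!!k. test_function Om (ph k)" "!!k. (Nd (ph k) (u k)) < 1 / real (Suc k)"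
  "!!k. (LINT x|M. norm (grad (ph k) x - g k x) powr p) < 1 / real (Suc k)"
  by (rule W0_approx_seq[OF W]) (rule that)
 note phL = test_Lp[OF ph(1) p_pos]
 note uL = W0_Lp[OF W]
 have "(LINT x|lborel. norm (grad (ph k) x) powr p) <= 2 powr p * (1 + G)" for k
 proof -
  have "(LINT x|lborel. norm (grad (ph k) x) powr p) = (LINT x|M. norm (grad (ph k) x) powr p)"
  using test_function_Lp(4)[OF dom_sets p_pos ph(1)] by simp
  also have "... <= 2 powr p * ((LINT x|M. norm (grad (ph k) x - g k x) powr p) + (Np (g k)))"
  using norm_triangle_ineq[of "grad (ph k) x - g k x" "g k x" for x]
  by (intro Lp_integral_triangle p_pos Lp_diff phL uL AE_I2 LpD(1)[OF phL(2)]) simp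
  also have "... <= 2 powr p * (1 + G)"
  using less_imp_le[OF ph(3)[of k]] G[of k] by (intro mult_left_mono add_mono) (auto intro: order_trans)
  finally show ?thesis .
 qed
 note bd = this
 obtain r where r: "strict_mono (r :: nat => nat)"
  and ca: "!!e. 0 < e ==> \<exists>N. \<forall>m\<ge>N. \<forall>n\<ge>N. (Nd (ph (r m)) (ph (r n))) < e"
  by (rule test_function_Rellich[OF p_gt_1 open_dom bounded_dom ph(1) bd]) (rule that)
 obtain U where U: "Lp_tendsto Om p (%n. ph (r n)) U" by (rule Lp_complete[OF p_pos phL(1) ca])
 have lim0: "(%k. 1 / real (Suc k)) ----> 0" using LIMSEQ_inverse_real_of_nat by (simp add: inverse_eq_divide)
 have "Lp_tendsto Om p (%k x. ph k x - u k x) (%x. 0)"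
  using uL(1) phL(1) less_imp_le[OF ph(2)]
  by (intro Lp_tendsto_squeeze[OF _ _ _ lim0] Lp_diff p_pos) auto
 from Lp_tendsto_diff[OF p_pos U Lp_tendsto_subseq[OF this r]]
 have "Lp_tendsto Om p (%n. u (r n)) U" by simp
 thus thesis by (rule that[OF r])
qed

end

context bounded_domain
begin

text \<open>This makes \<open>ps u\<close> an admissible test function when an equation is localised.\<close>

lemma W0_test_mult:
 assumes W: "W0 u g" and ps: "test_function Om ps"
 shows "W0 (%x. ps x * u x) (%x. ps x *R g x + u x *R grad ps x)"
proof -
 obtain ph where ph: "!!k. test_function Om (ph k)" "Lp_tendsto Om p ph u" "Lp_tendsto Om p (%k. grad (ph k)) g"
  by (rule W0E[OF W]) (rule that)
 obtain B where B: "0 < B" "!!x. \<bar>ps x\<bar> <= B" "!!x. norm (grad ps x) <= B" by (rule test_function_bounded[OF ps]) (rule that)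
 note psm[measurable] = borel_measurable_lebesgue_onI[OF test_functionD(5)[OF ps], of Om] borel_measurable_lebesgue_onI[OF test_functionD(6)[OF ps], of Om]
 have m1: "(%x. ps x *R v x) \<in> Lp Om p" if "v \<in> Lp Om p" for v :: "'a => 'b::euclidean_space"
  using B(2) by (intro Lp_bounded_scaleR[where K = B] p_pos that psm) auto
 have m2: "(%x. v x *R grad ps x) \<in> Lp Om p" if v: "v \<in> Lp Om p" for v :: "'a => real"
 proof (rule Lp_dominated)
  show "integrable M (%x. B powr p * norm (v x) powr p)" using LpD(2)[OF v] by simp
  show "(%x. v x *R grad ps x) \<in> borel_measurable M" using LpD(1)[OF v] by measurable
  show "AE x in M. norm (v x *R grad ps x) powr p <= B powr p * norm (v x) powr p"
  proof (rule AE_I2)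
  fix x
  have "norm (v x *R grad ps x) <= B * norm (v x)"
  using mult_right_mono[OF B(3)[of x] norm_ge_zero[of "v x"]] by (simp add: mult.commute)
  thus "norm (v x *R grad ps x) powr p <= B powr p * norm (v x) powr p"
  using p_pos unfolding powr_mult[symmetric] by (intro powr_mono2) auto
  qed
 qed
 have "Lp_tendsto Om p (%k x. ps x *R ph k x) (%x. ps x *R u x)"
  by (rule Lp_tendsto_Lipschitz_image[OF p_pos ph(2), where K = B])
  (use m1[OF Lp_tendstoD(1)[OF ph(2)]] m1[OF Lp_tendstoD(2)[OF ph(2)]] B(2) in \<open>auto simp: right_diff_distrib[symmetric] abs_mult intro!: mult_right_mono\<close>)
 moreover have "Lp_tendsto Om p (%k x. ps x *R grad (ph k) x) (%x. ps x *R g x)"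
  by (rule Lp_tendsto_Lipschitz_image[OF p_pos ph(3), where K = B])
  (use m1[OF Lp_tendstoD(1)[OF ph(3)]] m1[OF Lp_tendstoD(2)[OF ph(3)]] B(2) in \<open>auto simp: scaleR_diff_right[symmetric] intro!: mult_right_mono\<close>)
 moreover have "Lp_tendsto Om p (%k x. ph k x *R grad ps x) (%x. u x *R grad ps x)"
 proof (rule Lp_tendsto_Lipschitz_image[OF p_pos ph(2), where K = B])
  show "norm (ph n x *R grad ps x - u x *R grad ps x) <= B * norm (ph n x - u x)" for n x
  using mult_right_mono[OF B(3)[of x] norm_ge_zero[of "ph n x - u x"]]
  by (simp add: scaleR_diff_left[symmetric] mult.commute)
 qed (use m2 Lp_tendstoD[OF ph(2)] in auto)
 moreover have "grad (%x. ps x * ph k x) = (%x. ps x *R grad (ph k) x + ph k x *R grad ps x)" for k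
  by (intro ext grad_mult test_functionD(2)[OF ph(1)] test_functionD(2)[OF ps])
 ultimately show ?thesis unfolding W0_def
  using test_function_mult[OF test_functionD(1)[OF ps] ph(1)] Lp_tendsto_add[OF p_pos]
  by (intro exI[of _ "%k x. ps x * ph k x"]) simp
qed

end

subsection \<open>Truncation\<close>

text \<open>A smooth substitute for the positive part, with derivative between \<open>0\<close> and \<open>1\<close>.\<close>

definition soft_pos :: "real => real => real" where
 "soft_pos de t = t * theta 0 (t / de)"

definition soft_pos' :: "real => real => real" where
 "soft_pos' de t = theta 0 (t / de) + theta 1 (t / de)"

lemma soft_pos_deriv: "0 < de ==> (soft_pos de has_real_derivative soft_pos' de t) (at t)"
proof -
 assume d: "0 < de"
 have e: "(t / de) * theta 2 (t / de) = theta 1 (t / de)"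
  using d by (simp add: theta_def power2_eq_square)
 have t0: "(theta 0 has_real_derivative theta 2 s) (at s)" for s using theta_deriv[of 0 s] by (simp add: numeral_2_eq_2)
 have "((%t. theta 0 (t / de)) has_real_derivative theta 2 (t / de) * (1 / de)) (at t)"
  by (rule DERIV_chain'[where g = "theta 0" and f = "%t. t / de"]) (use d in \<open>auto intro!: derivative_eq_intros t0\<close>)
 from DERIV_mult[OF DERIV_ident this]
 have "((%t. t * theta 0 (t / de)) has_real_derivative 1 * theta 0 (t / de) + theta 2 (t / de) * (1 / de) * t) (at t)" .
 moreover have "1 * theta 0 (t / de) + theta 2 (t / de) * (1 / de) * t = soft_pos' de t"
  unfolding soft_pos'_def e[symmetric] by (simp add: mult.commute)
 ultimately show ?thesis by (simp add: soft_pos_def[abs_def])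
qed

lemma soft_pos'_bounds: "0 <= soft_pos' de t" "soft_pos' de t <= 1"
proof -
 define s where "s = t / de"
 have "0 <= theta n s" for n s by (simp add: theta_def)
 thus "0 <= soft_pos' de t" unfolding soft_pos'_def by (intro add_nonneg_nonneg)
 show "soft_pos' de t <= 1"
 proof (cases "s <= 0")
  case False
  have "exp (- (1/s)) * (1 + 1/s) <= exp (- (1/s)) * exp (1/s)"
  by (intro mult_left_mono exp_ge_add_one_self) auto
  thus ?thesis using False by (simp add: soft_pos'_def theta_def s_def[symmetric] exp_minus field_simps)
 qed (simp add: soft_pos'_def theta_def s_def[symmetric])
qed

lemma soft_pos_abs_le: "\<bar>soft_pos de t\<bar> <= \<bar>t\<bar>"
 using theta_0_bounds[of "t / de"] by (auto simp: soft_pos_def abs_mult intro!: mult_right_le_one_le)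

lemma theta_continuous: "continuous_on UNIV (theta n)"
 by (meson DERIV_isCont continuous_at_imp_continuous_on theta_deriv)

lemma soft_pos_continuous: "0 < de ==> continuous_on UNIV (soft_pos de)" "0 < de ==> continuous_on UNIV (soft_pos' de)"
proof -
 have "continuous_on UNIV (%t. theta n (t / de))" if "0 < de" for n
  using that by (intro continuous_on_compose2[OF theta_continuous]) (auto intro!: continuous_intros)
 thus "0 < de ==> continuous_on UNIV (soft_pos de)" "0 < de ==> continuous_on UNIV (soft_pos' de)"
  unfolding soft_pos_def[abs_def] soft_pos'_def[abs_def] by (auto intro!: continuous_intros)
qed

lemma soft_pos_limit:
 "(%n. soft_pos (1 / real (Suc n)) t) ----> max 0 t"
 "(%n. soft_pos' (1 / real (Suc n)) t) ----> (if 0 < t then 1 else 0)"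
proof -
 have *: "(%n. theta 0 (t / (1 / real (Suc n)))) ----> 1 & (%n. theta 1 (t / (1 / real (Suc n)))) ----> 0" if t: "t > 0"
 proof -
  have l: "(%n. inverse (real (Suc n)) * (1 / t)) ----> 0 * (1 / t)"
  by (intro tendsto_mult LIMSEQ_inverse_real_of_nat tendsto_const)
  hence "(%n. exp (- (inverse (real (Suc n)) * (1 / t)))) ----> exp (- 0)"
  by (intro tendsto_exp tendsto_minus) simp
  moreover have pos: "\<not> t / (1 / real (Suc n)) <= 0" for n using t by (simp add: not_le del: of_nat_Suc)
  hence "theta 0 (t / (1 / real (Suc n))) = exp (- (inverse (real (Suc n)) * (1 / t)))" for n
  unfolding theta_def using t by (subst if_not_P) (auto simp: field_simps simp del: of_nat_Suc)
  ultimately have 0: "(%n. theta 0 (t / (1 / real (Suc n)))) ----> 1" by simp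
  have "theta 1 (t / (1 / real (Suc n))) = theta 0 (t / (1 / real (Suc n))) * (inverse (real (Suc n)) * (1 / t))" for n
  unfolding theta_def using t pos[of n] by (simp only: if_not_P) (simp add: field_simps del: of_nat_Suc)
  with tendsto_mult[OF 0 l] 0 show ?thesis by simp
 qed
 have z: "theta k (t / (1 / real (Suc n))) = 0" if "t <= 0" for k n
  using that by (simp add: theta_def divide_nonpos_pos mult_nonpos_nonneg)
 show "(%n. soft_pos (1 / real (Suc n)) t) ----> max 0 t"
 proof (cases "t > 0")
  case True
  from tendsto_mult[OF tendsto_const[of t] conjunct1[OF *[OF True]]] show ?thesis using True by (simp add: soft_pos_def max_def)
 next
  case False thus ?thesis using z by (simp add: soft_pos_def max_def)
 qed
 show "(%n. soft_pos' (1 / real (Suc n)) t) ----> (if 0 < t then 1 else 0)"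
 proof (cases "t > 0")
  case True
  with tendsto_add[OF conjunct1[OF *[OF True]] conjunct2[OF *[OF True]]] show ?thesis by (simp add: soft_pos'_def)
 next
  case False thus ?thesis using z by (simp add: soft_pos'_def)
 qed
qed

context bounded_domain
begin

lemma W0_soft_pos:
 assumes W: "W0 u g" and de: "0 < de"
 shows "W0 (%x. soft_pos de (u x)) (%x. soft_pos' de (u x) *R g x)"
proof -
 obtain ph0 where ph0: "!!k. test_function Om (ph0 k)" "Lp_tendsto Om p ph0 u" "Lp_tendsto Om p (%k. grad (ph0 k)) g"
  by (rule W0E[OF W]) (rule that)
 obtain r D where r: "strict_mono r" and D: "integrable M D" "AE x in M. (%k. ph0 (r k) x) ----> u x"
  "AE x in M. \<forall>k. norm (ph0 (r k) x) powr p <= D x"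
  by (rule Lp_tendsto_dominated_subseq[OF p_pos ph0(2)])
 obtain r' D' where r': "strict_mono r'" and D': "integrable M D'" "AE x in M. (%k. grad (ph0 (r (r' k))) x) ----> g x"
  "AE x in M. \<forall>k. norm (grad (ph0 (r (r' k))) x) powr p <= D' x"
  by (rule Lp_tendsto_dominated_subseq[OF p_pos Lp_tendsto_subseq[OF ph0(3) r]])
 define ph where "ph k = ph0 (r (r' k))" for k
 have ph: "test_function Om (ph k)" for k unfolding ph_def by (rule ph0)
 have conv: "AE x in M. (%k. ph k x) ----> u x" using D(2)
 proof eventually_elim
  case (elim x)
  from LIMSEQ_subseq_LIMSEQ[OF elim r'] show ?case by (simp add: ph_def o_def)
 qed
 have dom: "AE x in M. norm (ph k x) powr p <= D x" for k using D(3) by eventually_elim (simp add: ph_def)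
 have conv': "AE x in M. (%k. grad (ph k) x) ----> g x" using D'(2) by (simp add: ph_def)
 have dom': "AE x in M. norm (grad (ph k) x) powr p <= D' x" for k using D'(3) by eventually_elim (simp add: ph_def)
 note c = soft_pos_continuous[OF de]
 have c1: "isCont (soft_pos de) y" "isCont (soft_pos' de) y" for y
  using c by (simp_all add: continuous_on_eq_continuous_at)
 have ct: "(%k. soft_pos de (s k)) ----> soft_pos de y" "(%k. soft_pos' de (s k)) ----> soft_pos' de y"
  if "s ----> y" for s y
  by (rule isCont_tendsto_compose[OF c1(1) that], rule isCont_tendsto_compose[OF c1(2) that])
 note um = W0_measurable[OF W]
 have phm: "ph k \<in> borel_measurable M" "grad (ph k) \<in> borel_measurable M" for k
  by (intro borel_measurable_lebesgue_onI test_functionD(5,6)[OF ph])+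
 have sm: "(%x. soft_pos de (v x)) \<in> borel_measurable M" "(%x. soft_pos' de (v x)) \<in> borel_measurable M"
  if "v \<in> borel_measurable M" for v
  by (rule measurable_compose[OF that borel_measurable_continuous_onI[OF c(1)]])
  (rule measurable_compose[OF that borel_measurable_continuous_onI[OF c(2)]])
 have T: "test_function Om (%x. soft_pos de (ph k x))" for k
 proof (rule test_function_mono_support[OF ph[of k]])
  have "C_inf (%x. ph k x * theta 0 ((1 / de) * ph k x))"
  by (intro C_inf_mult C_inf_theta C_inf_const test_functionD(1)[OF ph])
  thus "C_inf (%x. soft_pos de (ph k x))" by (simp add: soft_pos_def)
 qed (simp add: soft_pos_def)
 have G: "grad (%x. soft_pos de (ph k x)) = (%x. soft_pos' de (ph k x) *R grad (ph k) x)" for k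
  by (intro ext grad_compose test_functionD(2)[OF ph] soft_pos_deriv de)
 have 1: "Lp_tendsto Om p (%k x. soft_pos de (ph k x)) (%x. soft_pos de (u x))"
 proof (rule Lp_tendsto_dominated[OF p_pos _ _ D(1)])
  show "AE x in M. (%k. soft_pos de (ph k x)) ----> soft_pos de (u x)"
  using conv by eventually_elim (rule ct)
  show "AE x in M. norm (soft_pos de (ph k x)) powr p <= D x" for k
  using dom[of k]
  proof eventually_elim
  case (elim x)
  have "norm (soft_pos de (ph k x)) powr p <= norm (ph k x) powr p"
  using p_pos soft_pos_abs_le by (intro powr_mono2) auto
  thus ?case using elim by linarith
  qed
 qed (intro sm borel_measurable_scaleR phm um)+
 have 2: "Lp_tendsto Om p (%k x. soft_pos' de (ph k x) *R grad (ph k) x) (%x. soft_pos' de (u x) *R g x)"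
 proof (rule Lp_tendsto_dominated[OF p_pos _ _ D'(1)])
  show "AE x in M. (%k. soft_pos' de (ph k x) *R grad (ph k) x) ----> soft_pos' de (u x) *R g x"
  using conv conv' by eventually_elim (rule tendsto_scaleR[OF ct(2)])
  show "AE x in M. norm (soft_pos' de (ph k x) *R grad (ph k) x) powr p <= D' x" for k
  using dom'[of k]
  proof eventually_elim
  case (elim x)
  have "norm (soft_pos' de (ph k x) *R grad (ph k) x) powr p <= norm (grad (ph k) x) powr p"
  using p_pos soft_pos'_bounds[of de "ph k x"]
  by (intro powr_mono2) (simp_all add: mult_left_le_one_le)
  thus ?case using elim by linarith
  qed
 qed (intro sm borel_measurable_scaleR phm um)+
 show ?thesis unfolding W0_def
  by (intro exI[of _ "%k x. soft_pos de (ph k x)"] conjI allI T 1 2[folded G])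
qed

text \<open>Apply the chain rule to smooth substitutes for the positive part and let them converge boundedly.\<close>

theorem W0_pos:
 assumes W: "W0 u g"
 shows "W0 (%x. max 0 (u x)) (%x. if 0 < u x then g x else 0)"
proof (rule W0_closed[OF W0_soft_pos[OF W]])
 show "0 < 1 / real (Suc n)" for n by simp
 note [measurable] = W0_measurable[OF W]
 have [measurable]: "soft_pos (1 / real (Suc n)) \<in> borel_measurable borel" "soft_pos' (1 / real (Suc n)) \<in> borel_measurable borel" for n
  by (auto intro!: borel_measurable_continuous_onI soft_pos_continuous)
 show "Lp_tendsto Om p (%n x. soft_pos (1 / real (Suc n)) (u x)) (%x. max 0 (u x))"
 proof (rule Lp_tendsto_dominated[OF p_pos _ _ LpD(2)[OF W0_Lp(1)[OF W]]])
  show "AE x in M. (%n. soft_pos (1 / real (Suc n)) (u x)) ----> max 0 (u x)" by (intro AE_I2 soft_pos_limit)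
  show "AE x in M. norm (soft_pos (1 / real (Suc n)) (u x)) powr p <= norm (u x) powr p" for n
  using p_pos soft_pos_abs_le by (intro AE_I2 powr_mono2) auto
 qed measurable
 show "Lp_tendsto Om p (%n x. soft_pos' (1 / real (Suc n)) (u x) *R g x) (%x. if 0 < u x then g x else 0)"
 proof (rule Lp_tendsto_dominated[OF p_pos _ _ LpD(2)[OF W0_Lp(2)[OF W]]])
  have "(%n. soft_pos' (1 / real (Suc n)) (u x) *R g x) ----> (if 0 < u x then 1 else 0) *R g x" for x
  by (intro tendsto_scaleR soft_pos_limit tendsto_const)
  moreover have "(if 0 < u x then 1 else 0) *R g x = (if 0 < u x then g x else 0)" for x by simp
  ultimately show "AE x in M. (%n. soft_pos' (1 / real (Suc n)) (u x) *R g x) ----> (if 0 < u x then g x else 0)"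
  by (intro AE_I2) (simp only:)
  show "AE x in M. norm (soft_pos' (1 / real (Suc n)) (u x) *R g x) powr p <= norm (g x) powr p" for n
  using p_pos soft_pos'_bounds by (intro AE_I2 powr_mono2) (simp_all add: mult_left_le_one_le)
 qed measurable
qed

lemma W0_neg:
 assumes W: "W0 u g"
 shows "W0 (%x. max 0 (- u x)) (%x. if u x < 0 then - g x else 0)"
 using W0_pos[OF W0_minus[OF W]] by simp

text \<open>Comparing \<open>\<nabla>u\<close> with \<open>\<nabla>u\<^sup>+ - \<nabla>u\<^sup>-\<close>.\<close>

lemma W0_grad_zero_set:
 assumes W: "W0 u g"
 shows "AE x in M. u x = 0 --> g x = 0"
proof -
 have "W0 (%x. max 0 (u x) - max 0 (- u x)) (%x. (if 0 < u x then g x else 0) - (if u x < 0 then - g x else 0))"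
  by (rule W0_diff[OF W0_pos[OF W] W0_neg[OF W]])
 moreover have "(%x. max 0 (u x) - max 0 (- u x)) = u" by (auto simp: max_def)
 ultimately have "W0 u (%x. (if 0 < u x then g x else 0) - (if u x < 0 then - g x else 0))" by simp
 from W0_unique[OF this W] have "AE x in M. (if 0 < u x then g x else 0) - (if u x < 0 then - g x else 0) = g x" .
 thus ?thesis by eventually_elim auto
qed

subsection \<open>Weak compactness\<close>

lemma W_dualD:
 assumes "La \<in> W_dual Om p"
 shows "u \<in> W01p Om p ==> v \<in> W01p Om p ==> La (%x. u x + v x) = La u + La v"
  "u \<in> W01p Om p ==> La (%x. t * u x) = t * La u"
  "\<exists>K. \<forall>u\<in>W01p Om p. \<bar>La u\<bar> <= K * W_norm Om p u"
 using assms by (auto simp: W_dual_def)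

lemma W_dual_diff:
 assumes "La \<in> W_dual Om p" "u \<in> W01p Om p" "v \<in> W01p Om p"
 shows "La (%x. u x - v x) = La u - La v"
proof -
 have "(%x. - v x) \<in> W01p Om p" using W0_W01p[OF W0_minus[OF W0_wgrad[OF assms(3)]]] .
 from W_dualD(1)[OF assms(1,2) this] have "La (%x. u x + - v x) = La u + La (%x. - v x)" .
 moreover have "La (%x. (-1) * v x) = (-1) * La v" by (rule W_dualD(2)[OF assms(1,3)])
 ultimately show ?thesis by simp
qed

lemma W_dual_bound:
 assumes "La \<in> W_dual Om p"
 obtains K where "0 <= K" "!!u g. W0 u g ==> \<bar>La u\<bar> <= K * (Np g) powr (1/p)"
proof -
 obtain K where K: "!!u. u \<in> W01p Om p ==> \<bar>La u\<bar> <= K * W_norm Om p u" using W_dualD(3)[OF assms] by blast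
 obtain C where C: "0 < C" "!!u g. W0 u g ==> (Np u) <= C * (Np g)"
  by (rule W0_Poincare) (rule that)
 show thesis
 proof (rule that[of "\<bar>K\<bar> * (C + 1) powr (1/p)"])
  fix u g assume W: "W0 u g"
  have "\<bar>La u\<bar> <= K * W_norm Om p u" by (rule K[OF W0_W01p[OF W]])
  also have "... <= \<bar>K\<bar> * W_norm Om p u" by (intro mult_right_mono) (auto simp: W_norm_def)
  also have "W_norm Om p u = ((Np u) + (Np g)) powr (1/p)"
  by (rule W_norm_eq[OF W0_weak_grad[OF W]])
  also have "... <= ((C + 1) * (Np g)) powr (1/p)"
  using C(2)[OF W] p_pos by (intro powr_mono2) (auto simp: distrib_right add_nonneg_nonneg)
  also have "... = (C + 1) powr (1/p) * (Np g) powr (1/p)" by (rule powr_mult)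
  finally show "\<bar>La u\<bar> <= \<bar>K\<bar> * (C + 1) powr (1/p) * (Np g) powr (1/p)"
  by (simp add: mult.assoc mult_left_mono)
 qed simp
qed

lemma W_dual_continuous:
 assumes l: "La \<in> W_dual Om p" and W: "!!n. W0 (u n) (g n)" "W0 U G" and g: "Lp_tendsto Om p g G"
 shows "(%n. La (u n)) ----> La U"
proof -
 obtain K where K: "0 <= K" "!!u g. W0 u g ==> \<bar>La u\<bar> <= K * (Np g) powr (1/p)"
  by (rule W_dual_bound[OF l]) (rule that)
 have "(%n. La (u n) - La U) ----> 0"
 proof (rule Lim_null_comparison)
  show "\<forall>\<^sub>F n in sequentially. norm (La (u n) - La U) <= K * (Nd (g n) G) powr (1/p)"
  using K(2)[OF W0_diff[OF W(1) W(2)]] W_dual_diff[OF l W0_W01p[OF W(1)] W0_W01p[OF W(2)]] by (intro always_eventually) simp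
  have "(%n. (Nd (g n) G) powr (1/p)) ----> 0 powr (1/p)"
  using p_pos by (intro tendsto_powr' Lp_tendstoD(3)[OF g] tendsto_const) auto
  thus "(%n. K * (Nd (g n) G) powr (1/p)) ----> 0"
  by (intro tendsto_mult_right_zero) simp
 qed
 thus ?thesis by (simp add: LIM_zero_iff)
qed

lemma W_dualI:
 assumes w: "w \<in> Lp Om q" and z: "z \<in> Lp Om q"
 shows "(%v. (LINT x|M. w x \<bullet> \<nabla> v x) + (LINT x|M. z x \<bullet> v x)) \<in> W_dual Om p"
proof -
 have wg: "(LINT x|M. w x \<bullet> \<nabla> v x) = (LINT x|M. w x \<bullet> h x)" if "W0 v h" for v h
  using W0_wgrad_AE[OF that] LpD(1)[OF w] W0_measurable(2)[OF that] W0_measurable(2)[OF W0_wgrad[OF W0_W01p[OF that]]]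
  by (intro integral_cong_AE) auto
 have I: "integrable M (%x. w x \<bullet> h x)" "integrable M (%x. z x \<bullet> v x)" if "W0 v h" for v h
  using Lp_inner_integrable[OF p_gt_1 w W0_Lp(2)[OF that]] Lp_inner_integrable[OF p_gt_1 z W0_Lp(1)[OF that]] by auto
 let ?l = "%v. (LINT x|M. w x \<bullet> \<nabla> v x) + (LINT x|M. z x \<bullet> v x)"
 let ?W = "(LINT x|M. norm (w x) powr q) powr (1/q)" and ?Z = "(LINT x|M. norm (z x) powr q) powr (1/q)"
 show ?thesis unfolding W_dual_def
 proof (intro CollectI conjI ballI allI)
  fix u v assume u: "u \<in> W01p Om p" and v: "v \<in> W01p Om p"
  note U = W0_wgrad[OF u] and V = W0_wgrad[OF v]
  show "?l (%x. u x + v x) = ?l u + ?l v"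
  unfolding wg[OF W0_add[OF U V]] using I[OF U] I[OF V] by (simp add: inner_add_right distrib_left)
 next
  fix u t assume u: "u \<in> W01p Om p"
  note U = W0_wgrad[OF u]
  show "?l (%x. t * u x) = t * ?l u"
  unfolding wg[OF W0_cmult[OF U]] using I[OF U] by (simp add: distrib_left mult.left_commute)
 next
  show "\<exists>K. \<forall>u\<in>W01p Om p. \<bar>?l u\<bar> <= K * W_norm Om p u"
  proof (intro exI[of _ "?W + ?Z"] ballI)
  fix u assume u: "u \<in> W01p Om p"
  note U = W0_wgrad[OF u]
  let ?N = "W_norm Om p u"
  have "(Np (\<nabla> u)) powr (1/p) <= ?N"
  unfolding W_norm_def using p_pos by (intro powr_mono2) auto
  moreover have "(Np u) powr (1/p) <= ?N"
  unfolding W_norm_def using p_pos by (intro powr_mono2) auto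
  ultimately have "\<bar>LINT x|M. w x \<bullet> \<nabla> u x\<bar> <= ?W * ?N" "\<bar>LINT x|M. z x \<bullet> u x\<bar> <= ?Z * ?N"
  using order_trans[OF Lp_Holder[OF p_gt_1 w W0_Lp(2)[OF U]] mult_left_mono[OF _ powr_ge_zero]]
  order_trans[OF Lp_Holder[OF p_gt_1 z W0_Lp(1)[OF U]] mult_left_mono[OF _ powr_ge_zero]] by blast+
  thus "\<bar>?l u\<bar> <= (?W + ?Z) * ?N" unfolding distrib_right by linarith
  qed
 qed
qed

lemma W_dual_grad: "w \<in> Lp Om q ==> (%v. LINT x|M. w x \<bullet> \<nabla> v x) \<in> W_dual Om p"
 using W_dualI[of w "%x. 0"] by simp

lemma W_dual_fun: "z \<in> Lp Om q ==> (%v. LINT x|M. z x * v x) \<in> W_dual Om p"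
 using W_dualI[of "%x. 0" z] by simp

lemma wgrad_inner_integral:
 assumes "W0 v h" "w \<in> borel_measurable M"
 shows "(LINT x|M. w x \<bullet> \<nabla> v x) = (LINT x|M. w x \<bullet> h x)"
 using W0_wgrad_AE[OF assms(1)] W0_measurable(2)[OF assms(1)] W0_measurable(2)[OF W0_wgrad[OF W0_W01p[OF assms(1)]]] assms(2)
 by (intro integral_cong_AE) auto

text \<open>Dyadic convex combinations of the members with index at least \<open>N\<close>; midpoints suffice for a Mazur argument.\<close>

inductive midpoint_hull :: "(nat => 'a => real) => (nat => 'a => 'a) => nat => ('a => real) => ('a => 'a) => bool"
 for u g N where
 base: "N <= n ==> midpoint_hull u g N (u n) (g n)"
| mid: "midpoint_hull u g N v h ==> midpoint_hull u g N v' h' ==>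
  midpoint_hull u g N (%x. (1/2) * (v x + v' x)) (%x. (1/2) *R (h x + h' x))"

lemma midpoint_hull_mono: "midpoint_hull u g N v h ==> N' <= N ==> midpoint_hull u g N' v h"
proof (induction rule: midpoint_hull.induct)
 case (base n) thus ?case by (intro midpoint_hull.base) simp
next
 case (mid v h v' h') thus ?case by (intro midpoint_hull.mid) auto
qed

lemma integral_midpoint_le:
 fixes f g :: "'a => 'b::euclidean_space"
 assumes "f \<in> Lp Om p" "g \<in> Lp Om p"
 shows "(LINT x|M. norm ((1/2) *R (f x + g x)) powr p) <= ((Np f) + (Np g)) / 2"
proof -
 have "(LINT x|M. norm ((1/2) *R (f x + g x)) powr p) <= (LINT x|M. (norm (f x) powr p + norm (g x) powr p) / 2)"
  using LpD(2)[OF assms(1)] LpD(2)[OF assms(2)]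
  by (intro integral_mono norm_powr_midpoint_le p_gt_1 LpD(2) Lp_scaleR Lp_add p_pos assms) auto
 also have "... = ((Np f) + (Np g)) / 2"
  using LpD(2)[OF assms(1)] LpD(2)[OF assms(2)] by simp
 finally show ?thesis .
qed

text \<open>Mazur's argument without reflexivity: along (nearly) energy-minimal convex combinations of
 the tails the gradients are Cauchy by uniform convexity, and every functional that converges
 along the sequence converges to the same limit along the combinations.\<close>

lemma W0_weak_limit_aux:
 assumes W: "!!n. W0 (u n) (g n)" and G: "!!n. (Np (g n)) <= K"
  and U: "Lp_tendsto Om p u U" and l: "La \<in> W_dual Om p" and L: "(%n. La (u n)) ----> L"
 shows "\<exists>H. W0 U H & La U = L"
proof -
 let ?E = "%h :: 'a => 'a. LINT x|M. norm (h x) powr p"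
 let ?H = "midpoint_hull u g"
 have K0: "0 <= K" using G[of 0] by (rule order_trans[rotated]) simp
 have HW: "W0 v h" if "?H N v h" for N v h
  using that
 proof (induction rule: midpoint_hull.induct)
  case (mid v h v' h')
  from W0_cmult[OF W0_add[OF mid.IH], of "1/2"] show ?case by simp
 qed (rule W)
 have HE: "?E h <= K" if "?H N v h" for N v h
  using that
 proof (induction rule: midpoint_hull.induct)
  case (mid v h v' h')
  have "?E (%x. (1/2) *R (h x + h' x)) <= (?E h + ?E h') / 2"
  by (intro integral_midpoint_le W0_Lp(2)[OF HW[OF mid.hyps(1)]] W0_Lp(2)[OF HW[OF mid.hyps(2)]])
  also have "... <= K" using add_mono[OF mid.IH] by simp
  finally show ?case .
 qed (rule G)
 have HU: "(Nd v U) <= e" if "?H N v h" "!!n. n >= N ==> (Nd (u n) U) <= e" for N v h e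
  using that
 proof (induction rule: midpoint_hull.induct)
  case (mid v h v' h')
  have "(LINT x|M. norm ((1/2) *R ((v x - U x) + (v' x - U x))) powr p) <= ((Nd v U) + (Nd v' U)) / 2"
  by (intro integral_midpoint_le Lp_diff p_pos W0_Lp(1)[OF HW[OF mid.hyps(1)]] W0_Lp(1)[OF HW[OF mid.hyps(2)]] Lp_tendstoD(2)[OF U])
  also have "... <= e" using add_mono[OF mid.IH] mid.prems by simp
  also have "(%x. (1/2) *R ((v x - U x) + (v' x - U x))) = (%x. (1/2) * (v x + v' x) - U x)" by (simp add: field_simps)
  finally show ?case .
 qed auto
 have Hl: "\<bar>La v - L\<bar> <= e" if "?H N v h" "!!n. n >= N ==> \<bar>La (u n) - L\<bar> <= e" for N v h e
  using that
 proof (induction rule: midpoint_hull.induct)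
  case (mid v h v' h')
  note v = W0_W01p[OF HW[OF mid.hyps(1)]] and v' = W0_W01p[OF HW[OF mid.hyps(2)]]
  have vv: "(%x. v x + v' x) \<in> W01p Om p" by (rule W0_W01p[OF W0_add[OF HW[OF mid.hyps(1)] HW[OF mid.hyps(2)]]])
  have "La (%x. (1/2) * (v x + v' x)) = (1/2) * La (%x. v x + v' x)" by (rule W_dualD(2)[OF l vv])
  also have "La (%x. v x + v' x) = La v + La v'" by (rule W_dualD(1)[OF l v v'])
  finally have "La (%x. (1/2) * (v x + v' x)) - L = (La v - L) / 2 + (La v' - L) / 2" by (simp add: field_simps)
  moreover have "\<bar>La v - L\<bar> <= e" "\<bar>La v' - L\<bar> <= e" using mid.IH mid.prems by blast+
  moreover have "\<bar>a\<bar> <= e" if "a = b / 2 + c / 2" "\<bar>b\<bar> <= e" "\<bar>c\<bar> <= e" for a b c :: real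
  using that by linarith
  ultimately show ?case by blast
 qed auto
 define S where "S N = {?E h | v h. ?H N v h}" for N
 have S: "S N ~= {}" "bdd_below (S N)" for N
  unfolding S_def by (auto intro!: midpoint_hull.base bdd_belowI[of _ 0])
 define I where "I N = Inf (S N)" for N
 have I_le: "I N <= ?E h" if "?H N v h" for N v h
  unfolding I_def using that by (intro cInf_lower S) (auto simp: S_def)
 have I_mono: "incseq I"
  unfolding I_def
  by (intro monoI cInf_superset_mono S) (auto simp: S_def intro: midpoint_hull_mono)
 have I_K: "I N <= K" for N using I_le[OF midpoint_hull.base[OF order_refl]] G by (rule order_trans)
 obtain I0 where I0: "I ----> I0" "!!n. I n <= I0" by (rule incseq_convergent[OF I_mono]) (use I_K in auto)
 have "\<exists>v h. ?H N v h & ?E h < I N + 1 / real (Suc N)" for N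
  using cInf_less_iff[OF S, of N "I N + 1 / real (Suc N)"] unfolding I_def[symmetric] by (auto simp: S_def)
 then obtain v where "\<forall>N. \<exists>h. ?H N (v N) h & ?E h < I N + 1 / real (Suc N)" using choice[of "%N v. \<exists>h. ?H N v h & ?E h < I N + 1 / real (Suc N)"] by blast
 then obtain h where vh: "!!N. ?H N (v N) (h N)" "!!N. ?E (h N) < I N + 1 / real (Suc N)"
  using choice[of "%N h. ?H N (v N) h & ?E h < I N + 1 / real (Suc N)"] by blast
 note hL = W0_Lp(2)[OF HW[OF vh(1)]]
 have cauchy: "\<exists>N. \<forall>m\<ge>N. \<forall>n\<ge>N. (Nd (h m) (h n)) < e" if e: "0 < e" for e
 proof -
  define et where "et = e / (4 * (K + 1))"
  have et: "0 < et" using e K0 by (simp add: et_def)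
  obtain C where C: "0 <= C" "!!x y :: 'a. norm (x - y) powr p
  <= et * (norm x powr p + norm y powr p) + C * ((norm x powr p + norm y powr p) / 2 - norm ((1/2) *R (x + y)) powr p)"
  by (rule norm_powr_uniformly_convex[OF p_gt_1 et]) (rule that)
  define e' where "e' = e / (4 * (C + 1))"
  have e': "0 < e'" "C * e' < e / 2" using e C(1) by (auto simp: e'_def field_simps add_pos_nonneg)
  have "(%N. I N + 1 / real (Suc N)) ----> I0 + 0"
  using LIMSEQ_inverse_real_of_nat by (intro tendsto_add I0) (simp add: inverse_eq_divide)
  hence "\<forall>\<^sub>F N in sequentially. I N + 1 / real (Suc N) < I0 + e' / 2"
  using e' by (intro order_tendstoD(2)) auto
  moreover have "\<forall>\<^sub>F N in sequentially. I0 - e' / 2 < I N" using I0(1) e' by (intro order_tendstoD(1)) auto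
  ultimately have "\<forall>\<^sub>F N in sequentially. I N + 1 / real (Suc N) < I0 + e' / 2 & I0 - e' / 2 < I N" by eventually_elim simp
  then obtain N where N: "!!n. n >= N ==> I n + 1 / real (Suc n) < I0 + e' / 2" "!!n. n >= N ==> I0 - e' / 2 < I n"
  by (auto simp: eventually_sequentially)
  have "(Nd (h m) (h n)) < e" if mn: "m >= N" "n >= N" for m n
  proof -
  have hull: "?H N (%x. (1/2) * (v m x + v n x)) (%x. (1/2) *R (h m x + h n x))"
  using midpoint_hull_mono[OF vh(1)] mn by (intro midpoint_hull.mid) auto
  let ?m = "%x. (1/2) *R (h m x + h n x)"
  have mL: "?m \<in> Lp Om p" by (rule W0_Lp(2)[OF HW[OF hull]])
  have ge: "I0 - e' / 2 < ?E ?m" using I_le[OF hull] N(2)[OF order_refl] by linarith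
  have "(Nd (h m) (h n)) <=
  (LINT x|M. et * (norm (h m x) powr p + norm (h n x) powr p) + C * ((norm (h m x) powr p + norm (h n x) powr p) / 2 - norm (?m x) powr p))"
  using LpD(2)[OF hL, of m] LpD(2)[OF hL, of n] LpD(2)[OF mL]
  by (intro integral_mono C(2) LpD(2)[OF Lp_diff[OF p_pos hL hL]]) auto
  also have "... = et * (?E (h m) + ?E (h n)) + C * ((?E (h m) + ?E (h n)) / 2 - ?E ?m)"
  using LpD(2)[OF hL, of m] LpD(2)[OF hL, of n] LpD(2)[OF mL] by simp
  also have "... <= et * (K + K) + C * e'"
  proof (intro add_mono mult_left_mono)
  show "?E (h m) <= K" "?E (h n) <= K" by (intro HE[OF vh(1)])+
  show "(?E (h m) + ?E (h n)) / 2 - ?E ?m <= e'"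
  using vh(2)[of m] vh(2)[of n] N(1)[OF mn(1)] N(1)[OF mn(2)] ge unfolding add_divide_distrib by linarith
  qed (use et C in auto)
  also have "... < e"
  proof -
  have "et * (K + K) <= e / 2" using K0 e by (simp add: et_def field_simps)
  thus ?thesis using e' by linarith
  qed
  finally show ?thesis .
  qed
  thus ?thesis by blast
 qed
 obtain H where H: "Lp_tendsto Om p h H" by (rule Lp_complete[OF p_pos hL cauchy])
 have vU: "Lp_tendsto Om p v U"
  unfolding Lp_tendsto_def
 proof (intro conjI allI W0_Lp(1)[OF HW[OF vh(1)]] Lp_tendstoD(2)[OF U] LIMSEQ_I)
  fix e :: real assume "e > 0"
  hence "\<forall>\<^sub>F n in sequentially. (Nd (u n) U) < e / 2"
  by (intro order_tendstoD(2)[OF Lp_tendstoD(3)[OF U]]) simp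
  then obtain N where N: "!!n. n >= N ==> (Nd (u n) U) < e / 2" by (auto simp: eventually_sequentially)
  have "(Nd (v n) U) <= e / 2" if "n >= N" for n
  by (rule HU[OF vh(1)]) (use N that in \<open>auto intro: less_imp_le\<close>)
  note le = this
  have "norm ((Nd (v n) U) - 0) < e" if "n >= N" for n
  using le[OF that] \<open>e > 0\<close> Lp_integral_nonneg[of Om "%x. v n x - U x" p] by simp
  thus "\<exists>no. \<forall>n\<ge>no. norm ((Nd (v n) U) - 0) < e" by blast
 qed
 have UH: "W0 U H" by (rule W0_closed[OF HW[OF vh(1)] vU H])
 have "(%n. La (v n)) ----> La U" by (rule W_dual_continuous[OF l HW[OF vh(1)] UH H])
 moreover have "(%n. La (v n)) ----> L"
 proof (rule LIMSEQ_I)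
  fix e :: real assume "e > 0"
  then obtain N where N: "!!n. n >= N ==> \<bar>La (u n) - L\<bar> < e / 2" using LIMSEQ_D[OF L, of "e/2"] by auto
  have "\<bar>La (v n) - L\<bar> <= e / 2" if "n >= N" for n
  by (rule Hl[OF vh(1)]) (use N that in \<open>auto intro: less_imp_le\<close>)
  thus "\<exists>no. \<forall>n\<ge>no. norm (La (v n) - L) < e" using \<open>e > 0\<close> by (intro exI[of _ N]) fastforce
 qed
 ultimately have "La U = L" by (rule LIMSEQ_unique)
 thus ?thesis using UH by blast
qed

theorem W0_weak_limit:
 assumes W: "!!n. W0 (u n) (g n)" and G: "!!n. (Np (g n)) <= K"
  and U: "Lp_tendsto Om p u U"
 shows "\<exists>H. W0 U H" "La \<in> W_dual Om p ==> (%n. La (u n)) ----> La U"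
proof -
 have z: "(%u. 0) \<in> W_dual Om p" using W_dual_fun[of "%x. 0"] by simp
 show "\<exists>H. W0 U H" using W0_weak_limit_aux[OF W G U z, of 0] by auto
 show "(%n. La (u n)) ----> La U" if l: "La \<in> W_dual Om p"
 proof (rule tendsto_subseq_subseq)
  fix s :: "nat => nat" assume s: "strict_mono s"
  obtain C where C: "0 <= C" "!!u g. W0 u g ==> \<bar>La u\<bar> <= C * (Np g) powr (1/p)"
  by (rule W_dual_bound[OF l]) (rule that)
  have "\<bar>La (u (s n))\<bar> <= C * K powr (1/p)" for n
  by (rule order_trans[OF C(2)[OF W]]) (use C(1) G p_pos in \<open>auto intro!: mult_left_mono powr_mono2\<close>)
  hence "\<exists>K. \<forall>n. \<bar>(%_::unit. %n. La (u (s n))) j n\<bar> <= K" for j by blast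
  from bounded_real_diagonal[of "%_::unit. %n. La (u (s n))", OF this]
  obtain r where r: "strict_mono r" "convergent (%n. La (u (s (r n))))" by metis
  then obtain L where L: "(%n. La (u (s (r n)))) ----> L" by (auto simp: convergent_def)
  have "\<exists>H. W0 U H & La U = L"
  by (rule W0_weak_limit_aux[OF W G Lp_tendsto_subseq[OF Lp_tendsto_subseq[OF U s] r(1)] l L])
  thus "\<exists>r. strict_mono r & (%n. La (u (s (r n)))) ----> La U" using r(1) L by blast
 qed
qed

end

section \<open>Coefficients\<close>

text \<open>The consequences of the structure conditions that survive passage to the G-limit: each
 bounds a convex expression in one or two vectors by a linear combination of the products
 \<open>B xi \<bullet> xi\<close>, \<open>B xi \<bullet> ze\<close>, \<open>B ze \<bullet> xi\<close>, \<open>B ze \<bullet> ze\<close>, which are weakly continuous along solutions.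
 The last two conjuncts say that \<open>p B\<close> is a subgradient of \<open>xi \<mapsto> B xi \<bullet> xi\<close> and that this function is
 even; uniform convexity is expressed by the sequence \<open>om\<close> of constants.\<close>

definition admissible_field :: "real => real => real => (nat => real) => ('a::euclidean_space => 'a) => bool" where
 "admissible_field p al ka om B \<longleftrightarrow> continuous_on UNIV B &
  (\<forall>xi. al * norm xi powr p <= B xi \<bullet> xi) &
  (\<forall>xi. norm (B xi) powr conj_exp p <= ka * (B xi \<bullet> xi)) &
  (\<forall>n xi ze. norm (xi - ze) powr p <= (1 / real (Suc n)) * (B xi \<bullet> xi + B ze \<bullet> ze) + om n * ((B xi - B ze) \<bullet> (xi - ze))) &
  (\<forall>xi ze. B xi \<bullet> xi + p * (B xi \<bullet> (ze - xi)) <= B ze \<bullet> ze) &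
  (\<forall>xi ze. B xi \<bullet> xi - p * (B xi \<bullet> (ze + xi)) <= B ze \<bullet> ze)"

locale admissible_vector_field =
 fixes p al ka :: real and om :: "nat => real" and B :: "'a::euclidean_space => 'a"
 assumes p_1: "1 < p" and al: "0 < al" and ka: "0 < ka" and om: "!!n. 0 <= om n" and B: "admissible_field p al ka om B"
begin

lemma cont: "continuous_on UNIV B"
 and coercive: "al * norm xi powr p <= B xi \<bullet> xi"
 and growth_q: "norm (B xi) powr conj_exp p <= ka * (B xi \<bullet> xi)"
 and unif: "norm (xi - ze) powr p <= (1 / real (Suc n)) * (B xi \<bullet> xi + B ze \<bullet> ze) + om n * ((B xi - B ze) \<bullet> (xi - ze))"
 and subgrad: "B xi \<bullet> xi + p * (B xi \<bullet> (ze - xi)) <= B ze \<bullet> ze"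
 and subgrad_odd: "B xi \<bullet> xi - p * (B xi \<bullet> (ze + xi)) <= B ze \<bullet> ze"
 using B unfolding admissible_field_def by blast+

lemma energy_nonneg: "0 <= B xi \<bullet> xi"
 using coercive[of xi] al by (meson less_imp_le mult_nonneg_nonneg order_trans powr_ge_zero)

lemma growth: "norm (B xi) <= (ka * norm xi) powr (p - 1)"
proof (cases "B xi = 0")
 case False
 let ?q = "conj_exp p"
 have "norm (B xi) powr ?q <= ka * (norm (B xi) * norm xi)"
  using growth_q[of xi] mult_left_mono[OF norm_cauchy_schwarz[of "B xi" xi], of ka] ka by linarith
 moreover have "norm (B xi) powr ?q = norm (B xi) powr (?q - 1) * norm (B xi)"
  using powr_mult_base[of "norm (B xi)" "?q - 1"] by (simp add: mult.commute)
 ultimately have "norm (B xi) powr (?q - 1) * norm (B xi) <= (ka * norm xi) * norm (B xi)" by (simp add: mult_ac)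
 hence "norm (B xi) powr (?q - 1) <= ka * norm xi" using False by (simp add: mult_le_cancel_right)
 hence "(norm (B xi) powr (?q - 1)) powr (p - 1) <= (ka * norm xi) powr (p - 1)" using p_1 by (intro powr_mono2) auto
 moreover have "(?q - 1) * (p - 1) = 1" using p_1 by (simp add: conj_exp_def field_simps)
 ultimately show ?thesis by (simp add: powr_powr)
qed simp

lemma energy_le: "B xi \<bullet> xi <= ka powr (p - 1) * norm xi powr p"
proof -
 have "B xi \<bullet> xi <= norm (B xi) * norm xi" by (rule norm_cauchy_schwarz)
 also have "... <= (ka * norm xi) powr (p - 1) * norm xi" by (intro mult_right_mono growth) auto
 also have "... = ka powr (p - 1) * norm xi powr p"
  using powr_mult_base[of "norm xi" "p - 1"] by (simp add: powr_mult mult_ac)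
 finally show ?thesis .
qed

lemma zero: "B 0 = 0"
 using growth[of 0] by simp

lemma energy_convex:
 assumes "0 <= t" "t <= 1"
 shows "B ((1 - t) *R xi + t *R ze) \<bullet> ((1 - t) *R xi + t *R ze) <= (1 - t) * (B xi \<bullet> xi) + t * (B ze \<bullet> ze)"
proof -
 define m where "m = (1 - t) *R xi + t *R ze"
 have z: "(1 - t) *R (xi - m) + t *R (ze - m) = 0" unfolding m_def by (simp add: algebra_simps)
 have "(1 - t) * (B m \<bullet> m + p * (B m \<bullet> (xi - m))) + t * (B m \<bullet> m + p * (B m \<bullet> (ze - m))) <= (1 - t) * (B xi \<bullet> xi) + t * (B ze \<bullet> ze)"
  using assms by (intro add_mono mult_left_mono subgrad) auto
 also have "(1 - t) * (B m \<bullet> m + p * (B m \<bullet> (xi - m))) + t * (B m \<bullet> m + p * (B m \<bullet> (ze - m)))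
  = B m \<bullet> m + p * (B m \<bullet> ((1 - t) *R (xi - m) + t *R (ze - m)))"
  by (simp add: inner_add_right distrib_left left_diff_distrib algebra_simps)
 finally show ?thesis unfolding z by (simp add: m_def)
qed

text \<open>Subgradients at the midpoint and at the two quarter points.\<close>

lemma midpoint_gap:
 "norm (xi - ze) powr p <= 2 powr p * ((1 / real (Suc n)) * (B xi \<bullet> xi + B ze \<bullet> ze) +
  om n * (4 / p) * ((B xi \<bullet> xi + B ze \<bullet> ze) / 2 - B ((1/2) *R (xi + ze)) \<bullet> ((1/2) *R (xi + ze))))"
proof -
 define m where "m = (1/2) *R (xi + ze)"
 define k where "k = (3/4) *R xi + (1/4) *R ze"
 define l where "l = (1/4) *R xi + (3/4) *R ze"
 define d where "d = (1/4) *R (xi - ze)"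
 have half: "(1/4) *R x + (1/4) *R x = (1/2) *R x" "(1/4) *R x + (3/4) *R x = x" "(1/4) *R x + (1/2) *R x = (3/4) *R x" for x :: 'a
  unfolding scaleR_left_distrib[symmetric] by simp_all
 have diffs: "xi - k = d" "k - m = d" "ze - l = - d" "l - m = - d" "k - l = (1/2) *R (xi - ze)"
  unfolding k_def l_def m_def d_def by (simp_all add: algebra_simps half scaleR_left_distrib[symmetric] scaleR_left_diff_distrib[symmetric])
  (simp_all add: add.assoc[symmetric] scaleR_left_distrib[symmetric] scaleR_left_diff_distrib[symmetric])
 have kl: "k - l = 2 *R d" unfolding diffs d_def by simp
 have s: "B k \<bullet> k + p * (B k \<bullet> d) <= B xi \<bullet> xi" "B m \<bullet> m + p * (B m \<bullet> d) <= B k \<bullet> k"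
  "B l \<bullet> l - p * (B l \<bullet> d) <= B ze \<bullet> ze" "B m \<bullet> m - p * (B m \<bullet> d) <= B l \<bullet> l"
  using subgrad[of k xi] subgrad[of m k] subgrad[of l ze] subgrad[of m l] unfolding diffs by simp_all
 have gap: "(B k - B l) \<bullet> (k - l) <= (4 / p) * ((B xi \<bullet> xi + B ze \<bullet> ze) / 2 - B m \<bullet> m)"
 proof -
  have "p * (B k \<bullet> d) - p * (B l \<bullet> d) <= B xi \<bullet> xi + B ze \<bullet> ze - 2 * (B m \<bullet> m)" using s by linarith
  hence "2 * (B k \<bullet> d - B l \<bullet> d) <= (2 / p) * (B xi \<bullet> xi + B ze \<bullet> ze - 2 * (B m \<bullet> m))"
  using p_1 by (simp add: field_simps)
  moreover have "(B k - B l) \<bullet> (k - l) = 2 * (B k \<bullet> d - B l \<bullet> d)" unfolding kl by (simp add: inner_diff_left)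
  moreover have "(4 / p) * ((B xi \<bullet> xi + B ze \<bullet> ze) / 2 - B m \<bullet> m) = (2 / p) * (B xi \<bullet> xi + B ze \<bullet> ze - 2 * (B m \<bullet> m))"
  using p_1 by (simp add: field_simps)
  ultimately show ?thesis by (simp only:)
 qed
 have "B k \<bullet> k <= (3/4) * (B xi \<bullet> xi) + (1/4) * (B ze \<bullet> ze)" "B l \<bullet> l <= (1/4) * (B xi \<bullet> xi) + (3/4) * (B ze \<bullet> ze)"
  using energy_convex[of "1/4" xi ze] energy_convex[of "3/4" xi ze] by (simp_all add: k_def l_def)
 hence kl_le: "B k \<bullet> k + B l \<bullet> l <= B xi \<bullet> xi + B ze \<bullet> ze" by linarith
 have "xi - ze = 2 *R (k - l)" unfolding diffs by simp
 hence "norm (xi - ze) powr p = 2 powr p * norm (k - l) powr p" by (simp add: powr_mult)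
 also have "... <= 2 powr p * ((1 / real (Suc n)) * (B k \<bullet> k + B l \<bullet> l) + om n * ((B k - B l) \<bullet> (k - l)))"
  by (intro mult_left_mono unif) auto
 also have "... <= 2 powr p * ((1 / real (Suc n)) * (B xi \<bullet> xi + B ze \<bullet> ze) + om n * ((4 / p) * ((B xi \<bullet> xi + B ze \<bullet> ze) / 2 - B m \<bullet> m)))"
  by (intro mult_left_mono add_mono gap kl_le om) auto
 finally show ?thesis unfolding m_def by (simp only: mult.assoc)
qed

text \<open>Subgradients at two nearby points bound the increment from both sides, and \<open>B\<close> is continuous.\<close>

lemma energy_gderiv: "GDERIV (%xi. B xi \<bullet> xi) xi :> p *R B xi"
 unfolding gderiv_def
proof (rule has_derivativeI)
 show "bounded_linear (%h. h \<bullet> (p *R B xi))" by (rule bounded_linear_inner_left)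
 have "((%y. p * norm (B y - B xi)) \<longlongrightarrow> p * norm (B xi - B xi)) (at xi)"
  using cont by (intro tendsto_intros) (auto simp: continuous_on_eq_continuous_at isCont_def)
 hence lim: "((%y. p * norm (B y - B xi)) \<longlongrightarrow> 0) (at xi)" by simp
 show "((%y. ((B y \<bullet> y - B xi \<bullet> xi) - (y - xi) \<bullet> (p *R B xi)) /\<^sub>R norm (y - xi)) \<longlongrightarrow> 0) (at xi)"
 proof (rule Lim_null_comparison[OF always_eventually[OF allI] lim])
  fix y
  let ?r = "(B y \<bullet> y - B xi \<bullet> xi) - (y - xi) \<bullet> (p *R B xi)"
  have "0 <= ?r" using subgrad[of xi y] by (simp add: inner_commute)
  moreover have "?r <= p * ((B y - B xi) \<bullet> (y - xi))"
  proof -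
  have "B y \<bullet> (xi - y) = - (B y \<bullet> (y - xi))" by (metis inner_minus_right minus_diff_eq)
  hence "p * (B y \<bullet> (xi - y)) = - (p * (B y \<bullet> (y - xi)))" by (simp only: mult_minus_right)
  moreover have "(y - xi) \<bullet> (p *R B xi) = p * (B xi \<bullet> (y - xi))" by (simp only: inner_scaleR_right inner_commute)
  moreover have "p * ((B y - B xi) \<bullet> (y - xi)) = p * (B y \<bullet> (y - xi)) - p * (B xi \<bullet> (y - xi))"
  by (simp only: inner_diff_left right_diff_distrib)
  ultimately show ?thesis using subgrad[of y xi] by linarith
  qed
  moreover have "(B y - B xi) \<bullet> (y - xi) <= norm (B y - B xi) * norm (y - xi)" by (rule norm_cauchy_schwarz)
  ultimately have "\<bar>?r\<bar> <= p * norm (B y - B xi) * norm (y - xi)"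
  using p_1 by (smt (verit) mult.assoc mult_left_mono)
  hence "\<bar>?r\<bar> / norm (y - xi) <= p * norm (B y - B xi)"
  using p_1 by (cases "y = xi") (auto simp: divide_le_eq)
  thus "norm (?r /\<^sub>R norm (y - xi)) <= p * norm (B y - B xi)" by (simp add: divide_inverse abs_mult mult.commute)
 qed
qed

text \<open>By the derivative formula, \<open>ph(t) = B (t xi) \<bullet> t xi\<close> solves \<open>t ph' = p ph\<close>.\<close>

lemma energy_homogeneous:
 assumes t: "0 < t"
 shows "B (t *R xi) \<bullet> (t *R xi) = t powr p * (B xi \<bullet> xi)"
proof -
 define ph where "ph s = B (s *R xi) \<bullet> (s *R xi)" for s
 have dph: "(ph has_real_derivative p * (B (s *R xi) \<bullet> xi)) (at s)" for s
 proof -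
  have "((%s. s *R xi) has_derivative (%h. h *R xi)) (at s)" by (auto intro!: derivative_eq_intros)
  from has_derivative_compose[OF this energy_gderiv[unfolded gderiv_def]]
  show ?thesis unfolding ph_def has_field_derivative_def
  by (rule has_derivative_eq_rhs) (auto simp: inner_commute fun_eq_iff)
 qed
 have "\<exists>c. \<forall>s\<in>{0<..}. ph s * s powr (- p) = c"
 proof (rule has_field_derivative_zero_constant)
  fix s :: real assume s: "s \<in> {0<..}"
  have e: "p * (B (s *R xi) \<bullet> xi) * s powr (- p) + ((- p) * s powr (- p - 1)) * ph s = 0"
  proof -
  have "s powr (- p) = s powr (- p - 1) * s" using s powr_mult_base[of s "- p - 1"] by (simp add: mult.commute)
  thus ?thesis by (simp add: ph_def mult_ac)
  qed
  have "((%s. ph s * s powr (- p)) has_real_derivative p * (B (s *R xi) \<bullet> xi) * s powr (- p) + ((- p) * s powr (- p - 1)) * ph s) (at s)"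
  using s by (intro DERIV_mult' DERIV_cong[OF DERIV_mult[OF dph has_real_derivative_powr]]) auto
  thus "((%s. ph s * s powr (- p)) has_real_derivative 0) (at s within {0<..})"
  unfolding e by (rule has_field_derivative_at_within)
 qed simp
 then obtain c where c: "!!s. s > 0 ==> ph s * s powr (- p) = c" by auto
 have "ph t * t powr (- p) = ph 1" using c[OF t] c[of 1] by simp
 hence "ph t = t powr p * ph 1" using t by (simp add: powr_minus field_simps)
 thus ?thesis by (simp add: ph_def)
qed

lemma energy_even: "B (- xi) \<bullet> (- xi) = B xi \<bullet> xi"
 using subgrad_odd[of xi "- xi"] subgrad_odd[of "- xi" xi] by simp

lemma energy_scaleR: "B (t *R xi) \<bullet> (t *R xi) = \<bar>t\<bar> powr p * (B xi \<bullet> xi)"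
proof -
 consider "t > 0" | "t = 0" | "t < 0" by linarith
 thus ?thesis
 proof cases
  case 1 thus ?thesis using energy_homogeneous[of t xi] by simp
 next
  case 2 thus ?thesis by (simp add: zero)
 next
  case 3
  have "B (t *R xi) \<bullet> (t *R xi) = B (- (t *R xi)) \<bullet> (- (t *R xi))" by (rule energy_even[symmetric])
  also have "- (t *R xi) = (- t) *R xi" by simp
  finally show ?thesis using energy_homogeneous[of "- t" xi] 3 by simp
 qed
qed

text \<open>If the product vanished, letting \<open>n\<close> grow in the uniform convexity inequality would give \<open>xi = ze\<close>.\<close>

lemma strictly_monotone:
 assumes "xi ~= ze" shows "0 < (B xi - B ze) \<bullet> (xi - ze)"
proof (rule ccontr)
 assume neg: "\<not> ?thesis"
 have "norm (xi - ze) powr p <= (1 / real (Suc n)) * (B xi \<bullet> xi + B ze \<bullet> ze)" for n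
  using unif[of xi ze n] mult_nonneg_nonpos[OF om[of n]] neg by (meson add_le_same_cancel1 not_le order_trans)
 moreover have "(%n. (1 / real (Suc n)) * (B xi \<bullet> xi + B ze \<bullet> ze)) ----> 0 * (B xi \<bullet> xi + B ze \<bullet> ze)"
  using LIMSEQ_inverse_real_of_nat by (intro tendsto_mult tendsto_const) (simp add: inverse_eq_divide)
 ultimately have "norm (xi - ze) powr p <= 0" by (intro LIMSEQ_le_const) auto
 thus False using assms by simp
qed

lemma energy_strictly_convex:
 assumes "xi ~= ze" "0 < t" "t < 1"
 shows "B ((1 - t) *R xi + t *R ze) \<bullet> ((1 - t) *R xi + t *R ze) < (1 - t) * (B xi \<bullet> xi) + t * (B ze \<bullet> ze)"
proof -
 define m where "m = (1 - t) *R xi + t *R ze"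
 have z: "(1 - t) *R (xi - m) + t *R (ze - m) = 0" unfolding m_def by (simp add: algebra_simps)
 have xm: "xi - m = t *R (xi - ze)" unfolding m_def by (simp add: algebra_simps)
 hence "xi ~= m" using assms by auto
 have strict: "B m \<bullet> m + p * (B m \<bullet> (xi - m)) < B xi \<bullet> xi"
 proof -
  define k where "k = (1/2) *R (xi + m)"
  have k: "xi - k = (1/2) *R (xi - m)" "k - m = (1/2) *R (xi - m)"
  unfolding k_def by (simp_all add: algebra_simps scaleR_left_distrib[symmetric] scaleR_2[symmetric] flip: scaleR_scaleR)
  (simp_all add: scaleR_left_distrib[symmetric] add.assoc[symmetric])
  have "k ~= m" using k(2) \<open>xi ~= m\<close> by auto
  from strictly_monotone[OF this] have "0 < p * ((B k - B m) \<bullet> ((1/2) *R (xi - m)))" using p_1 unfolding k by simp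
  moreover have "B k \<bullet> k + p * (B k \<bullet> ((1/2) *R (xi - m))) <= B xi \<bullet> xi" "B m \<bullet> m + p * (B m \<bullet> ((1/2) *R (xi - m))) <= B k \<bullet> k"
  using subgrad[of k xi] subgrad[of m k] unfolding k by simp_all
  ultimately show ?thesis by (simp add: inner_diff_left algebra_simps)
 qed
 have "(1 - t) * (B m \<bullet> m + p * (B m \<bullet> (xi - m))) + t * (B m \<bullet> m + p * (B m \<bullet> (ze - m))) < (1 - t) * (B xi \<bullet> xi) + t * (B ze \<bullet> ze)"
  using assms by (intro add_less_le_mono mult_strict_left_mono strict mult_left_mono subgrad) auto
 also have "(1 - t) * (B m \<bullet> m + p * (B m \<bullet> (xi - m))) + t * (B m \<bullet> m + p * (B m \<bullet> (ze - m)))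
  = B m \<bullet> m + p * (B m \<bullet> ((1 - t) *R (xi - m) + t *R (ze - m)))"
  by (simp add: inner_add_right distrib_left left_diff_distrib algebra_simps)
 finally show ?thesis unfolding z by (simp add: m_def)
qed

end

definition admissible :: "'a::euclidean_space set => real => real => real => (nat => real) => ('a => 'a => 'a) => bool" where
 "admissible Om p al ka om b \<longleftrightarrow> (\<forall>xi. (%x. b x xi) \<in> borel_measurable (leb Om)) &
  (AE x in leb Om. admissible_vector_field p al ka om (b x))"

lemma borel_measurable_lebesgue_on_AE:
 fixes f g :: "'a::euclidean_space => 'b::euclidean_space"
 assumes "Om \<in> sets lebesgue" "f \<in> borel_measurable (leb Om)" "AE x in leb Om. f x = g x"
 shows "g \<in> borel_measurable (leb Om)"
proof -
 have "(%x. if x \<in> Om then f x else 0) \<in> borel_measurable lebesgue"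
  using assms(1,2) by (simp add: borel_measurable_if)
 moreover have "AE x in lebesgue. (if x \<in> Om then f x else 0) = (if x \<in> Om then g x else 0)"
  using assms(3) assms(1) by (simp add: AE_restrict_space_iff)
 ultimately have "(%x. if x \<in> Om then g x else 0) \<in> borel_measurable lebesgue" by (rule borel_measurable_AE)
 thus ?thesis using assms(1) by (simp add: borel_measurable_if)
qed

text \<open>Approximate \<open>g\<close> by simple functions and use continuity in the second variable at almost every point.\<close>

lemma caratheodory_measurable:
 fixes b :: "'a::euclidean_space => 'a => 'b::euclidean_space"
 assumes Om: "Om \<in> sets lebesgue" and m: "!!xi. (%x. b x xi) \<in> borel_measurable (leb Om)"
  and c: "AE x in leb Om. continuous_on UNIV (b x)" and g: "g \<in> borel_measurable (leb Om)"
 shows "(%x. b x (g x)) \<in> borel_measurable (leb Om)"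
proof -
 let ?M = "leb Om"
 obtain F where F: "!!i. simple_function ?M (F i)" "!!x. x \<in> space ?M ==> (%i. F i x) ----> g x"
  using borel_measurable_implies_sequence_metric[OF g, of 0] by blast
 have bF: "(%x. b x (F i x)) \<in> borel_measurable ?M" for i
 proof (rule measurable_compose_countable'[where I = "F i ` space ?M" and f = "%xi x. b x xi"])
  show "F i \<in> ?M \<rightarrow>\<^sub>M count_space (F i ` space ?M)"
  using F(1)[of i] by (subst measurable_count_space_eq2) (auto simp: simple_function_def)
  show "countable (F i ` space ?M)" using F(1)[of i] by (auto simp: simple_function_def intro: countable_finite)
 qed (rule m)
 define G where "G x = lim (%i. b x (F i x))" for x
 have "G \<in> borel_measurable ?M" unfolding G_def using bF by (intro borel_measurable_lim_metric)
 moreover have "AE x in ?M. G x = b x (g x)"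
  using c AE_space
 proof eventually_elim
  case (elim x)
  have "(%i. b x (F i x)) ----> b x (g x)"
  using elim F(2)[of x] by (auto simp: continuous_on_eq_continuous_at intro: isCont_tendsto_compose)
  thus ?case unfolding G_def by (rule limI)
 qed
 ultimately show ?thesis by (rule borel_measurable_lebesgue_on_AE[OF Om])
qed

context bounded_domain
begin

lemma admissible_measurable:
 assumes "admissible Om p al ka om b" "g \<in> borel_measurable M"
 shows "(%x. b x (g x)) \<in> borel_measurable M"
 by (rule caratheodory_measurable[OF dom_sets _ _ assms(2)])
  (use assms(1) in \<open>auto simp: admissible_def elim!: eventually_mono intro: admissible_vector_field.cont\<close>)

lemma admissible_AE: "admissible Om p al ka om b ==> AE x in M. admissible_vector_field p al ka om (b x)"
 by (simp add: admissible_def)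

definition energy :: "('a => 'a => 'a) => ('a => 'a) => real" where
 "energy b g = (LINT x|M. b x (g x) \<bullet> g x)"

lemma admissible_Lp:
 assumes adm: "admissible Om p al ka om b" and g: "g \<in> Lp Om p"
 shows "(%x. b x (g x)) \<in> Lp Om q" "integrable M (%x. b x (g x) \<bullet> g x)"
proof -
 have m: "(%x. b x (g x)) \<in> borel_measurable M" by (rule admissible_measurable[OF adm LpD(1)[OF g]])
 show L: "(%x. b x (g x)) \<in> Lp Om q"
 proof (rule Lp_dominated[OF m])
  show "integrable M (%x. ka * (ka powr (p - 1) * norm (g x) powr p))" using LpD(2)[OF g] by simp
  show "AE x in M. norm (b x (g x)) powr q <= ka * (ka powr (p - 1) * norm (g x) powr p)"
  using admissible_AE[OF adm]
  proof eventually_elim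
  case (elim x)
  interpret admissible_vector_field p al ka om "b x" by (rule elim)
  show ?case using growth_q[of "g x"] mult_left_mono[OF energy_le[of "g x"], of ka] ka by linarith
  qed
 qed
 show "integrable M (%x. b x (g x) \<bullet> g x)" by (rule Lp_inner_integrable[OF p_gt_1 L g])
qed

lemma energy_bounds:
 assumes adm: "admissible Om p al ka om b" and g: "g \<in> Lp Om p"
 shows "al * (Np g) <= energy b g" "energy b g <= ka powr (p - 1) * (Np g)"
  "(LINT x|M. norm (b x (g x)) powr q) <= ka * energy b g"
proof -
 note L = admissible_Lp[OF adm g]
 have "(LINT x|M. al * norm (g x) powr p) <= energy b g" unfolding energy_def
  by (intro integral_mono_AE L integrable_mult_right LpD(2)[OF g])
  (rule eventually_mono[OF admissible_AE[OF adm]], erule admissible_vector_field.coercive)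
 thus "al * (Np g) <= energy b g" by simp
 have "energy b g <= (LINT x|M. ka powr (p - 1) * norm (g x) powr p)" unfolding energy_def
  by (intro integral_mono_AE L integrable_mult_right LpD(2)[OF g])
  (rule eventually_mono[OF admissible_AE[OF adm]], erule admissible_vector_field.energy_le)
 thus "energy b g <= ka powr (p - 1) * (Np g)" by simp
 have "(LINT x|M. norm (b x (g x)) powr q) <= (LINT x|M. ka * (b x (g x) \<bullet> g x))"
  by (intro integral_mono_AE LpD(2) L integrable_mult_right)
  (rule eventually_mono[OF admissible_AE[OF adm]], erule admissible_vector_field.growth_q)
 thus "(LINT x|M. norm (b x (g x)) powr q) <= ka * energy b g" by (simp add: energy_def)
qed

lemma energy_tendsto:
 assumes adm: "admissible Om p al ka om b" and g: "Lp_tendsto Om p g G"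
 shows "(%n. energy b (g n)) ----> energy b G"
proof (rule tendsto_subseq_subseq)
 fix s :: "nat => nat" assume s: "strict_mono s"
 obtain r D where r: "strict_mono r" and D: "integrable M D" "AE x in M. (%k. g (s (r k)) x) ----> G x"
  "AE x in M. \<forall>k. norm (g (s (r k)) x) powr p <= D x"
  by (rule Lp_tendsto_dominated_subseq[OF p_pos Lp_tendsto_subseq[OF g s]])
 have "(%n. energy b (g (s (r n)))) ----> energy b G"
  unfolding energy_def
 proof (rule integral_dominated_convergence[where w = "%x. ka powr (p - 1) * D x"])
  show "(%x. b x (G x) \<bullet> G x) \<in> borel_measurable M" "(%x. b x (g (s (r n)) x) \<bullet> g (s (r n)) x) \<in> borel_measurable M" for n
  using admissible_Lp(2)[OF adm Lp_tendstoD(2)[OF g]] admissible_Lp(2)[OF adm Lp_tendstoD(1)[OF g]] by auto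
  show "AE x in M. (%n. b x (g (s (r n)) x) \<bullet> g (s (r n)) x) ----> b x (G x) \<bullet> G x"
  using D(2) admissible_AE[OF adm]
  proof eventually_elim
  case (elim x)
  have "isCont (b x) (G x)" using admissible_vector_field.cont[OF elim(2)] by (simp add: continuous_on_eq_continuous_at)
  from tendsto_inner[OF isCont_tendsto_compose[OF this elim(1)] elim(1)] show ?case .
  qed
  show "AE x in M. norm (b x (g (s (r n)) x) \<bullet> g (s (r n)) x) <= ka powr (p - 1) * D x" for n
  using D(3) admissible_AE[OF adm]
  proof eventually_elim
  case (elim x)
  interpret admissible_vector_field p al ka om "b x" by (rule elim)
  show ?case using energy_nonneg[of "g (s (r n)) x"] energy_le[of "g (s (r n)) x"] mult_left_mono[OF spec[OF elim(1), of n], of "ka powr (p - 1)"] by simp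
  qed
 qed (use D(1) in simp)
 thus "\<exists>r. strict_mono r & (%n. energy b (g (s (r n)))) ----> energy b G" using r by blast
qed

text \<open>The potential is the energy density \<open>b x xi \<bullet> xi\<close> itself.\<close>

theorem admissible_potential:
 assumes adm: "admissible Om p al ka om b"
 shows "is_potential Om p b (%x xi. b x xi \<bullet> xi)"
 unfolding is_potential_def caratheodory_def
proof (intro conjI allI)
 note ae = admissible_AE[OF adm]
 show "(%x. b x xi \<bullet> xi) \<in> borel_measurable M" for xi
 proof -
  have "(%x. b x xi) \<in> borel_measurable M" using adm by (simp add: admissible_def)
  thus ?thesis by measurable
 qed
 show "AE x in M. continuous_on UNIV (%xi. b x xi \<bullet> xi)" using ae
  by eventually_elim (intro continuous_intros admissible_vector_field.cont)
 show "AE x in M. \<forall>xi. b x (- xi) \<bullet> (- xi) = b x xi \<bullet> xi" using ae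
  by eventually_elim (intro allI admissible_vector_field.energy_even)
 show "AE x in M. \<forall>xi. \<forall>t>0. b x (t *R xi) \<bullet> (t *R xi) = t powr p * (b x xi \<bullet> xi)" using ae
  by eventually_elim (intro allI impI admissible_vector_field.energy_homogeneous)
 show "AE x in M. \<forall>xi et. \<forall>t. xi ~= et & 0 < t & t < 1 -->
  b x ((1 - t) *R xi + t *R et) \<bullet> ((1 - t) *R xi + t *R et) < (1 - t) * (b x xi \<bullet> xi) + t * (b x et \<bullet> et)" using ae
  by eventually_elim (intro allI impI, elim conjE, rule admissible_vector_field.energy_strictly_convex)
 show "AE x in M. \<forall>xi. GDERIV (%xi. b x xi \<bullet> xi) xi :> p *R b x xi" using ae
  by eventually_elim (intro allI admissible_vector_field.energy_gderiv)
 show "AE x in M. b x 0 \<bullet> 0 = 0" by simp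
 have "AE x in M. 0 < al & 0 < ka" using ae by eventually_elim (auto simp: admissible_vector_field_def)
 show "\<exists>al>0. \<exists>bt>0. AE x in M. \<forall>xi. al * norm xi powr p <= b x xi \<bullet> xi & b x xi \<bullet> xi <= bt * norm xi powr p"
 proof (cases "0 < al & 0 < ka")
  case True
  thus ?thesis using ae
  by (intro exI[of _ al] conjI exI[of _ "ka powr (p - 1)"])
  (auto elim!: eventually_mono intro: admissible_vector_field.coercive admissible_vector_field.energy_le)
 next
  case False
  hence "AE x in M. False" using \<open>AE x in M. 0 < al & 0 < ka\<close> by (auto elim: eventually_mono)
  thus ?thesis by (intro exI[of _ 1] conjI) (auto elim: eventually_mono)
 qed
qed

text \<open>Euler's identity for a homogeneous function determines it from its gradient.\<close>

lemma potential_AE: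
 assumes adm: "admissible Om p al ka om b"
 shows "AE x in M. \<forall>xi. potential Om p b x xi = b x xi \<bullet> xi"
proof -
 have P: "is_potential Om p b (potential Om p b)"
  unfolding potential_def by (rule someI[of "is_potential Om p b", OF admissible_potential[OF adm]])
 hence "AE x in M. \<forall>xi. \<forall>t>0. potential Om p b x (t *R xi) = t powr p * potential Om p b x xi"
  "AE x in M. \<forall>xi. GDERIV (potential Om p b x) xi :> p *R b x xi" by (auto simp: is_potential_def)
 thus ?thesis
 proof eventually_elim
  case (elim x)
  show ?case
  proof
  fix xi :: 'a
  let ?Ph = "potential Om p b x"
  have "((%t. t *R xi) has_derivative (%h. h *R xi)) (at 1)" by (auto intro!: derivative_eq_intros)
  moreover have "(?Ph has_derivative (%h. h \<bullet> (p *R b x xi))) (at (1 *R xi))" using elim(2) by (simp add: gderiv_def)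
  ultimately have "((%t. ?Ph (t *R xi)) has_derivative (%h. (h *R xi) \<bullet> (p *R b x xi))) (at 1)"
  by (rule has_derivative_compose)
  hence 1: "((%t. ?Ph (t *R xi)) has_real_derivative p * (b x xi \<bullet> xi)) (at 1)"
  unfolding has_field_derivative_def by (rule has_derivative_eq_rhs) (auto simp: inner_commute fun_eq_iff)
  have "((%t. t powr p * ?Ph xi) has_real_derivative (p * 1 powr (p - 1)) * ?Ph xi) (at 1)"
  by (intro DERIV_cmult_right has_real_derivative_powr) simp
  hence "((%t. ?Ph (t *R xi)) has_real_derivative (p * 1 powr (p - 1)) * ?Ph xi) (at 1)"
  by (rule has_field_derivative_transform_within_open[of _ _ _ "{0<..}"]) (use elim(1) in auto)
  from DERIV_unique[OF 1 this] show "?Ph xi = b x xi \<bullet> xi" using p_pos by simp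
  qed
 qed
qed

lemma energy_potential:
 assumes adm: "admissible Om p al ka om b" and W: "W0 u g"
 shows "(LINT x|M. potential Om p b x (\<nabla> u x)) = energy b g"
proof -
 have eq: "AE x in M. potential Om p b x (\<nabla> u x) = b x (g x) \<bullet> g x"
  using potential_AE[OF adm] W0_wgrad_AE[OF W] by eventually_elim simp
 have m: "(%x. b x (g x) \<bullet> g x) \<in> borel_measurable M" using admissible_Lp(2)[OF adm W0_Lp(2)[OF W]] by auto
 have "(%x. potential Om p b x (\<nabla> u x)) \<in> borel_measurable M"
  by (rule borel_measurable_lebesgue_on_AE[OF dom_sets m]) (use eq in \<open>eventually_elim, simp\<close>)
 from integral_cong_AE[OF this m eq] show ?thesis unfolding energy_def .
qed

end

subsection \<open>The structure conditions imply admissibility\<close>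

lemma powr_sum_bounds:
 assumes p: "1 < p"
 shows "p * (\<Sum>i<n. real i powr (p - 1)) <= real n powr p" "real n powr p <= p * (\<Sum>i<n. real (Suc i) powr (p - 1))"
proof -
 have tan: "x powr p + p * (x powr (p - 1) * (y - x)) <= y powr p" if "0 <= x" "0 <= y" for x y :: real
 proof -
  have "x powr (p - 2) * x = x powr (p - 1)"
  using that powr_mult_base[of x "p - 2"] by (simp add: mult.commute)
  thus ?thesis using norm_powr_tangent[OF p, of x y] that by (simp add: mult.assoc[symmetric])
 qed
 show "p * (\<Sum>i<n. real i powr (p - 1)) <= real n powr p"
 proof (induction n)
  case (Suc n)
  show ?case using tan[of "real n" "real (Suc n)"] Suc by (simp add: distrib_left)
 qed simp
 show "real n powr p <= p * (\<Sum>i<n. real (Suc i) powr (p - 1))"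
 proof (induction n)
  case (Suc n)
  show ?case using tan[of "real (Suc n)" "real n"] Suc by (simp add: distrib_left)
 qed simp
qed

lemma sum_lessThan_add: fixes m k :: nat shows "(\<Sum>i<m + k. f i) = (\<Sum>i<m. f i) + (\<Sum>j<k. f (m + j) :: real)"
 by (induction k) (simp_all add: add.assoc)

text \<open>Cyclic monotonicity along the polygon from \<open>0\<close> to \<open>xi\<close>, to \<open>ze\<close> and back to \<open>0\<close>; by homogeneity
 the sums over the two rays are Riemann sums of \<open>\<integral>\<^sub>0\<^sup>1 t\<^sup>p\<^sup>-\<^sup>1 dt = 1/p\<close>.\<close>

lemma cyclic_monotone_subgradient:
 fixes B :: "'a::euclidean_space => 'a"
 assumes p: "1 < p" and B0: "B 0 = 0" and pos: "!!xi. 0 <= B xi \<bullet> xi"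
  and hom: "!!xi t. 0 < t ==> B (t *R xi) = (t powr (p - 1)) *R B xi"
  and cyc: "!!(k::nat) xi. 1 <= k ==> xi (k + 1) = xi 1 ==> (\<Sum>i=1..k. B (xi i) \<bullet> (xi (i + 1) - xi i)) <= 0"
 shows "B xi \<bullet> xi + p * (B xi \<bullet> (ze - xi)) <= B ze \<bullet> ze"
proof -
 let ?X = "B xi \<bullet> xi" and ?Z = "B ze \<bullet> ze" and ?Y = "B xi \<bullet> (ze - xi)"
 have hom0: "B (t *R xi) = (t powr (p - 1)) *R B xi" if "0 <= t" for t xi
  using that hom[of t xi] B0 by (cases "t = 0") auto
 have key: "(1 / p - 1 / real n) * ?X + ?Y - (1 / p + 1 / real n) * ?Z <= 0" if n: "n >= 1" for n
 proof -
  let ?n = "real n"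
  have n0: "?n > 0" using n by simp
  define c where "c i = (if i <= n + 1 then (real (i - 1) / ?n) *R xi else (real (2 * n + 2 - i) / ?n) *R ze)" for i
  define f where "f i = B (c i) \<bullet> (c (i + 1) - c i)" for i
  have "(\<Sum>i=1..2 * n + 1. f i) <= 0" unfolding f_def by (rule cyc[of "2 * n + 1" c]) (auto simp: c_def)
  hence le: "(\<Sum>i<n + Suc n. f (Suc i)) <= 0" by (simp only: sum.atLeast1_atMost_eq One_nat_def) (simp add: mult_2)
  have f1: "f (Suc i) = (real i powr (p - 1)) * (?X / (?n powr (p - 1) * ?n))" if "i < n" for i
  proof -
  have "c (Suc i) = (real i / ?n) *R xi" "c (Suc i + 1) = (real (Suc i) / ?n) *R xi" using that by (auto simp: c_def)
  hence "f (Suc i) = ((real i / ?n) powr (p - 1) *R B xi) \<bullet> ((real (Suc i) / ?n - real i / ?n) *R xi)"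
  unfolding f_def scaleR_left_diff_distrib using n0 by (simp add: hom0)
  also have "real (Suc i) / ?n - real i / ?n = 1 / ?n" by (simp add: diff_divide_distrib[symmetric])
  finally show ?thesis by (simp add: powr_divide)
  qed
  have f2: "f (Suc n) = ?Y"
  proof -
  have "c (Suc n) = xi" "c (Suc n + 1) = ze" using n0 by (auto simp: c_def)
  thus ?thesis by (simp add: f_def)
  qed
  have f3: "f (Suc (n + Suc j)) = - ((real (Suc (n - Suc j)) powr (p - 1)) * (?Z / (?n powr (p - 1) * ?n)))" if "j < n" for j
  proof -
  let ?i = "Suc (n + Suc j)"
  have e: "2 * n + 2 - ?i = n - j" "2 * n + 2 - (?i + 1) = n - Suc j" "real (n - j) = real (Suc (n - Suc j))" using that by auto
  have "c ?i = (real (n - j) / ?n) *R ze" "c (?i + 1) = (real (n - Suc j) / ?n) *R ze" using that e by (auto simp: c_def)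
  hence "f ?i = ((real (n - j) / ?n) powr (p - 1) *R B ze) \<bullet> ((real (n - Suc j) / ?n - real (n - j) / ?n) *R ze)"
  unfolding f_def scaleR_left_diff_distrib using n0 by (simp add: hom0)
  also have "real (n - Suc j) / ?n - real (n - j) / ?n = - 1 / ?n" using that by (simp add: diff_divide_distrib[symmetric] of_nat_diff)
  finally show ?thesis unfolding e(3) by (simp add: powr_divide)
  qed
  define d where "d = ?n powr (p - 1) * ?n"
  have d: "d = ?n powr p" "d > 0" using powr_mult_base[of ?n "p - 1"] n0 by (auto simp: d_def mult.commute)
  define L where "L = (\<Sum>i<n. real i powr (p - 1)) / d"
  define U where "U = (\<Sum>i<n. real (Suc i) powr (p - 1)) / d"
  have "(\<Sum>i<n + Suc n. f (Suc i)) = (\<Sum>i<n. f (Suc i)) + (f (Suc n) + (\<Sum>j<n. f (Suc (n + Suc j))))"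
  unfolding sum_lessThan_add sum.lessThan_Suc_shift by simp
  also have "(\<Sum>i<n. f (Suc i)) = (\<Sum>i<n. real i powr (p - 1) * (?X / d))" using f1 by (simp add: d_def)
  also have "... = L * ?X" unfolding L_def by (simp only: sum_distrib_right[symmetric]) simp
  also have "(\<Sum>j<n. f (Suc (n + Suc j))) = - (\<Sum>j<n. (real (Suc (n - Suc j)) powr (p - 1)) * (?Z / d))"
  using f3 by (simp add: sum_negf d_def)
  also have "(\<Sum>j<n. (real (Suc (n - Suc j)) powr (p - 1)) * (?Z / d)) = (\<Sum>j<n. (real (Suc j) powr (p - 1)) * (?Z / d))"
  by (rule sum.nat_diff_reindex)
  also have "... = U * ?Z" unfolding U_def by (simp only: sum_distrib_right[symmetric]) simp
  finally have main: "L * ?X + ?Y - U * ?Z <= 0" using le f2 by simp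
  have UL: "U = L + 1 / ?n"
  proof -
  have "(\<Sum>i<n. real (Suc i) powr (p - 1)) - (\<Sum>i<n. real i powr (p - 1)) = real n powr (p - 1) - real 0 powr (p - 1)"
  unfolding sum_subtractf[symmetric] by (rule sum_lessThan_telescope)
  hence "(\<Sum>i<n. real (Suc i) powr (p - 1)) = (\<Sum>i<n. real i powr (p - 1)) + ?n powr (p - 1)" by simp
  moreover have "?n powr (p - 1) / d = 1 / ?n" using n0 by (simp add: d_def)
  ultimately show ?thesis by (simp add: U_def L_def add_divide_distrib)
  qed
  have "p * L <= 1" "1 <= p * U"
  using powr_sum_bounds[OF p, of n] d by (simp_all add: L_def U_def divide_le_eq le_divide_eq)
  hence "L <= 1 / p" "1 / p <= U" using p by (simp_all add: field_simps)
  hence "1 / p - 1 / ?n <= L" "U <= 1 / p + 1 / ?n" using UL by auto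
  hence "(1 / p - 1 / ?n) * ?X <= L * ?X" "U * ?Z <= (1 / p + 1 / ?n) * ?Z" by (intro mult_right_mono pos; simp)+
  thus ?thesis using main by linarith
 qed
 have lim: "(%n. (1 / p - 1 / real n) * ?X + ?Y - (1 / p + 1 / real n) * ?Z) ----> (1 / p - 0) * ?X + ?Y - (1 / p + 0) * ?Z"
  by (intro tendsto_intros lim_1_over_n)
 have "(1 / p - 0) * ?X + ?Y - (1 / p + 0) * ?Z <= 0"
  by (rule LIMSEQ_le_const2[OF lim]) (use key in blast)
 hence "p * ((1 / p - 0) * ?X + ?Y - (1 / p + 0) * ?Z) <= 0" using p by (intro mult_nonneg_nonpos) auto
 moreover have "p * ((1 / p - 0) * ?X + ?Y - (1 / p + 0) * ?Z) = ?X + p * ?Y - ?Z"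
  using p by (simp add: right_diff_distrib distrib_left)
 ultimately show ?thesis by linarith
qed

lemma powr_interpolation:
 fixes X S :: real
 assumes "0 <= X" "0 <= S" "0 < \<theta>" "\<theta> < 1" "0 < et"
 shows "X powr \<theta> * S powr (1 - \<theta>) <= et * S + et powr (- ((1 - \<theta>) / \<theta>)) * X"
proof (cases "X powr \<theta> <= et * S powr \<theta>")
 case True
 have "X powr \<theta> * S powr (1 - \<theta>) <= et * S powr \<theta> * S powr (1 - \<theta>)" using True by (intro mult_right_mono) auto
 also have "... = et * S" using assms by (simp add: mult.assoc powr_add[symmetric])
 finally show ?thesis using assms by (simp add: add_increasing2)
next
 case False
 hence "et * S powr \<theta> <= X powr \<theta>" by simp
 hence "(et * S powr \<theta>) powr ((1 - \<theta>) / \<theta>) <= (X powr \<theta>) powr ((1 - \<theta>) / \<theta>)"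
  using assms by (intro powr_mono2) auto
 hence "et powr ((1 - \<theta>) / \<theta>) * S powr (1 - \<theta>) <= X powr (1 - \<theta>)"
  using assms by (simp add: powr_mult powr_powr)
 hence "S powr (1 - \<theta>) <= et powr (- ((1 - \<theta>) / \<theta>)) * X powr (1 - \<theta>)"
  using assms by (simp add: powr_minus field_simps)
 hence "X powr \<theta> * S powr (1 - \<theta>) <= X powr \<theta> * (et powr (- ((1 - \<theta>) / \<theta>)) * X powr (1 - \<theta>))"
  by (intro mult_left_mono) auto
 also have "... = et powr (- ((1 - \<theta>) / \<theta>)) * X" using assms by (simp add: mult.left_commute powr_add[symmetric])
 finally show ?thesis using assms by (simp add: add_increasing)
qed

text \<open>For \<open>p < 2\<close> this is the constant that Young's inequality leaves when the factor \<open>Psi\<close> is split off.\<close>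

definition convexity_modulus :: "real => real => nat => real" where
 "convexity_modulus p al n = (if 2 <= p then 1 else (1 / real (Suc n)) powr (- ((1 - p / 2) / (p / 2)))) / al"

lemma uniform_convexity_from_monotonicity:
 fixes S D r :: real
 assumes p: "1 < p" and al: "0 < al" and S: "0 < S" and D: "0 <= D" and r: "0 <= r"
  and H: "al * r powr (max 2 p) * S powr (1 - max 2 p / p) <= D"
 shows "r powr p <= (1 / real (Suc n)) * S + convexity_modulus p al n * D"
proof (cases "2 <= p")
 case True
 hence "al * r powr p <= D" using H S p by simp
 hence "r powr p <= D / al" using al by (simp add: field_simps)
 moreover have "0 <= (1 / real (Suc n)) * S" using S by simp
 moreover have "convexity_modulus p al n * D = D / al" using True by (simp add: convexity_modulus_def)
 ultimately show ?thesis by linarith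
next
 case False
 define X where "X = r powr 2 * S powr (1 - 2 / p)"
 define et where "et = 1 / real (Suc n)"
 have X: "0 <= X" by (simp add: X_def)
 have XD: "X <= D / al" using H False al by (simp add: X_def field_simps max_def)
 have "X powr (p/2) * S powr (1 - p/2) = r powr p * (S powr ((1 - 2/p) * (p/2)) * S powr (1 - p/2))"
  unfolding X_def powr_mult powr_powr by (simp add: mult.assoc)
 also have "S powr ((1 - 2/p) * (p/2)) * S powr (1 - p/2) = S powr ((1 - 2/p) * (p/2) + (1 - p/2))" by (simp only: powr_add)
 also have "(1 - 2/p) * (p/2) + (1 - p/2) = 0" using p by (simp add: field_simps)
 finally have "r powr p = X powr (p/2) * S powr (1 - p/2)" using S by simp
 also have "... <= et * S + et powr (- ((1 - p/2) / (p/2))) * X"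
  using p False S X by (intro powr_interpolation) (auto simp: et_def)
 also have "... <= et * S + et powr (- ((1 - p/2) / (p/2))) * (D / al)"
  using XD by (intro add_left_mono mult_left_mono) auto
 finally show ?thesis using False by (simp only: et_def convexity_modulus_def if_False times_divide_eq_left times_divide_eq_right)
qed

text \<open>Cyclic monotonicity gives the subgradient inequality, oddness its mirror image, and the lower bound on the monotonicity uniform convexity.\<close>

lemma H0_to_H8_admissible:
 fixes b :: "'a::euclidean_space => 'a => 'a"
 assumes p: "1 < p" and al: "0 < al" and bt: "0 < bt" and H: "H0_to_H8 Om p al bt c b"
 shows "admissible Om p al (bt powr conj_exp p / al) (convexity_modulus p al) b"
 unfolding admissible_def
proof (intro conjI)
 let ?ka = "bt powr conj_exp p / al"
 show "\<forall>xi. (%x. b x xi) \<in> borel_measurable (leb Om)" using H by (simp add: H0_to_H8_def caratheodory_def)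
 have "AE x in leb Om. continuous_on UNIV (b x)"
  "AE x in leb Om. \<forall>xi1 xi2. 0 <= (b x xi1 - b x xi2) \<bullet> (xi1 - xi2)"
  "AE x in leb Om. \<forall>xi. al * norm xi powr p <= b x xi \<bullet> xi"
  "AE x in leb Om. \<forall>xi. norm (b x xi) <= bt * norm xi powr (p - 1)"
  "AE x in leb Om. \<forall>xi. \<forall>t>0. b x (t *R xi) = (t powr (p - 1)) *R b x xi"
  "AE x in leb Om. \<forall>xi. b x (- xi) = - b x xi"
  "AE x in leb Om. \<forall>k\<ge>1. \<forall>xi :: nat => 'a. xi (k + 1) = xi 1 --> (\<Sum>i=1..k. b x (xi i) \<bullet> (xi (i + 1) - xi i)) <= 0"
  "AE x in leb Om. \<forall>xi1 xi2. (xi1, xi2) ~= (0, 0) -->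
  al * norm (xi1 - xi2) powr (max 2 p) * Psi b x xi1 xi2 powr (1 - max 2 p / p) <= (b x xi1 - b x xi2) \<bullet> (xi1 - xi2)"
  using H by (simp_all add: H0_to_H8_def caratheodory_def H1_def H2_def H3_def H4_def H5_def H7_def H8_def Let_def)
 thus "AE x in leb Om. admissible_vector_field p al ?ka (convexity_modulus p al) (b x)"
 proof eventually_elim
  case (elim x)
  have b0: "b x 0 = 0" using spec[OF elim(4), of 0] by simp
  have pos: "0 <= b x xi \<bullet> xi" for xi using spec[OF elim(3), of xi] al by (meson less_imp_le mult_nonneg_nonneg order_trans powr_ge_zero)
  have sg: "b x xi \<bullet> xi + p * (b x xi \<bullet> (ze - xi)) <= b x ze \<bullet> ze" for xi ze
  by (rule cyclic_monotone_subgradient[OF p b0 pos]) (use elim(5) in blast, rule elim(7)[rule_format])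
  show ?case
  proof (unfold_locales)
  show "0 < ?ka" using al bt by simp
  show "0 <= convexity_modulus p al n" for n using al by (simp add: convexity_modulus_def)
  show "admissible_field p al ?ka (convexity_modulus p al) (b x)"
  unfolding admissible_field_def
  proof (intro conjI allI)
  fix xi ze :: 'a and n :: nat
  show "continuous_on UNIV (b x)" by (rule elim)
  show "al * norm xi powr p <= b x xi \<bullet> xi" using elim by blast
  have "norm (b x xi) powr conj_exp p <= (bt * norm xi powr (p - 1)) powr conj_exp p"
  using elim(4) conj_exp_gt_1[OF p] by (intro powr_mono2) auto
  also have "... = bt powr conj_exp p * norm xi powr p"
  unfolding powr_mult powr_powr conj_exp_mult[OF p] ..
  also have "... <= bt powr conj_exp p * ((b x xi \<bullet> xi) / al)"
  using spec[OF elim(3), of xi] al by (intro mult_left_mono) (auto simp: field_simps)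
  finally show "norm (b x xi) powr conj_exp p <= ?ka * (b x xi \<bullet> xi)" by simp
  show "b x xi \<bullet> xi + p * (b x xi \<bullet> (ze - xi)) <= b x ze \<bullet> ze" by (rule sg)
  have "b x (- xi) = - b x xi" using elim(6) by blast
  thus "b x xi \<bullet> xi - p * (b x xi \<bullet> (ze + xi)) <= b x ze \<bullet> ze" using sg[of "- xi" ze] by simp
  show "norm (xi - ze) powr p <= (1 / real (Suc n)) * (b x xi \<bullet> xi + b x ze \<bullet> ze) + convexity_modulus p al n * ((b x xi - b x ze) \<bullet> (xi - ze))"
  proof (cases "xi = 0 & ze = 0")
  case True thus ?thesis by simp
  next
  case False
  have "0 < al * norm xi powr p + al * norm ze powr p"
  using False al by (cases "xi = 0") (auto intro: add_pos_nonneg add_nonneg_pos)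
  hence S: "0 < b x xi \<bullet> xi + b x ze \<bullet> ze" using spec[OF elim(3), of xi] spec[OF elim(3), of ze] by linarith
  have "al * norm (xi - ze) powr (max 2 p) * (b x xi \<bullet> xi + b x ze \<bullet> ze) powr (1 - max 2 p / p) <= (b x xi - b x ze) \<bullet> (xi - ze)"
  using elim(8) False unfolding Psi_def by blast
  thus ?thesis using elim(2) by (intro uniform_convexity_from_monotonicity[OF p al S]) auto
  qed
  qed
  qed (use p al in auto)
 qed
qed

section \<open>Minimisation and weak solutions\<close>

text \<open>A smooth convex penalty of linear growth: its derivative is bounded, hence in the dual exponent, whatever \<open>p\<close> is.\<close>

definition pen :: "real => real" where "pen s = sqrt (1 + s\<^sup>2) - 1"
definition pen' :: "real => real" where "pen' s = s / sqrt (1 + s\<^sup>2)"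

lemma pen_tangent: "pen s + pen' s * (t - s) <= pen t"
proof -
 have p: "0 < sqrt (1 + s\<^sup>2)" by (simp add: add_pos_nonneg)
 have "(1 + s * t)\<^sup>2 <= (1 + s\<^sup>2) * (1 + t\<^sup>2)"
  using zero_le_power2[of "s - t"] by (simp add: power2_eq_square algebra_simps)
 hence "1 + s * t <= sqrt (1 + s\<^sup>2) * sqrt (1 + t\<^sup>2)"
  unfolding real_sqrt_mult[symmetric] by (rule real_le_rsqrt)
 hence "(1 + s * t) / sqrt (1 + s\<^sup>2) <= sqrt (1 + t\<^sup>2)" using p by (simp add: divide_le_eq mult.commute)
 moreover have "sqrt (1 + s\<^sup>2) + s / sqrt (1 + s\<^sup>2) * (t - s) = (1 + s * t) / sqrt (1 + s\<^sup>2)"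
 proof -
  have "sqrt (1 + s\<^sup>2) = (1 + s\<^sup>2) / sqrt (1 + s\<^sup>2)" by (simp add: real_div_sqrt add_nonneg_nonneg)
  hence "sqrt (1 + s\<^sup>2) + s / sqrt (1 + s\<^sup>2) * (t - s) = (1 + s\<^sup>2) / sqrt (1 + s\<^sup>2) + (s * (t - s)) / sqrt (1 + s\<^sup>2)" by simp
  also have "... = ((1 + s\<^sup>2) + s * (t - s)) / sqrt (1 + s\<^sup>2)" by (simp only: add_divide_distrib)
  finally show ?thesis by (simp add: power2_eq_square algebra_simps)
 qed
 ultimately show ?thesis by (simp add: pen_def pen'_def)
qed

lemma pen_nonneg: "0 <= pen s" by (simp add: pen_def)

lemma pen_eq_0: "pen s = 0 \<longleftrightarrow> s = 0" by (simp add: pen_def)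

lemma pen'_bound: "\<bar>pen' s\<bar> <= 1"
proof -
 have "\<bar>s\<bar> <= sqrt (1 + s\<^sup>2)" by (rule real_le_rsqrt) simp
 thus ?thesis by (simp add: pen'_def abs_divide divide_le_eq add_pos_nonneg)
qed

lemma pen_le: "pen s <= \<bar>s\<bar>"
proof -
 have "sqrt (1 + s\<^sup>2) <= 1 + \<bar>s\<bar>" by (rule real_le_lsqrt) (auto simp: power2_eq_square algebra_simps)
 thus ?thesis by (simp add: pen_def)
qed

lemma pen_continuous: "continuous_on UNIV pen" "continuous_on UNIV pen'"
 unfolding pen_def[abs_def] pen'_def[abs_def]
 by (auto intro!: continuous_intros simp: add_nonneg_eq_0_iff)

lemma pen_midpoint: "pen ((1/2) * (s + t)) <= (pen s + pen t) / 2"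
proof -
 let ?m = "(1/2) * (s + t)"
 have "pen ?m + pen' ?m * (s - ?m) <= pen s" "pen ?m + pen' ?m * (t - ?m) <= pen t" by (rule pen_tangent)+
 moreover have "pen' ?m * (t - ?m) = - (pen' ?m * (s - ?m))" by (simp add: algebra_simps)
 ultimately show ?thesis by simp
qed

context bounded_domain
begin

lemma pen_measurable: "v \<in> borel_measurable M ==> (%x. pen (v x)) \<in> borel_measurable M"
 "v \<in> borel_measurable M ==> (%x. pen' (v x)) \<in> borel_measurable M"
 by (erule measurable_compose[OF _ borel_measurable_continuous_onI[OF pen_continuous(1)]])
  (erule measurable_compose[OF _ borel_measurable_continuous_onI[OF pen_continuous(2)]])

lemma pen_integrable: assumes "v \<in> Lp Om p" shows "integrable M (%x. pen (v x))"
 by (rule Bochner_Integration.integrable_bound[OF Lp_integrable[OF assms less_imp_le[OF p_gt_1]] pen_measurable(1)[OF LpD(1)[OF assms]]])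
  (intro AE_I2, use pen_nonneg pen_le in simp)

lemma pen'_Lp: assumes "v \<in> borel_measurable M" "0 < r" shows "(%x. pen' (v x)) \<in> Lp Om r"
 using pen'_bound by (intro Lp_bounded[where K = 1] pen_measurable assms) auto

lemma Lp_cauchy_of_midpoint_gap:
 assumes adm: "admissible Om p al ka om b" and g: "g \<in> Lp Om p" and h: "h \<in> Lp Om p"
 shows "(Nd g h) <= 2 powr p * ((1 / real (Suc n)) * (energy b g + energy b h) +
  om n * (4 / p) * ((energy b g + energy b h) / 2 - energy b (%x. (1/2) *R (g x + h x))))"
proof -
 let ?m = "%x. (1/2) *R (g x + h x)"
 have m: "?m \<in> Lp Om p" by (intro Lp_scaleR Lp_add p_pos g h)
 note I = admissible_Lp(2)[OF adm]
 have "(Nd g h) <= (LINT x|M. 2 powr p * ((1 / real (Suc n)) * (b x (g x) \<bullet> g x + b x (h x) \<bullet> h x) +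
  om n * (4 / p) * ((b x (g x) \<bullet> g x + b x (h x) \<bullet> h x) / 2 - b x (?m x) \<bullet> ?m x)))"
 proof (rule integral_mono_AE)
  show "AE x in M. norm (g x - h x) powr p <= 2 powr p * ((1 / real (Suc n)) * (b x (g x) \<bullet> g x + b x (h x) \<bullet> h x) +
  om n * (4 / p) * ((b x (g x) \<bullet> g x + b x (h x) \<bullet> h x) / 2 - b x (?m x) \<bullet> ?m x))"
  using admissible_AE[OF adm] by (rule eventually_mono) (erule admissible_vector_field.midpoint_gap)
 qed (use I[OF g] I[OF h] I[OF m] LpD(2)[OF Lp_diff[OF p_pos g h]] in auto)
 also have "... = 2 powr p * ((1 / real (Suc n)) * (energy b g + energy b h) +
  om n * (4 / p) * ((energy b g + energy b h) / 2 - energy b ?m))"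
  using I[OF g] I[OF h] I[OF m] unfolding energy_def by simp
 finally show ?thesis .
qed

definition functional :: "('a => 'a => 'a) => real => ('a => real) => (('a => real) => real) => ('a => real) => ('a => 'a) => real" where
 "functional b k u0 La w g = energy b g / p + k * (LINT x|M. pen (w x - u0 x)) - La w"

lemma pen_integral_midpoint:
 assumes "v \<in> Lp Om p" "w \<in> Lp Om p" "u0 \<in> Lp Om p"
 shows "(LINT x|M. pen ((1/2) * (v x + w x) - u0 x)) <= ((LINT x|M. pen (v x - u0 x)) + (LINT x|M. pen (w x - u0 x))) / 2"
proof -
 note I = pen_integrable[OF Lp_diff[OF p_pos assms(1,3)]] pen_integrable[OF Lp_diff[OF p_pos assms(2,3)]]
  pen_integrable[OF Lp_diff[OF p_pos Lp_mult[OF Lp_add[OF p_pos assms(1,2)], of "1/2"] assms(3)]]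
 have e: "(1/2) * (v x + w x) - u0 x = (1/2) * ((v x - u0 x) + (w x - u0 x))" for x by (simp add: field_simps)
 have "(LINT x|M. pen ((1/2) * (v x + w x) - u0 x)) <= (LINT x|M. (pen (v x - u0 x) + pen (w x - u0 x)) / 2)"
  using I by (intro integral_mono) (auto simp only: e intro!: pen_midpoint integrable_divide Bochner_Integration.integrable_add)
 also have "... = ((LINT x|M. pen (v x - u0 x)) + (LINT x|M. pen (w x - u0 x))) / 2" using I by simp
 finally show ?thesis .
qed

lemma functional_midpoint:
 assumes adm: "admissible Om p al ka om b" and l: "La \<in> W_dual Om p" and u0: "u0 \<in> Lp Om p" and k: "0 <= k"
  and v: "W0 v g" and w: "W0 w h"
 shows "(energy b g + energy b h) / 2 - energy b (%x. (1/2) *R (g x + h x)) <=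
  p * ((functional b k u0 La v g + functional b k u0 La w h) / 2 - functional b k u0 La (%x. (1/2) * (v x + w x)) (%x. (1/2) *R (g x + h x)))"
proof -
 let ?m = "%x. (1/2) *R (g x + h x)" and ?u = "%x. (1/2) * (v x + w x)"
 let ?P = "%v. LINT x|M. pen (v x - u0 x)"
 have "La ?u = (1/2) * La (%x. v x + w x)" by (rule W_dualD(2)[OF l W0_W01p[OF W0_add[OF v w]]])
 also have "La (%x. v x + w x) = La v + La w" by (rule W_dualD(1)[OF l W0_W01p[OF v] W0_W01p[OF w]])
 finally have L: "La ?u = (La v + La w) / 2" by simp
 have P: "k * ?P ?u <= k * ((?P v + ?P w) / 2)"
  using k by (intro mult_left_mono pen_integral_midpoint W0_Lp(1)[OF v] W0_Lp(1)[OF w] u0)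
 have "(energy b g + energy b h) / 2 - energy b ?m + p * (k * ((?P v + ?P w) / 2) - k * ?P ?u) =
  p * ((functional b k u0 La v g + functional b k u0 La w h) / 2 - functional b k u0 La ?u ?m)"
  unfolding functional_def L using p_pos by (simp add: field_simps)
 moreover have "0 <= p * (k * ((?P v + ?P w) / 2) - k * ?P ?u)" using P p_pos by simp
 ultimately show ?thesis by linarith
qed

lemma functional_coercive:
 assumes adm: "admissible Om p al ka om b" and al: "0 < al" and l: "La \<in> W_dual Om p" and k: "0 <= k"
 obtains C where "!!w g. W0 w g ==> (al / (2 * p)) * (Np g) <= functional b k u0 La w g + C"
proof -
 obtain K where K: "0 <= K" "!!u g. W0 u g ==> \<bar>La u\<bar> <= K * (Np g) powr (1/p)"
  by (rule W_dual_bound[OF l]) (rule that)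
 define c where "c = al / (2 * p)"
 have c: "0 < c" using al p_pos by (simp add: c_def)
 define Y where "Y = (K / c) powr (1 / (p - 1))"
 show thesis
 proof (rule that[of "K * Y"])
  fix w g assume W: "W0 w g"
  define X where "X = (Np g)"
  define y where "y = X powr (1/p)"
  have X: "X = y powr p" "0 <= y" using p_pos by (auto simp: y_def X_def powr_powr)
  have Ky: "K * y <= c * X + K * Y"
  proof (cases "y <= Y")
  case True
  have "0 <= c * X" using c X by simp
  thus ?thesis using mult_left_mono[OF True K(1)] by linarith
  next
  case False
  have "Y powr (p - 1) <= y powr (p - 1)" using False p_gt_1 by (intro powr_mono2) (auto simp: Y_def)
  hence "K / c <= y powr (p - 1)" using K(1) c p_gt_1 by (simp add: Y_def powr_powr)
  hence "K <= c * y powr (p - 1)" using c by (simp add: field_simps)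
  hence "K * y <= c * y powr (p - 1) * y" using X by (intro mult_right_mono)
  also have "... = c * X" using powr_mult_base[of y "p - 1"] X by (simp add: mult.commute mult.left_commute)
  finally show ?thesis using mult_nonneg_nonneg[OF K(1), of Y] by (simp add: Y_def)
  qed
  have "La w <= K * y" using K(2)[OF W] by (simp add: y_def X_def)
  moreover have "al * X / p <= energy b g / p" using energy_bounds(1)[OF adm W0_Lp(2)[OF W]] p_pos by (intro divide_right_mono) (auto simp: X_def)
  moreover have "al * X / p = c * X + c * X" using p_pos by (simp add: c_def field_simps)
  moreover have "0 <= k * (LINT x|M. pen (w x - u0 x))" using k pen_nonneg by (intro mult_nonneg_nonneg integral_nonneg_AE) auto
  ultimately show "(al / (2 * p)) * (Np g) <= functional b k u0 La w g + K * Y"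
  using Ky unfolding functional_def c_def[symmetric] X_def[symmetric] by linarith
 qed
qed

lemma W0_Cauchy:
 assumes W: "!!n. W0 (w n) (g n)"
  and c: "!!e. 0 < e ==> \<exists>N. \<forall>m\<ge>N. \<forall>n\<ge>N. (Nd (g m) (g n)) < e"
 obtains u h where "W0 u h" "Lp_tendsto Om p w u" "Lp_tendsto Om p g h"
proof -
 obtain C where C: "0 < C" "!!u g. W0 u g ==> (Np u) <= C * (Np g)"
  by (rule W0_Poincare) (rule that)
 obtain h where h: "Lp_tendsto Om p g h" by (rule Lp_complete[OF p_pos W0_Lp(2)[OF W] c])
 have cw: "\<exists>N. \<forall>m\<ge>N. \<forall>n\<ge>N. (Nd (w m) (w n)) < e" if "0 < e" for e
 proof -
  from c[OF divide_pos_pos[OF that C(1)]]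
  obtain N where N: "\<forall>m\<ge>N. \<forall>n\<ge>N. (Nd (g m) (g n)) < e / C" by blast
  have "(Nd (w m) (w n)) < e" if "m >= N" "n >= N" for m n
  using C(2)[OF W0_diff[OF W W], of m n] mult_strict_left_mono[OF N[rule_format, OF that] C(1)] C(1) by simp
  thus ?thesis by blast
 qed
 obtain u where u: "Lp_tendsto Om p w u" by (rule Lp_complete[OF p_pos W0_Lp(1)[OF W] cw])
 show thesis by (rule that[OF W0_closed[OF W u h] u h])
qed

text \<open>The direct method: minimising sequences are Cauchy because the midpoint gap of the energy
 controls the distance of the gradients.\<close>

theorem functional_minimum:
 assumes adm: "admissible Om p al ka om b" and al: "0 < al" and om: "!!n. 0 <= om n"
  and l: "La \<in> W_dual Om p" and u0: "u0 \<in> Lp Om p" and k: "0 <= k"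
 obtains w g where "W0 w g" "!!v h. W0 v h ==> functional b k u0 La w g <= functional b k u0 La v h"
proof -
 let ?J = "functional b k u0 La"
 obtain C where C: "!!w g. W0 w g ==> (al / (2 * p)) * (Np g) <= ?J w g + C"
  by (rule functional_coercive[OF adm al l k]) (rule that)
 define S where "S = {?J w g | w g. W0 w g}"
 have S: "S ~= {}" unfolding S_def using W0_zero by blast
 have "- C <= ?J w g" if "W0 w g" for w g
 proof -
  have "0 <= (al / (2 * p)) * (Np g)" using al p_pos by (intro mult_nonneg_nonneg) auto
  thus ?thesis using C[OF that] by linarith
 qed
 hence bdd: "bdd_below S" unfolding S_def by (intro bdd_belowI[of _ "- C"]) auto
 define m where "m = Inf S"
 have m_le: "m <= ?J w g" if "W0 w g" for w g unfolding m_def using that bdd by (intro cInf_lower) (auto simp: S_def)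
 let ?P = "%n w g. W0 w g & ?J w g < m + 1 / real (Suc n)"
 have "\<exists>w g. ?P n w g" for n
  using cInf_less_iff[OF S bdd, of "m + 1 / real (Suc n)"] unfolding m_def[symmetric] by (auto simp: S_def)
 then obtain w where "\<forall>n. \<exists>g. ?P n (w n) g" using choice[of "%n w. \<exists>g. ?P n w g"] by blast
 then obtain g where wg: "!!n. W0 (w n) (g n)" "!!n. ?J (w n) (g n) < m + 1 / real (Suc n)"
  using choice[of "%n g. ?P n (w n) g"] by blast
 note gL = W0_Lp(2)[OF wg(1)]
 define E where "E = ka powr (p - 1) * ((m + 1 + C) / (al / (2 * p)))"
 have E: "energy b (g n) <= E" for n
 proof -
  have "1 / real (Suc n) <= 1" by simp
  hence "(al / (2 * p)) * (Np (g n)) <= m + 1 + C" using C[OF wg(1), of n] wg(2)[of n] by linarith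
  hence "(Np (g n)) <= (m + 1 + C) / (al / (2 * p))" using al p_pos by (subst pos_le_divide_eq) (auto simp: mult.commute)
  from order_trans[OF energy_bounds(2)[OF adm gL] mult_left_mono[OF this powr_ge_zero]] show ?thesis
  unfolding E_def .
 qed
 have E0: "0 <= E"
  using order_trans[OF order_trans[OF _ energy_bounds(1)[OF adm gL, of 0]] E[of 0]] al by (simp add: mult_nonneg_nonneg)
 have cauchy: "\<exists>N. \<forall>i\<ge>N. \<forall>j\<ge>N. (Nd (g i) (g j)) < e" if e: "0 < e" for e
 proof -
  define c where "c = (2 :: real) powr p"
  have c: "c > 0" by (simp add: c_def)
  have "(%n. c * (1 / real (Suc n) * (E + E))) ----> c * (0 * (E + E))"
  using LIMSEQ_inverse_real_of_nat by (intro tendsto_mult tendsto_const) (simp add: inverse_eq_divide)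
  hence "\<forall>\<^sub>F n in sequentially. c * (1 / real (Suc n) * (E + E)) < e / 2" using e by (intro order_tendstoD(2)) auto
  then obtain n where n: "c * (1 / real (Suc n) * (E + E)) < e / 2" by (auto simp: eventually_sequentially)
  have "(%N. c * (om n * (4 / p) * (p * (1 / real (Suc N))))) ----> c * (om n * (4 / p) * (p * 0))"
  using LIMSEQ_inverse_real_of_nat by (intro tendsto_mult tendsto_const) (simp add: inverse_eq_divide)
  hence "\<forall>\<^sub>F N in sequentially. c * (om n * (4 / p) * (p * (1 / real (Suc N)))) < e / 2" using e by (intro order_tendstoD(2)) auto
  then obtain N where N: "c * (om n * (4 / p) * (p * (1 / real (Suc N)))) < e / 2" by (auto simp: eventually_sequentially)
  have "(Nd (g i) (g j)) < e" if ij: "i >= N" "j >= N" for i j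
  proof -
  let ?gap = "(energy b (g i) + energy b (g j)) / 2 - energy b (%x. (1/2) *R (g i x + g j x))"
  have "W0 (%x. (1/2) * (w i x + w j x)) (%x. (1/2) *R (g i x + g j x))" by (intro W0_cmult W0_add wg)
  from m_le[OF this] have "m <= ?J (%x. (1/2) * (w i x + w j x)) (%x. (1/2) *R (g i x + g j x))" .
  moreover have "?J (w i) (g i) < m + 1 / real (Suc N)" "?J (w j) (g j) < m + 1 / real (Suc N)"
  proof -
  have "1 / real (Suc i) <= 1 / real (Suc N)" "1 / real (Suc j) <= 1 / real (Suc N)"
  using ij by (intro frac_le; simp)+
  thus "?J (w i) (g i) < m + 1 / real (Suc N)" "?J (w j) (g j) < m + 1 / real (Suc N)"
  using wg(2)[of i] wg(2)[of j] by linarith+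
  qed
  ultimately have "(?J (w i) (g i) + ?J (w j) (g j)) / 2 - ?J (%x. (1/2) * (w i x + w j x)) (%x. (1/2) *R (g i x + g j x)) <= 1 / real (Suc N)"
  unfolding add_divide_distrib by linarith
  hence gap: "?gap <= p * (1 / real (Suc N))"
  using p_pos by (intro order_trans[OF functional_midpoint[OF adm l u0 k wg(1) wg(1)] mult_left_mono]) auto
  have "(Nd (g i) (g j)) <= c * ((1 / real (Suc n)) * (energy b (g i) + energy b (g j)) + om n * (4 / p) * ?gap)"
  unfolding c_def by (rule Lp_cauchy_of_midpoint_gap[OF adm gL gL])
  also have "... <= c * ((1 / real (Suc n)) * (E + E) + om n * (4 / p) * (p * (1 / real (Suc N))))"
  using c om p_pos gap E by (intro mult_left_mono add_mono) auto
  also have "... < e" using n N unfolding distrib_left by linarith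
  finally show ?thesis .
  qed
  thus ?thesis by blast
 qed
 obtain u h where u: "W0 u h" "Lp_tendsto Om p w u" "Lp_tendsto Om p g h" by (rule W0_Cauchy[OF wg(1) cauchy])
 have "?J u h <= m"
 proof (rule LIMSEQ_le_const)
  let ?s = "%x. pen' (u x - u0 x)"
  have uL: "(%x. u x - u0 x) \<in> Lp Om p" by (intro Lp_diff p_pos W0_Lp[OF u(1)] u0)
  have s: "?s \<in> Lp Om q" by (rule pen'_Lp[OF LpD(1)[OF uL] q_pos])
  let ?R = "%n. m + 1 / real (Suc n) + (energy b h - energy b (g n)) / p + (La (w n) - La u) - k * ((LINT x|M. ?s x \<bullet> w n x) - (LINT x|M. ?s x \<bullet> u x))"
  have "?R ----> m + 0 + (energy b h - energy b h) / p + (La u - La u) - k * ((LINT x|M. ?s x \<bullet> u x) - (LINT x|M. ?s x \<bullet> u x))"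
  using LIMSEQ_inverse_real_of_nat p_pos
  by (intro tendsto_intros energy_tendsto[OF adm u(3)] W_dual_continuous[OF l wg(1) u(1,3)] Lp_tendsto_inner_const[OF u(2) s])
  (auto simp: inverse_eq_divide)
  thus "?R ----> m" by simp
  show "\<exists>N. \<forall>n\<ge>N. ?J u h <= ?R n"
  proof (intro exI allI impI)
  fix n
  have wL: "(%x. w n x - u0 x) \<in> Lp Om p" by (intro Lp_diff p_pos W0_Lp[OF wg(1)] u0)
  note I = Lp_inner_integrable[OF p_gt_1 s W0_Lp(1)[OF wg(1)], of n] Lp_inner_integrable[OF p_gt_1 s W0_Lp(1)[OF u(1)]]
  have "(LINT x|M. pen (u x - u0 x) + (?s x \<bullet> w n x - ?s x \<bullet> u x)) <= (LINT x|M. pen (w n x - u0 x))"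
  proof (rule integral_mono)
  show "pen (u x - u0 x) + (?s x \<bullet> w n x - ?s x \<bullet> u x) <= pen (w n x - u0 x)" for x
  using pen_tangent[of "u x - u0 x" "w n x - u0 x"] by (simp add: algebra_simps)
  qed (use I pen_integrable[OF uL] pen_integrable[OF wL] in auto)
  hence "(LINT x|M. pen (u x - u0 x)) + ((LINT x|M. ?s x \<bullet> w n x) - (LINT x|M. ?s x \<bullet> u x)) <= (LINT x|M. pen (w n x - u0 x))"
  using I pen_integrable[OF uL] by simp
  from mult_left_mono[OF this k] have "k * (LINT x|M. pen (u x - u0 x)) + k * ((LINT x|M. ?s x \<bullet> w n x) - (LINT x|M. ?s x \<bullet> u x)) <= k * (LINT x|M. pen (w n x - u0 x))"
  by (simp only: distrib_left)
  thus "?J u h <= ?R n" using wg(2)[of n] unfolding functional_def diff_divide_distrib by linarith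
  qed
 qed
 hence "?J u h <= ?J v h'" if "W0 v h'" for v h' using m_le[OF that] by linarith
 thus thesis by (rule that[OF u(1)])
qed

text \<open>The subgradient at the varied point bounds the difference quotient; vary in the directions \<open>v\<close> and \<open>-v\<close>.\<close>

theorem functional_Euler_Lagrange:
 assumes adm: "admissible Om p al ka om b" and l: "La \<in> W_dual Om p" and u0: "u0 \<in> Lp Om p" and k: "0 <= k"
  and W: "W0 w g" and min: "!!v h. W0 v h ==> functional b k u0 La w g <= functional b k u0 La v h" and V: "W0 v h"
 shows "(LINT x|M. b x (g x) \<bullet> h x) + k * (LINT x|M. pen' (w x - u0 x) * v x) = La v"
proof -
 have ineq: "La v <= (LINT x|M. b x (g x) \<bullet> h x) + k * (LINT x|M. pen' (w x - u0 x) * v x)" if V: "W0 v h" for v h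
 proof -
  note gL = W0_Lp(2)[OF W] and hL = W0_Lp(2)[OF V] and wL = W0_Lp(1)[OF W] and vL = W0_Lp(1)[OF V]
  let ?t = "%n. 1 / real (Suc n)"
  let ?g = "%n x. g x + ?t n *R h x" and ?w = "%n x. w x + ?t n * v x"
  have Wn: "W0 (?w n) (?g n)" for n by (intro W0_add W W0_cmult V)
  have t0: "(%n. ?t n) ----> 0" using LIMSEQ_inverse_real_of_nat by (simp add: inverse_eq_divide)
  have t01: "0 < ?t n" "?t n <= 1" for n by auto
  have gn: "?g n \<in> Lp Om p" for n by (rule W0_Lp(2)[OF Wn])
  have pL: "(%x. w x - u0 x) \<in> Lp Om p" "(%x. ?w n x - u0 x) \<in> Lp Om p" for n
  by (intro Lp_diff p_pos wL W0_Lp(1)[OF Wn] u0)+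
  note s = pen'_Lp[OF LpD(1)[OF pL(2)] q_pos]
  note I1 = Lp_inner_integrable[OF p_gt_1 admissible_Lp(1)[OF adm gn] hL]
  have I2: "integrable M (%x. pen' (?w n x - u0 x) * v x)" for n
  using Lp_inner_integrable[OF p_gt_1 s vL, of n] by simp
  have quot: "La v <= (LINT x|M. b x (?g n x) \<bullet> h x) + k * (LINT x|M. pen' (?w n x - u0 x) * v x)" for n
  proof -
  have "(LINT x|M. b x (?g n x) \<bullet> ?g n x - (p * ?t n) * (b x (?g n x) \<bullet> h x)) <= energy b g"
  unfolding energy_def
  proof (rule integral_mono_AE)
  show "AE x in M. b x (?g n x) \<bullet> ?g n x - (p * ?t n) * (b x (?g n x) \<bullet> h x) <= b x (g x) \<bullet> g x"
  using admissible_AE[OF adm]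
  proof eventually_elim
  case (elim x)
  have "g x - ?g n x = - (?t n *R h x)" by simp
  hence "b x (?g n x) \<bullet> (g x - ?g n x) = - (?t n * (b x (?g n x) \<bullet> h x))" by (simp only: inner_minus_right inner_scaleR_right)
  with admissible_vector_field.subgrad[OF elim, of "?g n x" "g x"]
  show ?case by (simp only: mult_minus_right mult.assoc)
  qed
  qed (use admissible_Lp(2)[OF adm gn] I1 admissible_Lp(2)[OF adm gL] in auto)
  hence e: "energy b (?g n) - (p * ?t n) * (LINT x|M. b x (?g n x) \<bullet> h x) <= energy b g"
  using admissible_Lp(2)[OF adm gn] I1 unfolding energy_def by simp
  have "(LINT x|M. pen (?w n x - u0 x) - ?t n * (pen' (?w n x - u0 x) * v x)) <= (LINT x|M. pen (w x - u0 x))"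
  proof (rule integral_mono)
  show "pen (?w n x - u0 x) - ?t n * (pen' (?w n x - u0 x) * v x) <= pen (w x - u0 x)" for x
  proof -
  have "(w x - u0 x) - (?w n x - u0 x) = - (?t n * v x)" by simp
  with pen_tangent[of "?w n x - u0 x" "w x - u0 x"]
  have "pen (?w n x - u0 x) + pen' (?w n x - u0 x) * (- (?t n * v x)) <= pen (w x - u0 x)" by (simp only:)
  thus ?thesis by (simp only: mult_minus_right mult.left_commute add_uminus_conv_diff)
  qed
  qed (use I2 pen_integrable pL in auto)
  hence "(LINT x|M. pen (?w n x - u0 x)) - ?t n * (LINT x|M. pen' (?w n x - u0 x) * v x) <= (LINT x|M. pen (w x - u0 x))"
  using I2 pen_integrable[OF pL(2)] by simp
  from mult_left_mono[OF this k] have pn: "k * (LINT x|M. pen (?w n x - u0 x)) - ?t n * (k * (LINT x|M. pen' (?w n x - u0 x) * v x)) <= k * (LINT x|M. pen (w x - u0 x))"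
  by (simp only: right_diff_distrib mult.left_commute)
  have "La (?w n) = La w + ?t n * La v"
  by (simp only: W_dualD(1)[OF l W0_W01p[OF W] W0_W01p[OF W0_cmult[OF V]]] W_dualD(2)[OF l W0_W01p[OF V]])
  with min[OF Wn, of n] have "energy b g / p + k * (LINT x|M. pen (w x - u0 x)) + ?t n * La v <= energy b (?g n) / p + k * (LINT x|M. pen (?w n x - u0 x))"
  unfolding functional_def by linarith
  moreover have "energy b (?g n) / p <= energy b g / p + ?t n * (LINT x|M. b x (?g n x) \<bullet> h x)"
  using divide_right_mono[OF e, of p] p_pos unfolding diff_divide_distrib by simp
  ultimately have "?t n * La v <= ?t n * (LINT x|M. b x (?g n x) \<bullet> h x) + ?t n * (k * (LINT x|M. pen' (?w n x - u0 x) * v x))"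
  using pn by linarith
  hence "?t n * La v <= ?t n * ((LINT x|M. b x (?g n x) \<bullet> h x) + k * (LINT x|M. pen' (?w n x - u0 x) * v x))"
  by (simp only: distrib_left)
  thus ?thesis using t01(1)[of n] by (simp only: mult_le_cancel_left_pos)
  qed
  have "(%n. LINT x|M. b x (?g n x) \<bullet> h x) ----> (LINT x|M. b x (g x) \<bullet> h x)"
  proof (rule integral_dominated_convergence[where w = "%x. ka * (ka powr (p - 1) * (2 powr p * (norm (g x) powr p + norm (h x) powr p))) / q + norm (h x) powr p / p"])
  show "AE x in M. (%n. b x (?g n x) \<bullet> h x) ----> b x (g x) \<bullet> h x" using admissible_AE[OF adm]
  proof eventually_elim
  case (elim x)
  have c: "isCont (b x) (g x)" using admissible_vector_field.cont[OF elim] by (simp add: continuous_on_eq_continuous_at)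
  have "(%n. ?g n x) ----> g x + 0 *R h x" by (intro tendsto_intros t0)
  hence "(%n. ?g n x) ----> g x" by simp
  from tendsto_inner[OF isCont_tendsto_compose[OF c this] tendsto_const] show ?case .
  qed
  show "AE x in M. norm (b x (?g n x) \<bullet> h x) <= ka * (ka powr (p - 1) * (2 powr p * (norm (g x) powr p + norm (h x) powr p))) / q + norm (h x) powr p / p" for n
  using admissible_AE[OF adm]
  proof eventually_elim
  case (elim x)
  interpret admissible_vector_field p al ka om "b x" by (rule elim)
  have "norm (?g n x) powr p <= 2 powr p * (norm (g x) powr p + norm (?t n *R h x) powr p)" by (rule norm_powr_add_le[OF p_pos])
  also have "norm (?t n *R h x) <= norm (h x)"
  unfolding norm_scaleR using t01[of n] by (intro mult_left_le_one_le) auto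
  hence "2 powr p * (norm (g x) powr p + norm (?t n *R h x) powr p) <= 2 powr p * (norm (g x) powr p + norm (h x) powr p)"
  using p_pos by (intro mult_left_mono add_left_mono powr_mono2) auto
  finally have N: "norm (?g n x) powr p <= 2 powr p * (norm (g x) powr p + norm (h x) powr p)" .
  have "norm (b x (?g n x)) powr q <= ka * (b x (?g n x) \<bullet> ?g n x)" by (rule growth_q)
  also have "... <= ka * (ka powr (p - 1) * norm (?g n x) powr p)" using ka by (intro mult_left_mono energy_le) auto
  also have "... <= ka * (ka powr (p - 1) * (2 powr p * (norm (g x) powr p + norm (h x) powr p)))"
  using ka by (intro mult_left_mono N) auto
  finally have "norm (b x (?g n x)) powr q / q <= ka * (ka powr (p - 1) * (2 powr p * (norm (g x) powr p + norm (h x) powr p))) / q"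
  using q_pos by (intro divide_right_mono) auto
  thus ?case using Young_norm[OF p_gt_1, of "b x (?g n x)" "h x"] unfolding real_norm_def by linarith
  qed
  qed (use I1 LpD(2)[OF gL] LpD(2)[OF hL] Lp_inner_integrable[OF p_gt_1 admissible_Lp(1)[OF adm gL] hL] in auto)
  moreover have "(%n. LINT x|M. pen' (?w n x - u0 x) * v x) ----> (LINT x|M. pen' (w x - u0 x) * v x)"
  proof (rule integral_dominated_convergence[where w = "%x. \<bar>v x\<bar>"])
  have "(%n. pen' (?w n x - u0 x) * v x) ----> pen' (w x - u0 x) * v x" for x
  proof -
  have c: "isCont pen' (w x - u0 x)" using pen_continuous(2) by (simp add: continuous_on_eq_continuous_at)
  have "(%n. ?w n x - u0 x) ----> (w x + 0 * v x) - u0 x" by (intro tendsto_intros t0)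
  hence "(%n. ?w n x - u0 x) ----> w x - u0 x" by simp
  from tendsto_mult[OF isCont_tendsto_compose[OF c this] tendsto_const] show ?thesis .
  qed
  thus "AE x in M. (%n. pen' (?w n x - u0 x) * v x) ----> pen' (w x - u0 x) * v x" by (intro AE_I2)
  show "AE x in M. norm (pen' (?w n x - u0 x) * v x) <= \<bar>v x\<bar>" for n
  using pen'_bound by (intro AE_I2) (simp add: abs_mult mult_left_le_one_le del: of_nat_Suc)
  show "(%x. pen' (w x - u0 x) * v x) \<in> borel_measurable M"
  by (intro borel_measurable_times pen_measurable(2) LpD(1)[OF pL(1)] LpD(1)[OF vL])
  qed (use I2 Lp_integrable[OF vL less_imp_le[OF p_gt_1]] in auto)
  ultimately have "(%n. (LINT x|M. b x (?g n x) \<bullet> h x) + k * (LINT x|M. pen' (?w n x - u0 x) * v x)) ----> (LINT x|M. b x (g x) \<bullet> h x) + k * (LINT x|M. pen' (w x - u0 x) * v x)"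
  by (intro tendsto_intros)
  thus ?thesis by (rule LIMSEQ_le_const) (use quot in blast)
 qed
 have "La (%x. - v x) = - La v" using W_dualD(2)[OF l W0_W01p[OF V], of "-1"] by simp
 with ineq[OF V] ineq[OF W0_minus[OF V]] show ?thesis by simp
qed

corollary weak_solution_exists:
 assumes adm: "admissible Om p al ka om b" and al: "0 < al" and om: "!!n. 0 <= om n" and l: "La \<in> W_dual Om p"
 shows "\<exists>u. weak_solution Om p b La u"
proof -
 obtain w g where W: "W0 w g" and min: "!!v h. W0 v h ==> functional b 0 (%x. 0) La w g <= functional b 0 (%x. 0) La v h"
  by (rule functional_minimum[OF adm al om l Lp_0 order_refl]) (rule that)
 have "weak_solution Om p b La w"
  unfolding weak_solution_def
 proof (intro conjI ballI W0_W01p[OF W])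
  fix v assume v: "v \<in> W01p Om p"
  have "(LINT x|M. b x (\<nabla> w x) \<bullet> \<nabla> v x) = (LINT x|M. b x (g x) \<bullet> \<nabla> v x)"
  by (intro integral_cong_AE borel_measurable_inner admissible_measurable[OF adm] W0_measurable(2)[OF W0_wgrad[OF W0_W01p[OF W]]]
  W0_measurable(2)[OF W] W0_measurable(2)[OF W0_wgrad[OF v]]) (use W0_wgrad_AE[OF W] in \<open>eventually_elim, simp\<close>)
  also have "... = La v" using functional_Euler_Lagrange[OF adm l Lp_0 order_refl W min W0_wgrad[OF v]] by simp
  finally show "(LINT x|M. b x (\<nabla> w x) \<bullet> \<nabla> v x) = La v" .
 qed
 thus ?thesis by blast
qed

lemma weak_solution_iff:
 assumes m: "!!xi. (%x. b x xi) \<in> borel_measurable M" and c: "AE x in M. continuous_on UNIV (b x)" and W: "W0 u g"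
 shows "weak_solution Om p b f u \<longleftrightarrow> (\<forall>v h. W0 v h --> (LINT x|M. b x (g x) \<bullet> h x) = f v)"
proof -
 note bm = caratheodory_measurable[OF dom_sets m c]
 have eq: "(LINT x|M. b x (\<nabla> u x) \<bullet> \<nabla> v x) = (LINT x|M. b x (g x) \<bullet> h x)" if V: "W0 v h" for v h
  by (intro integral_cong_AE borel_measurable_inner bm W0_measurable(2)[OF W0_wgrad[OF W0_W01p[OF W]]]
  W0_measurable(2)[OF W] W0_measurable(2)[OF V] W0_measurable(2)[OF W0_wgrad[OF W0_W01p[OF V]]])
  (use W0_wgrad_AE[OF W] W0_wgrad_AE[OF V] in \<open>eventually_elim, simp\<close>)
 show ?thesis
 proof (intro iffI allI impI)
  fix v h assume "weak_solution Om p b f u" and V: "W0 v h"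
  thus "(LINT x|M. b x (g x) \<bullet> h x) = f v" using eq[OF V] W0_W01p[OF V] unfolding weak_solution_def by simp
 next
  assume "\<forall>v h. W0 v h --> (LINT x|M. b x (g x) \<bullet> h x) = f v"
  thus "weak_solution Om p b f u" unfolding weak_solution_def using eq[OF W0_wgrad] W0_wgrad W0_W01p[OF W] by simp
 qed
qed

end

section \<open>The second eigenvalue by two-piece functions\<close>

context bounded_domain
begin

definition mass :: "('a => real) => ('a => real) => real" where
 "mass si u = (LINT x|M. si x * \<bar>u x\<bar> powr p)"

definition weight :: "real => real => ('a => real) => bool" where
 "weight s1 s2 si \<longleftrightarrow> 0 < s1 & si \<in> borel_measurable M & (AE x in M. s1 <= si x & si x <= s2)"

lemma weightD: assumes "weight s1 s2 si"
 shows "0 < s1" "si \<in> borel_measurable M" "AE x in M. s1 <= si x" "AE x in M. si x <= s2"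
 using assms by (auto simp: weight_def elim: eventually_mono)

lemma weight_integrable:
 assumes w: "weight s1 s2 si" and f: "integrable M (f :: 'a => real)"
 shows "integrable M (%x. si x * f x)"
proof (rule Bochner_Integration.integrable_bound)
 show "integrable M (%x. s2 * f x)" using f by simp
 show "(%x. si x * f x) \<in> borel_measurable M" using weightD(2)[OF w] f by measurable
 show "AE x in M. norm (si x * f x) <= norm (s2 * f x)" using weightD(3)[OF w] weightD(4)[OF w]
  by eventually_elim (use weightD(1)[OF w] in \<open>auto simp: abs_mult intro!: mult_right_mono\<close>)
qed

lemma mass_integrable: "weight s1 s2 si ==> u \<in> Lp Om p ==> integrable M (%x. si x * \<bar>u x\<bar> powr p)"
 using weight_integrable LpD(2) by fastforce

lemma mass_bounds:
 assumes w: "weight s1 s2 si" and u: "u \<in> Lp Om p"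
 shows "s1 * (Np u) <= mass si u" "mass si u <= s2 * (Np u)" "0 <= mass si u"
proof -
 have "(LINT x|M. s1 * norm (u x) powr p) <= mass si u" unfolding mass_def
  by (intro integral_mono_AE integrable_mult_right LpD(2)[OF u] mass_integrable[OF w u])
  (use weightD(3)[OF w] in \<open>eventually_elim, auto intro: mult_right_mono\<close>)
 thus 1: "s1 * (Np u) <= mass si u" by simp
 have "mass si u <= (LINT x|M. s2 * norm (u x) powr p)" unfolding mass_def
  by (intro integral_mono_AE integrable_mult_right LpD(2)[OF u] mass_integrable[OF w u])
  (use weightD(4)[OF w] in \<open>eventually_elim, auto intro: mult_right_mono\<close>)
 thus "mass si u <= s2 * (Np u)" by simp
 have "0 <= s1 * (Np u)" using weightD(1)[OF w] by (intro mult_nonneg_nonneg) auto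
 thus "0 <= mass si u" using 1 by linarith
qed

lemma Lp_tendsto_powr_L1:
 assumes f: "Lp_tendsto Om p f F"
 shows "(%n. LINT x|M. \<bar>norm (f n x) powr p - norm (F x) powr p\<bar>) ----> 0"
proof (rule tendsto_subseq_subseq)
 fix s :: "nat => nat" assume s: "strict_mono s"
 obtain r D where r: "strict_mono r" and D: "integrable M D" "AE x in M. (%k. f (s (r k)) x) ----> F x"
  "AE x in M. \<forall>k. norm (f (s (r k)) x) powr p <= D x"
  by (rule Lp_tendsto_dominated_subseq[OF p_pos Lp_tendsto_subseq[OF f s]])
 note [measurable] = LpD(1)[OF Lp_tendstoD(1)[OF f]] LpD(1)[OF Lp_tendstoD(2)[OF f]]
 have "(%n. LINT x|M. \<bar>norm (f (s (r n)) x) powr p - norm (F x) powr p\<bar>) ----> (LINT x|M. 0)"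
 proof (rule integral_dominated_convergence[where w = "%x. D x + norm (F x) powr p"])
  show "AE x in M. (%n. \<bar>norm (f (s (r n)) x) powr p - norm (F x) powr p\<bar>) ----> 0" using D(2)
  proof eventually_elim
  case (elim x)
  have "(%n. norm (f (s (r n)) x) powr p) ----> norm (F x) powr p"
  using p_pos by (intro tendsto_powr' tendsto_norm elim tendsto_const) auto
  thus ?case by (simp add: LIM_zero tendsto_rabs_zero)
  qed
  show "AE x in M. norm \<bar>norm (f (s (r n)) x) powr p - norm (F x) powr p\<bar> <= D x + norm (F x) powr p" for n
  using D(3)
  proof eventually_elim
  case (elim x)
  have "norm (f (s (r n)) x) powr p <= D x" using elim by blast
  moreover have "0 <= norm (f (s (r n)) x) powr p" "0 <= norm (F x) powr p" by auto
  ultimately show ?case unfolding real_norm_def by linarith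
  qed
  show "integrable M (%x. D x + norm (F x) powr p)" using D(1) LpD(2)[OF Lp_tendstoD(2)[OF f]] by simp
 qed measurable
 thus "\<exists>r. strict_mono r & (%n. LINT x|M. \<bar>norm (f (s (r n)) x) powr p - norm (F x) powr p\<bar>) ----> 0" using r by auto
qed

text \<open>Uniform in the weights, which themselves converge only weakly-*.\<close>

lemma mass_diff_tendsto:
 assumes w: "!!n. weight s1 s2 (si n)" and u: "Lp_tendsto Om p u U"
 shows "(%n. mass (si n) (u n) - mass (si n) U) ----> 0"
proof (rule Lim_null_comparison)
 let ?d = "%n. LINT x|M. \<bar>norm (u n x) powr p - norm (U x) powr p\<bar>"
 show "(%n. s2 * ?d n) ----> 0" by (intro tendsto_mult_right_zero Lp_tendsto_powr_L1 u)
 show "\<forall>\<^sub>F n in sequentially. norm (mass (si n) (u n) - mass (si n) U) <= s2 * ?d n"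
 proof (intro always_eventually allI)
  fix n
  have I: "integrable M (%x. norm (u n x) powr p - norm (U x) powr p)"
  using LpD(2)[OF Lp_tendstoD(1)[OF u]] LpD(2)[OF Lp_tendstoD(2)[OF u]] by auto
  have "mass (si n) (u n) - mass (si n) U = (LINT x|M. si n x * (norm (u n x) powr p - norm (U x) powr p))"
  unfolding mass_def using mass_integrable[OF w[of n] Lp_tendstoD(1)[OF u, of n]] mass_integrable[OF w[of n] Lp_tendstoD(2)[OF u]]
  by (simp add: right_diff_distrib)
  also have "norm ... <= (LINT x|M. norm (si n x * (norm (u n x) powr p - norm (U x) powr p)))" by (rule integral_norm_bound)
  also have "... <= (LINT x|M. s2 * \<bar>norm (u n x) powr p - norm (U x) powr p\<bar>)"
  proof (rule integral_mono_AE)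
  show "integrable M (%x. norm (si n x * (norm (u n x) powr p - norm (U x) powr p)))" by (intro integrable_norm weight_integrable[OF w[of n] I])
  show "integrable M (%x. s2 * \<bar>norm (u n x) powr p - norm (U x) powr p\<bar>)" using I by simp
  show "AE x in M. norm (si n x * (norm (u n x) powr p - norm (U x) powr p)) <= s2 * \<bar>norm (u n x) powr p - norm (U x) powr p\<bar>"
  using weightD(3)[OF w[of n]] weightD(4)[OF w[of n]]
  by eventually_elim (use weightD(1)[OF w[of n]] in \<open>auto simp: abs_mult intro!: mult_right_mono\<close>)
  qed
  finally show "norm (mass (si n) (u n) - mass (si n) U) <= s2 * ?d n" by simp
 qed
qed

lemma mass_tendsto:
 assumes w: "weight s1 s2 si" and u: "Lp_tendsto Om p u U"
 shows "(%n. mass si (u n)) ----> mass si U"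
 using mass_diff_tendsto[of s1 s2 "%_. si", OF w u] by (simp add: LIM_zero_iff)

lemma mass_AE_cong: "u \<in> borel_measurable M ==> v \<in> borel_measurable M ==> si \<in> borel_measurable M ==> AE x in M. u x = v x ==> mass si u = mass si v"
 unfolding mass_def by (intro integral_cong_AE) (auto elim: eventually_mono)

lemma energy_AE_cong:
 assumes "admissible Om p al ka om b" "g \<in> borel_measurable M" "h \<in> borel_measurable M" "AE x in M. g x = h x"
 shows "energy b g = energy b h"
 unfolding energy_def
 by (intro integral_cong_AE borel_measurable_inner admissible_measurable[OF assms(1)] assms)
  (use assms(4) in \<open>eventually_elim, simp\<close>)

definition pos_grad :: "('a => real) => ('a => 'a) => 'a => 'a" where
 "pos_grad v g x = (if 0 < v x then g x else 0)"

text \<open>The energy of the positive piece; that of the negative piece is obtained from \<open>- v\<close>.\<close>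

definition pos_energy :: "('a => 'a => 'a) => ('a => real) => real" where
 "pos_energy b v = energy b (pos_grad v (\<nabla> v))"

definition pos_mass :: "('a => real) => ('a => real) => real" where
 "pos_mass si v = mass si (%x. max 0 (v x))"

lemma W0_pos_grad: "W0 v g ==> W0 (%x. max 0 (v x)) (pos_grad v g)"
 using W0_pos[of v g] by (simp add: pos_grad_def[abs_def])

lemma pos_energy_W0:
 assumes adm: "admissible Om p al ka om b" and W: "W0 v g"
 shows "pos_energy b v = energy b (pos_grad v g)"
 unfolding pos_energy_def
 by (rule energy_AE_cong[OF adm W0_measurable(2)[OF W0_pos_grad[OF W0_wgrad[OF W0_W01p[OF W]]]] W0_measurable(2)[OF W0_pos_grad[OF W]]])
  (use W0_wgrad_AE[OF W] in \<open>eventually_elim, simp add: pos_grad_def\<close>)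

lemma pos_energy_nonneg:
 assumes adm: "admissible Om p al ka om b"
 shows "0 <= energy b g"
 unfolding energy_def
 by (rule integral_nonneg_AE, rule eventually_mono[OF admissible_AE[OF adm]]) (erule admissible_vector_field.energy_nonneg)

lemma energy_split:
 assumes adm: "admissible Om p al ka om b" and W: "W0 v g"
 shows "energy b g = pos_energy b v + pos_energy b (%x. - v x)"
proof -
 have e: "pos_energy b v = energy b (pos_grad v g)" "pos_energy b (%x. - v x) = energy b (pos_grad (%x. - v x) (%x. - g x))"
  by (rule pos_energy_W0[OF adm W]) (rule pos_energy_W0[OF adm W0_minus[OF W]])
 note I = admissible_Lp(2)[OF adm W0_Lp(2)[OF W0_pos_grad[OF W]]] admissible_Lp(2)[OF adm W0_Lp(2)[OF W0_pos_grad[OF W0_minus[OF W]]]]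
 have "energy b g = (LINT x|M. b x (pos_grad v g x) \<bullet> pos_grad v g x + b x (pos_grad (%x. - v x) (%x. - g x) x) \<bullet> pos_grad (%x. - v x) (%x. - g x) x)"
  unfolding energy_def
 proof (rule integral_cong_AE)
  show "AE x in M. b x (g x) \<bullet> g x = b x (pos_grad v g x) \<bullet> pos_grad v g x + b x (pos_grad (%x. - v x) (%x. - g x) x) \<bullet> pos_grad (%x. - v x) (%x. - g x) x"
  using admissible_AE[OF adm] W0_grad_zero_set[OF W]
  proof eventually_elim
  case (elim x)
  interpret admissible_vector_field p al ka om "b x" by (rule elim)
  consider "0 < v x" | "v x = 0" | "v x < 0" by linarith
  thus ?case using elim(2) energy_even[of "g x"] by cases (auto simp: pos_grad_def zero)
  qed
 qed (use I admissible_Lp(2)[OF adm W0_Lp(2)[OF W]] in auto)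
 thus ?thesis using I by (simp add: e energy_def)
qed

lemma mass_split:
 assumes w: "weight s1 s2 si" and v: "W0 v g"
 shows "mass si v = pos_mass si v + pos_mass si (%x. - v x)"
proof -
 note I = mass_integrable[OF w W0_Lp(1)[OF W0_pos[OF v]]] mass_integrable[OF w W0_Lp(1)[OF W0_pos[OF W0_minus[OF v]]]]
 have "si x * \<bar>v x\<bar> powr p = si x * \<bar>max 0 (v x)\<bar> powr p + si x * \<bar>max 0 (- v x)\<bar> powr p" for x
  using p_pos by (auto simp: max_def)
 thus ?thesis unfolding mass_def pos_mass_def using I by simp
qed

lemma pos_mass_nonneg: "weight s1 s2 si ==> W0 v g ==> 0 <= pos_mass si v"
 unfolding pos_mass_def by (rule mass_bounds(3)[OF _ W0_Lp(1)[OF W0_pos]])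

text \<open>Truncation is continuous in \<open>W\<close>: where the limit vanishes, so does its gradient.\<close>

lemma pos_grad_tendsto:
 assumes W: "!!n. W0 (v n) (g n)" "W0 V G" and v: "Lp_tendsto Om p v V" and g: "Lp_tendsto Om p g G"
  and adm: "admissible Om p al ka om b"
 shows "(%n. energy b (pos_grad (v n) (g n))) ----> energy b (pos_grad V G)"
proof (rule tendsto_subseq_subseq)
 fix s :: "nat => nat" assume s: "strict_mono s"
 obtain r D where r: "strict_mono r" and D: "integrable M D" "AE x in M. (%k. v (s (r k)) x) ----> V x"
  "AE x in M. \<forall>k. norm (v (s (r k)) x) powr p <= D x"
  by (rule Lp_tendsto_dominated_subseq[OF p_pos Lp_tendsto_subseq[OF v s]])
 obtain r' D' where r': "strict_mono r'" and D': "integrable M D'" "AE x in M. (%k. g (s (r (r' k))) x) ----> G x"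
  "AE x in M. \<forall>k. norm (g (s (r (r' k))) x) powr p <= D' x"
  by (rule Lp_tendsto_dominated_subseq[OF p_pos Lp_tendsto_subseq[OF Lp_tendsto_subseq[OF g s] r]])
 let ?t = "%n. s (r (r' n))"
 have "Lp_tendsto Om p (%n. pos_grad (v (?t n)) (g (?t n))) (pos_grad V G)"
 proof (rule Lp_tendsto_dominated[OF p_pos W0_measurable(2)[OF W0_pos_grad[OF W(1)]] W0_measurable(2)[OF W0_pos_grad[OF W(2)]] D'(1)])
  show "AE x in M. (%n. pos_grad (v (?t n)) (g (?t n)) x) ----> pos_grad V G x"
  using D(2) D'(2) W0_grad_zero_set[OF W(2)]
  proof eventually_elim
  case (elim x)
  have vl: "(%n. v (?t n) x) ----> V x" using LIMSEQ_subseq_LIMSEQ[OF elim(1) r'] by (simp add: o_def)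
  consider "0 < V x" | "V x = 0" | "V x < 0" by linarith
  thus ?case
  proof cases
  case 1
  have "\<forall>\<^sub>F n in sequentially. g (?t n) x = pos_grad (v (?t n)) (g (?t n)) x"
  using order_tendstoD(1)[OF vl 1] by eventually_elim (simp add: pos_grad_def)
  from Lim_transform_eventually[OF elim(2) this] show ?thesis using 1 by (simp add: pos_grad_def)
  next
  case 2
  hence "(%n. g (?t n) x) ----> 0" using elim by simp
  hence "(%n. norm (g (?t n) x)) ----> 0" by (rule tendsto_norm_zero)
  hence "(%n. pos_grad (v (?t n)) (g (?t n)) x) ----> 0"
  by (rule Lim_null_comparison[rotated]) (auto simp: pos_grad_def)
  thus ?thesis using 2 by (simp add: pos_grad_def)
  next
  case 3
  have "\<forall>\<^sub>F n in sequentially. 0 = pos_grad (v (?t n)) (g (?t n)) x"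
  using order_tendstoD(2)[OF vl 3] by eventually_elim (simp add: pos_grad_def)
  from Lim_transform_eventually[OF tendsto_const this] show ?thesis using 3 by (simp add: pos_grad_def)
  qed
  qed
  show "AE x in M. norm (pos_grad (v (?t n)) (g (?t n)) x) powr p <= D' x" for n
  using D'(3)
  proof eventually_elim
  case (elim x)
  have "norm (pos_grad (v (?t n)) (g (?t n)) x) powr p <= norm (g (?t n) x) powr p" by (simp add: pos_grad_def)
  thus ?case using spec[OF elim, of n] by linarith
  qed
 qed
 from energy_tendsto[OF adm this]
 have "(%n. energy b (pos_grad (v (s ((r \<circ> r') n))) (g (s ((r \<circ> r') n))))) ----> energy b (pos_grad V G)" by simp
 thus "\<exists>r. strict_mono r & (%n. energy b (pos_grad (v (s (r n))) (g (s (r n))))) ----> energy b (pos_grad V G)"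
  using strict_mono_o[OF r r'] by blast
qed

lemma pos_part_tendsto:
 fixes v :: "nat => 'a => real"
 assumes "Lp_tendsto Om p v V"
 shows "Lp_tendsto Om p (%n x. max 0 (v n x)) (%x. max 0 (V x))"
proof (rule Lp_tendsto_Lipschitz_image[OF p_pos assms, where K = 1])
 have m: "(%x. max 0 (w x)) \<in> Lp Om p" if "w \<in> Lp Om p" for w :: "'a => real"
 proof (rule Lp_dominated[OF _ LpD(2)[OF that]])
  show "(%x. max 0 (w x)) \<in> borel_measurable M" using LpD(1)[OF that] by measurable
  show "AE x in M. norm (max 0 (w x)) powr p <= norm (w x) powr p" using p_pos by (intro AE_I2 powr_mono2) (auto simp: max_def)
 qed
 show "(%x. max 0 (v n x)) \<in> Lp Om p" for n by (rule m[OF Lp_tendstoD(1)[OF assms]])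
 show "(%x. max 0 (V x)) \<in> Lp Om p" by (rule m[OF Lp_tendstoD(2)[OF assms]])
qed (auto simp: max_def)

lemma second_eigenvalue_alt:
 assumes adm: "admissible Om p al ka om b"
 shows "second_eigenvalue Om p b si = (INF C \<in> C_family Om p 2. SUP v \<in> C. ereal (energy b (\<nabla> v) / mass si v))"
 unfolding second_eigenvalue_def
proof (intro INF_cong refl SUP_cong)
 fix C v assume "C \<in> C_family Om p 2" "v \<in> C"
 hence "v \<in> W01p Om p" by (auto simp: C_family_def)
 from energy_potential[OF adm W0_wgrad[OF this]]
 show "ereal ((LINT x|M. potential Om p b x (\<nabla> v x)) / (LINT x|M. si x * \<bar>v x\<bar> powr p)) = ereal (energy b (\<nabla> v) / mass si v)"
  by (simp add: mass_def)
qed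

lemma C_family_genus_1:
 assumes "C \<in> C_family Om p 2" shows "\<not> odd_map Om p C 1 h"
proof
 assume "odd_map Om p C 1 h"
 hence "genus Om p C <= enat 1" unfolding genus_def by (intro Inf_lower) blast
 moreover have "enat 2 <= genus Om p C" using assms by (simp add: C_family_def)
 ultimately have "enat 2 <= enat 1" by (rule order_trans[rotated])
 thus False by simp
qed

text \<open>If no function in \<open>C\<close> had both its pieces below the level \<open>mu\<close>, then exactly one piece would be,
 and recording which one is an odd continuous map to \<open>{-1, 1}\<close>.\<close>

theorem two_piece_of_second_eigenvalue:
 assumes adm: "admissible Om p al ka om b" and w: "weight s1 s2 si" and less: "second_eigenvalue Om p b si < ereal mu"
 obtains v where "v \<in> W01p Om p" "0 < pos_mass si v" "pos_energy b v < mu * pos_mass si v"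
  "0 < pos_mass si (%x. - v x)" "pos_energy b (%x. - v x) < mu * pos_mass si (%x. - v x)"
proof -
 define P where "P v \<longleftrightarrow> pos_energy b v < mu * pos_mass si v" for v
 obtain C where C: "C \<in> C_family Om p 2" "(SUP v \<in> C. ereal (energy b (\<nabla> v) / mass si v)) < ereal mu"
  using less unfolding second_eigenvalue_alt[OF adm] INF_less_iff by blast
 have CW: "v \<in> W01p Om p" if "v \<in> C" for v using that C(1) by (auto simp: C_family_def)
 have Cm: "(%x. - v x) \<in> C" if "v \<in> C" for v using that C(1) by (auto simp: C_family_def)
 have Pmass: "0 < pos_mass si v" if "P v" "W0 v g" for v g
 proof (rule ccontr)
  assume "\<not> ?thesis"
  hence "pos_mass si v = 0" using pos_mass_nonneg[OF w that(2)] by linarith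
  thus False using that(1) pos_energy_nonneg[OF adm] unfolding P_def pos_energy_def by (metis mult_zero_right not_less)
 qed
 have one: "P v \<or> P (%x. - v x)" if v: "v \<in> C" for v
 proof (rule ccontr)
  assume no: "\<not> ?thesis"
  note V = W0_wgrad[OF CW[OF v]]
  have "ereal (energy b (\<nabla> v) / mass si v) < ereal mu"
  by (rule le_less_trans[OF SUP_upper[OF v] C(2)])
  hence R: "energy b (\<nabla> v) / mass si v < mu" by simp
  have "mass si v ~= 0"
  proof
  assume "mass si v = 0"
  hence "s1 * (Np v) <= 0" using mass_bounds(1)[OF w W0_Lp(1)[OF V]] by linarith
  hence "(Np v) <= 0" using weightD(1)[OF w] by (simp add: mult_le_0_iff)
  hence "(Np v) = 0" using Lp_integral_nonneg[of Om v p] by linarith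
  hence "AE x in M. v x = 0" by (rule Lp_integral_eq_0[OF W0_Lp(1)[OF V]])
  thus False using v C(1) by (auto simp: C_family_def)
  qed
  hence "0 < mass si v" using mass_bounds(3)[OF w W0_Lp(1)[OF V]] by linarith
  hence "energy b (\<nabla> v) < mu * mass si v" using R by (simp add: divide_less_eq)
  thus False using no unfolding energy_split[OF adm V] mass_split[OF w V] P_def distrib_left by linarith
 qed
 show thesis
 proof (cases "\<exists>v\<in>C. P v & P (%x. - v x)")
  case True
  then obtain v where v: "v \<in> C" "P v" "P (%x. - v x)" by blast
  show thesis
  by (rule that[OF CW[OF v(1)]])
  (use v(2,3) Pmass[OF v(2) W0_wgrad[OF CW[OF v(1)]]] Pmass[OF v(3) W0_minus[OF W0_wgrad[OF CW[OF v(1)]]]] in \<open>auto simp: P_def\<close>)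
 next
  case False
  define h :: "('a => real) => nat => real" where "h v i = (if P v then 1 else -1)" for v i
  have open_P: "\<exists>d>0. \<forall>w\<in>C. W_dist Om p w v < d --> P w" if v: "v \<in> C" "P v" for v
  proof (rule ccontr)
  assume "\<not> ?thesis"
  hence neg: "!!d. d > 0 ==> \<exists>w\<in>C. W_dist Om p w v < d & \<not> P w" by blast
  have "\<forall>n. \<exists>w. w \<in> C & W_dist Om p w v < 1 / real (Suc n) & \<not> P w"
  proof
  fix n show "\<exists>w. w \<in> C & W_dist Om p w v < 1 / real (Suc n) & \<not> P w" using neg[of "1 / real (Suc n)"] by auto
  qed
  from choice[OF this] obtain u where u: "!!n. u n \<in> C" "!!n. W_dist Om p (u n) v < 1 / real (Suc n)" "!!n. \<not> P (u n)" by blast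
  note U = W0_wgrad[OF CW[OF u(1)]] and V = W0_wgrad[OF CW[OF v(1)]]
  have "(%n. W_dist Om p (u n) v) ----> 0"
  proof (rule tendsto_sandwich[of "%_. 0" _ _ "%n. 1 / real (Suc n)"])
  show "(%n. 1 / real (Suc n)) ----> 0" using LIMSEQ_inverse_real_of_nat by (simp add: inverse_eq_divide)
  show "\<forall>\<^sub>F n in sequentially. 0 <= W_dist Om p (u n) v" by (simp add: W_dist_def W_norm_def)
  show "\<forall>\<^sub>F n in sequentially. W_dist Om p (u n) v <= 1 / real (Suc n)" using u(2) by (intro always_eventually allI less_imp_le)
  qed simp
  hence L: "Lp_tendsto Om p u v" "Lp_tendsto Om p (%n. \<nabla> (u n)) (\<nabla> v)"
  using W_dist_tendsto[of u "%n. \<nabla> (u n)" v "\<nabla> v"] W0_weak_grad[OF U] W0_weak_grad[OF V] by blast+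
  have "(%n. pos_energy b (u n)) ----> pos_energy b v"
  unfolding pos_energy_def by (rule pos_grad_tendsto[OF U V L adm])
  moreover have "(%n. mu * pos_mass si (u n)) ----> mu * pos_mass si v"
  unfolding pos_mass_def by (intro tendsto_mult_left mass_tendsto[OF w] pos_part_tendsto L)
  ultimately have "mu * pos_mass si v <= pos_energy b v"
  by (rule tendsto_le[OF sequentially_bot]) (use u(3) in \<open>auto simp: P_def not_less\<close>)
  thus False using v(2) by (simp add: P_def)
  qed
  have mm: "P (%x. - (- v x)) \<longleftrightarrow> P v" for v by simp
  have "odd_map Om p C 1 h"
  unfolding odd_map_def
  proof (intro conjI ballI allI impI)
  fix u assume u: "u \<in> C"
  show "\<exists>i<1. h u i ~= 0" by (simp add: h_def)
  show "h (%x. - u x) i = - h u i" for i using one[OF u] False u by (auto simp: h_def)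
  fix e :: real assume e: "e > 0"
  show "\<exists>d>0. \<forall>v\<in>C. W_dist Om p v u < d --> (\<forall>i<1. \<bar>h v i - h u i\<bar> < e)"
  proof (cases "P u")
  case True
  from open_P[OF u True] obtain d where d: "d > 0" "\<forall>w\<in>C. W_dist Om p w u < d --> P w" by blast
  thus ?thesis using True e by (intro exI[of _ d]) (auto simp: h_def)
  next
  case nP: False
  hence "P (%x. - u x)" using one[OF u] by blast
  from open_P[OF Cm[OF u] this] obtain d where d: "d > 0" "\<forall>w\<in>C. W_dist Om p w (%x. - u x) < d --> P w" by blast
  have "\<not> P v" if v: "v \<in> C" "W_dist Om p v u < d" for v
  proof -
  note D = W0_diff[OF W0_wgrad[OF CW[OF v(1)]] W0_wgrad[OF CW[OF u]]]
  have "W_dist Om p (%x. - v x) (%x. - u x) = W_dist Om p v u"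
  using W_norm_eq[OF W0_weak_grad[OF D]] W_norm_eq[OF W0_weak_grad[OF W0_minus[OF D]]]
  by (simp add: W_dist_def abs_minus_commute norm_minus_commute)
  hence "P (%x. - v x)" using d(2) Cm[OF v(1)] v(2) by simp
  thus ?thesis using False v(1) by blast
  qed
  thus ?thesis using nP e d(1) by (intro exI[of _ d]) (auto simp: h_def)
  qed
  qed
  thus ?thesis using C_family_genus_1[OF C(1)] by blast
 qed
qed

text \<open>Conversely the two pieces of \<open>u\<close> span a circle, which is connected and hence of genus at
 least two, on which the quotient is a mean of those of the pieces.\<close>

theorem second_eigenvalue_le_two_piece:
 assumes adm: "admissible Om p al ka om b" and w: "weight s1 s2 si" and u: "u \<in> W01p Om p"
  and pos: "0 < pos_mass si u" "pos_energy b u <= mu * pos_mass si u"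
  and neg: "0 < pos_mass si (%x. - u x)" "pos_energy b (%x. - u x) <= mu * pos_mass si (%x. - u x)"
 shows "second_eigenvalue Om p b si <= ereal mu"
proof -
 define g where "g = \<nabla> u"
 have U: "W0 u g" unfolding g_def by (rule W0_wgrad[OF u])
 define up where "up x = max 0 (u x)" for x
 define um where "um x = max 0 (- u x)" for x
 define gp where "gp = pos_grad u g"
 define gm where "gm = pos_grad (%x. - u x) (%x. - g x)"
 have Wp: "W0 up gp" unfolding up_def gp_def by (rule W0_pos_grad[OF U])
 have Wm: "W0 um gm" unfolding um_def gm_def by (rule W0_pos_grad[OF W0_minus[OF U]])
 define ga where "ga t x = cos t * up x + sin t * um x" for t x
 define ga' where "ga' t x = cos t *R gp x + sin t *R gm x" for t x
 have Wga: "W0 (ga t) (ga' t)" for t unfolding ga_def ga'_def by (intro W0_add W0_cmult Wp Wm)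
 have energy_ga: "energy b (ga' t) = \<bar>cos t\<bar> powr p * pos_energy b u + \<bar>sin t\<bar> powr p * pos_energy b (%x. - u x)" for t
 proof -
  note I = admissible_Lp(2)[OF adm W0_Lp(2)[OF Wp]] admissible_Lp(2)[OF adm W0_Lp(2)[OF Wm]]
  have "energy b (ga' t) = (LINT x|M. \<bar>cos t\<bar> powr p * (b x (gp x) \<bullet> gp x) + \<bar>sin t\<bar> powr p * (b x (gm x) \<bullet> gm x))"
  unfolding energy_def
  proof (rule integral_cong_AE)
  show "AE x in M. b x (ga' t x) \<bullet> ga' t x = \<bar>cos t\<bar> powr p * (b x (gp x) \<bullet> gp x) + \<bar>sin t\<bar> powr p * (b x (gm x) \<bullet> gm x)"
  using admissible_AE[OF adm]
  proof eventually_elim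
  case (elim x)
  interpret admissible_vector_field p al ka om "b x" by (rule elim)
  consider "0 < u x" | "u x = 0" | "u x < 0" by linarith
  thus ?case using energy_scaleR[of "cos t" "g x"] energy_scaleR[of "sin t" "- g x"]
  by cases (auto simp: ga'_def gp_def gm_def pos_grad_def zero)
  qed
  qed (use I admissible_Lp(2)[OF adm W0_Lp(2)[OF Wga]] in auto)
  thus ?thesis using I pos_energy_W0[OF adm U] pos_energy_W0[OF adm W0_minus[OF U]] by (simp add: energy_def gp_def gm_def)
 qed
 have mass_ga: "mass si (ga t) = \<bar>cos t\<bar> powr p * pos_mass si u + \<bar>sin t\<bar> powr p * pos_mass si (%x. - u x)" for t
 proof -
  note I = mass_integrable[OF w W0_Lp(1)[OF Wp]] mass_integrable[OF w W0_Lp(1)[OF Wm]]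
  have "si x * \<bar>ga t x\<bar> powr p = \<bar>cos t\<bar> powr p * (si x * \<bar>up x\<bar> powr p) + \<bar>sin t\<bar> powr p * (si x * \<bar>um x\<bar> powr p)" for x
  proof (cases "0 < u x")
  case True thus ?thesis using p_pos by (auto simp: ga_def up_def um_def max_def abs_mult powr_mult)
  next
  case False
  hence "up x = 0" "um x = - u x" "0 <= - u x" by (auto simp: up_def um_def max_def)
  thus ?thesis using p_pos powr_mult[of "\<bar>sin t\<bar>" "\<bar>- u x\<bar>" p] by (simp add: ga_def abs_mult)
  qed
  thus ?thesis unfolding mass_def pos_mass_def using I by (simp add: up_def um_def)
 qed
 have mass_pos: "0 < mass si (ga t)" for t
 proof (cases "cos t = 0")
  case True
  hence "sin t ~= 0" using sin_cos_squared_add[of t] by auto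
  thus ?thesis unfolding mass_ga using pos neg by (intro add_nonneg_pos mult_pos_pos mult_nonneg_nonneg) auto
 next
  case False
  thus ?thesis unfolding mass_ga using pos neg by (intro add_pos_nonneg mult_pos_pos mult_nonneg_nonneg) auto
 qed
 have ga_conv: "Lp_tendsto Om p (%n. ga (t n)) (ga s)" "Lp_tendsto Om p (%n. ga' (t n)) (ga' s)" if t: "t ----> s" for t s
 proof -
  have "\<bar>cos r\<bar> powr p <= 1" "\<bar>sin r\<bar> powr p <= 1" for r :: real
  using powr_mono2[of p "\<bar>cos r\<bar>" 1] powr_mono2[of p "\<bar>sin r\<bar>" 1] p_pos by simp_all
  hence bound: "norm (cos r *R y + sin r *R z) powr p <= 2 powr p * (norm y powr p + norm z powr p)" for r :: real and y z :: "'b::real_normed_vector"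
  by (intro order_trans[OF norm_powr_add_le[OF p_pos]] mult_left_mono add_mono) (auto simp: powr_mult mult_left_le_one_le)
  show "Lp_tendsto Om p (%n. ga (t n)) (ga s)"
  proof (rule Lp_tendsto_dominated[OF p_pos W0_measurable(1)[OF Wga] W0_measurable(1)[OF Wga]])
  show "integrable M (%x. 2 powr p * (norm (up x) powr p + norm (um x) powr p))"
  using LpD(2)[OF W0_Lp(1)[OF Wp]] LpD(2)[OF W0_Lp(1)[OF Wm]] by simp
  show "AE x in M. (%n. ga (t n) x) ----> ga s x" unfolding ga_def by (intro AE_I2 tendsto_intros t)
  show "AE x in M. norm (ga (t n) x) powr p <= 2 powr p * (norm (up x) powr p + norm (um x) powr p)" for n
  using bound[of "t n" "up _" "um _"] by (intro AE_I2) (simp add: ga_def)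
  qed
  show "Lp_tendsto Om p (%n. ga' (t n)) (ga' s)"
  proof (rule Lp_tendsto_dominated[OF p_pos W0_measurable(2)[OF Wga] W0_measurable(2)[OF Wga]])
  show "integrable M (%x. 2 powr p * (norm (gp x) powr p + norm (gm x) powr p))"
  using LpD(2)[OF W0_Lp(2)[OF Wp]] LpD(2)[OF W0_Lp(2)[OF Wm]] by simp
  show "AE x in M. (%n. ga' (t n) x) ----> ga' s x" unfolding ga'_def by (intro AE_I2 tendsto_intros t)
  show "AE x in M. norm (ga' (t n) x) powr p <= 2 powr p * (norm (gp x) powr p + norm (gm x) powr p)" for n
  using bound[of "t n" "gp _" "gm _"] by (intro AE_I2) (simp add: ga'_def)
  qed
 qed
 define C where "C = {v \<in> W01p Om p. \<exists>t\<in>{0..2 * pi}. AE x in M. v x = ga t x}"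
 have CI: "ga t \<in> C" if "t \<in> {0..2 * pi}" for t using that W0_W01p[OF Wga] unfolding C_def by auto
 have C_W0: "\<exists>t. W0 v (ga' t) & (AE x in M. v x = ga t x)" if "v \<in> C" for v
 proof -
  from that obtain t where t: "v \<in> W01p Om p" "AE x in M. v x = ga t x" unfolding C_def by auto
  have "W0 v (ga' t)"
  by (rule W0_AE_cong[OF Wga[of t] W0_measurable(1)[OF W0_wgrad[OF t(1)]] W0_measurable(2)[OF Wga]])
  (use t(2) in \<open>auto elim: eventually_mono\<close>)
  thus ?thesis using t(2) by blast
 qed
 have sup: "(SUP v \<in> C. ereal (energy b (\<nabla> v) / mass si v)) <= ereal mu"
 proof (rule SUP_least)
  fix v assume "v \<in> C"
  then obtain t where t: "W0 v (ga' t)" "AE x in M. v x = ga t x" using C_W0 by blast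
  have e: "energy b (\<nabla> v) = energy b (ga' t)"
  by (rule energy_AE_cong[OF adm W0_measurable(2)[OF W0_wgrad[OF W0_W01p[OF t(1)]]] W0_measurable(2)[OF Wga] W0_wgrad_AE[OF t(1)]])
  have m: "mass si v = mass si (ga t)"
  by (rule mass_AE_cong[OF W0_measurable(1)[OF t(1)] W0_measurable(1)[OF Wga] weightD(2)[OF w] t(2)])
  have "energy b (ga' t) <= \<bar>cos t\<bar> powr p * (mu * pos_mass si u) + \<bar>sin t\<bar> powr p * (mu * pos_mass si (%x. - u x))"
  unfolding energy_ga using pos(2) neg(2) by (intro add_mono mult_left_mono) auto
  also have "... = mu * mass si (ga t)" unfolding mass_ga by (simp add: distrib_left mult.left_commute)
  finally show "ereal (energy b (\<nabla> v) / mass si v) <= ereal mu"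
  using mass_pos[of t] unfolding e m by (simp add: divide_le_eq)
 qed
 have "C \<in> C_family Om p 2"
  unfolding C_family_def
 proof (intro CollectI conjI ballI allI impI)
  show "C \<subseteq> W01p Om p" unfolding C_def by blast
 next
  fix v assume v: "v \<in> C"
  show "\<not> (AE x in M. v x = 0)"
  proof
  assume z: "AE x in M. v x = 0"
  obtain t where t: "W0 v (ga' t)" "AE x in M. v x = ga t x" using C_W0[OF v] by blast
  have "mass si (ga t) = mass si (%x. 0)"
  by (rule mass_AE_cong[OF W0_measurable(1)[OF Wga] _ weightD(2)[OF w]]) (use z t(2) in \<open>auto elim: eventually_elim2\<close>)
  thus False using mass_pos[of t] by (simp add: mass_def)
  qed
  obtain t where t: "v \<in> W01p Om p" "t \<in> {0..2 * pi}" "AE x in M. v x = ga t x" using v unfolding C_def by blast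
  have "\<exists>s\<in>{0..2 * pi}. cos s = - cos t & sin s = - sin t"
  proof (cases "t <= pi")
  case True thus ?thesis using t(2) by (intro bexI[of _ "t + pi"]) auto
  next
  case False thus ?thesis using t(2) by (intro bexI[of _ "t - pi"]) (auto simp: cos_diff sin_diff)
  qed
  then obtain s where s: "s \<in> {0..2 * pi}" "cos s = - cos t" "sin s = - sin t" by blast
  have "ga s x = - ga t x" for x by (simp add: ga_def s)
  hence "AE x in M. - v x = ga s x" using t(3) by (auto elim: eventually_mono)
  moreover have "(%x. - v x) \<in> W01p Om p" by (rule W0_W01p[OF W0_minus[OF W0_wgrad[OF t(1)]]])
  ultimately show "(%x. - v x) \<in> C" using s(1) unfolding C_def by blast
 next
  fix v u' assume A: "(\<forall>n. v n \<in> C) & u' \<in> W01p Om p & (%n. W_dist Om p (v n) u') ----> 0"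
  have vW: "v n \<in> W01p Om p" for n using A unfolding C_def by blast
  note U' = W0_wgrad[of u'] and V' = W0_wgrad[OF vW]
  have L: "Lp_tendsto Om p v u'"
  using W_dist_tendsto[of v "%n. \<nabla> (v n)" u' "\<nabla> u'"] W0_weak_grad[OF V'] W0_weak_grad[OF U'] A by blast
  have "\<forall>n. \<exists>t. t \<in> {0..2 * pi} & (AE x in M. v n x = ga t x)" using A unfolding C_def by blast
  from choice[OF this] obtain t where t: "!!n. t n \<in> {0..2 * pi}" "!!n. AE x in M. v n x = ga (t n) x" by blast
  obtain s r where s: "s \<in> {0..2 * pi}" "strict_mono r" "(t \<circ> r) ----> s"
  using compact_Icc[of 0 "2 * pi"] t(1) unfolding compact_eq_seq_compact_metric seq_compact_def by metis
  have "Lp_tendsto Om p (%n. ga ((t \<circ> r) n)) (ga s)" by (rule ga_conv(1)[OF s(3)])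
  moreover have "(LINT x|M. norm (ga (t (r n)) x - u' x) powr p) = (Nd (v (r n)) u')" for n
  proof (rule integral_cong_AE)
  show "AE x in M. norm (ga (t (r n)) x - u' x) powr p = norm (v (r n) x - u' x) powr p"
  using t(2)[of "r n"] by eventually_elim simp
  note [measurable] = LpD(1)[OF Lp_tendstoD(1)[OF L]] LpD(1)[OF Lp_tendstoD(2)[OF L]] W0_measurable(1)[OF Wga]
  show "(%x. norm (ga (t (r n)) x - u' x) powr p) \<in> borel_measurable M" "(%x. norm (v (r n) x - u' x) powr p) \<in> borel_measurable M"
  by measurable
  qed
  hence "Lp_tendsto Om p (%n. ga ((t \<circ> r) n)) u'"
  using Lp_tendsto_subseq[OF L s(2)] W0_Lp(1)[OF Wga] by (simp add: Lp_tendsto_def)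
  ultimately have "AE x in M. u' x = ga s x" by (rule Lp_tendsto_unique[OF p_pos, rotated])
  thus "u' \<in> C" using A s(1) unfolding C_def by blast
 next
  show "enat 2 <= genus Om p C"
  unfolding genus_def
  proof (rule Inf_greatest)
  fix z assume "z \<in> {enat m |m. \<exists>h. odd_map Om p C m h}"
  then obtain m h where z: "z = enat m" and h: "odd_map Om p C m h" by blast
  have C0: "ga 0 \<in> C" by (rule CI) simp
  have "m ~= 0" using h C0 unfolding odd_map_def by fastforce
  moreover have "m ~= 1"
  proof
  assume m: "m = 1"
  define f where "f t = h (ga t) 0" for t
  have fne: "f t ~= 0" if "t \<in> {0..2 * pi}" for t
  using h CI[OF that] unfolding odd_map_def m f_def by auto
  have "ga pi = (%x. - ga 0 x)" by (simp add: ga_def fun_eq_iff)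
  hence fpi: "f pi = - f 0" using h C0 unfolding odd_map_def m f_def by simp
  have cont: "continuous_on {0..pi} f"
  unfolding continuous_on_sequentially
  proof (intro ballI allI impI)
  fix t and s assume s: "s \<in> {0..pi}" and t: "(\<forall>n. t n \<in> {0..pi}) & t ----> s"
  have sub: "r \<in> {0..2 * pi}" if "r \<in> {0..pi}" for r using that by auto
  have D: "(%n. W_dist Om p (ga (t n)) (ga s)) ----> 0"
  using W_dist_tendsto[of "%n. ga (t n)" "%n. ga' (t n)" "ga s" "ga' s"] W0_weak_grad[OF Wga] ga_conv t by blast
  have sC: "ga s \<in> C" by (rule CI[OF sub[OF s]])
  have tC: "ga (t n) \<in> C" for n by (rule CI[OF sub]) (use t in blast)
  show "(f \<circ> t) ----> f s"
  proof (rule LIMSEQ_I)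
  fix e :: real assume "e > 0"
  then obtain d where d: "d > 0" "\<forall>v\<in>C. W_dist Om p v (ga s) < d --> (\<forall>i<1. \<bar>h v i - h (ga s) i\<bar> < e)"
  using h sC unfolding odd_map_def m by meson
  from order_tendstoD(2)[OF D d(1)] obtain N where "\<forall>n\<ge>N. W_dist Om p (ga (t n)) (ga s) < d"
  by (auto simp: eventually_sequentially)
  thus "\<exists>no. \<forall>n\<ge>no. norm ((f \<circ> t) n - f s) < e" using d(2) tC by (intro exI[of _ N]) (simp add: f_def)
  qed
  qed
  have "\<exists>t. 0 <= t & t <= pi & f t = 0"
  proof (cases "f 0 <= 0")
  case True
  thus ?thesis using IVT'[of f 0 0 pi] cont fpi by auto
  next
  case False
  thus ?thesis using IVT2'[of f pi 0 0] cont fpi by auto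
  qed
  then obtain t where "0 <= t" "t <= pi" "f t = 0" by blast
  thus False using fne[of t] by simp
  qed
  ultimately have "2 <= m" by linarith
  thus "enat 2 <= z" unfolding z by simp
  qed
 qed
 hence "second_eigenvalue Om p b si <= (SUP v \<in> C. ereal (energy b (\<nabla> v) / mass si v))"
  unfolding second_eigenvalue_alt[OF adm] by (rule INF_lower)
 thus ?thesis using sup by (rule order_trans)
qed

end

section \<open>Weak limits of solutions\<close>

lemma powr_absorb:
 assumes "1 < p" "0 <= X" "0 < al" "al * X <= L * X powr (1/p)"
 shows "X <= (L / al) powr conj_exp p"
proof (cases "X = 0")
 case False
 hence X: "0 < X" using assms(2) by simp
 let ?q = "conj_exp p"
 have q: "0 < ?q" using conj_exp_gt_1[OF assms(1)] by simp
 have "X = X powr (1/p) * X powr (1/?q)" using X conj_exp_reciprocal[OF assms(1)] by (simp flip: powr_add)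
 hence "(al * X powr (1/?q)) * X powr (1/p) <= L * X powr (1/p)" using assms(4) by (metis mult.assoc mult.commute)
 hence "al * X powr (1/?q) <= L" using X by (simp add: mult_le_cancel_right)
 hence "X powr (1/?q) <= L / al" using assms(3) by (simp add: pos_le_divide_eq mult.commute)
 hence "(X powr (1/?q)) powr ?q <= (L / al) powr ?q" using q by (intro powr_mono2) auto
 thus ?thesis using X q by (simp add: powr_powr)
qed simp

lemma powr_dual_Lp:
 fixes w :: "'a::euclidean_space => 'b::euclidean_space"
 assumes "1 < r" "w \<in> Lp Om r"
 shows "(%x. norm (w x) powr (r - 2) *R w x) \<in> Lp Om (conj_exp r)"
proof (rule Lp_dominated[OF _ LpD(2)[OF assms(2)]])
 show "(%x. norm (w x) powr (r - 2) *R w x) \<in> borel_measurable (leb Om)" using LpD(1)[OF assms(2)] by measurable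
 have "norm (norm (w x) powr (r - 2) *R w x) powr conj_exp r = norm (w x) powr r" for x
 proof -
  have "norm (norm (w x) powr (r - 2) *R w x) = norm (w x) powr (r - 1)"
  using powr_mult_base[of "norm (w x)" "r - 2"] by (simp add: mult.commute)
  thus ?thesis using conj_exp_mult[OF assms(1)] by (simp add: powr_powr)
 qed
 thus "AE x in leb Om. norm (norm (w x) powr (r - 2) *R w x) powr conj_exp r <= norm (w x) powr r" by simp
qed

context bounded_domain
begin

lemma conj_q: "conj_exp q = p" by (rule conj_exp_conj_exp[OF p_gt_1])

lemma test_mult_integrable:
 assumes "test_function Om ps" "integrable M (f :: 'a => real)" shows "integrable M (%x. ps x * f x)"
proof -
 obtain B where B: "0 < B" "!!x. \<bar>ps x\<bar> <= B" "!!x. norm (grad ps x) <= B" by (rule test_function_bounded[OF assms(1)]) (rule that)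
 show ?thesis
 proof (rule Bochner_Integration.integrable_bound)
  show "integrable M (%x. B * f x)" using assms(2) by simp
  show "(%x. ps x * f x) \<in> borel_measurable M" using LpD(1)[OF test_Lp(1)[OF assms(1) p_pos]] assms(2) by measurable
  show "AE x in M. norm (ps x * f x) <= norm (B * f x)"
  using B by (intro AE_I2) (simp add: abs_mult mult_right_mono)
 qed
qed

lemma test_Lp_mult:
 fixes f :: "'a => 'b::euclidean_space"
 assumes "test_function Om ps" "f \<in> Lp Om r" "0 < r" shows "(%x. ps x *R f x) \<in> Lp Om r"
proof -
 obtain B where B: "0 < B" "!!x. \<bar>ps x\<bar> <= B" "!!x. norm (grad ps x) <= B" by (rule test_function_bounded[OF assms(1)]) (rule that)
 show ?thesis by (rule Lp_bounded_scaleR[OF assms(3,2) LpD(1)[OF test_Lp(1)[OF assms(1,3)]] B(2)])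
qed

text \<open>Linearise \<open>|\<cdot>|\<^sup>r\<close> at the weak limit; test functions turn the integrated inequality into one almost everywhere.\<close>

lemma weak_limit_norm_le:
 fixes w :: "nat => 'a => 'b::euclidean_space"
 assumes r: "1 < r" and w: "!!n. w n \<in> Lp Om r" "w0 \<in> Lp Om r"
  and weak: "!!ph. ph \<in> Lp Om (conj_exp r) ==> (%n. LINT x|M. w n x \<bullet> ph x) ----> (LINT x|M. w0 x \<bullet> ph x)"
  and G: "!!n. integrable M (G n)" "integrable M G0" and le: "!!n. AE x in M. norm (w n x) powr r <= G n x"
  and lim: "!!ps. test_function Om ps ==> (%n. LINT x|M. ps x * G n x) ----> (LINT x|M. ps x * G0 x)"
 shows "AE x in M. norm (w0 x) powr r <= G0 x"
proof -
 have r0: "0 < r" using r by simp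
 note I0 = LpD(2)[OF w(2)]
 have "AE x in M. norm (w0 x) powr r - G0 x <= 0"
 proof (rule AE_nonpos_of_test[OF open_dom])
  show "integrable M (%x. norm (w0 x) powr r - G0 x)" using I0 G(2) by simp
  fix ps :: "'a => real" assume ps: "test_function Om ps" and ps0: "!!x. 0 <= ps x"
  define ph where "ph x = ps x *R (norm (w0 x) powr (r - 2) *R w0 x)" for x
  have ph: "ph \<in> Lp Om (conj_exp r)" unfolding ph_def
  using conj_exp_gt_1[OF r] by (intro test_Lp_mult ps powr_dual_Lp r w) simp
  have I: "integrable M (%x. v x \<bullet> ph x)" if "v \<in> Lp Om r" for v
  using Lp_inner_integrable[OF r ph that] by (simp add: inner_commute)
  have le': "(LINT x|M. ps x * norm (w0 x) powr r) + r * ((LINT x|M. w n x \<bullet> ph x) - (LINT x|M. w0 x \<bullet> ph x)) <= (LINT x|M. ps x * G n x)" for n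
  proof -
  have "(LINT x|M. ps x * norm (w0 x) powr r + r * (w n x \<bullet> ph x - w0 x \<bullet> ph x)) <= (LINT x|M. ps x * G n x)"
  proof (rule integral_mono_AE)
  show "AE x in M. ps x * norm (w0 x) powr r + r * (w n x \<bullet> ph x - w0 x \<bullet> ph x) <= ps x * G n x"
  using le[of n]
  proof eventually_elim
  case (elim x)
  have "ps x * norm (w0 x) powr r + r * (w n x \<bullet> ph x - w0 x \<bullet> ph x) =
  ps x * (norm (w0 x) powr r + r * ((norm (w0 x) powr (r - 2) *R w0 x) \<bullet> (w n x - w0 x)))"
  by (simp add: ph_def algebra_simps inner_commute)
  also have "... <= ps x * norm (w n x) powr r" by (intro mult_left_mono norm_powr_tangent r ps0)
  also have "... <= ps x * G n x" by (intro mult_left_mono elim ps0)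
  finally show ?case .
  qed
  qed (use test_mult_integrable[OF ps I0] test_mult_integrable[OF ps G(1)] I[OF w(1)] I[OF w(2)] in auto)
  thus ?thesis using test_mult_integrable[OF ps I0] I[OF w(1)] I[OF w(2)] by simp
  qed
  have "(%n. (LINT x|M. ps x * norm (w0 x) powr r) + r * ((LINT x|M. w n x \<bullet> ph x) - (LINT x|M. w0 x \<bullet> ph x)))
  ----> (LINT x|M. ps x * norm (w0 x) powr r) + r * ((LINT x|M. w0 x \<bullet> ph x) - (LINT x|M. w0 x \<bullet> ph x))"
  by (intro tendsto_intros weak ph)
  from LIMSEQ_le[OF this lim[OF ps]] le'
  have "(LINT x|M. ps x * norm (w0 x) powr r) <= (LINT x|M. ps x * G0 x)" by auto
  thus "(LINT x|M. ps x * (norm (w0 x) powr r - G0 x)) <= 0"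
  using test_mult_integrable[OF ps I0] test_mult_integrable[OF ps G(2)] by (simp add: right_diff_distrib)
 qed
 thus ?thesis by simp
qed

lemma weak_grad_tendsto:
 assumes W: "!!n. W0 (u n) (g n)" and K: "!!n. (Np (g n)) <= K"
  and U: "Lp_tendsto Om p u U" and H: "W0 U H" and w: "w \<in> Lp Om q"
 shows "(%n. LINT x|M. w x \<bullet> g n x) ----> (LINT x|M. w x \<bullet> H x)"
 using W0_weak_limit(2)[OF W K U W_dual_grad[OF w]]
 by (simp add: wgrad_inner_integral[OF W LpD(1)[OF w]] wgrad_inner_integral[OF H LpD(1)[OF w]])

text \<open>Linearise \<open>|\<cdot>|\<^sup>p\<close> at the limit gradient.\<close>

lemma W0_lsc:
 assumes W: "!!n. W0 (u n) (g n)" and U: "Lp_tendsto Om p u U" and H: "W0 U H"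
  and K: "!!n. (Np (g n)) <= c n" and c: "c ----> C"
 shows "(Np H) <= C"
proof -
 define w where "w x = norm (H x) powr (p - 2) *R H x" for x
 have w: "w \<in> Lp Om q" unfolding w_def by (rule powr_dual_Lp[OF p_gt_1 W0_Lp(2)[OF H]])
 obtain B where B: "!!n. c n <= B"
  using convergent_imp_Bseq[OF convergentI[OF c]] unfolding Bseq_def by (metis abs_le_iff real_norm_def)
 note I = Lp_inner_integrable[OF p_gt_1 w]
 have "(Np H) + p * ((LINT x|M. w x \<bullet> g n x) - (LINT x|M. w x \<bullet> H x)) <= c n" for n
 proof -
  have "(LINT x|M. norm (H x) powr p + p * (w x \<bullet> g n x - w x \<bullet> H x)) <= (Np (g n))"
  using norm_powr_tangent[OF p_gt_1, of "H x" "g n x" for x] LpD(2)[OF W0_Lp(2)[OF H]] LpD(2)[OF W0_Lp(2)[OF W]]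
  I[OF W0_Lp(2)[OF H]] I[OF W0_Lp(2)[OF W]]
  by (intro integral_mono) (auto simp: w_def inner_diff_right)
  thus ?thesis using K[of n] LpD(2)[OF W0_Lp(2)[OF H]] I[OF W0_Lp(2)[OF H]] I[OF W0_Lp(2)[OF W]] by simp
 qed
 moreover have "(%n. (Np H) + p * ((LINT x|M. w x \<bullet> g n x) - (LINT x|M. w x \<bullet> H x)))
  ----> (Np H) + p * ((LINT x|M. w x \<bullet> H x) - (LINT x|M. w x \<bullet> H x))"
  by (intro tendsto_intros weak_grad_tendsto[OF W order_trans[OF K B] U H w])
 ultimately show ?thesis using LIMSEQ_le[OF _ c] by auto
qed

text \<open>Every subsequence has a strongly convergent one, and test functions identify its limit.\<close>

lemma Lp_tendsto_of_weak:
 assumes W: "!!n. W0 (U n) (g n)" and K: "!!n. (Np (g n)) <= K" and u: "u \<in> W01p Om p"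
  and conv: "!!La. La \<in> W_dual Om p ==> (%n. La (U n)) ----> La u"
 shows "Lp_tendsto Om p U u"
 unfolding Lp_tendsto_def
proof (intro conjI allI)
 show "U n \<in> Lp Om p" for n by (rule W0_Lp(1)[OF W])
 show uL: "u \<in> Lp Om p" by (rule W0_Lp(1)[OF W0_wgrad[OF u]])
 show "(%n. LINT x|M. norm (U n x - u x) powr p) ----> 0"
 proof (rule tendsto_subseq_subseq)
  fix s :: "nat => nat" assume s: "strict_mono s"
  obtain r V where r: "strict_mono (r :: nat => nat)" and V: "Lp_tendsto Om p (%n. U (s (r n))) V"
  by (rule W0_Rellich[of "%n. U (s n)" "%n. g (s n)", OF W K])
  note VL = Lp_tendstoD(2)[OF V]
  have "AE x in M. V x - u x = 0"
  proof (rule AE_zero_of_test[OF open_dom])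
  show "integrable M (%x. V x - u x)" using p_gt_1 by (intro Lp_integrable[OF Lp_diff[OF p_pos VL uL]]) simp
  fix ps :: "'a => real" assume ps: "test_function Om ps"
  note psL = test_Lp(1)[OF ps q_pos]
  have "(%n. LINT x|M. ps x * U (s (r n)) x) ----> (LINT x|M. ps x * u x)"
  using LIMSEQ_subseq_LIMSEQ[OF conv[OF W_dual_fun[OF psL]] strict_mono_o[OF s r]] by (simp add: o_def)
  moreover have "(%n. (LINT x|M. ps x \<bullet> U (s (r n)) x) - (LINT x|M. ps x \<bullet> V x)) ----> 0"
  by (rule Lp_tendsto_weak[OF p_gt_1 V psL order_refl])
  hence "(%n. LINT x|M. ps x * U (s (r n)) x) ----> (LINT x|M. ps x * V x)" by (simp add: LIM_zero_iff)
  ultimately have "(LINT x|M. ps x * V x) = (LINT x|M. ps x * u x)" using LIMSEQ_unique by blast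
  thus "(LINT x|M. ps x *R (V x - u x)) = 0"
  using Lp_inner_integrable[OF p_gt_1 psL VL] Lp_inner_integrable[OF p_gt_1 psL uL] by (simp add: right_diff_distrib)
  qed
  hence "AE x in M. V x = u x" by simp
  from Lp_tendstoD(3)[OF Lp_tendsto_AE_cong[OF V LpD(1)[OF uL] this]] r
  show "\<exists>r. strict_mono r & (%n. LINT x|M. norm (U (s (r n)) x - u x) powr p) ----> 0" by blast
 qed
qed

lemma vanishing_pairing:
 fixes z V :: "nat => 'a => real"
 assumes z: "Lp_tendsto Om q z (%x. 0)" and V: "Lp_tendsto Om p V v"
 shows "(%n. LINT x|M. z n x * V n x) ----> 0"
proof -
 obtain K where K: "!!n. (LINT x|M. norm (z n x) powr q) <= K" by (rule Lp_tendsto_integral_bounded[OF q_pos z]) (rule that)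
 have "(%n. (LINT x|M. z n x \<bullet> V n x) - (LINT x|M. z n x \<bullet> v x)) ----> 0"
  by (rule Lp_tendsto_weak[OF p_gt_1 V Lp_tendstoD(1)[OF z] K])
 moreover have "v \<in> Lp Om (conj_exp q)" using Lp_tendstoD(2)[OF V] by (simp add: conj_q)
 from Lp_tendsto_weak[OF q_gt_1 z this order_refl]
 have "(%n. LINT x|M. z n x \<bullet> v x) ----> 0" by (simp add: mult.commute)
 ultimately have "(%n. ((LINT x|M. z n x \<bullet> V n x) - (LINT x|M. z n x \<bullet> v x)) + (LINT x|M. z n x \<bullet> v x)) ----> 0 + 0" by (rule tendsto_add)
 thus ?thesis by simp
qed

section \<open>Compensated compactness along G-converging sequences\<close>

text \<open>The perturbation \<open>z\<close> of the right-hand side is needed for minimisers of penalised problems, whose equations change with \<open>n\<close>.\<close>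

definition recovers :: "(nat => 'a => 'a => 'a) => ('a => 'a => 'a) => (('a => real) => real) => (nat => 'a => real) => (nat => 'a => real) => ('a => real) => bool" where
 "recovers b a f z U u \<longleftrightarrow> f \<in> W_dual Om p & Lp_tendsto Om q z (%x. 0) &
  (\<forall>n. weak_solution Om p (b n) (%v. f v + (LINT x|M. z n x * v x)) (U n)) & weak_solution Om p a f u &
  W01p_weakly_tendsto Om p U u sequentially &
  Lp_weakly_tendsto Om q (%n x. b n x (\<nabla> (U n) x)) (%x. a x (\<nabla> u x)) sequentially"

context
 fixes b a f z U u al ka om
 assumes adm: "!!n. admissible Om p al ka om (b n)" and al: "0 < al" and ka: "0 < ka" and rec: "recovers b a f z U u"
begin

lemma recovers_W0: "W0 (U n) (\<nabla> (U n))" "W0 u (\<nabla> u)"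
 using rec by (auto simp: recovers_def weak_solution_def intro: W0_wgrad)

lemma recovers_flux_Lp: "(%x. b n x (\<nabla> (U n) x)) \<in> Lp Om q" "(%x. a x (\<nabla> u x)) \<in> Lp Om q"
 using admissible_Lp(1)[OF adm W0_Lp(2)[OF recovers_W0(1)]] rec by (auto simp: recovers_def Lp_weakly_tendsto_def)

lemma recovers_test:
 assumes "W0 v h"
 shows "(LINT x|M. b n x (\<nabla> (U n) x) \<bullet> h x) = f v + (LINT x|M. z n x * v x)"
  "(LINT x|M. a x (\<nabla> u x) \<bullet> h x) = f v"
 using rec W0_W01p[OF assms] wgrad_inner_integral[OF assms LpD(1)[OF recovers_flux_Lp(1)]] wgrad_inner_integral[OF assms LpD(1)[OF recovers_flux_Lp(2)]]
 by (auto simp: recovers_def weak_solution_def)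

lemma recovers_bound:
 obtains K where "!!n. (Np (\<nabla> (U n))) <= K"
proof -
 obtain K where K: "0 <= K" "!!u g. W0 u g ==> \<bar>f u\<bar> <= K * (Np g) powr (1/p)"
  by (rule W_dual_bound[of f]) (use rec in \<open>auto simp: recovers_def\<close>)
 obtain C where C: "0 < C" "!!u g. W0 u g ==> (Np u) <= C * (Np g)"
  by (rule W0_Poincare) (rule that)
 have zL: "Lp_tendsto Om q z (%x. 0)" using rec by (simp add: recovers_def)
 obtain Z where Z: "!!n. (LINT x|M. norm (z n x) powr q) <= Z" by (rule Lp_tendsto_integral_bounded[OF q_pos zL]) (rule that)
 show thesis
 proof (rule that[of "((K + Z powr (1/q) * C powr (1/p)) / al) powr q"])
  fix n
  note W = recovers_W0(1)[of n]
  let ?X = "LINT x|M. norm (\<nabla> (U n) x) powr p"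
  have "\<bar>LINT x|M. z n x \<bullet> U n x\<bar> <= (LINT x|M. norm (z n x) powr q) powr (1/q) * (Np (U n)) powr (1/p)"
  by (rule Lp_Holder[OF p_gt_1 Lp_tendstoD(1)[OF zL] W0_Lp(1)[OF W]])
  also have "... <= Z powr (1/q) * (C * ?X) powr (1/p)"
  using Z C(2)[OF W] p_pos q_pos by (intro mult_mono powr_mono2) auto
  finally have z: "\<bar>LINT x|M. z n x * U n x\<bar> <= Z powr (1/q) * C powr (1/p) * ?X powr (1/p)" by (simp add: powr_mult mult.assoc)
  have "al * ?X <= energy (b n) (\<nabla> (U n))" by (rule energy_bounds(1)[OF adm W0_Lp(2)[OF W]])
  also have "... = f (U n) + (LINT x|M. z n x * U n x)" unfolding energy_def by (rule recovers_test(1)[OF W])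
  also have "... <= (K + Z powr (1/q) * C powr (1/p)) * ?X powr (1/p)" using z K(2)[OF W] by (simp add: distrib_right)
  finally show "?X <= ((K + Z powr (1/q) * C powr (1/p)) / al) powr q"
  by (intro powr_absorb p_gt_1 al) auto
 qed
qed

lemma recovers_Lp: "Lp_tendsto Om p U u"
proof -
 obtain K where K: "!!n. (Np (\<nabla> (U n))) <= K" by (rule recovers_bound) (rule that)
 show ?thesis
  by (rule Lp_tendsto_of_weak[OF recovers_W0(1) K]) (use rec in \<open>auto simp: recovers_def W01p_weakly_tendsto_def\<close>)
qed

lemma recovers_energy: "(%n. energy (b n) (\<nabla> (U n))) ----> energy a (\<nabla> u)"
proof -
 have "(%n. f (U n) + (LINT x|M. z n x * U n x)) ----> f u + 0"
  by (intro tendsto_add vanishing_pairing[OF _ recovers_Lp]) (use rec in \<open>auto simp: recovers_def W01p_weakly_tendsto_def\<close>)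
 thus ?thesis unfolding energy_def using recovers_test(1)[OF recovers_W0(1)] recovers_test(2)[OF recovers_W0(2)] by simp
qed

lemma recovers_flux_bound:
 obtains K where "!!n. (LINT x|M. norm (b n x (\<nabla> (U n) x)) powr q) <= K"
proof -
 obtain B where B: "!!n. energy (b n) (\<nabla> (U n)) <= B"
  using convergent_imp_Bseq[OF convergentI[OF recovers_energy]] unfolding Bseq_def by (metis abs_le_iff real_norm_def)
 show thesis
  by (rule that[of "ka * B"], rule order_trans[OF energy_bounds(3)[OF adm W0_Lp(2)[OF recovers_W0(1)]]])
  (use B ka in \<open>auto intro: mult_left_mono\<close>)
qed

text \<open>The divergence of the flux is compact and \<open>\<nabla>V\<^sub>n\<close> is curl free, so their product converges
 although both converge only weakly: test the equation with \<open>ps V\<^sub>n\<close>.\<close>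

theorem div_curl:
 assumes W: "!!n. W0 (V n) (H n)" and K: "!!n. (Np (H n)) <= K"
  and V: "Lp_tendsto Om p V v" and h: "W0 v h" and ps: "test_function Om ps"
 shows "(%n. LINT x|M. ps x * (b n x (\<nabla> (U n) x) \<bullet> H n x)) ----> (LINT x|M. ps x * (a x (\<nabla> u x) \<bullet> h x))"
proof -
 obtain B where B: "0 < B" "!!x. \<bar>ps x\<bar> <= B" "!!x. norm (grad ps x) <= B" by (rule test_function_bounded[OF ps]) (rule that)
 define bt where "bt n x = b n x (\<nabla> (U n) x)" for n x
 define bt0 where "bt0 x = a x (\<nabla> u x)" for x
 have btL: "bt n \<in> Lp Om q" "bt0 \<in> Lp Om q" for n unfolding bt_def bt0_def using recovers_flux_Lp by auto
 have fd: "f \<in> W_dual Om p" and zL: "Lp_tendsto Om q z (%x. 0)" using rec by (auto simp: recovers_def)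
 note Wps = W0_test_mult[OF W ps] and hps = W0_test_mult[OF h ps]
 have gm: "grad ps \<in> borel_measurable M" by (rule LpD(1)[OF test_Lp(2)[OF ps p_pos]])
 have cutL: "(%x. w x *R grad ps x) \<in> Lp Om p" if w: "w \<in> Lp Om p" for w :: "'a => real"
 proof (rule Lp_dominated)
  show "(%x. w x *R grad ps x) \<in> borel_measurable M" using gm LpD(1)[OF w] by measurable
  show "integrable M (%x. B powr p * norm (w x) powr p)" using LpD(2)[OF w] by simp
  have "norm (w x *R grad ps x) powr p <= B powr p * norm (w x) powr p" for x
  proof -
  have "norm (w x *R grad ps x) <= B * norm (w x)" using mult_left_mono[OF B(3)[of x], of "norm (w x)"] by (simp add: mult.commute)
  hence "norm (w x *R grad ps x) powr p <= (B * norm (w x)) powr p" using p_pos by (intro powr_mono2) auto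
  thus ?thesis by (simp add: powr_mult)
  qed
  thus "AE x in M. norm (w x *R grad ps x) powr p <= B powr p * norm (w x) powr p" by simp
 qed
 have psV: "Lp_tendsto Om p (%n x. ps x * V n x) (%x. ps x * v x)"
  by (rule Lp_tendsto_Lipschitz_image[OF p_pos V W0_Lp(1)[OF Wps] W0_Lp(1)[OF hps], where K = B])
  (use B(2) in \<open>simp add: abs_mult mult_right_mono flip: right_diff_distrib\<close>)
 have Vps: "Lp_tendsto Om p (%n x. V n x *R grad ps x) (%x. v x *R grad ps x)"
  by (rule Lp_tendsto_Lipschitz_image[OF p_pos V cutL[OF W0_Lp(1)[OF W]] cutL[OF W0_Lp(1)[OF h]], where K = B])
  (simp add: mult_right_mono[OF B(3)] mult.commute[of "\<bar>_\<bar>"] flip: scaleR_left_diff_distrib)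
 obtain K1 where K1: "!!n. (LINT x|M. norm (V n x *R grad ps x) powr p) <= K1" by (rule Lp_tendsto_integral_bounded[OF p_pos Vps]) (rule that)
 have bound: "(LINT x|M. norm (ps x *R H n x + V n x *R grad ps x) powr p) <= 2 powr p * (B powr p * K + K1)" for n
 proof -
  have "(LINT x|M. norm (ps x *R H n x) powr p) <= (LINT x|M. B powr p * norm (H n x) powr p)"
  using LpD(2)[OF test_Lp_mult[OF ps W0_Lp(2)[OF W] p_pos]] LpD(2)[OF W0_Lp(2)[OF W]] B p_pos
  by (intro integral_mono) (auto simp: powr_mult intro!: mult_right_mono powr_mono2)
  also have "... <= B powr p * K" using K by (simp add: mult_left_mono)
  finally have "(LINT x|M. norm (ps x *R H n x) powr p) <= B powr p * K" .
  hence "2 powr p * ((LINT x|M. norm (ps x *R H n x) powr p) + (LINT x|M. norm (V n x *R grad ps x) powr p)) <= 2 powr p * (B powr p * K + K1)"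
  using K1[of n] by (intro mult_left_mono add_mono) auto
  moreover have "(LINT x|M. norm (ps x *R H n x + V n x *R grad ps x) powr p) <=
  2 powr p * ((LINT x|M. norm (ps x *R H n x) powr p) + (LINT x|M. norm (V n x *R grad ps x) powr p))"
  by (rule Lp_integral_triangle[OF p_pos test_Lp_mult[OF ps W0_Lp(2)[OF W] p_pos] cutL[OF W0_Lp(1)[OF W]] W0_measurable(2)[OF Wps]])
  (rule AE_I2, rule norm_triangle_ineq)
  ultimately show ?thesis by linarith
 qed
 have "(%n. f (%x. ps x * V n x) + (LINT x|M. z n x * (ps x * V n x))) ----> f (%x. ps x * v x) + 0"
  by (intro tendsto_add vanishing_pairing[OF zL psV] W0_weak_limit(2)[OF Wps bound psV fd])
 hence T: "(%n. LINT x|M. bt n x \<bullet> (ps x *R H n x + V n x *R grad ps x)) ----> (LINT x|M. bt0 x \<bullet> (ps x *R h x + v x *R grad ps x))"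
  unfolding bt_def bt0_def using recovers_test(1)[OF Wps] recovers_test(2)[OF hps] by simp
 obtain K2 where K2: "!!n. (LINT x|M. norm (bt n x) powr q) <= K2" by (rule recovers_flux_bound) (rule that, simp add: bt_def)
 have "(%x. v x *R grad ps x) \<in> Lp Om (conj_exp q)" using cutL[OF W0_Lp(1)[OF h]] by (simp add: conj_q)
 hence S1: "(%n. LINT x|M. bt n x \<bullet> (v x *R grad ps x)) ----> (LINT x|M. bt0 x \<bullet> (v x *R grad ps x))"
  using rec by (auto simp: recovers_def Lp_weakly_tendsto_def bt_def bt0_def)
 have S2: "(%n. (LINT x|M. bt n x \<bullet> (V n x *R grad ps x)) - (LINT x|M. bt n x \<bullet> (v x *R grad ps x))) ----> 0"
  by (rule Lp_tendsto_weak[OF p_gt_1 Vps btL(1) K2])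
 from tendsto_add[OF S2 S1]
 have S: "(%n. LINT x|M. bt n x \<bullet> (V n x *R grad ps x)) ----> (LINT x|M. bt0 x \<bullet> (v x *R grad ps x))" by simp
 have split: "(LINT x|M. ga x \<bullet> (ps x *R k x + w x *R grad ps x)) - (LINT x|M. ga x \<bullet> (w x *R grad ps x)) = (LINT x|M. ps x * (ga x \<bullet> k x))"
  if "ga \<in> Lp Om q" "W0 w k" for ga w k
  using Lp_inner_integrable[OF p_gt_1 that(1) W0_Lp(2)[OF W0_test_mult[OF that(2) ps]]] Lp_inner_integrable[OF p_gt_1 that(1) cutL[OF W0_Lp(1)[OF that(2)]]]
  by (simp add: inner_add_right flip: Bochner_Integration.integral_diff)
 show ?thesis
  using tendsto_diff[OF T S] split[OF btL(1) W] split[OF btL(2) h] by (simp add: bt_def bt0_def)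
qed

end

end

text \<open>The inequalities of \<open>admissible_field\<close> at one pair of vectors.\<close>

definition compatible :: "real => real => real => (nat => real) => ('a::euclidean_space => 'a) => 'a => 'a => bool" where
 "compatible p al ka om B xi ze \<longleftrightarrow> al * norm xi powr p <= B xi \<bullet> xi &
  norm (B xi) powr conj_exp p <= ka * (B xi \<bullet> xi) &
  (\<forall>n. norm (xi - ze) powr p <= (1 / real (Suc n)) * (B xi \<bullet> xi + B ze \<bullet> ze) + om n * ((B xi - B ze) \<bullet> (xi - ze))) &
  B xi \<bullet> xi + p * (B xi \<bullet> (ze - xi)) <= B ze \<bullet> ze &
  B xi \<bullet> xi - p * (B xi \<bullet> (ze + xi)) <= B ze \<bullet> ze"

lemma admissible_field_compatible:
 "admissible_field p al ka om B \<longleftrightarrow> continuous_on UNIV B & (\<forall>xi ze. compatible p al ka om B xi ze)"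
 unfolding admissible_field_def compatible_def by blast

lemma compatible_closed:
 assumes p: "1 < p" and B: "continuous_on UNIV B" and X: "X ----> xi" and Z: "Z ----> ze"
  and c: "!!n::nat. compatible p al ka om B (X n) (Z n)"
 shows "compatible p al ka om B xi ze"
proof -
 have BX: "(%n. B (X n)) ----> B xi" and BZ: "(%n. B (Z n)) ----> B ze"
  using B X Z by (auto simp: continuous_on_eq_continuous_at intro: isCont_tendsto_compose)
 have q: "0 < conj_exp p" using conj_exp_gt_1[OF p] by simp
 have np: "(%n. norm (Y n) powr r) ----> norm y powr r" if "Y ----> y" "0 < r" for Y and y :: 'a and r
  using that(2) by (intro tendsto_powr' tendsto_norm that(1) tendsto_const) auto
 note T = tendsto_intros BX BZ X Z
 show ?thesis
  unfolding compatible_def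
 proof (intro conjI allI)
  show "al * norm xi powr p <= B xi \<bullet> xi"
  by (rule LIMSEQ_le[of "%n. al * norm (X n) powr p" _ "%n. B (X n) \<bullet> X n"])
  (use c p in \<open>auto simp: compatible_def intro!: tendsto_mult tendsto_const np tendsto_inner BX X\<close>)
  show "norm (B xi) powr conj_exp p <= ka * (B xi \<bullet> xi)"
  by (rule LIMSEQ_le[of "%n. norm (B (X n)) powr conj_exp p" _ "%n. ka * (B (X n) \<bullet> X n)"])
  (use c q in \<open>auto simp: compatible_def intro!: tendsto_mult tendsto_const np tendsto_inner BX X\<close>)
  show "norm (xi - ze) powr p <= (1 / real (Suc m)) * (B xi \<bullet> xi + B ze \<bullet> ze) + om m * ((B xi - B ze) \<bullet> (xi - ze))" for m
  proof (rule LIMSEQ_le)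
  show "(%n. norm (X n - Z n) powr p) ----> norm (xi - ze) powr p" using p by (intro np tendsto_diff X Z) simp
  show "(%n. (1 / real (Suc m)) * (B (X n) \<bullet> X n + B (Z n) \<bullet> Z n) + om m * ((B (X n) - B (Z n)) \<bullet> (X n - Z n)))
  ----> (1 / real (Suc m)) * (B xi \<bullet> xi + B ze \<bullet> ze) + om m * ((B xi - B ze) \<bullet> (xi - ze))" by (intro T)
  qed (use c in \<open>auto simp: compatible_def\<close>)
  show "B xi \<bullet> xi + p * (B xi \<bullet> (ze - xi)) <= B ze \<bullet> ze"
  proof (rule LIMSEQ_le)
  show "(%n. B (X n) \<bullet> X n + p * (B (X n) \<bullet> (Z n - X n))) ----> B xi \<bullet> xi + p * (B xi \<bullet> (ze - xi))" by (intro T)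
  show "(%n. B (Z n) \<bullet> Z n) ----> B ze \<bullet> ze" by (intro T)
  qed (use c in \<open>auto simp: compatible_def\<close>)
  show "B xi \<bullet> xi - p * (B xi \<bullet> (ze + xi)) <= B ze \<bullet> ze"
  proof (rule LIMSEQ_le)
  show "(%n. B (X n) \<bullet> X n - p * (B (X n) \<bullet> (Z n + X n))) ----> B xi \<bullet> xi - p * (B xi \<bullet> (ze + xi))" by (intro T)
  show "(%n. B (Z n) \<bullet> Z n) ----> B ze \<bullet> ze" by (intro T)
  qed (use c in \<open>auto simp: compatible_def\<close>)
 qed
qed

context bounded_domain
begin

text \<open>Subsequences are built in, because later arguments pass to them repeatedly.\<close>

definition G_solution :: "(nat => 'a => 'a => 'a) => ('a => 'a => 'a) => (('a => real) => real) => ('a => real) => bool" where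
 "G_solution b a f u \<longleftrightarrow> (\<forall>r z U. strict_mono r --> Lp_tendsto Om q z (%x. 0) -->
  (\<forall>n. weak_solution Om p (b (r n)) (%v. f v + (LINT x|M. z n x * v x)) (U n)) --> recovers (%n. b (r n)) a f z U u)"

definition G_limit :: "(nat => 'a => 'a => 'a) => ('a => 'a => 'a) => bool" where
 "G_limit b a \<longleftrightarrow> (\<forall>f \<in> W_dual Om p. \<exists>u. G_solution b a f u)"

lemma G_limit_subseq: "G_limit b a ==> strict_mono s ==> G_limit (%n. b (s n)) a"
 unfolding G_limit_def G_solution_def
proof (intro ballI, drule bspec, assumption, elim exE, intro exI allI impI)
 fix f u r z U
 assume s: "strict_mono s" and f: "\<forall>r z U. strict_mono r --> Lp_tendsto Om q z (%x. 0) -->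
  (\<forall>n. weak_solution Om p (b (r n)) (%v. f v + (LINT x|M. z n x * v x)) (U n)) --> recovers (%n. b (r n)) a f z U u"
  and r: "strict_mono (r :: nat => nat)" and z: "Lp_tendsto Om q z (%x. 0)"
  and U: "\<forall>n. weak_solution Om p (b (s (r n))) (%v. f v + (LINT x|M. z n x * v x)) (U n)"
 show "recovers (%n. b (s (r n))) a f z U u"
  using f[rule_format, of "s \<circ> r" z U] strict_mono_o[OF s r] z U by (simp add: o_def)
qed

context
 fixes b :: "nat => 'a => 'a => 'a" and a :: "'a => 'a => 'a" and al ka om
 assumes adm: "!!n. admissible Om p al ka om (b n)" and al: "0 < al" and ka: "0 < ka" and om: "!!n. 0 <= om n"
begin

lemma recovery_exists:
 assumes "f \<in> W_dual Om p" "G_solution b a f u"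
 obtains U where "recovers b a f (%n x. 0) U u"
proof -
 have "\<forall>n. \<exists>w. weak_solution Om p (b n) f w" using weak_solution_exists[OF adm al om assms(1)] by blast
 from choice[OF this] obtain U where U: "!!n. weak_solution Om p (b n) f (U n)" by blast
 have z0: "Lp_tendsto Om q (%n x. 0::real) (%x. 0)" by (rule Lp_tendsto_const[OF Lp_0])
 have "recovers (%n. b (id n)) a f (%n x. 0) U u"
  using assms(2)[unfolded G_solution_def, rule_format, of id "%n x. 0" U] U z0 by (simp add: strict_mono_def)
 thus thesis using that by simp
qed

lemma recovers_pair:
 assumes u: "recovers b a f z U u" and v: "recovers b a f' z' V v" and ps: "test_function Om ps"
 shows "(%n. LINT x|M. ps x * (pairing (b n) (U n) (V n) x))
  ----> (LINT x|M. ps x * (pairing a u v x))"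
proof -
 obtain K where K: "!!n. (Np (\<nabla> (V n))) <= K" by (rule recovers_bound[OF adm al ka v]) (rule that)
 show ?thesis
  by (rule div_curl[OF adm al ka u recovers_W0(1)[OF adm al ka v] K recovers_Lp[OF adm al ka v] recovers_W0(2)[OF adm al ka v] ps])
qed

text \<open>Every bound of a convex expression by products of fluxes and gradients survives in the limit.\<close>

lemma recovers_pair_inequality:
 fixes w :: "nat => 'a => 'b::euclidean_space"
 assumes u: "recovers b a f z U u" and v: "recovers b a f' z' V v"
  and r: "1 < r" and w: "!!n. w n \<in> Lp Om r" "w0 \<in> Lp Om r"
  and weak: "!!ph. ph \<in> Lp Om (conj_exp r) ==> (%n. LINT x|M. w n x \<bullet> ph x) ----> (LINT x|M. w0 x \<bullet> ph x)"
  and le: "!!n. AE x in M. norm (w n x) powr r <=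
  c1 * (pairing (b n) (U n) (U n) x) + c2 * (pairing (b n) (U n) (V n) x) +
  c3 * (pairing (b n) (V n) (U n) x) + c4 * (pairing (b n) (V n) (V n) x)"
 shows "AE x in M. norm (w0 x) powr r <=
  c1 * (pairing a u u x) + c2 * (pairing a u v x) +
  c3 * (pairing a v u x) + c4 * (pairing a v v x)"
proof (rule weak_limit_norm_le[OF r w weak _ _ le])
 note J = Lp_inner_integrable[OF p_gt_1]
 have I: "integrable M (%x. pairing (b n) (U n) (U n) x)"
  "integrable M (%x. pairing (b n) (U n) (V n) x)"
  "integrable M (%x. pairing (b n) (V n) (U n) x)"
  "integrable M (%x. pairing (b n) (V n) (V n) x)" for n
  by (intro J recovers_flux_Lp(1)[OF adm al ka u] recovers_flux_Lp(1)[OF adm al ka v]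
  W0_Lp(2)[OF recovers_W0(1)[OF adm al ka u]] W0_Lp(2)[OF recovers_W0(1)[OF adm al ka v]])+
 have I0: "integrable M (%x. pairing a u u x)" "integrable M (%x. pairing a u v x)"
  "integrable M (%x. pairing a v u x)" "integrable M (%x. pairing a v v x)"
  by (intro J recovers_flux_Lp(2)[OF adm al ka u] recovers_flux_Lp(2)[OF adm al ka v]
  W0_Lp(2)[OF recovers_W0(2)[OF adm al ka u]] W0_Lp(2)[OF recovers_W0(2)[OF adm al ka v]])+
 show "integrable M (%x. c1 * (pairing (b n) (U n) (U n) x) + c2 * (pairing (b n) (U n) (V n) x) +
  c3 * (pairing (b n) (V n) (U n) x) + c4 * (pairing (b n) (V n) (V n) x))" for n
  by (intro Bochner_Integration.integrable_add integrable_mult_right I)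
 show "integrable M (%x. c1 * (pairing a u u x) + c2 * (pairing a u v x) +
  c3 * (pairing a v u x) + c4 * (pairing a v v x))"
  by (intro Bochner_Integration.integrable_add integrable_mult_right I0)
 fix ps :: "'a => real" assume ps: "test_function Om ps"
 have lin: "(LINT x|M. ps x * (c1 * P1 x + c2 * P2 x + c3 * P3 x + c4 * P4 x)) =
  c1 * (LINT x|M. ps x * P1 x) + c2 * (LINT x|M. ps x * P2 x) + c3 * (LINT x|M. ps x * P3 x) + c4 * (LINT x|M. ps x * P4 x)"
  if "integrable M P1" "integrable M P2" "integrable M P3" "integrable M P4" for P1 P2 P3 P4
 proof -
  have e: "ps x * (c1 * P1 x + c2 * P2 x + c3 * P3 x + c4 * P4 x) =
  c1 * (ps x * P1 x) + c2 * (ps x * P2 x) + c3 * (ps x * P3 x) + c4 * (ps x * P4 x)" for x by (simp add: algebra_simps)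
  show ?thesis unfolding e using that[THEN test_mult_integrable[OF ps]] by simp
 qed
 show "(%n. LINT x|M. ps x * (c1 * (pairing (b n) (U n) (U n) x) + c2 * (pairing (b n) (U n) (V n) x) +
  c3 * (pairing (b n) (V n) (U n) x) + c4 * (pairing (b n) (V n) (V n) x)))
  ----> (LINT x|M. ps x * (c1 * (pairing a u u x) + c2 * (pairing a u v x) +
  c3 * (pairing a v u x) + c4 * (pairing a v v x)))"
  unfolding lin[OF I] lin[OF I0] by (intro tendsto_add tendsto_mult tendsto_const
  recovers_pair[OF u u ps] recovers_pair[OF u v ps] recovers_pair[OF v u ps] recovers_pair[OF v v ps])
qed

lemma G_solution_compatible:
 assumes f: "f \<in> W_dual Om p" "G_solution b a f u" and f': "f' \<in> W_dual Om p" "G_solution b a f' v"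
 shows "AE x in M. compatible p al ka om (a x) (\<nabla> u x) (\<nabla> v x)"
proof -
 obtain U where U: "recovers b a f (%n x. 0) U u" by (rule recovery_exists[OF f])
 obtain V where V: "recovers b a f' (%n x. 0) V v" by (rule recovery_exists[OF f'])
 note R = recovers_pair_inequality[OF U V]
 note UL = W0_Lp(2)[OF recovers_W0(1)[OF adm al ka U]] W0_Lp(2)[OF recovers_W0(2)[OF adm al ka U]]
 note VL = W0_Lp(2)[OF recovers_W0(1)[OF adm al ka V]] W0_Lp(2)[OF recovers_W0(2)[OF adm al ka V]]
 have wk: "(%n. LINT x|M. \<nabla> (W n) x \<bullet> ph x) ----> (LINT x|M. \<nabla> w x \<bullet> ph x)"
  if W: "recovers b a h z W w" and ph: "ph \<in> Lp Om q" for W w ph h z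
 proof -
  obtain K where K: "!!n. (Np (\<nabla> (W n))) <= K" by (rule recovers_bound[OF adm al ka W]) (rule that)
  show ?thesis
  using weak_grad_tendsto[OF recovers_W0(1)[OF adm al ka W] K recovers_Lp[OF adm al ka W] recovers_W0(2)[OF adm al ka W] ph]
  by (simp add: inner_commute)
 qed
 have c1: "AE x in M. norm (\<nabla> u x) powr p <= 1 / al * (pairing a u u x) + 0 * (pairing a u v x) +
  0 * (pairing a v u x) + 0 * (pairing a v v x)"
  by (rule R[OF p_gt_1 UL wk[OF U]], assumption, rule eventually_mono[OF admissible_AE[OF adm]])
  (drule admissible_vector_field.coercive, use al in \<open>simp add: pos_le_divide_eq mult.commute\<close>)
 have c2: "AE x in M. norm (a x (\<nabla> u x)) powr q <= ka * (pairing a u u x) + 0 * (pairing a u v x) +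
  0 * (pairing a v u x) + 0 * (pairing a v v x)"
 proof (rule R[OF q_gt_1 recovers_flux_Lp[OF adm al ka U]])
  show "AE x in M. norm (b n x (\<nabla> (U n) x)) powr q <= ka * (pairing (b n) (U n) (U n) x) + 0 * (pairing (b n) (U n) (V n) x) +
  0 * (pairing (b n) (V n) (U n) x) + 0 * (pairing (b n) (V n) (V n) x)" for n
  by (rule eventually_mono[OF admissible_AE[OF adm]]) (drule admissible_vector_field.growth_q, simp)
 qed (use U in \<open>simp add: recovers_def Lp_weakly_tendsto_def\<close>)
 have c3: "AE x in M. norm (\<nabla> u x - \<nabla> v x) powr p <= (1 / real (Suc m) + om m) * (pairing a u u x) + (- om m) * (pairing a u v x) +
  (- om m) * (pairing a v u x) + (1 / real (Suc m) + om m) * (pairing a v v x)" for m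
 proof (rule R[OF p_gt_1 Lp_diff[OF p_pos UL(1) VL(1)] Lp_diff[OF p_pos UL(2) VL(2)]])
  fix ph :: "'a => 'a" assume ph: "ph \<in> Lp Om q"
  have I: "integrable M (%x. w x \<bullet> ph x)" if "w \<in> Lp Om p" for w
  using Lp_inner_integrable[OF p_gt_1 ph that] by (simp add: inner_commute)
  show "(%n. LINT x|M. (\<nabla> (U n) x - \<nabla> (V n) x) \<bullet> ph x) ----> (LINT x|M. (\<nabla> u x - \<nabla> v x) \<bullet> ph x)"
  using tendsto_diff[OF wk[OF U ph] wk[OF V ph]] I UL VL by (simp add: inner_diff_left)
 next
  show "AE x in M. norm (\<nabla> (U n) x - \<nabla> (V n) x) powr p <= (1 / real (Suc m) + om m) * (pairing (b n) (U n) (U n) x) + (- om m) * (pairing (b n) (U n) (V n) x) +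
  (- om m) * (pairing (b n) (V n) (U n) x) + (1 / real (Suc m) + om m) * (pairing (b n) (V n) (V n) x)" for n
  using admissible_AE[OF adm[of n]]
  proof eventually_elim
  case (elim x)
  show ?case
  using admissible_vector_field.unif[OF elim, of "\<nabla> (U n) x" "\<nabla> (V n) x" m] by (simp add: inner_diff_left inner_diff_right algebra_simps)
  qed
 qed
 have z: "norm (0::'a) powr p = 0" using p_pos by simp
 have c4: "AE x in M. norm (0::'a) powr p <= (p - 1) * (pairing a u u x) + (- p) * (pairing a u v x) +
  0 * (pairing a v u x) + 1 * (pairing a v v x)"
 proof (rule R[OF p_gt_1 Lp_0 Lp_0])
  fix n show "AE x in M. norm (0::'a) powr p <= (p - 1) * (pairing (b n) (U n) (U n) x) + (- p) * (pairing (b n) (U n) (V n) x) +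
  0 * (pairing (b n) (V n) (U n) x) + 1 * (pairing (b n) (V n) (V n) x)"
  using admissible_AE[OF adm[of n]]
  proof eventually_elim
  case (elim x)
  show ?case
  using admissible_vector_field.subgrad[OF elim, of "\<nabla> (U n) x" "\<nabla> (V n) x"] by (simp add: inner_diff_right algebra_simps)
  qed
 qed simp
 have c5: "AE x in M. norm (0::'a) powr p <= (p - 1) * (pairing a u u x) + p * (pairing a u v x) +
  0 * (pairing a v u x) + 1 * (pairing a v v x)"
 proof (rule R[OF p_gt_1 Lp_0 Lp_0])
  fix n show "AE x in M. norm (0::'a) powr p <= (p - 1) * (pairing (b n) (U n) (U n) x) + p * (pairing (b n) (U n) (V n) x) +
  0 * (pairing (b n) (V n) (U n) x) + 1 * (pairing (b n) (V n) (V n) x)"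
  using admissible_AE[OF adm[of n]]
  proof eventually_elim
  case (elim x)
  show ?case
  using admissible_vector_field.subgrad_odd[OF elim, of "\<nabla> (U n) x" "\<nabla> (V n) x"] by (simp add: inner_add_right algebra_simps)
  qed
 qed simp
 have c3': "AE x in M. \<forall>m. norm (\<nabla> u x - \<nabla> v x) powr p <= (1 / real (Suc m) + om m) * (pairing a u u x) + (- om m) * (pairing a u v x) +
  (- om m) * (pairing a v u x) + (1 / real (Suc m) + om m) * (pairing a v v x)"
  unfolding AE_all_countable by (intro allI c3)
 show ?thesis
  using c1 c2 c3' c4 c5
 proof eventually_elim
  case (elim x)
  show ?case
  unfolding compatible_def
  proof (intro conjI allI)
  show "al * norm (\<nabla> u x) powr p <= pairing a u u x" using elim(1) al by (simp add: pos_le_divide_eq mult.commute)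
  show "norm (a x (\<nabla> u x)) powr q <= ka * (pairing a u u x)" using elim(2) by simp
  fix m show "norm (\<nabla> u x - \<nabla> v x) powr p <= (1 / real (Suc m)) * (pairing a u u x + pairing a v v x) +
  om m * ((a x (\<nabla> u x) - a x (\<nabla> v x)) \<bullet> (\<nabla> u x - \<nabla> v x))"
  using spec[OF elim(3), of m] by (simp add: inner_diff_left inner_diff_right algebra_simps)
  qed (use elim(4,5) z in \<open>simp_all add: inner_diff_right inner_add_right algebra_simps\<close>)
 qed
qed

end

end

section \<open>Density of the limit solutions\<close>

context bounded_domain
begin

text \<open>The tangent of the convex penalty at the limit is a bounded functional.\<close>

lemma pen_lsc:
 assumes V: "Lp_tendsto Om p v V" and u: "u \<in> Lp Om p" and le: "!!n. (LINT x|M. pen (v n x - u x)) <= c n" and c: "c ----> C"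
 shows "(LINT x|M. pen (V x - u x)) <= C"
proof -
 note VL = Lp_tendstoD(1,2)[OF V]
 define w where "w x = pen' (V x - u x)" for x
 have w: "w \<in> Lp Om q" unfolding w_def using LpD(1)[OF Lp_diff[OF p_pos VL(2) u]] q_pos by (intro pen'_Lp) auto
 note I = pen_integrable[OF Lp_diff[OF p_pos VL(1) u]] pen_integrable[OF Lp_diff[OF p_pos VL(2) u]]
  Lp_inner_integrable[OF p_gt_1 w VL(1), simplified] Lp_inner_integrable[OF p_gt_1 w VL(2), simplified]
 have "(LINT x|M. pen (V x - u x)) + ((LINT x|M. w x * v n x) - (LINT x|M. w x * V x)) <= c n" for n
 proof -
  have "(LINT x|M. pen (V x - u x) + (w x * v n x - w x * V x)) <= (LINT x|M. pen (v n x - u x))"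
  using I pen_tangent[of "V x - u x" "v n x - u x" for x] by (intro integral_mono) (auto simp: w_def algebra_simps)
  thus ?thesis using le[of n] I by simp
 qed
 moreover have "(%n. (LINT x|M. w x \<bullet> v n x) - (LINT x|M. w x \<bullet> V x)) ----> 0"
  by (rule Lp_tendsto_weak[OF p_gt_1 V w order_refl])
 hence "(%n. (LINT x|M. pen (V x - u x)) + ((LINT x|M. w x * v n x) - (LINT x|M. w x * V x))) ----> (LINT x|M. pen (V x - u x)) + 0"
  by (intro tendsto_add tendsto_const) simp
 ultimately show ?thesis using LIMSEQ_le[OF _ c] by auto
qed

lemma pen'_tendsto:
 assumes V: "Lp_tendsto Om p v V" and u: "u \<in> Lp Om p"
 shows "Lp_tendsto Om q (%n x. pen' (v n x - u x)) (%x. pen' (V x - u x))"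
 unfolding Lp_tendsto_def
proof (intro conjI allI)
 note VL = Lp_tendstoD(1,2)[OF V]
 show L: "(%x. pen' (v n x - u x)) \<in> Lp Om q" "(%x. pen' (V x - u x)) \<in> Lp Om q" for n
  using LpD(1)[OF Lp_diff[OF p_pos VL(1) u]] LpD(1)[OF Lp_diff[OF p_pos VL(2) u]] q_pos by (auto intro!: pen'_Lp)
 show "(%n. LINT x|M. norm (pen' (v n x - u x) - pen' (V x - u x)) powr q) ----> 0"
 proof (rule tendsto_subseq_subseq)
  fix s :: "nat => nat" assume s: "strict_mono s"
  obtain r D where r: "strict_mono r" and D: "AE x in M. (%k. v (s (r k)) x) ----> V x"
  by (rule Lp_tendsto_dominated_subseq[OF p_pos Lp_tendsto_subseq[OF V s]])
  have "Lp_tendsto Om q (%k x. pen' (v (s (r k)) x - u x)) (%x. pen' (V x - u x))"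
  proof (rule Lp_tendsto_dominated[OF q_pos LpD(1)[OF L(1)] LpD(1)[OF L(2)] integrable_const_dom[of 1]])
  show "AE x in M. (%k. pen' (v (s (r k)) x - u x)) ----> pen' (V x - u x)"
  using D
  proof eventually_elim
  case (elim x)
  have "isCont pen' (V x - u x)" using pen_continuous(2) by (simp add: continuous_on_eq_continuous_at)
  thus ?case by (rule isCont_tendsto_compose) (intro tendsto_diff elim tendsto_const)
  qed
  show "AE x in M. norm (pen' (v (s (r n)) x - u x)) powr q <= 1" for n
  using pen'_bound powr_mono2[of q "\<bar>pen' t\<bar>" 1 for t] q_pos by (intro AE_I2) simp
  qed
  from Lp_tendstoD(3)[OF this] r
  show "\<exists>r. strict_mono r & (%n. LINT x|M. norm (pen' (v (s (r n)) x - u x) - pen' (V x - u x)) powr q) ----> 0" by blast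
 qed
qed

lemma Lp_tendsto_offset:
 assumes "Lp_tendsto Om p (%n. w (n + k)) X" "!!n. w n \<in> Lp Om p" shows "Lp_tendsto Om p w X"
 using assms LIMSEQ_offset[of "%n. LINT x|M. norm (w n x - X x) powr p" k 0] by (simp add: Lp_tendsto_def)

lemma Rellich_diagonal:
 assumes W: "!!k n. W0 (w k n) (h k n)" and K: "!!k n. (LINT x|M. norm (h k n x) powr p) <= K"
 obtains r :: "nat => nat" and X :: "nat => 'a => real" where "strict_mono r" "!!k. Lp_tendsto Om p (%n. w k (r n)) (X k)"
proof -
 interpret subseqs "%k s. \<exists>X. Lp_tendsto Om p (%n. w k (s n)) X"
 proof
  fix k and s :: "nat => nat" assume "strict_mono s"
  obtain r U where "strict_mono (r :: nat => nat)" "Lp_tendsto Om p (%n. w k (s (r n))) U"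
  by (rule W0_Rellich[of "%n. w k (s n)" "%n. h k (s n)", OF W K])
  thus "\<exists>r. strict_mono r & (\<exists>X. Lp_tendsto Om p (%n. w k ((s \<circ> r) n)) X)" by (auto simp: o_def)
 qed
 have "\<forall>k. \<exists>X. Lp_tendsto Om p (%n. w k (diagseq n)) X"
 proof
  fix k
  have "\<exists>X. Lp_tendsto Om p (%n. w k ((diagseq \<circ> (+) (Suc k)) n)) X"
  proof (rule diagseq_holds)
  fix r s :: "nat => nat" and n assume "strict_mono r" "\<exists>X. Lp_tendsto Om p (%m. w n (s m)) X"
  thus "\<exists>X. Lp_tendsto Om p (%m. w n ((s \<circ> r) m)) X" using Lp_tendsto_subseq by fastforce
  qed
  then obtain X where "Lp_tendsto Om p (%n. w k (diagseq (n + Suc k))) X" by (auto simp: o_def add.commute)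
  from Lp_tendsto_offset[of "%n. w k (diagseq n)", OF this W0_Lp(1)[OF W]]
  show "\<exists>X. Lp_tendsto Om p (%n. w k (diagseq n)) X" by blast
 qed
 from choice[OF this] show thesis using that[OF subseq_diagseq] by blast
qed

context
 fixes b :: "nat => 'a => 'a => 'a" and a :: "'a => 'a => 'a" and al ka om
 assumes adm: "!!n. admissible Om p al ka om (b n)" and al: "0 < al" and ka: "0 < ka" and om: "!!n. 0 <= om n"
  and G: "G_limit b a"
begin

text \<open>Minimise \<open>energy (b n) / p + k \<integral>pen(w - u)\<close>.  The minimisers solve equations whose right-hand
 sides converge strongly as \<open>n \<rightarrow> \<infinity>\<close>, so their limits solve the limit equation; since the minimal
 values increase with \<open>k\<close> to a finite limit, uniform convexity makes the limits converge strongly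
 in \<open>W\<close>, and the penalty forces the limit to be \<open>u\<close>.\<close>

theorem limit_solutions_dense:
 assumes u: "u \<in> W01p Om p"
 obtains f v where "!!k::nat. f k \<in> W_dual Om p" "!!k. G_solution b a (f k) (v k)" "Lp_tendsto Om p (%k. \<nabla> (v k)) (\<nabla> u)"
proof -
 note Wu = W0_wgrad[OF u]
 note uL = W0_Lp(1)[OF Wu]
 let ?g = "\<nabla> u"
 have zd: "(%v. 0) \<in> W_dual Om p" using W_dual_fun[of "%x. 0"] by simp
 define J where "J n k = functional (b n) (real k) u (%_. 0)" for n k
 have "\<forall>i. \<exists>wh. W0 (fst wh) (snd wh) & (\<forall>v h'. W0 v h' --> J (snd i) (fst i) (fst wh) (snd wh) <= J (snd i) (fst i) v h')"
 proof
  fix i :: "nat \<times> nat"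
  obtain w h where "W0 w h" "!!v h'. W0 v h' ==> J (snd i) (fst i) w h <= J (snd i) (fst i) v h'"
  by (rule functional_minimum[OF adm[of "snd i"] al om zd uL, of "real (fst i)"]) (simp, rule that, auto simp: J_def)
  thus "\<exists>wh. W0 (fst wh) (snd wh) & (\<forall>v h'. W0 v h' --> J (snd i) (fst i) (fst wh) (snd wh) <= J (snd i) (fst i) v h')"
  by (intro exI[of _ "(w, h)"]) simp
 qed
 from choice[OF this] obtain wh where wh: "!!i. W0 (fst (wh i)) (snd (wh i))"
  "!!i v h'. W0 v h' ==> J (snd i) (fst i) (fst (wh i)) (snd (wh i)) <= J (snd i) (fst i) v h'" by blast
 define w where "w k n = fst (wh (k, n))" for k n
 define h where "h k n = snd (wh (k, n))" for k n
 define m where "m k n = J n k (w k n) (h k n)" for k n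
 have W: "W0 (w k n) (h k n)" for k n using wh(1)[of "(k, n)"] by (simp add: w_def h_def)
 have min: "m k n <= J n k v h'" if "W0 v h'" for k n v h' using wh(2)[OF that, of "(k, n)"] by (simp add: m_def w_def h_def)
 define E where "E = ka powr (p - 1) * (LINT x|M. norm (?g x) powr p) / p"
 have m_le: "m k n <= E" for k n
 proof -
  have "m k n <= J n k u ?g" by (rule min[OF Wu])
  also have "... = energy (b n) ?g / p" by (simp add: J_def functional_def pen_def)
  also have "... <= E" unfolding E_def using p_pos energy_bounds(2)[OF adm W0_Lp(2)[OF Wu]] by (intro divide_right_mono) auto
  finally show ?thesis .
 qed
 have m_eq: "m k n = energy (b n) (h k n) / p + real k * (LINT x|M. pen (w k n x - u x))" for k n by (simp add: m_def J_def functional_def)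
 have pen0: "0 <= (LINT x|M. pen (v x - u x))" for v by (simp add: pen_nonneg)
 have en0: "0 <= energy (b n) g" for n g by (rule pos_energy_nonneg[OF adm])
 have e1: "energy (b n) (h k n) <= p * E" for k n
 proof -
  have "energy (b n) (h k n) / p <= E" using m_le[of k n] m_eq[of k n] pen0[of "w k n"] by (smt (verit) mult_nonneg_nonneg of_nat_0_le_iff)
  thus ?thesis using p_pos by (simp add: pos_divide_le_eq mult.commute)
 qed
 have e2: "real k * (LINT x|M. pen (w k n x - u x)) <= E" for k n
  using m_le[of k n] m_eq[of k n] divide_nonneg_pos[OF en0 p_pos, of n "h k n"] by linarith
 have m0: "0 <= m k n" for k n
  using m_eq[of k n] divide_nonneg_pos[OF en0 p_pos, of n "h k n"] mult_nonneg_nonneg[OF of_nat_0_le_iff pen0, of k "w k n"] by linarith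
 have hb: "(LINT x|M. norm (h k n x) powr p) <= p * E / al" for k n
  using order_trans[OF energy_bounds(1)[OF adm W0_Lp(2)[OF W]] e1] al by (simp add: pos_le_divide_eq mult.commute)
 have J_mono: "J n k v g <= J n l v g" if "k <= l" for n k l v g
  unfolding J_def functional_def using that pen0[of v] by (simp add: mult_right_mono)
 have m_mono: "m k n <= m l n" if "k <= l" for k l n
  using order_trans[OF min[OF W[of l n], of k n] J_mono[OF that]] by (simp add: m_def)
 obtain r0 X0 where r0: "strict_mono r0" and X0: "!!k. Lp_tendsto Om p (%n. w k (r0 n)) (X0 k)" by (rule Rellich_diagonal[of w h, OF W hb]) (rule that)
 have mb: "\<exists>K. \<forall>n. \<bar>m k (r0 n)\<bar> <= K" for k using m_le m0 by (intro exI[of _ E]) auto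
 obtain r1 where r1: "strict_mono r1" and mc: "!!k::nat. convergent (%n. m k (r0 (r1 n)))"
  by (rule bounded_real_diagonal[of "%k n. m k (r0 n)", OF mb]) (rule that)
 define r where "r = r0 \<circ> r1"
 have r: "strict_mono r" unfolding r_def by (rule strict_mono_o[OF r0 r1])
 have X: "Lp_tendsto Om p (%n. w k (r n)) (X0 k)" for k using Lp_tendsto_subseq[OF X0 r1] by (simp add: r_def)
 have "\<forall>k. \<exists>L. (%n. m k (r n)) ----> L" using mc by (simp add: convergent_def r_def)
 from choice[OF this] obtain mu where mu: "!!k. (%n. m k (r n)) ----> mu k" by blast
 define ze where "ze k x = - real k * pen' (X0 k x - u x)" for k x
 define f where "f k v = (LINT x|M. ze k x * v x)" for k and v :: "'a => real"
 have penL: "(%x. pen' (v x - u x)) \<in> Lp Om q" if "v \<in> Lp Om p" for v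
  using LpD(1)[OF Lp_diff[OF p_pos that uL]] q_pos by (intro pen'_Lp) auto
 have zeL: "ze k \<in> Lp Om q" for k unfolding ze_def by (intro Lp_mult penL Lp_tendstoD(2)[OF X])
 have fd: "f k \<in> W_dual Om p" for k unfolding f_def using W_dual_fun[OF zeL] .
 have "\<forall>k. \<exists>v. G_solution b a (f k) v" using G fd by (simp add: G_limit_def)
 from choice[OF this] obtain v where v: "!!k. G_solution b a (f k) (v k)" by blast
 define z where "z k n x = - real k * (pen' (w k (r n) x - u x) - pen' (X0 k x - u x))" for k n x
 have zL: "Lp_tendsto Om q (z k) (%x. 0)" for k
  using Lp_tendsto_mult[OF Lp_tendsto_diff[OF q_pos pen'_tendsto[OF X[of k] uL] Lp_tendsto_const[OF penL[OF Lp_tendstoD(2)[OF X[of k]]]]], of "- real k"] by (simp add: z_def[abs_def])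
 have sol: "weak_solution Om p (b (r n)) (%v. f k v + (LINT x|M. z k n x * v x)) (w k (r n))" for k n
 proof -
  have ae: "AE x in M. continuous_on UNIV (b (r n) x)"
  by (rule eventually_mono[OF admissible_AE[OF adm]]) (erule admissible_vector_field.cont)
  show ?thesis
  proof (subst weak_solution_iff[OF _ ae W], use adm[of "r n"] in \<open>simp add: admissible_def\<close>, intro allI impI)
  fix v' h' assume V: "W0 v' h'"
  have "(LINT x|M. b (r n) x (h k (r n) x) \<bullet> h' x) + real k * (LINT x|M. pen' (w k (r n) x - u x) * v' x) = 0"
  by (rule functional_Euler_Lagrange[OF adm zd uL _ W _ V]) (use min in \<open>auto simp: J_def m_def\<close>)
  moreover have "f k v' + (LINT x|M. z k n x * v' x) = - (real k * (LINT x|M. pen' (w k (r n) x - u x) * v' x))"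
  proof -
  have "f k v' + (LINT x|M. z k n x * v' x) = (LINT x|M. ze k x * v' x + z k n x * v' x)" unfolding f_def
  using Lp_inner_integrable[OF p_gt_1 zeL W0_Lp(1)[OF V]] Lp_inner_integrable[OF p_gt_1 Lp_tendstoD(1)[OF zL] W0_Lp(1)[OF V]] by simp
  also have "... = (LINT x|M. - real k * (pen' (w k (r n) x - u x) * v' x))" by (simp add: ze_def z_def algebra_simps)
  finally show ?thesis by simp
  qed
  ultimately show "(LINT x|M. b (r n) x (h k (r n) x) \<bullet> h' x) = f k v' + (LINT x|M. z k n x * v' x)" by linarith
  qed
 qed
 have rec: "recovers (%n. b (r n)) a (f k) (z k) (%n. w k (r n)) (v k)" for k
  using v[of k, unfolded G_solution_def, rule_format, OF r zL sol] .
 have Wv: "W0 (v k) (\<nabla> (v k))" for k by (rule recovers_W0(2)[OF adm al ka rec])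
 have Lv: "Lp_tendsto Om p (%n. w k (r n)) (v k)" for k by (rule recovers_Lp[OF adm al ka rec])
 have gap: "(Nd (\<nabla> (v k)) (\<nabla> (v l))) <=
  2 powr p * ((1 / real (Suc N)) * (2 * p * E) + om N * (4 / p) * (p * ((mu l - mu k) / 2)))" if kl: "k <= l" for k l N
 proof (rule W0_lsc[OF W0_diff[OF W W] Lp_tendsto_diff[OF p_pos Lv Lv] W0_diff[OF Wv Wv]])
  show "(%n. 2 powr p * ((1 / real (Suc N)) * (2 * p * E) + om N * (4 / p) * (p * ((m l (r n) - m k (r n)) / 2))))
  ----> 2 powr p * ((1 / real (Suc N)) * (2 * p * E) + om N * (4 / p) * (p * ((mu l - mu k) / 2)))" by (intro tendsto_intros mu) auto
  fix n
  let ?h = "h k (r n)" and ?h' = "h l (r n)"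
  let ?mid = "%x. (1/2) *R (?h x + ?h' x)"
  have "(energy (b (r n)) ?h + energy (b (r n)) ?h') / 2 - energy (b (r n)) ?mid <=
  p * ((J (r n) k (w k (r n)) ?h + J (r n) k (w l (r n)) ?h') / 2 - J (r n) k (%x. (1/2) * (w k (r n) x + w l (r n) x)) ?mid)"
  unfolding J_def by (rule functional_midpoint[OF adm zd uL _ W W]) simp
  also have "... <= p * ((m l (r n) - m k (r n)) / 2)"
  proof (intro mult_left_mono)
  have "m k (r n) <= J (r n) k (%x. (1/2) * (w k (r n) x + w l (r n) x)) ?mid" by (rule min[OF W0_cmult[OF W0_add[OF W W]]])
  moreover have "J (r n) k (w l (r n)) ?h' <= m l (r n)" using J_mono[OF kl] by (simp add: m_def)
  moreover have "J (r n) k (w k (r n)) ?h = m k (r n)" by (simp add: m_def)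
  ultimately show "(J (r n) k (w k (r n)) ?h + J (r n) k (w l (r n)) ?h') / 2 - J (r n) k (%x. (1/2) * (w k (r n) x + w l (r n) x)) ?mid <= (m l (r n) - m k (r n)) / 2"
  unfolding add_divide_distrib diff_divide_distrib by linarith
  qed (use p_pos in simp)
  finally have g: "(energy (b (r n)) ?h + energy (b (r n)) ?h') / 2 - energy (b (r n)) ?mid <= p * ((m l (r n) - m k (r n)) / 2)" .
  have "(LINT x|M. norm (?h x - ?h' x) powr p) <= 2 powr p * ((1 / real (Suc N)) * (energy (b (r n)) ?h + energy (b (r n)) ?h') +
  om N * (4 / p) * ((energy (b (r n)) ?h + energy (b (r n)) ?h') / 2 - energy (b (r n)) ?mid))"
  by (rule Lp_cauchy_of_midpoint_gap[OF adm W0_Lp(2)[OF W] W0_Lp(2)[OF W]])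
  also have "... <= 2 powr p * ((1 / real (Suc N)) * (2 * p * E) + om N * (4 / p) * (p * ((m l (r n) - m k (r n)) / 2)))"
  using e1[of "r n" k] e1[of "r n" l] p_pos om by (intro mult_left_mono add_mono g) auto
  finally show "(LINT x|M. norm (?h x - ?h' x) powr p) <=
  2 powr p * ((1 / real (Suc N)) * (2 * p * E) + om N * (4 / p) * (p * ((m l (r n) - m k (r n)) / 2)))" .
 qed
 have mu_mono: "mu k <= mu l" if "k <= l" for k l using LIMSEQ_le[OF mu mu] m_mono[OF that] by blast
 have "mu k <= E" for k using LIMSEQ_le_const2[OF mu] m_le by blast
 then obtain mu' where mu': "mu ----> mu'" "!!k. mu k <= mu'"
  using incseq_convergent[of mu E] mu_mono by (auto simp: incseq_def)
 have cauchy: "\<exists>N. \<forall>k\<ge>N. \<forall>l\<ge>N. (Nd (\<nabla> (v k)) (\<nabla> (v l))) < e" if e: "0 < e" for e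
 proof -
  define A where "A = 2 powr p * (2 * p * E)"
  have "(%N. A * (1 / real (Suc N))) ----> A * 0" using LIMSEQ_inverse_real_of_nat by (intro tendsto_mult tendsto_const) (simp add: inverse_eq_divide)
  from order_tendstoD(2)[OF this, of "e / 2"] obtain N where N: "A * (1 / real (Suc N)) < e / 2" using e by (auto simp: eventually_sequentially)
  define B where "B = 2 powr p * (om N * 2)"
  have B: "0 <= B" unfolding B_def using om by simp
  have "(%k. B * (mu' - mu k)) ----> B * (mu' - mu')" by (intro tendsto_intros mu')
  from order_tendstoD(2)[OF this, of "e / 2"] obtain K where K: "!!k. k >= K ==> B * (mu' - mu k) < e / 2" using e by (auto simp: eventually_sequentially)
  have main: "(Nd (\<nabla> (v k)) (\<nabla> (v l))) < e" if "k >= K" "k <= l" for k l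
  proof -
  have i: "om N * (4 / p) * (p * ((mu l - mu k) / 2)) = om N * 2 * (mu l - mu k)" using p_pos by simp
  have "2 powr p * ((1 / real (Suc N)) * (2 * p * E) + om N * (4 / p) * (p * ((mu l - mu k) / 2))) = A * (1 / real (Suc N)) + B * (mu l - mu k)"
  unfolding i A_def B_def by (simp only: distrib_left mult.assoc mult.left_commute mult.commute)
  moreover have "B * (mu l - mu k) <= B * (mu' - mu k)" using mu'(2) by (intro mult_left_mono B) auto
  ultimately show ?thesis using gap[OF that(2), of N] N K[OF that(1)] by linarith
  qed
  have "(Nd (\<nabla> (v k)) (\<nabla> (v l))) < e" if "k >= K" "l >= K" for k l
  proof (cases "k <= l")
  case False
  thus ?thesis using main[OF that(2), of k] by (simp add: norm_minus_commute)
  qed (rule main[OF that(1)])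
  thus ?thesis by blast
 qed
 obtain u' h' where u': "W0 u' h'" "Lp_tendsto Om p v u'" "Lp_tendsto Om p (%k. \<nabla> (v k)) h'"
  by (rule W0_Cauchy[OF Wv cauchy])
 have pk: "(LINT x|M. pen (v (Suc k) x - u x)) <= E / real (Suc k)" for k
  by (rule pen_lsc[OF Lv uL _ tendsto_const]) (use e2[of "Suc k"] in \<open>simp add: pos_le_divide_eq mult.commute del: of_nat_Suc\<close>)
 have "(%k. E / real (Suc k)) ----> 0" using LIMSEQ_Suc[OF lim_const_over_n[of E]] by simp
 from pen_lsc[OF Lp_tendsto_subseq[OF u'(2)] uL pk this, unfolded strict_mono_def]
 have "(LINT x|M. pen (u' x - u x)) <= 0" by simp
 hence "(LINT x|M. pen (u' x - u x)) = 0" using pen0[of u'] by linarith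
 hence "AE x in M. pen (u' x - u x) = 0"
  using integral_nonneg_eq_0_iff_AE[of M "%x. pen (u' x - u x)"] pen_integrable[OF Lp_diff[OF p_pos W0_Lp(1)[OF u'(1)] uL]] by (simp add: pen_nonneg)
 hence "AE x in M. u' x = u x" by (simp add: pen_eq_0)
 from W0_unique_AE[OF u'(1) Wu this] have "AE x in M. h' x = ?g x" .
 from Lp_tendsto_AE_cong[OF u'(3) W0_measurable(2)[OF Wu] this]
 show thesis by (rule that[OF fd v])
qed

end

end

section \<open>The G-limit is admissible\<close>

text \<open>Gradients of solutions cover all pairs of vectors: near a given point \<open>box_bump a b k\<close> times a
 linear function is, for large \<open>k\<close>, as close to that linear function as we like in \<open>C\<^sup>1\<close>.\<close>

lemma theta_2_scaled_tendsto:
 assumes s: "0 < s" shows "(%k. real k * theta 2 (real k * s - 1)) ----> 0"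
proof (rule Lim_null_comparison)
 show "(%k. (4 / s\<^sup>2) / real k) ----> 0" by (rule lim_const_over_n)
 obtain N :: nat where N: "2 / s < real N" using reals_Archimedean2 by blast
 show "\<forall>\<^sub>F k in sequentially. norm (real k * theta 2 (real k * s - 1)) <= (4 / s\<^sup>2) / real k"
  using eventually_ge_at_top[of N]
 proof eventually_elim
  case (elim k)
  have "2 / s < real k" using N elim by linarith
  hence ks: "2 < real k * s" using s by (simp add: pos_divide_less_eq)
  hence k: "0 < real k" by (cases "k = 0") auto
  define t where "t = real k * s - 1"
  have t: "0 < t" "real k * s / 2 <= t" using ks unfolding t_def by linarith+
  have t2: "0 < t\<^sup>2 * (real k * s / 2)\<^sup>2" using t(1) k s by simp
  have "theta 2 t <= 1 / t\<^sup>2" using t(1) by (simp add: theta_def divide_right_mono)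
  also have "... <= 1 / (real k * s / 2)\<^sup>2" using t ks by (intro divide_left_mono power_mono t2) auto
  finally have "real k * theta 2 t <= real k * (1 / (real k * s / 2)\<^sup>2)" by (intro mult_left_mono) auto
  also have "... = (4 / s\<^sup>2) / real k" using k s by (simp add: field_simps power2_eq_square)
  finally show ?case using t(1) by (simp add: t_def theta_def)
 qed
qed

lemma grad_prod_tendsto:
 fixes F :: "'i => nat => 'a::euclidean_space => real"
 assumes "finite S" "!!i k. i \<in> S ==> F i k differentiable (at x)"
  and "!!i. i \<in> S ==> (%k. F i k x) ----> c i" "!!i. i \<in> S ==> (%k. grad (F i k) x) ----> 0"
 shows "(\<forall>k. (%y. \<Prod>i\<in>S. F i k y) differentiable (at x)) & (%k. grad (%y. \<Prod>i\<in>S. F i k y) x) ----> 0"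
 using assms
proof (induction S rule: finite_induct)
 case (insert j S)
 have IH: "(%y. \<Prod>i\<in>S. F i k y) differentiable (at x)" "(%k. grad (%y. \<Prod>i\<in>S. F i k y) x) ----> 0" for k using insert by auto
 have d: "F j k differentiable (at x)" for k using insert.prems(1) by simp
 have e: "(%y. \<Prod>i\<in>insert j S. F i k y) = (%y. F j k y * (\<Prod>i\<in>S. F i k y))" for k using insert.hyps by simp
 have "(%k. F j k x *R grad (%y. \<Prod>i\<in>S. F i k y) x + (\<Prod>i\<in>S. F i k x) *R grad (F j k) x) ----> c j *R 0 + (\<Prod>i\<in>S. c i) *R 0"
  using insert.prems by (intro tendsto_add tendsto_scaleR tendsto_prod IH) auto
 thus ?case unfolding e using grad_mult[OF d IH(1)] d IH(1) by simp
qed simp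

lemma grad_box_bump_tendsto:
 assumes x: "x \<in> box a b" shows "(%k. grad (box_bump a b k) x) ----> 0"
proof -
 have d1: "((%y. real k * ((y - a) \<bullet> i) - 1) has_derivative (%h. (real k *R i) \<bullet> h)) (at x)" for k and i :: 'a
  by (auto intro!: derivative_eq_intros simp: inner_commute)
 have d2: "((%y. real k * ((b - y) \<bullet> i) - 1) has_derivative (%h. (- (real k *R i)) \<bullet> h)) (at x)" for k and i :: 'a
  by (auto intro!: derivative_eq_intros simp: inner_commute)
 note lin = grad_eqI[OF d1] grad_eqI[OF d2] differentiableI[OF d1] differentiableI[OF d2]
 have th: "(theta 0 has_real_derivative theta 2 t) (at t)" for t using theta_deriv[of 0 t] by (simp add: numeral_2_eq_2)
 have dth: "theta 0 differentiable (at t)" for t using th real_differentiable_def by blast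
 note D = differentiable_chain_at[OF lin(3) dth, unfolded o_def] differentiable_chain_at[OF lin(4) dth, unfolded o_def]
 let ?F = "%i k y. theta 0 (real k * ((y - a) \<bullet> i) - 1) * theta 0 (real k * ((b - y) \<bullet> i) - 1)"
 have pos: "0 < (x - a) \<bullet> i" "0 < (b - x) \<bullet> i" if "i \<in> Basis" for i using x that by (auto simp: mem_box inner_diff_left)
 have "(\<forall>k. (%y. \<Prod>i\<in>Basis. ?F i k y) differentiable (at x)) & (%k. grad (%y. \<Prod>i\<in>Basis. ?F i k y) x) ----> 0"
 proof (rule grad_prod_tendsto[where c = "%_. 1 * 1"])
  fix i :: 'a assume i: "i \<in> Basis"
  show "(%k. ?F i k x) ----> 1 * 1" by (intro tendsto_mult theta_0_tendsto_1 pos i)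
  have "(%k. theta 0 (real k * ((x - a) \<bullet> i) - 1) *R (- ((real k * theta 2 (real k * ((b - x) \<bullet> i) - 1)) *R i)) +
  theta 0 (real k * ((b - x) \<bullet> i) - 1) *R ((real k * theta 2 (real k * ((x - a) \<bullet> i) - 1)) *R i)) ----> 1 *R (- (0 *R i)) + 1 *R (0 *R i)"
  by (intro tendsto_add tendsto_scaleR tendsto_minus tendsto_const theta_0_tendsto_1 theta_2_scaled_tendsto pos i)
  moreover have "grad (?F i k) x = theta 0 (real k * ((x - a) \<bullet> i) - 1) *R (- ((real k * theta 2 (real k * ((b - x) \<bullet> i) - 1)) *R i)) +
  theta 0 (real k * ((b - x) \<bullet> i) - 1) *R ((real k * theta 2 (real k * ((x - a) \<bullet> i) - 1)) *R i)" for k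
  unfolding grad_mult[OF D] grad_compose[OF lin(3) th] grad_compose[OF lin(4) th] lin(1,2) by (simp add: mult.commute)
  ultimately show "(%k. grad (?F i k) x) ----> 0" by (simp only: scaleR_zero_left scaleR_zero_right minus_zero add_0_right)
  show "?F i k differentiable (at x)" for k by (intro differentiable_mult D)
 qed simp
 thus ?thesis by (simp add: box_bump_def[abs_def])
qed

context bounded_domain
begin

context
 fixes b :: "nat => 'a => 'a => 'a" and a :: "'a => 'a => 'a" and al ka om
 assumes adm: "!!n. admissible Om p al ka om (b n)" and al: "0 < al" and ka: "0 < ka" and om: "!!n. 0 <= om n"
  and G: "G_limit b a" and car: "caratheodory Om a"
begin

text \<open>Approximate both gradients by those of limit solutions, almost everywhere along a subsequence.\<close>

lemma limit_compatible:
 assumes u: "u1 \<in> W01p Om p" "u2 \<in> W01p Om p"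
 shows "AE x in M. compatible p al ka om (a x) (\<nabla> u1 x) (\<nabla> u2 x)"
proof -
 obtain f v where v: "!!k::nat. f k \<in> W_dual Om p" "!!k. G_solution b a (f k) (v k)" "Lp_tendsto Om p (%k. \<nabla> (v k)) (\<nabla> u1)"
  by (rule limit_solutions_dense[OF adm al ka om G u(1)]) (rule that)
 obtain f' v' where v': "!!k::nat. f' k \<in> W_dual Om p" "!!k. G_solution b a (f' k) (v' k)" "Lp_tendsto Om p (%k. \<nabla> (v' k)) (\<nabla> u2)"
  by (rule limit_solutions_dense[OF adm al ka om G u(2)]) (rule that)
 obtain r D where r: "strict_mono r" and D: "AE x in M. (%k. \<nabla> (v (r k)) x) ----> \<nabla> u1 x"
  by (rule Lp_tendsto_dominated_subseq[OF p_pos v(3)])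
 obtain r' D' where r': "strict_mono r'" and D': "AE x in M. (%k. \<nabla> (v' (r (r' k))) x) ----> \<nabla> u2 x"
  by (rule Lp_tendsto_dominated_subseq[OF p_pos Lp_tendsto_subseq[OF v'(3) r]])
 have "AE x in M. \<forall>k. compatible p al ka om (a x) (\<nabla> (v (r (r' k))) x) (\<nabla> (v' (r (r' k))) x)"
  unfolding AE_all_countable by (intro allI G_solution_compatible[OF adm al ka om v(1,2) v'(1,2)])
 moreover have "AE x in M. continuous_on UNIV (a x)" using car by (simp add: caratheodory_def)
 ultimately show ?thesis
  using D D'
 proof eventually_elim
  case (elim x)
  show ?case
  by (rule compatible_closed[OF p_gt_1 elim(2) _ elim(4) spec[OF elim(1)]]) (use LIMSEQ_subseq_LIMSEQ[OF elim(3) r'] in \<open>simp add: o_def\<close>)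
 qed
qed

text \<open>Countably many boxes, directions and cut-offs leave a single exceptional null set; continuity in the vector variable reaches all vectors.\<close>

theorem G_limit_admissible: "admissible Om p al ka om a"
proof -
 obtain D where D: "countable D" "!!X. open X ==> X ~= {} ==> \<exists>d::'a\<in>D. d \<in> X"
  by (rule countable_dense_setE[where 'a = 'a]) (rule that)
 have approx: "\<exists>X. (\<forall>n. X n \<in> D) & X ----> xi" for xi
 proof -
  have "\<forall>n. \<exists>d. d \<in> D & dist d xi < 1 / real (Suc n)"
  proof
  fix n
  have "ball xi (1 / real (Suc n)) ~= {}" by (simp del: of_nat_Suc)
  from D(2)[OF open_ball this] show "\<exists>d. d \<in> D & dist d xi < 1 / real (Suc n)" by (auto simp: dist_commute)
  qed
  from choice[OF this] obtain X where X: "!!n. X n \<in> D" "!!n. dist (X n) xi < 1 / real (Suc n)" by blast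
  have "(%n. dist (X n) xi) ----> 0"
  proof (rule tendsto_sandwich[of "%_. 0" _ _ "%n. 1 / real (Suc n)"])
  show "(%n. 1 / real (Suc n)) ----> 0" using LIMSEQ_inverse_real_of_nat by (simp add: inverse_eq_divide)
  show "\<forall>\<^sub>F n in sequentially. dist (X n) xi <= 1 / real (Suc n)" using X(2) by (intro always_eventually allI less_imp_le)
  qed auto
  hence "X ----> xi" by (rule tendsto_dist_iff[THEN iffD2])
  thus ?thesis using X(1) by blast
 qed
 obtain DD where DD: "countable DD" "DD \<subseteq> Pow Om" "!!X. X \<in> DD ==> \<exists>l u. X = box l u" "\<Union>DD = Om"
  by (rule open_countable_Union_open_box[OF open_dom]) (rule that)
 have "\<forall>X. \<exists>lu. X \<in> DD --> X = box (fst lu) (snd lu)"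
 proof
  fix X
  show "\<exists>lu. X \<in> DD --> X = box (fst lu) (snd lu)"
  proof (cases "X \<in> DD")
  case True
  obtain l u where "X = box l u" using DD(3)[OF True] by (elim exE)
  thus ?thesis by (intro exI[of _ "(l, u)"]) simp
  qed simp
 qed
 from choice[OF this] obtain lu where "\<forall>X. X \<in> DD --> X = box (fst (lu X)) (snd (lu X))" ..
 hence lu: "X = box (fst (lu X)) (snd (lu X))" if "X \<in> DD" for X using that by (elim allE impE)
 define ph where "ph X k xi x = (x \<bullet> xi) * box_bump (fst (lu X)) (snd (lu X)) k x" for X k and xi x :: 'a
 have ph: "test_function Om (ph X k xi)" if "X \<in> DD" for X k xi
  unfolding ph_def[abs_def] by (intro test_function_mult C_inf_inner test_function_subset[OF box_bump_test]) (subst lu[OF that, symmetric], use DD(2) that in blast)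
 have phlim: "(%k. grad (ph X k xi) x) ----> xi" if X: "X \<in> DD" "x \<in> X" for X x xi
 proof -
  have x: "x \<in> box (fst (lu X)) (snd (lu X))" using X(2) by (subst lu[OF X(1), symmetric])
  have d: "(%y. y \<bullet> xi) differentiable (at x)" by (rule C_inf_differentiable[OF C_inf_inner])
  have g: "grad (%y. y \<bullet> xi) x = xi" by (rule grad_eqI) (auto intro!: derivative_eq_intros simp: inner_commute)
  have "(%k. (x \<bullet> xi) *R grad (box_bump (fst (lu X)) (snd (lu X)) k) x + box_bump (fst (lu X)) (snd (lu X)) k x *R xi) ----> (x \<bullet> xi) *R 0 + 1 *R xi"
  by (intro tendsto_add tendsto_scaleR tendsto_const grad_box_bump_tendsto box_bump_limit x)
  moreover have "grad (ph X k xi) x = (x \<bullet> xi) *R grad (box_bump (fst (lu X)) (snd (lu X)) k) x + box_bump (fst (lu X)) (snd (lu X)) k x *R xi" for k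
  unfolding ph_def[abs_def] by (simp add: grad_mult[OF d test_functionD(2)[OF box_bump_test]] g)
  ultimately show ?thesis by simp
 qed
 have "AE x in M. compatible p al ka om (a x) (grad (ph X k xi) x) (grad (ph X k ze) x)" if X: "X \<in> DD" for X k xi ze
  using limit_compatible[OF W0_W01p[OF W0_test[OF ph[OF X, of k xi]]] W0_W01p[OF W0_test[OF ph[OF X, of k ze]]]]
  W0_wgrad_AE[OF W0_test[OF ph[OF X, of k xi]]] W0_wgrad_AE[OF W0_test[OF ph[OF X, of k ze]]]
  by eventually_elim simp
 hence "AE x in M. \<forall>X\<in>DD. \<forall>xi\<in>D. \<forall>ze\<in>D. \<forall>k. compatible p al ka om (a x) (grad (ph X k xi) x) (grad (ph X k ze) x)"
  unfolding AE_ball_countable[OF DD(1)] AE_ball_countable[OF D(1)] AE_all_countable by (intro ballI allI)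
 moreover have "AE x in M. continuous_on UNIV (a x)" using car by (simp add: caratheodory_def)
 ultimately have "AE x in M. admissible_vector_field p al ka om (a x)"
  using AE_space
 proof eventually_elim
  case (elim x)
  obtain X where X: "X \<in> DD" "x \<in> X" using elim(3) DD(4) by auto
  have dense: "compatible p al ka om (a x) xi ze" if "xi \<in> D" "ze \<in> D" for xi ze
  by (rule compatible_closed[OF p_gt_1 elim(2) phlim[OF X] phlim[OF X]]) (use elim(1) X(1) that in blast)
  have "compatible p al ka om (a x) xi ze" for xi ze
  proof -
  obtain Y where Y: "\<forall>n. Y n \<in> D" "Y ----> xi" using approx by blast
  obtain Z where Z: "\<forall>n. Z n \<in> D" "Z ----> ze" using approx by blast
  show ?thesis by (rule compatible_closed[OF p_gt_1 elim(2) Y(2) Z(2)]) (use Y(1) Z(1) dense in blast)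
  qed
  thus ?case using p_gt_1 al ka om elim(2) by (simp add: admissible_vector_field_def admissible_field_compatible)
 qed
 thus ?thesis using car by (simp add: admissible_def caratheodory_def)
qed

end

end

section \<open>From G-convergence to sequences\<close>

context bounded_domain
begin

lemma W_dual_add:
 assumes "f \<in> W_dual Om p" "g \<in> W_dual Om p" shows "(%v. f v + g v) \<in> W_dual Om p"
proof -
 obtain K where K: "\<forall>u\<in>W01p Om p. \<bar>f u\<bar> <= K * W_norm Om p u" using W_dualD(3)[OF assms(1)] by blast
 obtain L where L: "\<forall>u\<in>W01p Om p. \<bar>g u\<bar> <= L * W_norm Om p u" using W_dualD(3)[OF assms(2)] by blast
 have "\<bar>f u + g u\<bar> <= (K + L) * W_norm Om p u" if "u \<in> W01p Om p" for u
  using K[rule_format, OF that] L[rule_format, OF that] by (simp add: distrib_right)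
 thus ?thesis using W_dualD(1,2)[OF assms(1)] W_dualD(1,2)[OF assms(2)] by (auto simp: W_dual_def distrib_left)
qed

lemma W_dual_norm_bounds:
 assumes "!!v. v \<in> W01p Om p ==> W_norm Om p v <= 1 ==> \<bar>f v\<bar> <= K"
 shows "0 <= W_dual_norm Om p f" "W_dual_norm Om p f <= K"
proof -
 have z: "(%x. 0) \<in> {v \<in> W01p Om p. W_norm Om p v <= 1}"
  using W0_W01p[OF W0_zero] W_norm_eq[OF W0_weak_grad[OF W0_zero]] by simp
 have "\<bar>f (%x. 0)\<bar> <= W_dual_norm Om p f" unfolding W_dual_norm_def
  by (rule cSUP_upper[OF z]) (use assms in \<open>auto intro!: bdd_aboveI2\<close>)
 thus "0 <= W_dual_norm Om p f" by linarith
 show "W_dual_norm Om p f <= K" unfolding W_dual_norm_def by (rule cSUP_least) (use z assms in auto)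
qed

lemma W_dual_norm_tendsto:
 assumes z: "Lp_tendsto Om q z (%x. 0)"
 shows "(%n. W_dual_norm Om p (%v. LINT x|M. z n x * v x)) ----> 0"
proof (rule tendsto_sandwich[of "%_. 0" _ _ "%n. (LINT x|M. norm (z n x) powr q) powr (1/q)"])
 have b: "\<bar>LINT x|M. z n x * v x\<bar> <= (LINT x|M. norm (z n x) powr q) powr (1/q)" if v: "v \<in> W01p Om p" "W_norm Om p v <= 1" for n v
 proof -
  note W = W0_wgrad[OF v(1)]
  have "(Np v) <= 1"
  proof (rule ccontr)
  assume "\<not> ?thesis"
  hence "1 < (Np v) + (Np (\<nabla> v))"
  using Lp_integral_nonneg[of Om "\<nabla> v" p] by linarith
  hence "1 < W_norm Om p v" unfolding W_norm_eq[OF W0_weak_grad[OF W]] using p_pos by (intro gr_one_powr) auto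
  thus False using v(2) by simp
  qed
  hence "(Np v) powr (1/p) <= 1 powr (1/p)" using p_pos by (intro powr_mono2) auto
  hence "(LINT x|M. norm (z n x) powr q) powr (1/q) * (Np v) powr (1/p) <= (LINT x|M. norm (z n x) powr q) powr (1/q) * 1"
  by (intro mult_left_mono) auto
  thus ?thesis using Lp_Holder[OF p_gt_1 Lp_tendstoD(1)[OF z] W0_Lp(1)[OF W], of n] by simp
 qed
 show "\<forall>\<^sub>F n in sequentially. 0 <= W_dual_norm Om p (%v. LINT x|M. z n x * v x)"
  by (intro always_eventually allI W_dual_norm_bounds(1)[OF b])
 show "\<forall>\<^sub>F n in sequentially. W_dual_norm Om p (%v. LINT x|M. z n x * v x) <= (LINT x|M. norm (z n x) powr q) powr (1/q)"
  by (intro always_eventually allI W_dual_norm_bounds(2)[OF b])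
 have "(%n. (LINT x|M. norm (z n x) powr q) powr (1/q)) ----> 0 powr (1/q)"
  using Lp_tendstoD(3)[OF z] q_pos by (intro tendsto_powr' tendsto_const) auto
 thus "(%n. (LINT x|M. norm (z n x) powr q) powr (1/q)) ----> 0" by simp
qed simp

text \<open>G-convergence speaks of families indexed by all positive numbers: put the given data on the range of the sequence, which is possible by injectivity, and unperturbed solutions elsewhere.\<close>

lemma G_limit_of_G_converges:
 assumes G: "G_converges Om p aep a" and pos: "!!n. 0 < ep n" and inj: "inj ep" and lim: "filterlim ep (at_right 0) sequentially"
  and ex: "!!t f. 0 < t ==> f \<in> W_dual Om p ==> \<exists>u. weak_solution Om p (aep t) f u"
 shows "G_limit (%n. aep (ep n)) a"
 unfolding G_limit_def
proof
 fix f assume f: "f \<in> W_dual Om p"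
 obtain u where u: "weak_solution Om p a f u" and conv: "!!fep uep. [|\<forall>ep>0. fep ep \<in> W_dual Om p; W_dual_tendsto Om p fep f (at_right 0); \<forall>ep>0. weak_solution Om p (aep ep) (fep ep) (uep ep)|] ==>
  W01p_weakly_tendsto Om p uep u (at_right 0) & Lp_weakly_tendsto Om q (%ep x. aep ep x (\<nabla> (uep ep) x)) (%x. a x (\<nabla> u x)) (at_right 0)"
  using bspec[OF G[unfolded G_converges_def] f] by blast
 have "\<forall>t. \<exists>w. 0 < t --> weak_solution Om p (aep t) f w" using ex f by blast
 from choice[OF this] obtain s where s: "!!t. 0 < t ==> weak_solution Om p (aep t) f (s t)" by blast
 have "G_solution (%n. aep (ep n)) a f u"
  unfolding G_solution_def
 proof (intro allI impI)
  fix r :: "nat => nat" and z :: "nat => 'a => real" and U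
  assume r: "strict_mono r" and z: "Lp_tendsto Om q z (%x. 0)"
  and U: "\<forall>n. weak_solution Om p (aep (ep (r n))) (%v. f v + (LINT x|M. z n x * v x)) (U n)"
  define e where "e n = ep (r n)" for n
  have "inj (ep \<circ> r)" by (rule inj_compose[OF inj strict_mono_imp_inj_on[OF r]])
  moreover have "ep \<circ> r = e" by (simp add: e_def fun_eq_iff)
  ultimately have e_inj: "inj e" by simp
  have e_pos: "0 < e n" for n by (simp add: e_def pos)
  have e_lim: "filterlim e (at_right 0) sequentially" unfolding e_def by (rule filterlim_compose[OF lim filterlim_subseq[OF r]])
  define F where "F t = (if t \<in> range e then (%v. f v + (LINT x|M. z (inv e t) x * v x)) else f)" for t
  define w where "w t = (if t \<in> range e then U (inv e t) else s t)" for t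
  have Fe: "F (e n) = (%v. f v + (LINT x|M. z n x * v x))" and we: "w (e n) = U n" for n
  using inv_f_f[OF e_inj, of n] by (auto simp: F_def w_def)
  have Fd: "F t \<in> W_dual Om p" for t
  unfolding F_def using f W_dual_add[OF f W_dual_fun[OF Lp_tendstoD(1)[OF z]]] by simp
  have sol: "weak_solution Om p (aep t) (F t) (w t)" if "0 < t" for t
  proof (cases "t \<in> range e")
  case True
  then obtain n where t: "t = e n" by blast
  show ?thesis unfolding t Fe we using spec[OF U, of n] by (simp add: e_def)
  next
  case False
  thus ?thesis using s[OF that] by (simp add: F_def w_def)
  qed
  have "W_dual_tendsto Om p F f (at_right 0)"
  unfolding W_dual_tendsto_def tendsto_iff
  proof (intro allI impI)
  fix d :: real assume d: "0 < d"
  have "\<forall>\<^sub>F n in sequentially. dist (W_dual_norm Om p (%v. LINT x|M. z n x * v x)) 0 < d" using W_dual_norm_tendsto[OF z] d unfolding tendsto_iff by blast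
  then obtain N where N: "!!n. n >= N ==> dist (W_dual_norm Om p (%v. LINT x|M. z n x * v x)) 0 < d" by (auto simp: eventually_sequentially)
  have "\<forall>\<^sub>F t in at_right 0. \<forall>n\<in>{..<N}. t < e n"
  by (intro eventually_ball_finite ballI finite_lessThan order_tendstoD(2)[OF tendsto_ident_at e_pos])
  thus "\<forall>\<^sub>F t in at_right 0. dist (W_dual_norm Om p (%v. F t v - f v)) 0 < d"
  proof eventually_elim
  case (elim t)
  show ?case
  proof (cases "t \<in> range e")
  case True
  then obtain n where t: "t = e n" by blast
  hence "n >= N" using elim by (meson lessThan_iff less_irrefl not_le)
  thus ?thesis using N[of n] by (simp add: t Fe)
  next
  case False
  hence "(%v. F t v - f v) = (%v. 0)" by (simp add: F_def)
  thus ?thesis using W_dual_norm_bounds[of "%v. 0" 0] d by simp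
  qed
  qed
  qed
  from conv[of F w, OF _ this] Fd sol
  have A: "W01p_weakly_tendsto Om p w u (at_right 0)" "Lp_weakly_tendsto Om q (%t x. aep t x (\<nabla> (w t) x)) (%x. a x (\<nabla> u x)) (at_right 0)" by blast+
  have "W01p_weakly_tendsto Om p (%n. w (e n)) u sequentially"
  using A(1) eventually_compose_filterlim[OF _ e_lim] filterlim_compose[OF _ e_lim] unfolding W01p_weakly_tendsto_def by blast
  moreover have "Lp_weakly_tendsto Om q (%n x. aep (e n) x (\<nabla> (w (e n)) x)) (%x. a x (\<nabla> u x)) sequentially"
  using A(2) eventually_compose_filterlim[OF _ e_lim] filterlim_compose[OF _ e_lim] unfolding Lp_weakly_tendsto_def by blast
  ultimately show "recovers (%n. aep (ep (r n))) a f z U u"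
  using f z U u unfolding recovers_def we by (simp add: e_def)
 qed
 thus "\<exists>u. G_solution (%n. aep (ep n)) a f u" by blast
qed

end

section \<open>Convergence of the energies\<close>

context bounded_domain
begin

text \<open>Strict monotonicity determines the gradient, and the Poincare inequality the function.\<close>

lemma weak_solution_unique:
 assumes adm: "admissible Om p al ka om a" and u: "weak_solution Om p a f u" and v: "weak_solution Om p a f v"
 shows "AE x in M. \<nabla> u x = \<nabla> v x" "AE x in M. u x = v x"
proof -
 have W: "u \<in> W01p Om p" "v \<in> W01p Om p" using u v by (auto simp: weak_solution_def)
 let ?g = "\<nabla> u" and ?h = "\<nabla> v"
 note gL = W0_Lp(2)[OF W0_wgrad[OF W(1)]] and hL = W0_Lp(2)[OF W0_wgrad[OF W(2)]]
 note I = Lp_inner_integrable[OF p_gt_1 admissible_Lp(1)[OF adm]]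
 have "(LINT x|M. (a x (?g x) - a x (?h x)) \<bullet> (?g x - ?h x)) = 0"
  using u v W I[OF gL gL] I[OF gL hL] I[OF hL gL] I[OF hL hL] by (simp add: weak_solution_def inner_diff_left inner_diff_right)
 moreover have "AE x in M. 0 <= (a x (?g x) - a x (?h x)) \<bullet> (?g x - ?h x)"
  using admissible_AE[OF adm]
 proof eventually_elim
  case (elim x)
  show ?case using admissible_vector_field.strictly_monotone[OF elim, of "?g x" "?h x"] by (cases "?g x = ?h x") auto
 qed
 moreover have "integrable M (%x. (a x (?g x) - a x (?h x)) \<bullet> (?g x - ?h x))"
  using I[OF gL gL] I[OF gL hL] I[OF hL gL] I[OF hL hL] by (simp add: inner_diff_left inner_diff_right)
 ultimately have "AE x in M. (a x (?g x) - a x (?h x)) \<bullet> (?g x - ?h x) = 0" by (simp add: integral_nonneg_eq_0_iff_AE)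
 thus g: "AE x in M. ?g x = ?h x"
  using admissible_AE[OF adm]
 proof eventually_elim
  case (elim x)
  show ?case using admissible_vector_field.strictly_monotone[OF elim(2), of "?g x" "?h x"] elim(1) by fastforce
 qed
 obtain C where C: "0 < C" "!!u g. W0 u g ==> (Np u) <= C * (Np g)"
  by (rule W0_Poincare) (rule that)
 note D = W0_diff[OF W0_wgrad[OF W(1)] W0_wgrad[OF W(2)]]
 have "(LINT x|M. norm (?g x - ?h x) powr p) = (LINT x|M. 0)"
  using W0_measurable(2)[OF D] g p_pos by (intro integral_cong_AE) (auto elim: eventually_mono)
 hence "(Nd u v) <= C * 0" using C(2)[OF D] by simp
 hence "(Nd u v) = 0" using Lp_integral_nonneg[of Om "%x. u x - v x" p] by linarith
 from Lp_integral_eq_0[OF W0_Lp(1)[OF D] this] show "AE x in M. u x = v x" by simp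
qed

context
 fixes b :: "nat => 'a => 'a => 'a" and a :: "'a => 'a => 'a" and al ka om
 assumes adm: "!!n. admissible Om p al ka om (b n)" and al: "0 < al" and ka: "0 < ka" and om: "!!n. 0 <= om n"
  and G: "G_limit b a" and adm_a: "admissible Om p al ka om a"
begin

text \<open>Solve the equations whose right-hand side is that of \<open>u\<close> in the limit equation.\<close>

lemma recovery_sequence:
 assumes W: "W0 u g"
 obtains U K where "!!n. W0 (U n) (\<nabla> (U n))" "!!n. (Np (\<nabla> (U n))) <= K" "Lp_tendsto Om p U u"
  "(%n. energy (b n) (\<nabla> (U n))) ----> energy a g"
  "!!V H v h K. [|\<forall>n. W0 (V n) (H n); \<forall>n. (Np (H n)) <= K; Lp_tendsto Om p V v; W0 v h|] ==>
  (%n. LINT x|M. b n x (\<nabla> (U n) x) \<bullet> H n x) ----> (LINT x|M. a x (g x) \<bullet> h x)"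
proof -
 note fl = admissible_Lp(1)[OF adm_a W0_Lp(2)[OF W]]
 define f where "f v = (LINT x|M. a x (g x) \<bullet> \<nabla> v x)" for v
 have fd: "f \<in> W_dual Om p" unfolding f_def by (rule W_dual_grad[OF fl])
 have fv: "f v = (LINT x|M. a x (g x) \<bullet> h x)" if "W0 v h" for v h
  unfolding f_def by (rule wgrad_inner_integral[OF that LpD(1)[OF fl]])
 have ae: "AE x in M. continuous_on UNIV (a x)"
  by (rule eventually_mono[OF admissible_AE[OF adm_a]]) (erule admissible_vector_field.cont)
 have su: "weak_solution Om p a f u"
  by (subst weak_solution_iff[OF _ ae W]) (use adm_a fv in \<open>auto simp: admissible_def\<close>)
 obtain u' where u': "G_solution b a f u'" using G fd by (auto simp: G_limit_def)
 obtain U where U: "recovers b a f (%n x. 0) U u'" by (rule recovery_exists[OF adm al ka om fd u'])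
 have su': "weak_solution Om p a f u'" using U by (simp add: recovers_def)
 note R = recovers_W0[OF adm al ka U] and T = recovers_test[OF adm al ka U]
 obtain K where K: "!!n. (Np (\<nabla> (U n))) <= K" by (rule recovers_bound[OF adm al ka U]) (rule that)
 show thesis
 proof (rule that[of U, OF R(1) K])
  have eq: "AE x in M. u' x = u x" by (rule weak_solution_unique(2)[OF adm_a su' su])
  show "Lp_tendsto Om p U u" by (rule Lp_tendsto_AE_cong[OF recovers_Lp[OF adm al ka U] W0_measurable(1)[OF W] eq])
  have "energy a (\<nabla> u') = energy a g"
  by (rule energy_AE_cong[OF adm_a W0_measurable(2)[OF R(2)] W0_measurable(2)[OF W] W0_unique_AE[OF R(2) W eq]])
  thus "(%n. energy (b n) (\<nabla> (U n))) ----> energy a g" using recovers_energy[OF adm al ka U] by simp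
  fix V H v h K assume V: "\<forall>n. W0 (V n) (H n)" "\<forall>n. (Np (H n)) <= K" "Lp_tendsto Om p V v" "W0 v h"
  have "(%n. f (V n)) ----> f v" by (rule W0_weak_limit(2)[OF spec[OF V(1)] spec[OF V(2)] V(3) fd])
  thus "(%n. LINT x|M. b n x (\<nabla> (U n) x) \<bullet> H n x) ----> (LINT x|M. a x (g x) \<bullet> h x)"
  using T(1)[OF spec[OF V(1)]] fv[OF V(4)] by simp
 qed
qed

text \<open>The convexity inequality at the recovery sequence of the limit bounds the energies from below.\<close>

lemma energy_lower_bound:
 assumes V: "!!n. W0 (V n) (H n)" "!!n. (Np (H n)) <= K" "Lp_tendsto Om p V v" and h: "W0 v h"
 obtains L where "!!n. L n <= energy (b n) (H n)" "L ----> energy a h"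
proof -
 obtain U K' where U: "!!n. W0 (U n) (\<nabla> (U n))" "(%n. energy (b n) (\<nabla> (U n))) ----> energy a h"
  and T: "!!V H v' h' K. [|\<forall>n. W0 (V n) (H n); \<forall>n. (Np (H n)) <= K; Lp_tendsto Om p V v'; W0 v' h'|] ==>
  (%n. LINT x|M. b n x (\<nabla> (U n) x) \<bullet> H n x) ----> (LINT x|M. a x (h x) \<bullet> h' x)"
  by (rule recovery_sequence[OF h]) (rule that)
 let ?e = "%n. energy (b n) (\<nabla> (U n))" and ?c = "%n. LINT x|M. b n x (\<nabla> (U n) x) \<bullet> H n x"
 show thesis
 proof (rule that[of "%n. ?e n + p * (?c n - ?e n)"])
  have "(%n. ?e n + p * (?c n - ?e n)) ----> energy a h + p * ((LINT x|M. a x (h x) \<bullet> h x) - energy a h)"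
  by (intro tendsto_intros U(2) T[OF allI[OF V(1)] allI[OF V(2)] V(3) h])
  thus "(%n. ?e n + p * (?c n - ?e n)) ----> energy a h" by (simp add: energy_def)
  fix n
  note UL = W0_Lp(2)[OF U(1)[of n]] and HL = W0_Lp(2)[OF V(1)[of n]]
  note I = admissible_Lp(2)[OF adm[of n] UL] Lp_inner_integrable[OF p_gt_1 admissible_Lp(1)[OF adm[of n] UL] HL] admissible_Lp(2)[OF adm[of n] HL]
  have "(LINT x|M. pairing (b n) (U n) (U n) x + p * (b n x (\<nabla> (U n) x) \<bullet> H n x - pairing (b n) (U n) (U n) x)) <= energy (b n) (H n)"
  unfolding energy_def
  proof (rule integral_mono_AE)
  show "AE x in M. pairing (b n) (U n) (U n) x + p * (b n x (\<nabla> (U n) x) \<bullet> H n x - pairing (b n) (U n) (U n) x) <= b n x (H n x) \<bullet> H n x"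
  by (rule eventually_mono[OF admissible_AE[OF adm[of n]]], drule admissible_vector_field.subgrad) (simp only: inner_diff_right)
  qed (use I in auto)
  thus "?e n + p * (?c n - ?e n) <= energy (b n) (H n)" using I by (simp add: energy_def)
 qed
qed

end

lemma pos_grad_bound:
 assumes "W0 v g" shows "(LINT x|M. norm (pos_grad v g x) powr p) <= (Np g)"
 by (intro integral_mono LpD(2) W0_Lp(2)[OF W0_pos_grad[OF assms]] W0_Lp(2)[OF assms]) (simp add: pos_grad_def)

end

section \<open>Convergence of the second eigenvalue\<close>

context bounded_domain
begin

lemma energy_scale:
 assumes adm: "admissible Om p al ka om b" and g: "g \<in> Lp Om p"
 shows "energy b (%x. t *R g x) = \<bar>t\<bar> powr p * energy b g"
proof -
 have "energy b (%x. t *R g x) = (LINT x|M. \<bar>t\<bar> powr p * (b x (g x) \<bullet> g x))" unfolding energy_def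
 proof (rule integral_cong_AE)
  show "AE x in M. b x (t *R g x) \<bullet> t *R g x = \<bar>t\<bar> powr p * (b x (g x) \<bullet> g x)"
  by (rule eventually_mono[OF admissible_AE[OF adm]]) (rule admissible_vector_field.energy_scaleR)
 qed (use admissible_Lp(2)[OF adm Lp_scaleR[OF g, of t]] admissible_Lp(2)[OF adm g] in auto)
 thus ?thesis by (simp add: energy_def)
qed

text \<open>Unit norm keeps a piece from vanishing in the limit.\<close>

lemma normalised_piece:
 assumes adm: "admissible Om p al ka om b" and w: "weight s1 s2 si" and W: "W0 v g"
  and pos: "0 < pos_mass si v" and le: "pos_energy b v < mu * pos_mass si v"
 obtains t where "0 < t" "(LINT x|M. norm (t * max 0 (v x)) powr p) = 1"
  "energy b (%x. t *R pos_grad v g x) <= mu * mass si (%x. t * max 0 (v x))"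
proof -
 note P = W0_pos_grad[OF W]
 define c where "c = (LINT x|M. norm (max 0 (v x)) powr p)"
 have "pos_mass si v <= s2 * c" unfolding pos_mass_def c_def by (rule mass_bounds(2)[OF w W0_Lp(1)[OF P]])
 moreover have "0 <= c" unfolding c_def by (rule Lp_integral_nonneg)
 ultimately have c: "0 < c" using pos by (cases "c = 0") auto
 define t where "t = c powr (- 1 / p)"
 have t0: "0 < t" using c by (simp add: t_def)
 have "t powr p = c powr (- 1 / p * p)" by (simp only: t_def powr_powr)
 also have "- 1 / p * p = - 1" using p_pos by simp
 finally have t: "0 < t" "\<bar>t\<bar> powr p = 1 / c" using c t0 by (simp_all add: powr_minus_divide)
 show thesis
 proof (rule that[OF t(1)])
  have "(LINT x|M. norm (t * max 0 (v x)) powr p) = \<bar>t\<bar> powr p * c" unfolding c_def by (simp add: abs_mult powr_mult)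
  thus "(LINT x|M. norm (t * max 0 (v x)) powr p) = 1" using c t(2) by simp
  have m: "mass si (%x. t * max 0 (v x)) = \<bar>t\<bar> powr p * pos_mass si v"
  unfolding mass_def pos_mass_def by (simp only: abs_mult powr_mult mult.left_commute[of "si _"] integral_mult_right_zero)
  have "\<bar>t\<bar> powr p * energy b (pos_grad v g) <= \<bar>t\<bar> powr p * (mu * pos_mass si v)"
  using le pos_energy_W0[OF adm W] by (intro mult_left_mono) auto
  thus "energy b (%x. t *R pos_grad v g x) <= mu * mass si (%x. t * max 0 (v x))"
  unfolding m energy_scale[OF adm W0_Lp(2)[OF P]] by (simp add: mult_ac)
 qed
qed

lemma weak_star_weight:
 assumes w: "!!n. weight s1 s2 (si n)" and si0: "si0 \<in> Linf Om"
  and conv: "!!g. integrable M g ==> (%n. LINT x|M. si n x * g x) ----> (LINT x|M. si0 x * g x)"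
 shows "weight s1 s2 si0"
proof -
 obtain K where K: "si0 \<in> borel_measurable M" "AE x in M. \<bar>si0 x\<bar> <= K" using si0 by (auto simp: Linf_def)
 have I0: "integrable M si0"
  by (rule Bochner_Integration.integrable_bound[OF integrable_const_dom[of K] K(1)]) (use K(2) in \<open>eventually_elim, simp\<close>)
 have I: "integrable M (si n)" for n using weight_integrable[OF w integrable_const_dom[of "1::real"]] by simp
 have lim: "(%n. LINT x|M. ps x * si n x) ----> (LINT x|M. ps x * si0 x)" if "test_function Om ps" for ps
  using conv[of ps] Lp_integrable[OF test_Lp(1)[OF that, of 1]] by (simp add: mult.commute)
 have "AE x in M. s1 - si0 x <= 0"
 proof (rule AE_nonpos_of_test[OF open_dom])
  show "integrable M (%x. s1 - si0 x)" using I0 integrable_const_dom by (rule Bochner_Integration.integrable_diff[rotated])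
  fix ps :: "'a => real" assume ps: "test_function Om ps" "!!x. 0 <= ps x"
  note T = test_mult_integrable[OF ps(1)]
  have "(LINT x|M. ps x * s1) <= (LINT x|M. ps x * si n x)" for n
  by (intro integral_mono_AE T I integrable_const_dom, rule eventually_mono[OF weightD(3)[OF w[of n]]]) (simp add: mult_left_mono ps(2))
  hence "(LINT x|M. ps x * s1) <= (LINT x|M. ps x * si0 x)" using LIMSEQ_le_const[OF lim[OF ps(1)]] by blast
  thus "(LINT x|M. ps x * (s1 - si0 x)) <= 0" using T[OF I0] T[OF integrable_const_dom[of s1]] by (simp add: right_diff_distrib)
 qed
 moreover have "AE x in M. si0 x - s2 <= 0"
 proof (rule AE_nonpos_of_test[OF open_dom])
  show "integrable M (%x. si0 x - s2)" using I0 integrable_const_dom by (rule Bochner_Integration.integrable_diff)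
  fix ps :: "'a => real" assume ps: "test_function Om ps" "!!x. 0 <= ps x"
  note T = test_mult_integrable[OF ps(1)]
  have "(LINT x|M. ps x * si n x) <= (LINT x|M. ps x * s2)" for n
  by (intro integral_mono_AE T I integrable_const_dom, rule eventually_mono[OF weightD(4)[OF w[of n]]]) (simp add: mult_left_mono ps(2))
  hence "(LINT x|M. ps x * si0 x) <= (LINT x|M. ps x * s2)" using LIMSEQ_le_const2[OF lim[OF ps(1)]] by blast
  thus "(LINT x|M. ps x * (si0 x - s2)) <= 0" using T[OF I0] T[OF integrable_const_dom[of s2]] by (simp add: right_diff_distrib)
 qed
 ultimately have "AE x in M. s1 <= si0 x & si0 x <= s2" by eventually_elim simp
 thus ?thesis using K(1) weightD(1)[OF w[of 0]] by (simp add: weight_def)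
qed

context
 fixes b :: "nat => 'a => 'a => 'a" and a :: "'a => 'a => 'a" and al ka om and si :: "nat => 'a => real" and si0 s1 s2
 assumes adm: "!!n. admissible Om p al ka om (b n)" and al: "0 < al" and ka: "0 < ka" and om: "!!n. 0 <= om n"
  and G: "G_limit b a" and adm_a: "admissible Om p al ka om a"
  and w: "!!n. weight s1 s2 (si n)" and w0: "weight s1 s2 si0"
  and conv: "!!g. integrable M g ==> (%n. LINT x|M. si n x * g x) ----> (LINT x|M. si0 x * g x)"
begin

lemma mass_weak_star:
 assumes "Lp_tendsto Om p u U" shows "(%n. mass (si n) (u n)) ----> mass si0 U"
proof -
 have "(%n. mass (si n) U) ----> mass si0 U" unfolding mass_def
  using conv[OF LpD(2)[OF Lp_tendstoD(2)[OF assms]]] by simp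
 from tendsto_add[OF mass_diff_tendsto[of s1 s2 si, OF w assms] this] show ?thesis by simp
qed

text \<open>The equations with the right-hand side of a two-piece function \<open>u\<close> turn its pieces into competitors.\<close>

theorem second_eigenvalue_upper:
 assumes less: "second_eigenvalue Om p a si0 < ereal mu"
 shows "\<forall>\<^sub>F n in sequentially. second_eigenvalue Om p (b n) (si n) <= ereal mu"
proof -
 obtain u where u: "u \<in> W01p Om p" "0 < pos_mass si0 u" "pos_energy a u < mu * pos_mass si0 u"
  "0 < pos_mass si0 (%x. - u x)" "pos_energy a (%x. - u x) < mu * pos_mass si0 (%x. - u x)"
  by (rule two_piece_of_second_eigenvalue[OF adm_a w0 less])
 note Wu = W0_wgrad[OF u(1)]
 obtain U K where U: "!!n. W0 (U n) (\<nabla> (U n))" "!!n. (Np (\<nabla> (U n))) <= K" "Lp_tendsto Om p U u"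
  "(%n. energy (b n) (\<nabla> (U n))) ----> energy a (\<nabla> u)"
  by (rule recovery_sequence[OF adm al ka om G adm_a Wu]) (rule that)
 have lower: "\<exists>L. (\<forall>n. L n <= pos_energy (b n) (V n)) & L ----> pos_energy a v"
  if V: "!!n. W0 (V n) (H n)" "!!n. (Np (H n)) <= K" "Lp_tendsto Om p V v" "W0 v h" for V H v h
 proof -
  obtain L where "!!n. L n <= energy (b n) (pos_grad (V n) (H n))" "L ----> energy a (pos_grad v h)"
  by (rule energy_lower_bound[OF adm al ka om G adm_a W0_pos_grad[OF V(1)] order_trans[OF pos_grad_bound[OF V(1)] V(2)] pos_part_tendsto[OF V(3)] W0_pos_grad[OF V(4)]]) (rule that)
  thus ?thesis using pos_energy_W0[OF adm V(1)] pos_energy_W0[OF adm_a V(4)] by auto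
 qed
 obtain L where L: "!!n. L n <= pos_energy (b n) (U n)" "L ----> pos_energy a u" using lower[OF U(1-3) Wu] by blast
 have Um: "Lp_tendsto Om p (%n x. - U n x) (%x. - u x)" using Lp_tendsto_mult[OF U(3), of "-1"] by simp
 have "(LINT x|M. norm (- \<nabla> (U n) x) powr p) <= K" for n using U(2) by simp
 from lower[OF W0_minus[OF U(1)] this Um W0_minus[OF Wu]]
 obtain L' where L': "!!n. L' n <= pos_energy (b n) (%x. - U n x)" "L' ----> pos_energy a (%x. - u x)" by blast
 \<comment> \<open>the whole energy converges, so a lower bound for one piece is an upper bound for the other\<close>
 have up: "pos_energy (b n) (U n) <= energy (b n) (\<nabla> (U n)) - L' n" "pos_energy (b n) (%x. - U n x) <= energy (b n) (\<nabla> (U n)) - L n" for n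
  using energy_split[OF adm U(1), of n n] L(1)[of n] L'(1)[of n] by linarith+
 note sp = energy_split[OF adm_a Wu]
 have lim: "(%n. energy (b n) (\<nabla> (U n)) - L' n) ----> pos_energy a u" "(%n. energy (b n) (\<nabla> (U n)) - L n) ----> pos_energy a (%x. - u x)"
  using tendsto_diff[OF U(4) L'(2)] tendsto_diff[OF U(4) L(2)] by (simp_all add: sp)
 have m: "(%n. pos_mass (si n) (U n)) ----> pos_mass si0 u" "(%n. pos_mass (si n) (%x. - U n x)) ----> pos_mass si0 (%x. - u x)"
  unfolding pos_mass_def by (intro mass_weak_star pos_part_tendsto U(3) Um)+
 have d1: "(%n. mu * pos_mass (si n) (U n) - (energy (b n) (\<nabla> (U n)) - L' n)) ----> mu * pos_mass si0 u - pos_energy a u"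
  by (intro tendsto_diff tendsto_mult_left m lim)
 have d2: "(%n. mu * pos_mass (si n) (%x. - U n x) - (energy (b n) (\<nabla> (U n)) - L n)) ----> mu * pos_mass si0 (%x. - u x) - pos_energy a (%x. - u x)"
  by (intro tendsto_diff tendsto_mult_left m lim)
 have "\<forall>\<^sub>F n in sequentially. 0 < pos_mass (si n) (U n)" "\<forall>\<^sub>F n in sequentially. 0 < pos_mass (si n) (%x. - U n x)"
  "\<forall>\<^sub>F n in sequentially. 0 < mu * pos_mass (si n) (U n) - (energy (b n) (\<nabla> (U n)) - L' n)"
  "\<forall>\<^sub>F n in sequentially. 0 < mu * pos_mass (si n) (%x. - U n x) - (energy (b n) (\<nabla> (U n)) - L n)"
  using order_tendstoD(1)[OF m(1) u(2)] order_tendstoD(1)[OF m(2) u(4)] order_tendstoD(1)[OF d1, of 0] order_tendstoD(1)[OF d2, of 0] u(3,5) by simp_all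
 thus ?thesis
 proof eventually_elim
  case (elim n)
  have "pos_energy (b n) (U n) <= mu * pos_mass (si n) (U n)" "pos_energy (b n) (%x. - U n x) <= mu * pos_mass (si n) (%x. - U n x)"
  using up[of n] elim(3,4) by linarith+
  from second_eigenvalue_le_two_piece[OF adm w W0_W01p[OF U(1)] elim(1) this(1) elim(2) this(2)] show ?case .
 qed
qed

lemma normalised_sequence_limit:
 assumes V: "!!n. W0 (V n) (H n)" and norm1: "!!n. (Np (V n)) = 1"
  and le: "!!n. energy (b n) (H n) <= mu * mass (si n) (V n)" and v: "Lp_tendsto Om p V v" and h: "W0 v h"
  and K: "!!n. (Np (H n)) <= K"
 shows "0 < mass si0 v" "energy a h <= mu * mass si0 v"
proof -
 have "(%n. 1) ----> (Np v)" using Lp_tendsto_integral_norm[OF p_pos v] norm1 by simp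
 hence "(Np v) = 1" using LIMSEQ_unique tendsto_const by blast
 thus "0 < mass si0 v" using mass_bounds(1)[OF w0 W0_Lp(1)[OF h]] weightD(1)[OF w0] by simp
 obtain L where L: "!!n. L n <= energy (b n) (H n)" "L ----> energy a h"
  by (rule energy_lower_bound[OF adm al ka om G adm_a V K v h]) (rule that)
 show "energy a h <= mu * mass si0 v"
  by (rule LIMSEQ_le[OF L(2) tendsto_mult_left[OF mass_weak_star[OF v]]]) (use order_trans[OF L(1) le] in blast)
qed

end

text \<open>Disjointness survives strong \<open>L\<^sup>p\<close> limits, so the limits of the two normalised pieces are the pieces of one function.\<close>

theorem second_eigenvalue_lower:
 fixes b :: "nat => 'a => 'a => 'a" and a :: "'a => 'a => 'a"
 assumes adm: "!!n. admissible Om p al ka om (b n)" and al: "0 < al" and ka: "0 < ka" and om: "!!n. 0 <= om n"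
  and G: "G_limit b a" and adm_a: "admissible Om p al ka om a"
  and w: "!!n. weight s1 s2 (si n)" and w0: "weight s1 s2 si0"
  and conv: "!!g. integrable M g ==> (%n. LINT x|M. si n x * g x) ----> (LINT x|M. si0 x * g x)"
  and less: "!!n. second_eigenvalue Om p (b n) (si n) < ereal mu"
 shows "second_eigenvalue Om p a si0 <= ereal mu"
proof -
 have ex: "\<exists>v t t'. W0 v (\<nabla> v) & 0 < t & 0 < t' &
  (LINT x|M. norm (t * max 0 (v x)) powr p) = 1 & energy (b n) (%x. t *R pos_grad v (\<nabla> v) x) <= mu * mass (si n) (%x. t * max 0 (v x)) &
  (LINT x|M. norm (t' * max 0 (- v x)) powr p) = 1 & energy (b n) (%x. t' *R pos_grad (%x. - v x) (%x. - \<nabla> v x) x) <= mu * mass (si n) (%x. t' * max 0 (- v x))" for n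
 proof -
  obtain v where v: "v \<in> W01p Om p" "0 < pos_mass (si n) v" "pos_energy (b n) v < mu * pos_mass (si n) v"
  "0 < pos_mass (si n) (%x. - v x)" "pos_energy (b n) (%x. - v x) < mu * pos_mass (si n) (%x. - v x)"
  by (rule two_piece_of_second_eigenvalue[OF adm w less])
  note W = W0_wgrad[OF v(1)]
  obtain t where t: "0 < t" "(LINT x|M. norm (t * max 0 (v x)) powr p) = 1" "energy (b n) (%x. t *R pos_grad v (\<nabla> v) x) <= mu * mass (si n) (%x. t * max 0 (v x))"
  by (rule normalised_piece[OF adm w W v(2,3)])
  obtain t' where t': "0 < t'" "(LINT x|M. norm (t' * max 0 (- v x)) powr p) = 1"
  "energy (b n) (%x. t' *R pos_grad (%x. - v x) (%x. - \<nabla> v x) x) <= mu * mass (si n) (%x. t' * max 0 (- v x))"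
  by (rule normalised_piece[OF adm w W0_minus[OF W] v(4,5)])
  show ?thesis using W t t' by blast
 qed
 then obtain v t t' where v: "!!n. W0 (v n) (\<nabla> (v n))" and tpos: "!!n. 0 < t n" "!!n. 0 < t' n"
  and n1: "!!n. (LINT x|M. norm (t n * max 0 (v n x)) powr p) = 1"
  and e1: "!!n. energy (b n) (%x. t n *R pos_grad (v n) (\<nabla> (v n)) x) <= mu * mass (si n) (%x. t n * max 0 (v n x))"
  and n2: "!!n. (LINT x|M. norm (t' n * max 0 (- v n x)) powr p) = 1"
  and e2: "!!n. energy (b n) (%x. t' n *R pos_grad (%x. - v n x) (%x. - \<nabla> (v n) x) x) <= mu * mass (si n) (%x. t' n * max 0 (- v n x))"
  by metis
 define V where "V n x = t n * max 0 (v n x)" for n x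
 define V' where "V' n x = t' n * max 0 (- v n x)" for n x
 define H where "H n x = t n *R pos_grad (v n) (\<nabla> (v n)) x" for n x
 define H' where "H' n x = t' n *R pos_grad (%x. - v n x) (%x. - \<nabla> (v n) x) x" for n x
 have W: "W0 (V n) (H n)" "W0 (V' n) (H' n)" for n
  unfolding V_def H_def V'_def H'_def by (intro W0_cmult W0_pos_grad v W0_minus)+
 have n: "(Np (V n)) = 1" "(Np (V' n)) = 1" for n
  using n1 n2 by (simp_all only: V_def V'_def)
 have e: "energy (b n) (H n) <= mu * mass (si n) (V n)" "energy (b n) (H' n) <= mu * mass (si n) (V' n)" for n
  using e1 e2 by (simp_all only: V_def[abs_def] V'_def[abs_def] H_def[abs_def] H'_def[abs_def])
 have bound: "(Np G) <= \<bar>mu\<bar> * s2 / al" if "W0 u G" "(Np u) = 1" "energy (b n) G <= mu * mass (si n) u" for n u G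
 proof -
  have "al * (Np G) <= mu * mass (si n) u" using energy_bounds(1)[OF adm W0_Lp(2)[OF that(1)]] that(3) by (rule order_trans)
  also have "... <= \<bar>mu\<bar> * mass (si n) u" using mass_bounds(3)[OF w W0_Lp(1)[OF that(1)]] by (intro mult_right_mono) auto
  also have "... <= \<bar>mu\<bar> * s2" using mass_bounds(2)[OF w W0_Lp(1)[OF that(1)], of n] that(2) by (intro mult_left_mono) auto
  finally show ?thesis using al by (simp add: pos_le_divide_eq mult.commute)
 qed
 have K: "(Np (H n)) <= \<bar>mu\<bar> * s2 / al" "(Np (H' n)) <= \<bar>mu\<bar> * s2 / al" for n
  by (rule bound[OF W(1) n(1) e(1)], rule bound[OF W(2) n(2) e(2)])
 obtain r1 y where r1: "strict_mono (r1 :: nat => nat)" and y: "Lp_tendsto Om p (%n. V (r1 n)) y"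
  by (rule W0_Rellich[of V H, OF W(1) K(1)])
 obtain r2 y' where r2: "strict_mono (r2 :: nat => nat)" and y': "Lp_tendsto Om p (%n. V' (r1 (r2 n))) y'"
  by (rule W0_Rellich[of "%n. V' (r1 n)" "%n. H' (r1 n)", OF W(2) K(2)])
 define r where "r n = r1 (r2 n)" for n
 have r: "strict_mono r" using strict_mono_o[OF r1 r2] by (simp add: r_def[abs_def] o_def)
 have Y: "Lp_tendsto Om p (%n. V (r n)) y" "Lp_tendsto Om p (%n. V' (r n)) y'"
  using Lp_tendsto_subseq[OF y r2] y' by (simp_all add: r_def)
 obtain h where h: "W0 y h" using W0_weak_limit(1)[OF W(1) K(1) Y(1)] by blast
 obtain h' where h': "W0 y' h'" using W0_weak_limit(1)[OF W(2) K(2) Y(2)] by blast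
 have conv': "(%n. LINT x|M. si (r n) x * g x) ----> (LINT x|M. si0 x * g x)" if "integrable M g" for g
  using LIMSEQ_subseq_LIMSEQ[OF conv[OF that] r] by (simp add: o_def)
 note N = normalised_sequence_limit[OF adm al ka om G_limit_subseq[OF G r] adm_a w w0 conv']
 have P: "0 < mass si0 y" "energy a h <= mu * mass si0 y" by (rule N[OF _ W(1) n(1) e(1) Y(1) h K(1)], assumption)+
 have P': "0 < mass si0 y'" "energy a h' <= mu * mass si0 y'" by (rule N[OF _ W(2) n(2) e(2) Y(2) h' K(2)], assumption)+
 obtain s1 D where s1: "strict_mono s1" and D: "AE x in M. (%k. V (r (s1 k)) x) ----> y x"
  by (rule Lp_tendsto_dominated_subseq[OF p_pos Y(1)])
 obtain s2 D' where s2: "strict_mono s2" and D': "AE x in M. (%k. V' (r (s1 (s2 k))) x) ----> y' x"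
  by (rule Lp_tendsto_dominated_subseq[OF p_pos Lp_tendsto_subseq[OF Y(2) s1]])
 have disj: "AE x in M. 0 <= y x & 0 <= y' x & y x * y' x = 0"
  using D D'
 proof eventually_elim
  case (elim x)
  have l: "(%k. V (r (s1 (s2 k))) x) ----> y x" using LIMSEQ_subseq_LIMSEQ[OF elim(1) s2] by (simp add: o_def)
  have nn: "0 <= V n x" "0 <= V' n x" for n using tpos[of n] by (simp_all add: V_def V'_def)
  have vv: "V n x * V' n x = 0" for n by (simp add: V_def V'_def max_def)
  have "(%k. V (r (s1 (s2 k))) x * V' (r (s1 (s2 k))) x) ----> 0" unfolding vv by (rule tendsto_const)
  hence "y x * y' x = 0" using tendsto_mult[OF l elim(2)] LIMSEQ_unique by blast
  thus ?case using LIMSEQ_le_const[OF l] LIMSEQ_le_const[OF elim(2)] nn by blast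
 qed
 let ?u = "%x. y x - y' x"
 note U = W0_diff[OF h h']
 have p1: "AE x in M. max 0 (?u x) = y x" and p2: "AE x in M. max 0 (- ?u x) = y' x"
  using disj by (eventually_elim, force simp: max_def)+
 have pe: "pos_energy a ?u = energy a h" "pos_energy a (%x. - ?u x) = energy a h'"
  unfolding pos_energy_W0[OF adm_a U] pos_energy_W0[OF adm_a W0_minus[OF U]]
  by (rule energy_AE_cong[OF adm_a W0_measurable(2)[OF W0_pos_grad[OF U]] W0_measurable(2)[OF h] W0_unique_AE[OF W0_pos_grad[OF U] h p1]],
  rule energy_AE_cong[OF adm_a W0_measurable(2)[OF W0_pos_grad[OF W0_minus[OF U]]] W0_measurable(2)[OF h'] W0_unique_AE[OF W0_pos_grad[OF W0_minus[OF U]] h' p2]])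
 have pm: "pos_mass si0 ?u = mass si0 y" "pos_mass si0 (%x. - ?u x) = mass si0 y'"
  unfolding pos_mass_def
  by (rule mass_AE_cong[OF W0_measurable(1)[OF W0_pos_grad[OF U]] W0_measurable(1)[OF h] weightD(2)[OF w0] p1],
  rule mass_AE_cong[OF W0_measurable(1)[OF W0_pos_grad[OF W0_minus[OF U]]] W0_measurable(1)[OF h'] weightD(2)[OF w0] p2])
 show ?thesis
  by (rule second_eigenvalue_le_two_piece[OF adm_a w0 W0_W01p[OF U]]) (use P P' pe pm in auto)
qed

end

text \<open>The sequence is strictly decreasing, hence injective as \<open>G_limit_of_G_converges\<close> demands.\<close>

lemma frequently_at_right_sequence:
 assumes "\<not> eventually P (at_right (0::real))"
 obtains ep :: "nat => real" where "!!n. 0 < ep n" "!!n. \<not> P (ep n)" "inj ep" "filterlim ep (at_right 0) sequentially"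
proof -
 have ex: "\<exists>t. 0 < t & t < d & \<not> P t" if "0 < d" for d
  using assms that unfolding eventually_at_right_field by (metis not_le)
 have "\<exists>ep. (\<forall>n. (0 < ep n & \<not> P (ep n) & ep n < 1 / real (Suc n)) & ep (Suc n) < ep n)"
 proof (rule dependent_nat_choice)
  show "\<exists>x. 0 < x & \<not> P x & x < 1 / real (Suc 0)" using ex[of 1] by auto
  fix x n assume "0 < x & \<not> P x & x < 1 / real (Suc n)"
  thus "\<exists>y. (0 < y & \<not> P y & y < 1 / real (Suc (Suc n))) & y < x" using ex[of "min x (1 / real (Suc (Suc n)))"] by auto
 qed
 then obtain ep where ep: "!!n. 0 < ep n" "!!n. \<not> P (ep n)" "!!n. ep n < 1 / real (Suc n)" "!!n. ep (Suc n) < ep n" by blast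
 have "strict_mono (%n. - ep n)" using ep(4) by (intro strict_monoI_Suc) simp
 hence "inj (%n. - ep n)" by (rule strict_mono_imp_inj_on)
 hence inj: "inj ep" by (simp add: inj_def)
 have "ep ----> 0"
 proof (rule tendsto_sandwich[of "%_. 0" _ _ "%n. 1 / real (Suc n)"])
  show "(%n. 1 / real (Suc n)) ----> 0" using LIMSEQ_inverse_real_of_nat by (simp add: inverse_eq_divide)
  show "\<forall>\<^sub>F n in sequentially. ep n <= 1 / real (Suc n)" using ep(3) by (intro always_eventually allI less_imp_le)
  show "\<forall>\<^sub>F n in sequentially. 0 <= ep n" using ep(1) by (intro always_eventually allI less_imp_le)
 qed simp
 hence "filterlim ep (at_right 0) sequentially" using ep(1) by (intro tendsto_imp_filterlim_at_right always_eventually allI)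
 thus thesis by (rule that[OF ep(1,2) inj])
qed

theorem theorem5p6:
  fixes \<Omega> :: "'a::euclidean_space set"
    and p \<alpha> \<beta> c \<rho>min \<rho>max :: real
    and a\<epsilon> :: "real \<Rightarrow> 'a \<Rightarrow> 'a \<Rightarrow> 'a"
    and a :: "'a \<Rightarrow> 'a \<Rightarrow> 'a"
    and \<rho>\<epsilon> :: "real \<Rightarrow> 'a \<Rightarrow> real"
    and \<rho> :: "'a \<Rightarrow> real"
  assumes domain: "open \<Omega>" "connected \<Omega>" "bounded \<Omega>" "\<Omega> \<noteq> {}"
    and p: "1 < p"
    and constants: "0 < \<alpha>" "0 < \<beta>" "0 < c"
    and coefficients: "\<And>\<epsilon>. 0 < \<epsilon> \<Longrightarrow> H0_to_H8 \<Omega> p \<alpha> \<beta> c (a\<epsilon> \<epsilon>)"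
    and limit_coefficient: "caratheodory \<Omega> a"
    and G_convergence: "G_converges \<Omega> p a\<epsilon> a"
    and weights: "\<And>\<epsilon>. 0 < \<epsilon> \<Longrightarrow> \<rho>\<epsilon> \<epsilon> \<in> Linf \<Omega>"
    and weight_bounds: "0 < \<rho>min"
      "\<And>\<epsilon>. 0 < \<epsilon> \<Longrightarrow> AE x in lebesgue_on \<Omega>. \<rho>min \<le> \<rho>\<epsilon> \<epsilon> x \<and> \<rho>\<epsilon> \<epsilon> x \<le> \<rho>max"
    and weight_convergence: "Linf_weak_star_tendsto \<Omega> \<rho>\<epsilon> \<rho> (at_right 0)"
  shows "((\<lambda>\<epsilon>. second_eigenvalue \<Omega> p (a\<epsilon> \<epsilon>) (\<rho>\<epsilon> \<epsilon>)) \<longlongrightarrow> second_eigenvalue \<Omega> p a \<rho>) (at_right 0)"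
proof -
 interpret bounded_domain \<Omega> p using domain(1,3) p by unfold_locales
 define \<kappa> where "\<kappa> = \<beta> powr conj_exp p / \<alpha>"
 define \<omega> where "\<omega> = convexity_modulus p \<alpha>"
 have adm: "admissible \<Omega> p \<alpha> \<kappa> \<omega> (a\<epsilon> t)" if "0 < t" for t
  unfolding \<kappa>_def \<omega>_def by (rule H0_to_H8_admissible[OF p constants(1,2) coefficients[OF that]])
 have \<kappa>: "0 < \<kappa>" using constants by (simp add: \<kappa>_def)
 have \<omega>: "0 <= \<omega> n" for n using constants by (simp add: \<omega>_def convexity_modulus_def)
 have w: "weight \<rho>min \<rho>max (\<rho>\<epsilon> t)" if "0 < t" for t
  using weights[OF that] weight_bounds(1) weight_bounds(2)[OF that] by (auto simp: weight_def Linf_def)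
 \<comment> \<open>a limit along the filter is tested on injective sequences, along which all the hypotheses hold\<close>
 have along: "G_limit (%n. a\<epsilon> (\<epsilon> n)) a & admissible \<Omega> p \<alpha> \<kappa> \<omega> a & weight \<rho>min \<rho>max \<rho> &
  (\<forall>g. integrable M g --> (%n. LINT x|M. \<rho>\<epsilon> (\<epsilon> n) x * g x) ----> (LINT x|M. \<rho> x * g x))"
  if \<epsilon>: "!!n. 0 < \<epsilon> n" "inj \<epsilon>" "filterlim \<epsilon> (at_right 0) sequentially" for \<epsilon>
 proof -
  have G: "G_limit (%n. a\<epsilon> (\<epsilon> n)) a"
  by (rule G_limit_of_G_converges[OF G_convergence \<epsilon> weak_solution_exists[OF adm constants(1) \<omega>]])
  have "admissible \<Omega> p \<alpha> \<kappa> \<omega> a"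
  by (rule G_limit_admissible[OF adm[OF \<epsilon>(1)] constants(1) \<kappa> \<omega> G limit_coefficient])
  moreover have c: "(%n. LINT x|M. \<rho>\<epsilon> (\<epsilon> n) x * g x) ----> (LINT x|M. \<rho> x * g x)" if "integrable M g" for g
  using weight_convergence that filterlim_compose[OF _ \<epsilon>(3)] by (auto simp: Linf_weak_star_tendsto_def)
  moreover have "weight \<rho>min \<rho>max \<rho>"
  by (rule weak_star_weight[of _ _ "%n. \<rho>\<epsilon> (\<epsilon> n)", OF w[OF \<epsilon>(1)] _ c]) (use weight_convergence in \<open>simp add: Linf_weak_star_tendsto_def\<close>)
  ultimately show ?thesis using G by blast
 qed
 show ?thesis
 proof (rule order_tendstoI)
  fix y assume y: "second_eigenvalue \<Omega> p a \<rho> < y"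
  show "\<forall>\<^sub>F t in at_right 0. second_eigenvalue \<Omega> p (a\<epsilon> t) (\<rho>\<epsilon> t) < y"
  proof (rule ccontr)
  assume "\<not> ?thesis"
  then obtain \<epsilon> where \<epsilon>: "!!n. 0 < \<epsilon> n" "!!n. \<not> second_eigenvalue \<Omega> p (a\<epsilon> (\<epsilon> n)) (\<rho>\<epsilon> (\<epsilon> n)) < y" "inj \<epsilon>" "filterlim \<epsilon> (at_right 0) sequentially"
  by (rule frequently_at_right_sequence) (rule that)
  note A = along[OF \<epsilon>(1,3,4)]
  obtain \<mu> where \<mu>: "second_eigenvalue \<Omega> p a \<rho> < ereal \<mu>" "ereal \<mu> < y" using ereal_dense2[OF y] by blast
  have "\<forall>\<^sub>F n in sequentially. second_eigenvalue \<Omega> p (a\<epsilon> (\<epsilon> n)) (\<rho>\<epsilon> (\<epsilon> n)) <= ereal \<mu>"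
  by (rule second_eigenvalue_upper[OF adm[OF \<epsilon>(1)] constants(1) \<kappa> \<omega> _ _ w[OF \<epsilon>(1)] _ _ \<mu>(1)]) (use A in auto)
  then obtain n where "second_eigenvalue \<Omega> p (a\<epsilon> (\<epsilon> n)) (\<rho>\<epsilon> (\<epsilon> n)) <= ereal \<mu>" by (auto simp: eventually_sequentially)
  thus False using le_less_trans[OF _ \<mu>(2)] \<epsilon>(2)[of n] by blast
  qed
 next
  fix y assume y: "y < second_eigenvalue \<Omega> p a \<rho>"
  show "\<forall>\<^sub>F t in at_right 0. y < second_eigenvalue \<Omega> p (a\<epsilon> t) (\<rho>\<epsilon> t)"
  proof (rule ccontr)
  assume "\<not> ?thesis"
  then obtain \<epsilon> where \<epsilon>: "!!n. 0 < \<epsilon> n" "!!n. \<not> y < second_eigenvalue \<Omega> p (a\<epsilon> (\<epsilon> n)) (\<rho>\<epsilon> (\<epsilon> n))" "inj \<epsilon>" "filterlim \<epsilon> (at_right 0) sequentially"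
  by (rule frequently_at_right_sequence) (rule that)
  note A = along[OF \<epsilon>(1,3,4)]
  obtain \<mu> where \<mu>: "y < ereal \<mu>" "ereal \<mu> < second_eigenvalue \<Omega> p a \<rho>" using ereal_dense2[OF y] by blast
  have less: "second_eigenvalue \<Omega> p (a\<epsilon> (\<epsilon> n)) (\<rho>\<epsilon> (\<epsilon> n)) < ereal \<mu>" for n
  using \<epsilon>(2)[of n] \<mu>(1) by (meson le_less_trans not_le)
  have "second_eigenvalue \<Omega> p a \<rho> <= ereal \<mu>"
  by (rule second_eigenvalue_lower[of _ _ _ "%n. a\<epsilon> (\<epsilon> n)", OF adm[OF \<epsilon>(1)] constants(1) \<kappa> \<omega> _ _ w[OF \<epsilon>(1)] _ _ less]) (use A in auto)
  thus False using \<mu>(2) by simp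
  qed
 qed
qed

end
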